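(* Let $n\ge 2$, let $\Omega\subset\mathbb{R}^n$ be a bounded open set with Lipschitz boundary, and let $u\in \mathrm{BV}(\Omega;\mathbb{R}^m)$. Let $K\subset\mathbb{R}^n$ be a (nonempty, bounded, open) convex set with $K=-K$. Then for $|D^c u|$-a.e. $x\in\Omega\setminus \mathrm{TS}(u)$ there exists a sequence $\varepsilon_i\downarrow 0$ such that $$u_{K,\varepsilon_i,x}\longrightarrow v\quad\text{strictly in } \mathrm{BV}(K;\mathbb{R}^m),\qquad v(y):=\frac{\mathrm{d} D u}{\mathrm{d}|D u|}(x)\,y .$$
   Context: For $x\in\Omega$ and $\varepsilon>0$ write $K_\varepsilon(x):=x+\varepsilon K$; $|K|=\mathcal{L}^n(K)$ is the Lebesgue measure of $K$, and $(u)_{K_\varepsilon(x)}$ is the average of $u$ over $K_\varepsilon(x)$. For $\varepsilon$ small enough that $K_\varepsilon(x)\subset\Omega$, and with $|Du|(K_\varepsilon(x))>0$, the blow-up of $u$ at $x$ is the function on $K$ $$u_{K,\varepsilon,x}(y):=\frac{u(x+\varepsilon y)-(u)_{K_\varepsilon(x)}}{\dfrac{|Du|(K_\varepsilon(x))}{|K|\,\varepsilon^{n-1}}} .$$ An $L^1$-limit point of $\{u_{K,\varepsilon,x}\}_{\varepsilon>0}$ is a function $p$ such that $u_{K,\varepsilon_i,x}\to p$ in $L^1(K;\mathbb{R}^m)$ for some sequence $\varepsilon_i\downarrow0$. Totally singular points: $x\in\Omega$ is $\mathrm{BV}$-totally singular for $u$ if every $L^1$-limit point $p\in \mathrm{BV}(K;\mathbb{R}^m)$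 of $\{u_{K,\varepsilon,x}\}_{\varepsilon>0}$ satisfies $Dp=D^s p$, where $D^s p$ is the part of the measure $Dp$ singular with respect to $\mathcal{L}^n$. $\mathrm{TS}(u)$ denotes the set of such points (defined with the convex set $K$ under consideration). $D^c u$ is the Cantor part of $Du$, i.e. $D^c u=D^s u$ restricted to $\Omega\setminus S_u$, where $S_u$ is the complement of the set of approximate continuity points of $u$. $\frac{\mathrm{d} Du}{\mathrm{d}|Du|}(x)$ is the polar (Radon–Nikodým density) of $Du$ with respect to its total variation $|Du|$, an $m\times n$ matrix. Strict convergence $u_i\to v$ in $\mathrm{BV}(K;\mathbb{R}^m)$ means $u_i\to v$ in $L^1(K;\mathbb{R}^m)$ and $|Du_i|(K)\to|Dv|(K)$. *)

theory Defs
  imports "HOL-Analysis.Analysis"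
begin

section \<open>Vector measures\<close>

text \<open>
  A vector measure on the sigma-algebra of \<open>M\<close> is a countably additive set function. Only
  \<open>space M\<close> and \<open>sets M\<close> are used. Outside \<open>sets M\<close> its value is fixed to be \<open>0\<close>, so that
  two vector measures agreeing on \<open>sets M\<close> are equal. Such a set function has finite total
  variation when its values lie in a finite-dimensional space.
\<close>

definition vector_measure :: "'a measure \<Rightarrow> ('a set \<Rightarrow> 'b::real_normed_vector) \<Rightarrow> bool" where
  "vector_measure M \<mu> \<longleftrightarrow>
     (\<forall>A :: nat \<Rightarrow> 'a set. range A \<subseteq> sets M \<longrightarrow> disjoint_family A \<longrightarrow>
        (\<lambda>i. \<mu> (A i)) sums \<mu> (\<Union>i. A i)) \<and>
     (\<forall>B. B \<notin> sets M \<longrightarrow> \<mu> B = 0)"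

definition total_variation :: "'a measure \<Rightarrow> ('a set \<Rightarrow> 'b::real_normed_vector) \<Rightarrow> 'a measure" where
  "total_variation M \<mu> = measure_of (space M) (sets M)
     (\<lambda>B. SUP A \<in> {A :: nat \<Rightarrow> 'a set. range A \<subseteq> sets M \<and> disjoint_family A \<and> (\<Union>i. A i) = B}.
            (\<Sum>i. ennreal (norm (\<mu> (A i)))))"

text \<open>The positive part \<open>(\<bar>\<nu>\<bar> + \<nu>) / 2\<close> of a signed measure; the negative part of \<open>\<nu>\<close> is the
  positive part of \<open>-\<nu>\<close>.\<close>

definition positive_part :: "'a measure \<Rightarrow> ('a set \<Rightarrow> real) \<Rightarrow> 'a measure" where
  "positive_part M \<nu> = measure_of (space M) (sets M)
     (\<lambda>B. ennreal ((measure (total_variation M \<nu>) B + \<nu> B) / 2))"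

definition signed_integral :: "'a measure \<Rightarrow> ('a set \<Rightarrow> real) \<Rightarrow> ('a \<Rightarrow> real) \<Rightarrow> real" where
  "signed_integral M \<nu> f =
     integral\<^sup>L (positive_part M \<nu>) f - integral\<^sup>L (positive_part M (\<lambda>B. - \<nu> B)) f"

text \<open>Singularity and Lebesgue decomposition are with respect to the measure \<open>M\<close> itself.\<close>

definition singular_vector_measure :: "'a measure \<Rightarrow> ('a set \<Rightarrow> 'b::real_normed_vector) \<Rightarrow> bool" where
  "singular_vector_measure M \<nu> \<longleftrightarrow>
     (\<exists>N \<in> null_sets M. emeasure (total_variation M \<nu>) (space M - N) = 0)"

definition singular_part ::
    "'a measure \<Rightarrow> ('a set \<Rightarrow> 'b::real_normed_vector) \<Rightarrow> 'a set \<Rightarrow> 'b" where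
  "singular_part M \<mu> = (THE \<nu>. vector_measure M \<nu> \<and> singular_vector_measure M \<nu> \<and>
     absolutely_continuous M (total_variation M (\<lambda>B. \<mu> B - \<nu> B)))"

text \<open>The density of \<open>\<mu>\<close> with respect to its total variation; it is determined only up to
  \<open>\<bar>\<mu>\<bar>\<close>-null sets, and an arbitrary representative is selected.\<close>

definition polar_density ::
    "'a measure \<Rightarrow> ('a set \<Rightarrow> 'b::{banach, second_countable_topology}) \<Rightarrow> 'a \<Rightarrow> 'b" where
  "polar_density M \<mu> = (SOME f. integrable (total_variation M \<mu>) f \<and>
     (\<forall>B \<in> sets M. \<mu> B = (LINT x:B|total_variation M \<mu>. f x)))"


section \<open>Functions of bounded variation\<close>

definition partial_deriv :: "'n \<Rightarrow> (real^'n \<Rightarrow> real) \<Rightarrow> real^'n \<Rightarrow> real" where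
  "partial_deriv j \<phi> x = frechet_derivative \<phi> (at x) (axis j 1)"

definition C1_compact_support :: "(real^'n) set \<Rightarrow> (real^'n \<Rightarrow> real) set" where
  "C1_compact_support \<Omega> = {\<phi>. (\<forall>x. \<phi> differentiable (at x)) \<and>
     (\<forall>j. continuous_on UNIV (partial_deriv j \<phi>)) \<and>
     (\<exists>C. compact C \<and> C \<subseteq> \<Omega> \<and> (\<forall>x. x \<notin> C \<longrightarrow> \<phi> x = 0))}"

text \<open>The base measure: Lebesgue measure on the Borel subsets of \<open>\<Omega>\<close>.\<close>

abbreviation lborel_on :: "'a::euclidean_space set \<Rightarrow> 'a measure" where
  "lborel_on \<Omega> \<equiv> restrict_space lborel \<Omega>"

text \<open>\<open>\<mu>\<close> is the distributional derivative of \<open>u\<close> in \<open>\<Omega>\<close>; the entry in row \<open>i\<close>, column \<open>j\<close>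
  is \<open>D\<^sub>j u\<^sub>i\<close>. As a norm on matrices, \<open>norm\<close> is the Frobenius norm.\<close>

definition is_distr_deriv ::
    "(real^'n) set \<Rightarrow> (real^'n \<Rightarrow> real^'m) \<Rightarrow> ((real^'n) set \<Rightarrow> real^'n^'m) \<Rightarrow> bool" where
  "is_distr_deriv \<Omega> u \<mu> \<longleftrightarrow> vector_measure (lborel_on \<Omega>) \<mu> \<and>
     (\<forall>\<phi> \<in> C1_compact_support \<Omega>. \<forall>i j.
        (LINT x|lebesgue_on \<Omega>. u x $ i * partial_deriv j \<phi> x) =
        - signed_integral (lborel_on \<Omega>) (\<lambda>B. \<mu> B $ i $ j) \<phi>)"

definition BV :: "(real^'n) set \<Rightarrow> (real^'n \<Rightarrow> real^'m) set" where
  "BV \<Omega> = {u. integrable (lebesgue_on \<Omega>) u \<and> (\<exists>\<mu>. is_distr_deriv \<Omega> u \<mu>)}"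

definition BV_deriv ::
    "(real^'n) set \<Rightarrow> (real^'n \<Rightarrow> real^'m) \<Rightarrow> (real^'n) set \<Rightarrow> real^'n^'m" where
  "BV_deriv \<Omega> u = (THE \<mu>. is_distr_deriv \<Omega> u \<mu>)"

definition BV_variation :: "(real^'n) set \<Rightarrow> (real^'n \<Rightarrow> real^'m) \<Rightarrow> (real^'n) measure" where
  "BV_variation \<Omega> u = total_variation (lborel_on \<Omega>) (BV_deriv \<Omega> u)"

definition BV_deriv_singular ::
    "(real^'n) set \<Rightarrow> (real^'n \<Rightarrow> real^'m) \<Rightarrow> (real^'n) set \<Rightarrow> real^'n^'m" where
  "BV_deriv_singular \<Omega> u = singular_part (lborel_on \<Omega>) (BV_deriv \<Omega> u)"

definition set_average :: "(real^'n) set \<Rightarrow> (real^'n \<Rightarrow> 'b::{banach, second_countable_topology}) \<Rightarrow> 'b" where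
  "set_average S f = (1 / measure lebesgue S) *\<^sub>R (LINT y|lebesgue_on S. f y)"

text \<open>The set \<open>S\<^sub>u\<close>: points of \<open>\<Omega>\<close> without an approximate limit. The value of \<open>u\<close> at the point
  plays no role, so the set depends only on the equivalence class of \<open>u\<close>. It is
  a Borel set for integrable \<open>u\<close> and open \<open>\<Omega>\<close>.\<close>

definition approx_discontinuity_set :: "(real^'n) set \<Rightarrow> (real^'n \<Rightarrow> real^'m) \<Rightarrow> (real^'n) set" where
  "approx_discontinuity_set \<Omega> u =
     {x \<in> \<Omega>. \<not> (\<exists>z. ((\<lambda>\<rho>. set_average (ball x \<rho>) (\<lambda>y. norm (u y - z))) \<longlongrightarrow> 0) (at_right 0))}"

definition BV_deriv_Cantor ::
    "(real^'n) set \<Rightarrow> (real^'n \<Rightarrow> real^'m) \<Rightarrow> (real^'n) set \<Rightarrow> real^'n^'m" where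
  "BV_deriv_Cantor \<Omega> u = (\<lambda>B. if B \<in> sets (lborel_on \<Omega>)
     then BV_deriv_singular \<Omega> u (B - approx_discontinuity_set \<Omega> u) else 0)"

definition BV_Cantor_variation :: "(real^'n) set \<Rightarrow> (real^'n \<Rightarrow> real^'m) \<Rightarrow> (real^'n) measure" where
  "BV_Cantor_variation \<Omega> u = total_variation (lborel_on \<Omega>) (BV_deriv_Cantor \<Omega> u)"

definition L1_converges ::
    "(real^'n) set \<Rightarrow> (nat \<Rightarrow> real^'n \<Rightarrow> real^'m) \<Rightarrow> (real^'n \<Rightarrow> real^'m) \<Rightarrow> bool" where
  "L1_converges K w v \<longleftrightarrow> (\<forall>i. integrable (lebesgue_on K) (w i)) \<and> integrable (lebesgue_on K) v \<and>
     (\<lambda>i. LINT y|lebesgue_on K. norm (w i y - v y)) \<longlonglongrightarrow> 0"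

definition BV_strictly_converges ::
    "(real^'n) set \<Rightarrow> (nat \<Rightarrow> real^'n \<Rightarrow> real^'m) \<Rightarrow> (real^'n \<Rightarrow> real^'m) \<Rightarrow> bool" where
  "BV_strictly_converges K w v \<longleftrightarrow> (\<forall>i. w i \<in> BV K) \<and> v \<in> BV K \<and> L1_converges K w v \<and>
     (\<lambda>i. measure (BV_variation K (w i)) K) \<longlonglongrightarrow> measure (BV_variation K v) K"


section \<open>Lipschitz boundary\<close>

text \<open>Near each boundary point, \<open>\<Omega>\<close> is the strict epigraph, in some unit direction \<open>e\<close>, of a
  Lipschitz function on the hyperplane orthogonal to \<open>e\<close>.\<close>

definition Lipschitz_boundary :: "'a::euclidean_space set \<Rightarrow> bool" where
  "Lipschitz_boundary \<Omega> \<longleftrightarrow>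
     (\<forall>x \<in> frontier \<Omega>. \<exists>e r L. \<exists>\<gamma> :: 'a \<Rightarrow> real. norm e = 1 \<and> 0 < r \<and>
        L-lipschitz_on {z. z \<bullet> e = 0} \<gamma> \<and>
        (\<forall>y \<in> ball x r. y \<in> \<Omega> \<longleftrightarrow> \<gamma> (y - (y \<bullet> e) *\<^sub>R e) < y \<bullet> e))"


section \<open>Blow-ups and totally singular points\<close>

definition dilate_at :: "'a::real_vector set \<Rightarrow> real \<Rightarrow> 'a \<Rightarrow> 'a set" where
  "dilate_at K \<epsilon> x = (\<lambda>y. x + \<epsilon> *\<^sub>R y) ` K"

definition blow_up ::
    "(real^'n) set \<Rightarrow> (real^'n \<Rightarrow> real^'m) \<Rightarrow> (real^'n) set \<Rightarrow> real \<Rightarrow> real^'n \<Rightarrow> real^'n \<Rightarrow> real^'m" where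
  "blow_up \<Omega> u K \<epsilon> x = (\<lambda>y.
     (u (x + \<epsilon> *\<^sub>R y) - set_average (dilate_at K \<epsilon> x) u) /\<^sub>R
     (measure (BV_variation \<Omega> u) (dilate_at K \<epsilon> x) /
      (measure lebesgue K * \<epsilon> ^ (CARD('n) - 1))))"

text \<open>Sequences of scales decreasing to zero along which the blow-up is defined.\<close>

definition blow_up_scales ::
    "(real^'n) set \<Rightarrow> (real^'n \<Rightarrow> real^'m) \<Rightarrow> (real^'n) set \<Rightarrow> real^'n \<Rightarrow> (nat \<Rightarrow> real) \<Rightarrow> bool" where
  "blow_up_scales \<Omega> u K x \<epsilon> \<longleftrightarrow> decseq \<epsilon> \<and> \<epsilon> \<longlonglongrightarrow> 0 \<and>
     (\<forall>i. 0 < \<epsilon> i \<and> dilate_at K (\<epsilon> i) x \<subseteq> \<Omega> \<and>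
          0 < measure (BV_variation \<Omega> u) (dilate_at K (\<epsilon> i) x))"

definition L1_limit_point ::
    "(real^'n) set \<Rightarrow> (real^'n \<Rightarrow> real^'m) \<Rightarrow> (real^'n) set \<Rightarrow> real^'n \<Rightarrow> (real^'n \<Rightarrow> real^'m) \<Rightarrow> bool" where
  "L1_limit_point \<Omega> u K x p \<longleftrightarrow>
     (\<exists>\<epsilon>. blow_up_scales \<Omega> u K x \<epsilon> \<and> L1_converges K (\<lambda>i. blow_up \<Omega> u K (\<epsilon> i) x) p)"

definition totally_singular_points ::
    "(real^'n) set \<Rightarrow> (real^'n \<Rightarrow> real^'m) \<Rightarrow> (real^'n) set \<Rightarrow> (real^'n) set" where
  "totally_singular_points \<Omega> u K =
     {x \<in> \<Omega>. \<forall>p \<in> BV K. L1_limit_point \<Omega> u K x p \<longrightarrow> BV_deriv K p = BV_deriv_singular K p}"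

end

theory Submission
  imports Defs
begin

text \<open>
  Write \<open>Du = F \<tau>\<close> with \<open>\<tau> = \<bar>Du\<bar>\<close>. At almost every \<open>x\<close> the density \<open>F\<close> is approximately
  continuous, so that a limit \<open>p\<close> of blow-ups at \<open>x\<close> has the derivative \<open>F x \<nu>\<close> with a positive
  measure \<open>\<nu>\<close>. If \<open>Dp\<close> is not singular, \<open>\<nu>\<close> has a positive density \<open>c\<close> at some Lebesgue point
  \<open>y\<^sub>0\<close>, and by the Poincare inequality \<open>p\<close> is close to the map \<open>c F x\<close>, up to a constant, on small
  copies of \<open>K\<close> around \<open>y\<^sub>0\<close>. Hence blow-ups of \<open>u\<close> at points near \<open>x + \<epsilon>\<^sub>i y\<^sub>0\<close> are close to linear
  maps in \<open>L\<^sup>1\<close>. Let \<open>B\<^sub>k\<close> be the set of points at which no blow-up at a scale below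
  \<open>1/k\<close> is \<open>1/k\<close>-close to its linear map. Almost every \<open>x\<close> in \<open>B\<^sub>k\<close> is a density point of a measurable
  hull of \<open>B\<^sub>k\<close>, hence if \<open>x\<close> is not totally singular there are points of \<open>B\<^sub>k\<close> near
  \<open>x + \<epsilon>\<^sub>i y\<^sub>0\<close>, a contradiction. Convergence in \<open>L\<^sup>1\<close> is already strict, because every blow-up has
  variation \<open>\<bar>K\<bar>\<close> in \<open>K\<close>, as has a linear map of norm one.
\<close>

section \<open>Vector measures\<close>

text \<open>The variation measure \<open>\<tau>\<close> of \<open>u\<close> is an arbitrary finite
  measure, in general far from doubling, and this shapes the proof twice. First, density points and
  approximate continuity with respect to \<open>\<tau>\<close> come from a covering of Besicovitch
  type with bounded overlap. It is carried out in the gauge of \<open>K\<close>, which is a norm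
  because \<open>K = - K\<close>, so that the balls of the differentiation theory are exactly the
  copies of \<open>K\<close> on which blow-ups live. Second, a small copy of \<open>K\<close> inside
  the copy of scale \<open>\<epsilon> i\<close> around \<open>x\<close> might carry less mass than
  the exceptional sets that have to be avoided. Around \<open>x + \<epsilon> i y0\<close> this
  cannot happen: the rescaled masses converge to \<open>\<nu>\<close>, which is comparable to
  Lebesgue measure near \<open>y0\<close>. The same comparison fixes the normalising constant of the
  secondary blow-up, so its limit is the linear map \<open>F x\<close> itself and not a multiple of
  it. Derivatives are handled as densities over finite Borel measures on the whole space, which
  turns rescaling into a push-forward. The result holds almost everywhere for the full variation;
  the Cantor part evaluates \<open>Du\<close> on subsets only and inherits its null sets.\<close>

definition variation_fun :: "'a measure \<Rightarrow> ('a set \<Rightarrow> 'b::real_normed_vector) \<Rightarrow> 'a set \<Rightarrow> ennreal" where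
  "variation_fun M \<mu> B =
     (SUP A \<in> {A :: nat \<Rightarrow> 'a set. range A \<subseteq> sets M \<and> disjoint_family A \<and> (\<Union>i. A i) = B}.
            (\<Sum>i. ennreal (norm (\<mu> (A i)))))"

lemma total_variation_alt: "total_variation M \<mu> = measure_of (space M) (sets M) (variation_fun M \<mu>)"
  unfolding total_variation_def variation_fun_def by simp

lemma sets_total_variation [simp, measurable_cong]: "sets (total_variation M \<mu>) = sets M"
  unfolding total_variation_alt by (simp add: sets.space_closed)

lemma space_total_variation [simp]: "space (total_variation M \<mu>) = space M"
  unfolding total_variation_alt by (simp add: space_measure_of_conv)

lemma vector_measure_sums:
  assumes "vector_measure M \<mu>" "range A \<subseteq> sets M" "disjoint_family (A :: nat \<Rightarrow> _)"
  shows "(\<lambda>i. \<mu> (A i)) sums \<mu> (\<Union>i. A i)"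
  using assms unfolding vector_measure_def by blast

lemma vector_measure_empty:
  assumes "vector_measure M \<mu>" shows "\<mu> {} = 0"
proof -
  have "(\<lambda>i::nat. \<mu> {}) sums \<mu> (\<Union>i::nat. {})"
    by (rule vector_measure_sums[OF assms]) (auto simp: disjoint_family_on_def)
  then have "summable (\<lambda>i::nat. \<mu> {})" by (auto simp: sums_iff)
  then show ?thesis by (simp add: summable_const_iff)
qed

lemma vector_measure_Un:
  assumes "vector_measure M \<mu>" "A \<in> sets M" "B \<in> sets M" "A \<inter> B = {}"
  shows "\<mu> (A \<union> B) = \<mu> A + \<mu> B"
proof -
  define C where "C = (\<lambda>i::nat. if i = 0 then A else if i = 1 then B else {})"
  have "(\<lambda>i. \<mu> (C i)) sums \<mu> (\<Union>i. C i)"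
    by (rule vector_measure_sums[OF assms(1)]) (use assms in \<open>auto simp: disjoint_family_on_def C_def\<close>)
  moreover have "(\<lambda>i. \<mu> (C i)) sums (\<Sum>i\<in>{0,1}. \<mu> (C i))"
    by (rule sums_finite) (auto simp: C_def vector_measure_empty[OF assms(1)])
  moreover have "(\<Union>i. C i) = A \<union> B"
    by (auto simp: C_def split: if_splits)
  ultimately show ?thesis by (auto dest: sums_unique2 simp: C_def)
qed

lemma vector_measure_Diff:
  assumes "vector_measure M \<mu>" "A \<in> sets M" "B \<in> sets M" "A \<subseteq> B"
  shows "\<mu> (B - A) = \<mu> B - \<mu> A"
proof -
  have "\<mu> (A \<union> (B - A)) = \<mu> A + \<mu> (B - A)"
    by (rule vector_measure_Un) (use assms in auto)
  moreover have "A \<union> (B - A) = B" using assms by auto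
  ultimately show ?thesis by simp
qed

lemma vector_measure_finite_UN:
  assumes "vector_measure M \<mu>" "finite I" "\<And>i. i \<in> I \<Longrightarrow> A i \<in> sets M" "disjoint_family_on A I"
  shows "\<mu> (\<Union>i\<in>I. A i) = (\<Sum>i\<in>I. \<mu> (A i))"
  using assms(2-4)
proof (induction I rule: finite_induct)
  case empty then show ?case by (simp add: vector_measure_empty[OF assms(1)])
next
  case (insert x F)
  have "\<mu> (A x \<union> (\<Union>i\<in>F. A i)) = \<mu> (A x) + \<mu> (\<Union>i\<in>F. A i)"
    by (rule vector_measure_Un[OF assms(1)]) (use insert in \<open>auto simp: disjoint_family_on_def\<close>)
  then show ?case using insert by (auto simp: disjoint_family_on_def)
qed

text \<open>Lower bounds by finite disjoint families that need not exhaust \<open>B\<close>: the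
  convenient form of a supremum that ranges over exact partitions into sequences.\<close>

lemma variation_fun_finite_family:
  fixes A :: "'i \<Rightarrow> 'a set"
  assumes "finite I" "\<And>i. i \<in> I \<Longrightarrow> A i \<in> sets M" "disjoint_family_on A I"
    "B \<in> sets M" "(\<Union>i\<in>I. A i) \<subseteq> B"
  shows "(\<Sum>i\<in>I. ennreal (norm (\<mu> (A i)))) \<le> variation_fun M \<mu> B"
proof -
  obtain e where e: "bij_betw e {..<card I} I"
    using ex_bij_betw_nat_finite[OF assms(1)] by (auto simp: lessThan_atLeast0)
  \<comment> \<open>Index \<open>card I\<close> receives the leftover of \<open>B\<close> and all
    later indices the empty set, which makes an exact sequence partition of the finite
    family.\<close>
  define C where "C k = (if k < card I then A (e k) else if k = card I then B - (\<Union>i\<in>I. A i) else {})" for k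
  have eI: "e k \<in> I" if "k < card I" for k using e that by (auto simp: bij_betw_def)
  have einj: "e k \<noteq> e l" if "k < card I" "l < card I" "k \<noteq> l" for k l
    using e that by (auto simp: bij_betw_def inj_on_def)
  have disj: "disjoint_family C"
    unfolding disjoint_family_on_def
  proof (intro ballI impI)
    fix k l :: nat assume "k \<noteq> l"
    then show "C k \<inter> C l = {}"
      using eI[of k] eI[of l] einj[of k l] assms(3)
      by (auto simp: C_def disjoint_family_on_def)
  qed
  have rng: "range C \<subseteq> sets M" using assms eI by (auto simp: C_def)
  have "(\<Union>k. C k) = B"
  proof
    show "(\<Union>k. C k) \<subseteq> B" using eI assms(5) by (auto simp: C_def split: if_splits)
    show "B \<subseteq> (\<Union>k. C k)"
    proof
      fix x assume x: "x \<in> B"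
      show "x \<in> (\<Union>k. C k)"
      proof (cases "x \<in> (\<Union>i\<in>I. A i)")
        case True
        then obtain i where "i \<in> I" "x \<in> A i" by auto
        moreover have "i \<in> e ` {..<card I}" using e \<open>i \<in> I\<close> by (simp add: bij_betw_def)
        then obtain k where "k < card I" "e k = i" by auto
        ultimately show ?thesis by (auto simp: C_def intro!: exI[of _ k])
      next
        case False
        then show ?thesis using x by (auto simp: C_def intro!: exI[of _ "card I"])
      qed
    qed
  qed
  then have *: "(\<Sum>k. ennreal (norm (\<mu> (C k)))) \<le> variation_fun M \<mu> B"
    unfolding variation_fun_def using rng disj by (intro SUP_upper) auto
  have "(\<Sum>i\<in>I. ennreal (norm (\<mu> (A i)))) = (\<Sum>k<card I. ennreal (norm (\<mu> (A (e k)))))"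
    by (rule sum.reindex_bij_betw[OF e, symmetric])
  also have "\<dots> = (\<Sum>k<card I. ennreal (norm (\<mu> (C k))))" by (simp add: C_def)
  also have "\<dots> \<le> (\<Sum>k. ennreal (norm (\<mu> (C k))))" by (rule sum_le_suminf) auto
  finally show ?thesis using * by simp
qed

lemma norm_le_variation_fun:
  assumes "B \<in> sets M" shows "ennreal (norm (\<mu> B)) \<le> variation_fun M \<mu> B"
  using variation_fun_finite_family[of "{()}" "\<lambda>_. B" M B \<mu>] assms
  by (simp add: disjoint_family_on_def)

lemma variation_fun_le:
  assumes "\<And>A :: nat \<Rightarrow> 'a set. range A \<subseteq> sets M \<Longrightarrow> disjoint_family A \<Longrightarrow> (\<Union>i. A i) = B \<Longrightarrow>
     (\<Sum>i. ennreal (norm (\<mu> (A i)))) \<le> c"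
  shows "variation_fun M \<mu> B \<le> c"
  unfolding variation_fun_def using assms by (auto intro!: SUP_least)

lemma ennreal_SUP_add_SUP_le:
  fixes f :: "'a \<Rightarrow> ennreal" and g :: "'b \<Rightarrow> ennreal"
  assumes "\<And>a b. a \<in> S \<Longrightarrow> b \<in> T \<Longrightarrow> f a + g b \<le> c" "S \<noteq> {}" "T \<noteq> {}"
  shows "(SUP a\<in>S. f a) + (SUP b\<in>T. g b) \<le> c"
proof -
  have "f a + (SUP b\<in>T. g b) \<le> c" if "a \<in> S" for a
    unfolding add.commute[of "f a"] ennreal_SUP_add_left[OF assms(3), symmetric] SUP_le_iff
    using assms that by (simp add: add.commute)
  then show ?thesis
    unfolding ennreal_SUP_add_left[OF assms(2), symmetric] SUP_le_iff by simp
qed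

text \<open>Superadditivity: partitions of \<open>B1\<close> and \<open>B2\<close> together form a
  disjoint family inside \<open>B\<close>. Only finitely many members are merged at a time, so that
  \<open>variation_fun_finite_family\<close> applies.\<close>

lemma variation_fun_add_le:
  assumes "B1 \<in> sets M" "B2 \<in> sets M" "B1 \<inter> B2 = {}" "B1 \<union> B2 \<subseteq> B" "B \<in> sets M"
  shows "variation_fun M \<mu> B1 + variation_fun M \<mu> B2 \<le> variation_fun M \<mu> B"
  unfolding variation_fun_def[of M \<mu> B1] variation_fun_def[of M \<mu> B2]
proof (rule ennreal_SUP_add_SUP_le)
  fix A1 A2
  assume A1: "A1 \<in> {A :: nat \<Rightarrow> 'a set. range A \<subseteq> sets M \<and> disjoint_family A \<and> (\<Union>i. A i) = B1}"
    and A2: "A2 \<in> {A :: nat \<Rightarrow> 'a set. range A \<subseteq> sets M \<and> disjoint_family A \<and> (\<Union>i. A i) = B2}"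
  \<comment> \<open>The Boolean records from which of the two partitions a member is taken.\<close>
  define A where "A p = (if fst p then A1 (snd p) else A2 (snd p))" for p
  have cross: "A1 i \<inter> A2 j = {}" for i j using A1 A2 assms(3) by blast
  have "(\<Sum>i<N. ennreal (norm (\<mu> (A1 i))) + ennreal (norm (\<mu> (A2 i)))) \<le> variation_fun M \<mu> B" for N
  proof -
    have "(\<Sum>i<N. ennreal (norm (\<mu> (A1 i))) + ennreal (norm (\<mu> (A2 i)))) = (\<Sum>p\<in>UNIV \<times> {..<N}. ennreal (norm (\<mu> (A p))))"
      proof -
      have "(\<Sum>p\<in>UNIV \<times> {..<N}. f p) = (\<Sum>b\<in>UNIV. \<Sum>i<N. f (b, i))" for f :: "bool \<times> nat \<Rightarrow> ennreal"
        by (simp add: sum.cartesian_product)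
      then show ?thesis by (simp add: UNIV_bool A_def sum.distrib add.commute del: sum_ennreal)
    qed
    also have "\<dots> \<le> variation_fun M \<mu> B"
    proof (rule variation_fun_finite_family)
      show "disjoint_family_on A (UNIV \<times> {..<N})"
        unfolding disjoint_family_on_def
      proof (intro ballI impI)
        fix p q :: "bool \<times> nat" assume "p \<noteq> q"
        moreover obtain b i where p: "p = (b, i)" by (cases p)
        moreover obtain b' i' where q: "q = (b', i')" by (cases q)
        moreover have "A1 i \<inter> A1 i' = {}" "A2 i \<inter> A2 i' = {}" if "i \<noteq> i'"
          using A1 A2 that by (auto simp: disjoint_family_on_def)
        ultimately show "A p \<inter> A q = {}"
          using cross[of i i'] cross[of i' i] by (cases b; cases b') (simp_all add: A_def Int_commute)
      qed
      show "(\<Union>i\<in>UNIV \<times> {..<N}. A i) \<subseteq> B"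
      proof
        fix x assume "x \<in> (\<Union>i\<in>UNIV \<times> {..<N}. A i)"
        then obtain b i where "x \<in> A (b, i)" by auto
        then have "x \<in> B1 \<union> B2" using A1 A2 by (cases b) (auto simp: A_def)
        then show "x \<in> B" using assms by blast
      qed
    qed (use A1 A2 assms in \<open>auto simp: A_def\<close>)
    finally show ?thesis .
  qed
  then have "(\<Sum>i. ennreal (norm (\<mu> (A1 i))) + ennreal (norm (\<mu> (A2 i)))) \<le> variation_fun M \<mu> B"
    by (intro suminf_le_const summableI)
  then show "(\<Sum>i. ennreal (norm (\<mu> (A1 i)))) + (\<Sum>i. ennreal (norm (\<mu> (A2 i)))) \<le> variation_fun M \<mu> B"
    by (simp add: suminf_add)
next
  have *: "(\<lambda>i::nat. if i = 0 then B else {}) \<in> {A. range A \<subseteq> sets M \<and> disjoint_family A \<and> (\<Union>i. A i) = B}"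
    if "B \<in> sets M" for B
    using that by (auto simp: disjoint_family_on_def split: if_splits)
  show "{A :: nat \<Rightarrow> 'a set. range A \<subseteq> sets M \<and> disjoint_family A \<and> (\<Union>i. A i) = B1} \<noteq> {}"
    by (rule ex_in_conv[THEN iffD1], rule exI, rule *[OF assms(1)])
  show "{A :: nat \<Rightarrow> 'a set. range A \<subseteq> sets M \<and> disjoint_family A \<and> (\<Union>i. A i) = B2} \<noteq> {}"
    by (rule ex_in_conv[THEN iffD1], rule exI, rule *[OF assms(2)])
qed

lemma suminf_swap_ennreal:
  fixes f :: "nat \<Rightarrow> nat \<Rightarrow> ennreal"
  shows "(\<Sum>i. \<Sum>j. f i j) = (\<Sum>j. \<Sum>i. f i j)"
  using nn_integral_suminf[of "\<lambda>j i. f i j" "count_space UNIV"]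
  by (simp add: nn_integral_count_space_nat)

text \<open>Only a countably additive set function is reproduced by \<open>measure_of\<close>, so
  this is what gives \<open>total_variation\<close> its intended values. One inequality is
  superadditivity, the other comes from refining a partition of the union by the sets
  \<open>B j\<close>.\<close>

lemma countably_additive_variation_fun:
  assumes vm: "vector_measure M (\<mu> :: 'a set \<Rightarrow> 'b::banach)"
  shows "measure_space (space M) (sets M) (variation_fun M \<mu>)"
proof -
  have pos: "variation_fun M \<mu> {} = 0"
  proof -
    have "variation_fun M \<mu> {} \<le> 0"
      by (rule variation_fun_le) (auto simp: vector_measure_empty[OF vm])
    then show ?thesis by simp
  qed
  have fin: "(\<Sum>j<N. variation_fun M \<mu> (B j)) \<le> variation_fun M \<mu> (\<Union>j<N. B j)"
    if B: "range B \<subseteq> sets M" "disjoint_family B" for B :: "nat \<Rightarrow> _" and N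
  proof (induction N)
    case 0 then show ?case by simp
  next
    case (Suc N)
    have BN: "B j \<inter> B N = {}" if "j < N" for j using B(2) that by (auto simp: disjoint_family_on_def)
    have "(\<Sum>j<Suc N. variation_fun M \<mu> (B j)) \<le> variation_fun M \<mu> (\<Union>j<N. B j) + variation_fun M \<mu> (B N)"
      using Suc by (simp add: add_right_mono)
    also have "\<dots> \<le> variation_fun M \<mu> (\<Union>j<Suc N. B j)"
      by (rule variation_fun_add_le) (use B BN in \<open>auto simp: lessThan_Suc\<close>)
    finally show ?case .
  qed
  have mono: "variation_fun M \<mu> A \<le> variation_fun M \<mu> B" if "A \<in> sets M" "B \<in> sets M" "A \<subseteq> B" for A B
    using variation_fun_add_le[of A M "{}" B \<mu>] that pos by simp
  have "countably_additive (sets M) (variation_fun M \<mu>)"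
    unfolding countably_additive_def
  proof (intro allI impI antisym)
    fix B :: "nat \<Rightarrow> 'a set"
    assume B: "range B \<subseteq> sets M" "disjoint_family B" "(\<Union>i. B i) \<in> sets M"
    have "(\<Sum>j<N. variation_fun M \<mu> (B j)) \<le> variation_fun M \<mu> (\<Union>j. B j)" for N
      using fin[OF B(1,2), of N] mono[of "\<Union>j<N. B j" "\<Union>j. B j"] B
      by (auto intro: order_trans)
    then show "(\<Sum>j. variation_fun M \<mu> (B j)) \<le> variation_fun M \<mu> (\<Union>j. B j)"
      by (intro suminf_le_const summableI)
    show "variation_fun M \<mu> (\<Union>j. B j) \<le> (\<Sum>j. variation_fun M \<mu> (B j))"
    proof (rule variation_fun_le)
      fix A :: "nat \<Rightarrow> 'a set"
      assume A: "range A \<subseteq> sets M" "disjoint_family A" "(\<Union>i. A i) = (\<Union>j. B j)"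
      \<comment> \<open>The triangle inequality for the countable splitting of \<open>A i\<close>:
        trivial if the norms have infinite sum, otherwise absolute summability lets the norm pass
        inside the series.\<close>
      have 1: "ennreal (norm (\<mu> (A i))) \<le> (\<Sum>j. ennreal (norm (\<mu> (A i \<inter> B j))))" for i
      proof -
        have "A i \<inter> B m \<inter> (A i \<inter> B n) = {}" if "m \<noteq> n" for m n
          using B(2) that unfolding disjoint_family_on_def by blast
        then have "disjoint_family (\<lambda>j. A i \<inter> B j)" unfolding disjoint_family_on_def by simp
        then have "(\<lambda>j. \<mu> (A i \<inter> B j)) sums \<mu> (\<Union>j. A i \<inter> B j)"
          by (intro vector_measure_sums[OF vm]) (use A B in auto)
        moreover have "(\<Union>j. A i \<inter> B j) = A i" using A(3) by auto
        ultimately have s: "(\<lambda>j. \<mu> (A i \<inter> B j)) sums \<mu> (A i)" by simp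
        show ?thesis
        proof (cases "(\<Sum>j. ennreal (norm (\<mu> (A i \<inter> B j)))) = top")
          case False
          then have "summable (\<lambda>j. norm (\<mu> (A i \<inter> B j)))"
            by (intro summable_suminf_not_top) auto
          then have "norm (\<mu> (A i)) \<le> (\<Sum>j. norm (\<mu> (A i \<inter> B j)))"
            using s summable_norm[of "\<lambda>j. \<mu> (A i \<inter> B j)"] by (simp add: sums_iff)
          moreover have "(\<Sum>j. ennreal (norm (\<mu> (A i \<inter> B j)))) = ennreal (\<Sum>j. norm (\<mu> (A i \<inter> B j)))"
            by (rule suminf_ennreal2) (use \<open>summable _\<close> in auto)
          ultimately show ?thesis by (simp add: ennreal_leI)
        qed simp
      qed
      have "(\<Sum>i. ennreal (norm (\<mu> (A i)))) \<le> (\<Sum>i. \<Sum>j. ennreal (norm (\<mu> (A i \<inter> B j))))"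
        by (intro suminf_le 1 summableI)
      also have "\<dots> = (\<Sum>j. \<Sum>i. ennreal (norm (\<mu> (A i \<inter> B j))))" by (rule suminf_swap_ennreal)
      also have "\<dots> \<le> (\<Sum>j. variation_fun M \<mu> (B j))"
      proof (intro suminf_le summableI)
        fix j
        show "(\<Sum>i. ennreal (norm (\<mu> (A i \<inter> B j)))) \<le> variation_fun M \<mu> (B j)"
          unfolding variation_fun_def
        proof (rule SUP_upper2[of "\<lambda>i. A i \<inter> B j"])
          have "disjoint_family (\<lambda>i. A i \<inter> B j)"
            using A(2) unfolding disjoint_family_on_def by blast
          moreover have "(\<Union>i. A i \<inter> B j) = B j"
            using A(3) by auto
          ultimately show "(\<lambda>i. A i \<inter> B j) \<in> {A. range A \<subseteq> sets M \<and> disjoint_family A \<and> \<Union> (range A) = B j}"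
            using A(1) B(1) by auto
        qed simp
      qed
      finally show "(\<Sum>i. ennreal (norm (\<mu> (A i)))) \<le> (\<Sum>j. variation_fun M \<mu> (B j))" .
    qed
  qed
  then show ?thesis
    unfolding measure_space_def using pos sets.sigma_algebra_axioms
    by (auto simp: positive_def)
qed

lemma emeasure_total_variation:
  assumes vm: "vector_measure M (\<mu> :: 'a set \<Rightarrow> 'b::banach)" and "B \<in> sets M"
  shows "emeasure (total_variation M \<mu>) B = variation_fun M \<mu> B"
  unfolding total_variation_alt
  by (rule emeasure_measure_of_sigma)
     (use countably_additive_variation_fun[OF vm] assms in \<open>auto simp: measure_space_def\<close>)

text \<open>In a partition with large total, the pieces of one sign alone have a union
  \<open>A\<close> with \<open>\<bar>\<mu> A\<bar>\<close> above
  \<open>1 + \<bar>\<mu> B\<bar>\<close>; then \<open>\<mu> (B - A) = \<mu> B - \<mu> A\<close>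
  exceeds 1 in modulus as well.\<close>

lemma variation_fun_infinite_split:
  assumes vm: "vector_measure M (\<mu> :: 'a set \<Rightarrow> real)" and B: "B \<in> sets M" "variation_fun M \<mu> B = top"
  obtains A where "A \<in> sets M" "A \<subseteq> B" "1 < norm (\<mu> A)" "1 < norm (\<mu> (B - A))"
proof -
  \<comment> \<open>The factor 2 pays for keeping only the better of the two signs.\<close>
  have "ennreal (2 * (1 + \<bar>\<mu> B\<bar>)) < variation_fun M \<mu> B" using B by simp
  then obtain A where A: "range A \<subseteq> sets M" "disjoint_family A" "(\<Union>i. A i) = B"
    and l: "ennreal (2 * (1 + \<bar>\<mu> B\<bar>)) < (\<Sum>i::nat. ennreal \<bar>\<mu> (A i)\<bar>)"
    unfolding variation_fun_def less_SUP_iff by auto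
  obtain N where N: "ennreal (2 * (1 + \<bar>\<mu> B\<bar>)) < (\<Sum>i<N. ennreal \<bar>\<mu> (A i)\<bar>)"
    using l unfolding suminf_eq_SUP less_SUP_iff by auto
  then have "ennreal (2 * (1 + \<bar>\<mu> B\<bar>)) < ennreal (\<Sum>i<N. \<bar>\<mu> (A i)\<bar>)"
    by (subst sum_ennreal[symmetric]) auto
  then have N: "2 * (1 + \<bar>\<mu> B\<bar>) < (\<Sum>i<N. \<bar>\<mu> (A i)\<bar>)"
    by (subst (asm) ennreal_less_iff) auto
  define P where "P = {i. i < N \<and> 0 \<le> \<mu> (A i)}"
  define Q where "Q = {i. i < N \<and> \<mu> (A i) < 0}"
  have PQ: "finite P" "finite Q" "P \<inter> Q = {}" "{..<N} = P \<union> Q" by (auto simp: P_def Q_def)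
  have "(\<Sum>i<N. \<bar>\<mu> (A i)\<bar>) = (\<Sum>i\<in>P. \<bar>\<mu> (A i)\<bar>) + (\<Sum>i\<in>Q. \<bar>\<mu> (A i)\<bar>)"
    unfolding PQ(4) by (rule sum.union_disjoint) (use PQ in auto)
  also have "(\<Sum>i\<in>P. \<bar>\<mu> (A i)\<bar>) = (\<Sum>i\<in>P. \<mu> (A i))" by (rule sum.cong) (auto simp: P_def)
  also have "(\<Sum>i\<in>Q. \<bar>\<mu> (A i)\<bar>) = - (\<Sum>i\<in>Q. \<mu> (A i))"
    unfolding sum_negf[symmetric] by (rule sum.cong) (auto simp: Q_def)
  finally have *: "(\<Sum>i<N. \<bar>\<mu> (A i)\<bar>) = (\<Sum>i\<in>P. \<mu> (A i)) + - (\<Sum>i\<in>Q. \<mu> (A i))" .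
  have "2 * x < p + - q \<Longrightarrow> x < \<bar>p\<bar> \<or> x < \<bar>q\<bar>" for x p q :: real by linarith
  from this[OF N[unfolded *]] have "1 + \<bar>\<mu> B\<bar> < \<bar>\<Sum>i\<in>P. \<mu> (A i)\<bar> \<or> 1 + \<bar>\<mu> B\<bar> < \<bar>\<Sum>i\<in>Q. \<mu> (A i)\<bar>" .
  then obtain I where I: "finite I" "1 + \<bar>\<mu> B\<bar> < \<bar>\<Sum>i\<in>I. \<mu> (A i)\<bar>" using PQ by blast
  define C where "C = (\<Union>i\<in>I. A i)"
  have "\<mu> C = (\<Sum>i\<in>I. \<mu> (A i))"
    unfolding C_def by (rule vector_measure_finite_UN[OF vm I(1)]) (use A in \<open>auto simp: disjoint_family_on_def\<close>)
  moreover have C: "C \<in> sets M" "C \<subseteq> B" unfolding C_def using A I by auto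
  moreover have "\<mu> (B - C) = \<mu> B - \<mu> C" by (rule vector_measure_Diff[OF vm C(1) B(1) C(2)])
  ultimately show ?thesis using that[of C] I by auto
qed

text \<open>Infinite variation would be inherited by one part of each splitting, hence forever. The
  discarded parts are disjoint and exceed 1 in modulus, against the convergence of the series over
  them.\<close>

lemma variation_fun_finite_real:
  assumes vm: "vector_measure M (\<mu> :: 'a set \<Rightarrow> real)"
  shows "variation_fun M \<mu> (space M) < top"
proof (rule ccontr)
  assume "\<not> ?thesis"
  then have inf: "variation_fun M \<mu> (space M) = top" using top.not_eq_extremum by blast
  let ?P = "\<lambda>n B. B \<in> sets M \<and> variation_fun M \<mu> B = top"
  have "\<exists>B. \<forall>n::nat. ?P n (B n) \<and> (B (Suc n) \<subseteq> B n \<and> 1 < norm (\<mu> (B n - B (Suc n))))"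
  proof (rule dependent_nat_choice)
    show "\<exists>B. ?P 0 B" using inf by auto
    fix B and n :: nat assume B: "?P n B"
    then obtain A where A: "A \<in> sets M" "A \<subseteq> B" "1 < norm (\<mu> A)" "1 < norm (\<mu> (B - A))"
      using variation_fun_infinite_split[OF vm] by metis
    have "emeasure (total_variation M \<mu>) (A \<union> (B - A)) = emeasure (total_variation M \<mu>) A + emeasure (total_variation M \<mu>) (B - A)"
      by (rule plus_emeasure[symmetric]) (use A B in auto)
    moreover have "A \<union> (B - A) = B" using A by auto
    ultimately have "variation_fun M \<mu> B = variation_fun M \<mu> A + variation_fun M \<mu> (B - A)"
      using A B by (simp add: emeasure_total_variation[OF vm] sets.Diff)
    then consider "variation_fun M \<mu> A = top" | "variation_fun M \<mu> (B - A) = top"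
      using B by (metis ennreal_add_eq_top)
    then show "\<exists>B'. ?P (Suc n) B' \<and> (B' \<subseteq> B \<and> 1 < norm (\<mu> (B - B')))"
    proof cases
      case 1 then show ?thesis using A by auto
    next
      case 2
      then show ?thesis using A B by (intro exI[of _ "B - A"]) (auto simp: double_diff)
    qed
  qed
  then obtain B where B: "\<And>n::nat. B n \<in> sets M" "\<And>n. B (Suc n) \<subseteq> B n" "\<And>n. 1 < norm (\<mu> (B n - B (Suc n)))"
    by blast
  have dec: "B m \<subseteq> B n" if "n \<le> m" for m n
    using lift_Suc_antimono_le[of B, OF B(2) that] .
  have disj: "disjoint_family (\<lambda>n. B n - B (Suc n))"
    unfolding disjoint_family_on_def
  proof (intro ballI impI)
    fix m n :: nat assume "m \<noteq> n"
    then have "Suc m \<le> n \<or> Suc n \<le> m" by auto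
    then show "(B m - B (Suc m)) \<inter> (B n - B (Suc n)) = {}"
      using dec[of "Suc m" n] dec[of "Suc n" m] by auto
  qed
  have "(\<lambda>n. \<mu> (B n - B (Suc n))) sums \<mu> (\<Union>n. B n - B (Suc n))"
    by (rule vector_measure_sums[OF vm]) (use B disj in auto)
  then have "(\<lambda>n. \<mu> (B n - B (Suc n))) \<longlonglongrightarrow> 0" by (auto simp: sums_iff intro: summable_LIMSEQ_zero)
  then have "(\<lambda>n. norm (\<mu> (B n - B (Suc n)))) \<longlonglongrightarrow> 0" by (rule tendsto_norm_zero)
  then have "eventually (\<lambda>n. norm (\<mu> (B n - B (Suc n))) < 1) sequentially"
    by (rule order_tendstoD) simp
  then obtain n where "norm (\<mu> (B n - B (Suc n))) < 1" by (auto simp: eventually_sequentially)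
  then show False using B(3)[of n] by simp
qed

lemma vector_measure_bounded_linear:
  assumes "vector_measure M \<mu>" "bounded_linear f"
  shows "vector_measure M (\<lambda>B. f (\<mu> B))"
  using assms bounded_linear.sums[OF assms(2)] linear_0[OF bounded_linear.linear[OF assms(2)]]
  unfolding vector_measure_def by auto

text \<open>The norm is at most the sum of the moduli of the coordinates, which reduces finiteness
  to real-valued set functions.\<close>

lemma finite_measure_total_variation:
  assumes vm: "vector_measure M (\<mu> :: 'a set \<Rightarrow> 'b::euclidean_space)"
  shows "finite_measure (total_variation M \<mu>)"
proof
  have comp: "vector_measure M (\<lambda>B. \<mu> B \<bullet> b)" for b
    by (rule vector_measure_bounded_linear[OF vm bounded_linear_inner_left])
  have "variation_fun M \<mu> (space M) \<le> (\<Sum>b\<in>Basis. variation_fun M (\<lambda>B. \<mu> B \<bullet> b) (space M))"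
  proof (rule variation_fun_le)
    fix A :: "nat \<Rightarrow> 'a set"
    assume A: "range A \<subseteq> sets M" "disjoint_family A" "(\<Union>i. A i) = space M"
    have "(\<Sum>i. ennreal (norm (\<mu> (A i)))) \<le> (\<Sum>i. \<Sum>b\<in>Basis. ennreal (norm (\<mu> (A i) \<bullet> b)))"
    proof (intro suminf_le summableI)
      fix i
      have "norm (\<mu> (A i)) \<le> (\<Sum>b\<in>Basis. norm (\<mu> (A i) \<bullet> b))" using norm_le_l1 by auto
      then show "ennreal (norm (\<mu> (A i))) \<le> (\<Sum>b\<in>Basis. ennreal (norm (\<mu> (A i) \<bullet> b)))"
        by (subst sum_ennreal) (auto intro: ennreal_leI)
    qed
    also have "\<dots> = (\<Sum>b\<in>Basis. \<Sum>i. ennreal (norm (\<mu> (A i) \<bullet> b)))"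
      by (rule suminf_sum[OF summableI])
    also have "\<dots> \<le> (\<Sum>b\<in>Basis. variation_fun M (\<lambda>B. \<mu> B \<bullet> b) (space M))"
      by (rule sum_mono) (unfold variation_fun_def, rule SUP_upper, use A in auto)
    finally show "(\<Sum>i. ennreal (norm (\<mu> (A i)))) \<le> \<dots>" .
  qed
  also have "\<dots> < top" using variation_fun_finite_real[OF comp] by (simp add: less_top[symmetric])
  finally show "emeasure (total_variation M \<mu>) (space (total_variation M \<mu>)) \<noteq> \<infinity>"
    by (simp add: emeasure_total_variation[OF vm])
qed

section \<open>Densities of vector measures and of their total variation\<close>

lemma integrable_imp_set_integrable:
  fixes f :: "_ \<Rightarrow> _::{banach, second_countable_topology}"
  shows "integrable M f \<Longrightarrow> A \<in> sets M \<Longrightarrow> set_integrable M A f"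
  unfolding set_integrable_def by (rule integrable_mult_indicator)

lemma vector_measure_diff:
  assumes "vector_measure M \<mu>" "vector_measure M \<nu>"
  shows "vector_measure M (\<lambda>B. \<mu> B - \<nu> B)"
  using assms unfolding vector_measure_def by (auto intro!: sums_diff)

lemma vector_measure_measure:
  assumes "finite_measure \<tau>" "sets \<tau> = sets M"
  shows "vector_measure M (measure \<tau>)"
  unfolding vector_measure_def
  using finite_measure.finite_measure_UNION[OF assms(1)] measure_notin_sets[of _ \<tau>] assms(2) by auto

lemma vector_measure_density:
  fixes F :: "'a \<Rightarrow> 'b::{banach, second_countable_topology}"
  assumes F: "integrable \<tau> F" and sets: "sets \<tau> = sets M"
  shows "vector_measure M (\<lambda>B. if B \<in> sets M then LINT x:B|\<tau>. F x else 0)"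
  unfolding vector_measure_def
proof (intro conjI allI impI)
  fix A :: "nat \<Rightarrow> 'a set" assume A: "range A \<subseteq> sets M" "disjoint_family A"
  have si: "set_integrable \<tau> B F" if "B \<in> sets M" for B
    unfolding set_integrable_def using that sets by (intro integrable_mult_indicator F) auto
  have "(\<lambda>n. LINT x:(\<Union>i<n. A i)|\<tau>. F x) \<longlonglongrightarrow> (LINT x:(\<Union>n. \<Union>i<n. A i)|\<tau>. F x)"
    by (rule set_integral_cont_up) (use A sets si in \<open>fastforce simp: incseq_def\<close>)+
  moreover have "(\<Union>n. \<Union>i<n. A i) = (\<Union>i. A i)" by auto
  moreover have "(LINT x:(\<Union>i<n. A i)|\<tau>. F x) = (\<Sum>i<n. LINT x:A i|\<tau>. F x)" for n
  proof (rule set_integral_finite_Union)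
    show "disjoint_family_on A {..<n}" using A(2) by (auto simp: disjoint_family_on_def)
  qed (use A sets si in auto)
  ultimately have "(\<lambda>i. LINT x:A i|\<tau>. F x) sums (LINT x:(\<Union>i. A i)|\<tau>. F x)"
    unfolding sums_def by simp
  moreover have "A i \<in> sets M" "(\<Union>i. A i) \<in> sets M" for i using A by auto
  ultimately show "(\<lambda>i. if A i \<in> sets M then LINT x:A i|\<tau>. F x else 0) sums
      (if (\<Union>i. A i) \<in> sets M then LINT x:(\<Union>i. A i)|\<tau>. F x else 0)" by simp
qed auto

lemma finite_measure_density_measure:
  fixes g :: "'a \<Rightarrow> real"
  assumes "integrable T g" "AE x in T. 0 \<le> g x" "B \<in> sets T"
  shows "measure (density T g) B = (LINT x:B|T. g x)"
proof -
  have "measure (density T g) B = integral\<^sup>L (density T g) (indicator B)"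
    using assms(3) sets.sets_into_space[OF assms(3)] by (simp add: Int_absorb2)
  also have "\<dots> = (\<integral>x. g x *\<^sub>R indicator B x \<partial>T)"
    using assms by (subst integral_density) auto
  finally show ?thesis by (simp add: set_lebesgue_integral_def mult.commute)
qed

text \<open>Radon-Nikodym for a signed set function: by the domination, adding \<open>T\<close>
  gives a positive measure \<open>N\<close>, and the density 1 of \<open>T\<close> is subtracted
  afterwards.\<close>

lemma dominated_real_vector_measure_density:
  fixes c :: "'a set \<Rightarrow> real"
  assumes fin: "finite_measure T" and vm: "vector_measure T c"
    and dom: "\<And>B. B \<in> sets T \<Longrightarrow> \<bar>c B\<bar> \<le> measure T B"
  obtains h where "integrable T h" "\<And>B. B \<in> sets T \<Longrightarrow> c B = (LINT x:B|T. h x)"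
proof -
  interpret T: finite_measure T by fact
  define N where "N = measure_of (space T) (sets T) (\<lambda>B. ennreal (measure T B + c B))"
  have nn: "0 \<le> measure T B + c B" if "B \<in> sets T" for B using dom[OF that] by linarith
  have sN: "sets N = sets T" "space N = space T"
    by (auto simp: N_def sets.space_closed space_measure_of_conv)
  have eN: "emeasure N B = ennreal (measure T B + c B)" if "B \<in> sets T" for B
    unfolding N_def
  proof (rule emeasure_measure_of_sigma[OF sets.sigma_algebra_axioms _ _ that])
    show "positive (sets T) (\<lambda>B. ennreal (measure T B + c B))"
      by (auto simp: positive_def vector_measure_empty[OF vm])
    show "countably_additive (sets T) (\<lambda>B. ennreal (measure T B + c B))"
      unfolding countably_additive_def
    proof (intro allI impI)
      fix A :: "nat \<Rightarrow> 'a set" assume A: "range A \<subseteq> sets T" "disjoint_family A" "(\<Union>i. A i) \<in> sets T"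
      have s: "(\<lambda>i. measure T (A i) + c (A i)) sums (measure T (\<Union>i. A i) + c (\<Union>i. A i))"
        by (intro sums_add T.finite_measure_UNION vector_measure_sums[OF vm] A)
      show "(\<Sum>i. ennreal (measure T (A i) + c (A i))) = ennreal (measure T (\<Union>i. A i) + c (\<Union>i. A i))"
        using s nn A by (subst suminf_ennreal2) (auto simp: sums_iff)
    qed
  qed
  have ac: "absolutely_continuous T N"
    unfolding absolutely_continuous_def
  proof
    fix A assume A: "A \<in> null_sets T"
    then have "measure T A = 0" "A \<in> sets T" by (auto simp: measure_eq_0_null_sets)
    moreover then have "c A = 0" using dom[of A] by simp
    ultimately show "A \<in> null_sets N" using eN[of A] sN by (simp add: null_sets_def)
  qed
  then obtain f where f: "f \<in> borel_measurable T" "density T f = N"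
    using T.Radon_Nikodym[OF ac sN(1)] by auto
  have fin: "(\<integral>\<^sup>+x. f x \<partial>T) \<noteq> top"
  proof -
    have "emeasure (density T f) (space T) = (\<integral>\<^sup>+x. f x \<partial>T)"
      by (subst emeasure_density) (use f(1) in \<open>auto intro!: nn_integral_cong\<close>)
    then show ?thesis using eN[of "space T"] f by (metis ennreal_neq_top sets.top)
  qed
  then have "AE x in T. f x \<noteq> top" using f nn_integral_PInf_AE[of f T] by auto
  define g where "g x = enn2real (f x)" for x
  have gm: "g \<in> borel_measurable T" unfolding g_def using f(1) by measurable
  have fg: "AE x in T. f x = ennreal (g x)"
    using \<open>AE x in T. f x \<noteq> top\<close> by eventually_elim (simp add: g_def less_top[symmetric])
  have "(\<integral>\<^sup>+x. ennreal (g x) \<partial>T) = (\<integral>\<^sup>+x. f x \<partial>T)"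
    using fg by (intro nn_integral_cong_AE) auto
  then have gi: "integrable T g"
    using gm fin by (intro integrableI_nonneg) (auto simp: g_def less_top)
  have "density T g = N"
    unfolding f(2)[symmetric] by (rule density_cong) (use gm f fg in auto)
  then have *: "measure T B + c B = (LINT x:B|T. g x)" if "B \<in> sets T" for B
    using finite_measure_density_measure[OF gi _ that] eN[OF that] nn[OF that]
    by (simp add: g_def measure_def)
  show thesis
  proof (rule that[of "\<lambda>x. g x - 1"])
    show "integrable T (\<lambda>x. g x - 1)" using gi by simp
    fix B assume B: "B \<in> sets T"
    have "(LINT x:B|T. g x - 1) = (LINT x:B|T. g x) - (LINT x:B|T. 1)"
      by (rule set_integral_diff) (use B gi in \<open>auto intro: integrable_imp_set_integrable\<close>)
    also have "(LINT x:B|T. 1) = measure T B"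
      using sets.sets_into_space[OF B] by (simp add: set_lebesgue_integral_def Int_absorb2)
    finally show "c B = (LINT x:B|T. g x - 1)" using *[OF B] by simp
  qed
qed

lemma norm_le_measure_total_variation:
  fixes \<mu> :: "'a set \<Rightarrow> 'b::euclidean_space"
  assumes vm: "vector_measure M \<mu>" and B: "B \<in> sets M"
  shows "norm (\<mu> B) \<le> measure (total_variation M \<mu>) B"
proof -
  interpret T: finite_measure "total_variation M \<mu>" by (rule finite_measure_total_variation[OF vm])
  have "ennreal (norm (\<mu> B)) \<le> emeasure (total_variation M \<mu>) B"
    using norm_le_variation_fun[OF B, of \<mu>] by (simp add: emeasure_total_variation[OF vm B])
  then show ?thesis by (simp add: T.emeasure_eq_measure)
qed

text \<open>Every coordinate of \<open>\<mu>\<close> is dominated by the total variation, so the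
  densities of the coordinates can be assembled. That the result has norm one is settled separately,
  in \<open>polar_density_properties\<close>.\<close>

lemma vector_measure_polar_exists:
  fixes \<mu> :: "'a set \<Rightarrow> 'b::euclidean_space"
  assumes vm: "vector_measure M \<mu>"
  shows "\<exists>f. integrable (total_variation M \<mu>) f \<and>
     (\<forall>B \<in> sets M. \<mu> B = (LINT x:B|total_variation M \<mu>. f x))"
proof -
  let ?T = "total_variation M \<mu>"
  interpret T: finite_measure ?T by (rule finite_measure_total_variation[OF vm])
  have "\<exists>h. integrable ?T h \<and> (\<forall>B\<in>sets M. \<mu> B \<bullet> b = (LINT x:B|?T. h x))" if "b \<in> Basis" for b
  proof -
    have vmb: "vector_measure ?T (\<lambda>B. \<mu> B \<bullet> b)"
      using vector_measure_bounded_linear[OF vm bounded_linear_inner_left[of b]]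
      by (simp add: vector_measure_def)
    have dom: "\<bar>\<mu> B \<bullet> b\<bar> \<le> measure ?T B" if "B \<in> sets ?T" for B
      using norm_le_measure_total_variation[OF vm, of B] that Basis_le_norm[OF \<open>b \<in> Basis\<close>, of "\<mu> B"] by simp
    obtain h where "integrable ?T h" "\<And>B. B \<in> sets ?T \<Longrightarrow> \<mu> B \<bullet> b = (LINT x:B|?T. h x)"
      using dominated_real_vector_measure_density[OF T.finite_measure_axioms vmb dom] by metis
    then show ?thesis by auto
  qed
  then obtain h where h: "\<And>b. b \<in> Basis \<Longrightarrow> integrable ?T (h b)"
    "\<And>b B. b \<in> Basis \<Longrightarrow> B \<in> sets M \<Longrightarrow> \<mu> B \<bullet> b = (LINT x:B|?T. h b x)" by metis
  define f where "f x = (\<Sum>b\<in>Basis. h b x *\<^sub>R b)" for x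
  have f: "integrable ?T f" unfolding f_def using h by (intro Bochner_Integration.integrable_sum integrable_scaleR_left) auto
  have "\<mu> B = (LINT x:B|?T. f x)" if B: "B \<in> sets M" for B
  proof (rule euclidean_eqI)
    fix b :: 'b assume b: "b \<in> Basis"
    have fb: "f x \<bullet> b = h b x" for x
      using b by (simp add: f_def inner_sum_left inner_Basis if_distrib cong: if_cong)
    have "integrable ?T (\<lambda>x. indicator B x *\<^sub>R f x)"
      by (rule integrable_mult_indicator) (use B f in auto)
    then have "(LINT x:B|?T. f x) \<bullet> b = (LINT x:B|?T. h b x)"
      unfolding set_lebesgue_integral_def
      by (subst integral_inner_left[symmetric]) (auto simp: fb)
    then show "\<mu> B \<bullet> b = (LINT x:B|?T. f x) \<bullet> b" using h b B by simp
  qed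
  with f show ?thesis by auto
qed

lemma AE_le_if_set_integral_le:
  fixes f g :: "'a \<Rightarrow> real"
  assumes f: "integrable M f" and g: "integrable M g"
    and le: "\<And>A. A \<in> sets M \<Longrightarrow> (LINT x:A|M. f x) \<le> (LINT x:A|M. g x)"
  shows "AE x in M. f x \<le> g x"
proof -
  define A where "A = {x \<in> space M. g x < f x}"
  have A: "A \<in> sets M" unfolding A_def using f g by measurable
  have i: "set_integrable M A f" "set_integrable M A g"
    using A f g by (auto intro: integrable_imp_set_integrable)
  have int: "integrable M (\<lambda>x. indicator A x *\<^sub>R (f x - g x))"
    using A f g by (intro integrable_mult_indicator) auto
  have nn: "0 \<le> indicator A x *\<^sub>R (f x - g x)" for x by (auto simp: A_def indicator_def)
  have "(LINT x:A|M. f x - g x) \<le> 0"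
    using le[OF A] set_integral_diff(2)[OF i] by simp
  moreover have "(LINT x:A|M. f x - g x) \<ge> 0"
    unfolding set_lebesgue_integral_def by (rule integral_nonneg_AE) (use nn in auto)
  ultimately have "AE x in M. indicator A x *\<^sub>R (f x - g x) = 0"
    using integral_nonneg_eq_0_iff_AE[OF int] nn unfolding set_lebesgue_integral_def by simp
  then show ?thesis using AE_space by eventually_elim (auto simp: A_def indicator_def split: if_splits)
qed

text \<open>The exceptional null set depends on the direction \<open>e\<close>, so a countable dense
  set of directions is used; strict violation is an open condition on \<open>e\<close> and is
  therefore seen by one of them.\<close>

lemma AE_norm_le_if_inner_le:
  fixes F :: "'a \<Rightarrow> 'b::euclidean_space"
  assumes "\<And>e. norm e \<le> 1 \<Longrightarrow> AE x in M. F x \<bullet> e \<le> G x"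
  shows "AE x in M. norm (F x) \<le> G x"
proof -
  obtain D :: "'b set" where D: "countable D" "\<And>X. open X \<Longrightarrow> X \<noteq> {} \<Longrightarrow> \<exists>d\<in>D. d \<in> X"
    using countable_dense_exists by blast
  have "AE x in M. \<forall>d\<in>D \<inter> cball 0 1. F x \<bullet> d \<le> G x"
    by (subst AE_ball_countable) (use D assms in auto)
  then show ?thesis
  proof eventually_elim
    case (elim x)
    show "norm (F x) \<le> G x"
    proof (rule ccontr)
      assume n: "\<not> ?thesis"
      define X where "X = {e. norm e < 1 \<and> G x < F x \<bullet> e}"
      have "open X" unfolding X_def by (intro open_Collect_conj open_Collect_less continuous_intros)
      moreover have "X \<noteq> {}"
      proof (cases "F x = 0")
        case True then show ?thesis using n by (auto simp: X_def intro!: exI[of _ 0])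
      next
        case False
        \<comment> \<open>The midpoint between 1 and \<open>G x / norm (F x)\<close>, truncated at
          0: it is below 1 and still makes \<open>s * norm (F x)\<close> exceed
          \<open>G x\<close>.\<close>
        define s where "s = max 0 (1 + G x / norm (F x)) / 2"
        have s: "0 \<le> s" "s < 1" "G x < s * norm (F x)"
          using n False by (auto simp: s_def field_simps max_def split: if_splits)
        have "F x \<bullet> ((s / norm (F x)) *\<^sub>R F x) = s * norm (F x)"
          using False by (simp add: dot_square_norm power2_eq_square)
        then have "(s / norm (F x)) *\<^sub>R F x \<in> X" using s False by (auto simp: X_def)
        then show ?thesis by auto
      qed
      ultimately obtain d where "d \<in> D" "d \<in> X" using D by blast
      then show False using elim by (force simp: X_def)
    qed
  qed
qed

text \<open>The total variation of a vector measure with a density is computed by another application of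
  the Radon-Nikodym theorem, to \<open>\<bar>\<mu>\<bar>\<close> itself, which avoids manipulating partitions.\<close>

lemma total_variation_density:
  fixes F :: "'a \<Rightarrow> 'b::euclidean_space"
  assumes fin: "finite_measure \<tau>" and F: "integrable \<tau> F" and sets: "sets \<tau> = sets M"
    and \<mu>: "\<And>B. B \<in> sets M \<Longrightarrow> \<mu> B = (LINT x:B|\<tau>. F x)" and vm: "vector_measure M \<mu>"
  shows "total_variation M \<mu> = density \<tau> (\<lambda>x. ennreal (norm (F x)))"
proof (rule measure_eqI)
  interpret \<tau>: finite_measure \<tau> by fact
  let ?T = "total_variation M \<mu>" and ?d = "density \<tau> (\<lambda>x. ennreal (norm (F x)))"
  interpret T: finite_measure ?T by (rule finite_measure_total_variation[OF vm])
  have Fm[measurable]: "F \<in> borel_measurable \<tau>" using F by auto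
  have Fn: "integrable \<tau> (\<lambda>x. norm (F x))" using F by auto
  show "sets ?T = sets ?d" using sets by simp
  have d: "emeasure ?d A = (\<integral>\<^sup>+x. norm (indicator A x *\<^sub>R F x) \<partial>\<tau>)" if "A \<in> sets M" for A
    using that sets by (subst emeasure_density) (auto intro!: nn_integral_cong simp: indicator_def)
  have le1: "ennreal (norm (\<mu> A)) \<le> emeasure ?d A" if "A \<in> sets M" for A
  proof -
    have "integrable \<tau> (\<lambda>x. indicator A x *\<^sub>R F x)" using that sets F by (intro integrable_mult_indicator) auto
    from integral_norm_bound_ennreal[OF this] show ?thesis
      using \<mu>[OF that] d[OF that] by (simp add: set_lebesgue_integral_def)
  qed
  have le: "emeasure ?T B \<le> emeasure ?d B" if "B \<in> sets M" for B
    unfolding emeasure_total_variation[OF vm that]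
  proof (rule variation_fun_le)
    fix A :: "nat \<Rightarrow> 'a set" assume A: "range A \<subseteq> sets M" "disjoint_family A" "(\<Union>i. A i) = B"
    have "(\<Sum>i. ennreal (norm (\<mu> (A i)))) \<le> (\<Sum>i. emeasure ?d (A i))"
      by (intro suminf_le le1 summableI) (use A in auto)
    also have "\<dots> = emeasure ?d (\<Union>i. A i)" using A sets by (intro suminf_emeasure) auto
    finally show "(\<Sum>i. ennreal (norm (\<mu> (A i)))) \<le> emeasure ?d B" using A by simp
  qed
  have find: "finite_measure ?d"
  proof
    have "emeasure ?d (space ?d) = (\<integral>\<^sup>+x. norm (F x) \<partial>\<tau>)"
      by (subst emeasure_density) (auto intro!: nn_integral_cong)
    also have "\<dots> < \<infinity>" using F by (simp add: integrable_iff_bounded)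
    finally show "emeasure ?d (space ?d) \<noteq> \<infinity>" by simp
  qed
  interpret d: finite_measure ?d by fact
  have vmT: "vector_measure ?d (measure ?T)"
    using vector_measure_measure[OF T.finite_measure_axioms, of ?d] sets by simp
  have dom: "\<bar>measure ?T B\<bar> \<le> measure ?d B" if "B \<in> sets ?d" for B
    using le[of B] that sets by (simp add: T.emeasure_eq_measure d.emeasure_eq_measure)
  obtain h where h: "integrable ?d h" "\<And>B. B \<in> sets ?d \<Longrightarrow> measure ?T B = (LINT x:B|?d. h x)"
    using dominated_real_vector_measure_density[OF find vmT dom] by metis
  \<comment> \<open>\<open>G\<close> is the density of \<open>?T\<close> over \<open>\<tau>\<close>.
    What remains is \<open>norm (F x) \<le> G x\<close>, which is tested one direction at a time
    with \<open>norm (\<mu> A) \<le> measure ?T A\<close>.\<close>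
  define G where "G x = norm (F x) * h x" for x
  have hm[measurable]: "h \<in> borel_measurable \<tau>" using h(1) by auto
  have G: "integrable \<tau> G" using h(1) integrable_density[of h \<tau> "\<lambda>x. norm (F x)"] unfolding G_def by simp
  have TG: "measure ?T B = (LINT x:B|\<tau>. G x)" if "B \<in> sets M" for B
  proof -
    have "measure ?T B = (LINT x:B|?d. h x)" using h(2) that sets by simp
    also have "\<dots> = (LINT x|\<tau>. norm (F x) *\<^sub>R (indicator B x *\<^sub>R h x))"
      unfolding set_lebesgue_integral_def
      by (rule integral_density) (use that sets in auto)
    also have "\<dots> = (LINT x:B|\<tau>. G x)"
      unfolding set_lebesgue_integral_def by (rule Bochner_Integration.integral_cong) (auto simp: G_def)
    finally show ?thesis .
  qed
  have "AE x in \<tau>. norm (F x) \<le> G x"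
  proof (rule AE_norm_le_if_inner_le, rule AE_le_if_set_integral_le)
    fix e :: 'b assume e: "norm e \<le> 1"
    show "integrable \<tau> (\<lambda>x. F x \<bullet> e)" using F by auto
    show "integrable \<tau> G" by (rule G)
    fix A assume A: "A \<in> sets \<tau>"
    have "integrable \<tau> (\<lambda>x. indicator A x *\<^sub>R F x)" using A F by (intro integrable_mult_indicator) auto
    then have "(LINT x:A|\<tau>. F x \<bullet> e) = \<mu> A \<bullet> e"
      using A sets \<mu>[of A] integral_inner_left[of e \<tau> "\<lambda>x. indicator A x *\<^sub>R F x"]
      unfolding set_lebesgue_integral_def by simp
    also have "\<dots> \<le> norm (\<mu> A) * norm e" by (rule norm_cauchy_schwarz)
    also have "\<dots> \<le> norm (\<mu> A)" using e by (simp add: mult_left_le)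
    also have "\<dots> \<le> measure ?T A" using A sets norm_le_measure_total_variation[OF vm] by simp
    finally show "(LINT x:A|\<tau>. F x \<bullet> e) \<le> (LINT x:A|\<tau>. G x)" using TG A sets by simp
  qed
  then have FG: "AE x in \<tau>. norm (F x) \<le> G x" .
  fix B assume "B \<in> sets ?T"
  then have B: "B \<in> sets M" by simp
  have "measure ?d B = (LINT x:B|\<tau>. norm (F x))"
    using B sets by (intro finite_measure_density_measure[OF Fn]) auto
  also have "\<dots> \<le> (LINT x:B|\<tau>. G x)"
    unfolding set_lebesgue_integral_def
  proof (rule integral_mono_AE)
    show "AE x in \<tau>. indicator B x *\<^sub>R norm (F x) \<le> indicator B x *\<^sub>R G x"
      using FG by eventually_elim (auto simp: indicator_def)
  qed (use B sets Fn G in \<open>auto simp del: real_scaleR_def intro!: integrable_mult_indicator\<close>)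
  also have "\<dots> = measure ?T B" using TG[OF B] by simp
  finally have "emeasure ?d B \<le> emeasure ?T B"
    by (simp add: T.emeasure_eq_measure d.emeasure_eq_measure)
  then show "emeasure ?T B = emeasure ?d B" using le[OF B] by simp
qed

text \<open>For the norm, \<open>total_variation_density\<close> is applied with the total variation
  itself as reference measure: multiplying it by the norm of the density changes nothing, so that
  norm is 1 almost everywhere.\<close>

lemma polar_density_properties:
  fixes \<mu> :: "'a set \<Rightarrow> 'b::euclidean_space"
  assumes vm: "vector_measure M \<mu>"
  shows "integrable (total_variation M \<mu>) (polar_density M \<mu>)"
    and "B \<in> sets M \<Longrightarrow> \<mu> B = (LINT x:B|total_variation M \<mu>. polar_density M \<mu> x)"
    and "AE x in total_variation M \<mu>. norm (polar_density M \<mu> x) = 1"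
proof -
  let ?T = "total_variation M \<mu>" and ?f = "polar_density M \<mu>"
  interpret T: finite_measure ?T by (rule finite_measure_total_variation[OF vm])
  have *: "integrable ?T ?f \<and> (\<forall>B \<in> sets M. \<mu> B = (LINT x:B|?T. ?f x))"
    unfolding polar_density_def by (rule someI_ex[OF vector_measure_polar_exists[OF vm]])
  then show f: "integrable ?T ?f" and "B \<in> sets M \<Longrightarrow> \<mu> B = (LINT x:B|?T. ?f x)" by auto
  have d: "?T = density ?T (\<lambda>x. ennreal (norm (?f x)))"
    using * by (intro total_variation_density[OF T.finite_measure_axioms f _ _ vm]) auto
  have fm[measurable]: "?f \<in> borel_measurable ?T" using f by auto
  have "AE x in ?T. ennreal (norm (?f x)) = 1"
  proof (rule T.density_unique_finite_measure)
    fix A assume A: "A \<in> sets ?T"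
    have "(\<integral>\<^sup>+x. ennreal (norm (?f x)) * indicator A x \<partial>?T) = emeasure (density ?T (\<lambda>x. ennreal (norm (?f x)))) A"
      by (rule emeasure_density[symmetric]) (use A in auto)
    also have "\<dots> = emeasure ?T A" using d by simp
    finally show "(\<integral>\<^sup>+x. ennreal (norm (?f x)) * indicator A x \<partial>?T) = (\<integral>\<^sup>+x. 1 * indicator A x \<partial>?T)"
      using A by simp
  qed auto
  then show "AE x in ?T. norm (?f x) = 1" by (auto simp: ennreal_eq_1)
qed

text \<open>The total variation has density \<open>\<bar>h\<bar>\<close>, and
  \<open>(\<bar>h\<bar> + h) / 2 = max h 0\<close>.\<close>

lemma positive_part_density:
  fixes h :: "'a \<Rightarrow> real"
  assumes fin: "finite_measure \<tau>" and h: "integrable \<tau> h" and sets: "sets \<tau> = sets M"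
    and \<nu>: "\<And>B. B \<in> sets M \<Longrightarrow> \<nu> B = (LINT x:B|\<tau>. h x)" and vm: "vector_measure M \<nu>"
  shows "positive_part M \<nu> = density \<tau> (\<lambda>x. ennreal (max (h x) 0))"
proof -
  let ?d = "density \<tau> (\<lambda>x. ennreal (max (h x) 0))"
  interpret \<tau>: finite_measure \<tau> by fact
  interpret T: finite_measure "total_variation M \<nu>" by (rule finite_measure_total_variation[OF vm])
  have hm: "h \<in> borel_measurable \<tau>" and hi: "integrable \<tau> (\<lambda>x. max (h x) 0)" "integrable \<tau> (\<lambda>x. norm (h x))"
    using h by auto
  have sp: "space \<tau> = space M" using sets by (rule sets_eq_imp_space_eq)
  have "positive_part M \<nu> = measure_of (space M) (sets M) (emeasure ?d)"
    unfolding positive_part_def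
  proof (rule measure_of_eq)
    fix B assume "B \<in> sigma_sets (space M) (sets M)"
    then have B: "B \<in> sets M" by (simp add: sets.sigma_sets_eq)
    have "emeasure ?d B = (\<integral>\<^sup>+x. ennreal (indicator B x *\<^sub>R max (h x) 0) \<partial>\<tau>)"
      using B sets hm by (subst emeasure_density) (auto intro!: nn_integral_cong simp: indicator_def)
    also have "\<dots> = ennreal (LINT x:B|\<tau>. max (h x) 0)"
      unfolding set_lebesgue_integral_def using B sets hi
      by (intro nn_integral_eq_integral integrable_mult_indicator) auto
    also have "(LINT x:B|\<tau>. max (h x) 0) = (LINT x:B|\<tau>. (norm (h x) + h x) / 2)"
      by (rule set_lebesgue_integral_cong) (use B sets in auto)
    also have "\<dots> = ((LINT x:B|\<tau>. norm (h x)) + (LINT x:B|\<tau>. h x)) / 2"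
      unfolding set_integral_divide_zero[symmetric, where a=2]
      by (subst set_integral_add(2)[symmetric])
         (use B sets hi h in \<open>auto intro!: integrable_imp_set_integrable\<close>)
    also have "(LINT x:B|\<tau>. norm (h x)) = measure (total_variation M \<nu>) B"
      using total_variation_density[OF fin h sets \<nu> vm] finite_measure_density_measure[OF hi(2), of B] B sets
      by auto
    finally show "ennreal ((measure (total_variation M \<nu>) B + \<nu> B) / 2) = emeasure ?d B"
      using \<nu>[OF B] by simp
  qed (rule sets.space_closed)
  also have "\<dots> = ?d"
    using measure_of_of_measure[of ?d] sets sp by simp
  finally show ?thesis .
qed

text \<open>Replaces \<open>signed_integral\<close> by an ordinary integral against one density. The
  two positive parts recombine through \<open>max h 0 - max (- h) 0 = h\<close>, and boundedness of
  \<open>f\<close> makes both pieces integrable.\<close>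

lemma signed_integral_density:
  fixes h :: "'a \<Rightarrow> real"
  assumes fin: "finite_measure \<tau>" and h: "integrable \<tau> h" and sets: "sets \<tau> = sets M"
    and \<nu>: "\<And>B. B \<in> sets M \<Longrightarrow> \<nu> B = (LINT x:B|\<tau>. h x)" and vm: "vector_measure M \<nu>"
    and f: "f \<in> borel_measurable M" "\<And>x. \<bar>f x\<bar> \<le> C"
  shows "signed_integral M \<nu> f = (LINT x|\<tau>. f x * h x)"
proof -
  have [measurable]: "f \<in> borel_measurable \<tau>" using f sets by (simp cong: measurable_cong_sets)
  have [measurable]: "h \<in> borel_measurable \<tau>" using h by auto
  have b: "\<bar>max a 0 * f x\<bar> \<le> \<bar>a * C\<bar>" for a x
    using f(2)[of x] unfolding abs_mult by (intro mult_mono) auto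
  have i1: "integrable \<tau> (\<lambda>x. max (h x) 0 * f x)" "integrable \<tau> (\<lambda>x. max (- h x) 0 * f x)"
    by (rule Bochner_Integration.integrable_bound[of _ "\<lambda>x. h x * C"];
        use h b[of "h _"] b[of "- h _"] in \<open>simp add: AE_I2\<close>)+
  have m: "vector_measure M (\<lambda>B. - \<nu> B)"
    by (rule vector_measure_bounded_linear[OF vm bounded_linear_minus[OF bounded_linear_ident]])
  have p1: "positive_part M \<nu> = density \<tau> (\<lambda>x. ennreal (max (h x) 0))"
    by (rule positive_part_density[OF fin h sets \<nu> vm])
  have p2: "positive_part M (\<lambda>B. - \<nu> B) = density \<tau> (\<lambda>x. ennreal (max (- h x) 0))"
    by (rule positive_part_density[OF fin _ sets _ m]) (use h \<nu> in \<open>auto simp: set_lebesgue_integral_def\<close>)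
  have "signed_integral M \<nu> f = (LINT x|\<tau>. max (h x) 0 * f x) - (LINT x|\<tau>. max (- h x) 0 * f x)"
    unfolding signed_integral_def p1 p2 by (simp add: integral_density)
  also have "\<dots> = (LINT x|\<tau>. max (h x) 0 * f x - max (- h x) 0 * f x)"
    using i1 by simp
  also have "\<dots> = (LINT x|\<tau>. f x * h x)"
    by (rule Bochner_Integration.integral_cong) (auto simp: max_def)
  finally show ?thesis .
qed

section \<open>Test functions\<close>

text \<open>In this form the derivative is an inner product with \<open>grad \<phi> x\<close>, so
  the chain rule and directional derivatives need no sums over coordinates.\<close>

definition grad :: "(real^'n \<Rightarrow> real) \<Rightarrow> real^'n \<Rightarrow> real^'n" where
  "grad \<phi> x = (\<chi> j. partial_deriv j \<phi> x)"

lemma partial_deriv_eq_grad: "partial_deriv j \<phi> x = grad \<phi> x \<bullet> axis j 1"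
  by (simp add: grad_def inner_axis)

lemma has_derivative_grad:
  fixes \<phi> :: "real^'n \<Rightarrow> real"
  assumes "\<phi> differentiable (at x)"
  shows "(\<phi> has_derivative (\<lambda>h. grad \<phi> x \<bullet> h)) (at x)"
proof -
  have d: "(\<phi> has_derivative frechet_derivative \<phi> (at x)) (at x)"
    using assms by (simp add: frechet_derivative_works)
  then have l: "linear (frechet_derivative \<phi> (at x))" by (rule has_derivative_linear)
  have "frechet_derivative \<phi> (at x) h = grad \<phi> x \<bullet> h" for h
  proof -
    have "frechet_derivative \<phi> (at x) h = frechet_derivative \<phi> (at x) (\<Sum>j\<in>UNIV. (h $ j) *\<^sub>R axis j 1)"
      using basis_expansion[of h] by (simp add: scalar_mult_eq_scaleR)
    also have "\<dots> = (\<Sum>j\<in>UNIV. h $ j * partial_deriv j \<phi> x)"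
      using l by (simp add: linear_sum linear_cmul partial_deriv_def)
    finally show ?thesis by (simp add: grad_def inner_vec_def mult.commute)
  qed
  then have "frechet_derivative \<phi> (at x) = (\<lambda>h. grad \<phi> x \<bullet> h)" by auto
  then show ?thesis using d by simp
qed

lemma grad_eqI:
  fixes \<phi> :: "real^'n \<Rightarrow> real"
  assumes "(\<phi> has_derivative (\<lambda>h. g \<bullet> h)) (at x)"
  shows "grad \<phi> x = g"
  unfolding grad_def partial_deriv_def frechet_derivative_at[OF assms, symmetric]
  by (simp add: vec_eq_iff inner_axis)

lemma C1_compact_supportI:
  fixes \<phi> :: "real^'n \<Rightarrow> real"
  assumes "\<And>x. (\<phi> has_derivative (\<lambda>h. G x \<bullet> h)) (at x)" "continuous_on UNIV G"
    and "compact C" "C \<subseteq> \<Omega>" "\<And>x. x \<notin> C \<Longrightarrow> \<phi> x = 0"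
  shows "\<phi> \<in> C1_compact_support \<Omega>" and "grad \<phi> = G"
proof -
  show g: "grad \<phi> = G" using grad_eqI[OF assms(1)] by auto
  have "partial_deriv j \<phi> = (\<lambda>x. G x $ j)" for j
    using g by (auto simp: partial_deriv_eq_grad inner_axis)
  then show "\<phi> \<in> C1_compact_support \<Omega>"
    unfolding C1_compact_support_def using assms
    by (auto simp: differentiable_def intro!: continuous_intros)
qed

lemma C1_compact_supportD:
  fixes \<phi> :: "real^'n \<Rightarrow> real"
  assumes "\<phi> \<in> C1_compact_support \<Omega>"
  shows "(\<phi> has_derivative (\<lambda>h. grad \<phi> x \<bullet> h)) (at x)"
    and "continuous_on UNIV (grad \<phi>)" and "continuous_on UNIV \<phi>"
    and "\<phi> \<in> borel_measurable borel" and "grad \<phi> \<in> borel_measurable borel"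
    and "\<exists>C. compact C \<and> C \<subseteq> \<Omega> \<and> (\<forall>x. x \<notin> C \<longrightarrow> \<phi> x = 0 \<and> grad \<phi> x = 0)"
    and "\<exists>B\<ge>0. \<forall>x. \<bar>\<phi> x\<bar> \<le> B \<and> norm (grad \<phi> x) \<le> B"
proof -
  show d: "(\<phi> has_derivative (\<lambda>h. grad \<phi> x \<bullet> h)) (at x)" for x
    using assms by (intro has_derivative_grad) (auto simp: C1_compact_support_def)
  show cg: "continuous_on UNIV (grad \<phi>)"
    using assms unfolding grad_def[abs_def] by (intro continuous_on_vec_lambda) (auto simp: C1_compact_support_def)
  show c: "continuous_on UNIV \<phi>"
    using d by (intro continuous_at_imp_continuous_on ballI has_derivative_continuous) auto
  show "\<phi> \<in> borel_measurable borel" "grad \<phi> \<in> borel_measurable borel"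
    using c cg by (auto intro: borel_measurable_continuous_onI)
  obtain C where C: "compact C" "C \<subseteq> \<Omega>" "\<And>x. x \<notin> C \<Longrightarrow> \<phi> x = 0"
    using assms by (auto simp: C1_compact_support_def)
  have g0: "grad \<phi> x = 0" if "x \<notin> C" for x
  proof (rule grad_eqI)
    have "((\<lambda>x. 0) has_derivative (\<lambda>h. 0 \<bullet> h)) (at x)" by simp
    then show "(\<phi> has_derivative (\<lambda>h. 0 \<bullet> h)) (at x)"
      by (rule has_derivative_transform_within_open[where s="- C"])
         (use C that compact_imp_closed in \<open>auto simp: closed_def\<close>)
  qed
  show "\<exists>C. compact C \<and> C \<subseteq> \<Omega> \<and> (\<forall>x. x \<notin> C \<longrightarrow> \<phi> x = 0 \<and> grad \<phi> x = 0)"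
    using C g0 by auto
  have "bounded (\<phi> ` C)" "bounded (grad \<phi> ` C)"
    by (auto intro!: compact_imp_bounded compact_continuous_image C(1) continuous_on_subset[OF c] continuous_on_subset[OF cg])
  then obtain B1 B2 where B: "\<And>x. x \<in> C \<Longrightarrow> \<bar>\<phi> x\<bar> \<le> B1" "\<And>x. x \<in> C \<Longrightarrow> norm (grad \<phi> x) \<le> B2"
    unfolding bounded_iff by (metis imageI real_norm_def)
  show "\<exists>B\<ge>0. \<forall>x. \<bar>\<phi> x\<bar> \<le> B \<and> norm (grad \<phi> x) \<le> B"
  proof (intro exI[of _ "max 0 (max B1 B2)"] conjI allI)
    fix x show "\<bar>\<phi> x\<bar> \<le> max 0 (max B1 B2)" "norm (grad \<phi> x) \<le> max 0 (max B1 B2)"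
      using B[of x] C(3)[of x] g0[of x] by (cases "x \<in> C"; auto)+
  qed simp
qed

lemma C1_compact_support_mono: "\<phi> \<in> C1_compact_support U \<Longrightarrow> U \<subseteq> V \<Longrightarrow> \<phi> \<in> C1_compact_support V"
  unfolding C1_compact_support_def by blast

lemma C1_compact_support_Lipschitz:
  fixes \<phi> :: "real^'n \<Rightarrow> real"
  assumes "\<phi> \<in> C1_compact_support \<Omega>"
  shows "\<exists>L\<ge>0. \<forall>x y. \<bar>\<phi> x - \<phi> y\<bar> \<le> L * norm (x - y)"
proof -
  note D = C1_compact_supportD[OF assms]
  obtain B where B: "B \<ge> 0" "\<And>x. norm (grad \<phi> x) \<le> B" using D(7) by auto
  have "norm (\<phi> x - \<phi> y) \<le> B * norm (x - y)" for x y
  proof (rule differentiable_bound[of UNIV \<phi> "\<lambda>x h. grad \<phi> x \<bullet> h"])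
    fix x :: "real^'n"
    show "(\<phi> has_derivative (\<lambda>h. grad \<phi> x \<bullet> h)) (at x within UNIV)" using D(1) by simp
    show "onorm (\<lambda>h. grad \<phi> x \<bullet> h) \<le> B"
    proof (rule onorm_le)
      fix h
      have "norm (grad \<phi> x \<bullet> h) \<le> norm (grad \<phi> x) * norm h" by (simp add: Cauchy_Schwarz_ineq2)
      also have "\<dots> \<le> B * norm h" using B by (intro mult_right_mono) auto
      finally show "norm (grad \<phi> x \<bullet> h) \<le> B * norm h" .
    qed
  qed auto
  then show ?thesis using B(1) by auto
qed

lemma C1_compact_support_affine:
  fixes \<phi> :: "real^'n \<Rightarrow> real"
  assumes "\<phi> \<in> C1_compact_support K" "\<epsilon> \<noteq> 0"
  shows "(\<lambda>z. \<phi> ((1 / \<epsilon>) *\<^sub>R (z - x))) \<in> C1_compact_support ((\<lambda>y. x + \<epsilon> *\<^sub>R y) ` K)"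
    and "grad (\<lambda>z. \<phi> ((1 / \<epsilon>) *\<^sub>R (z - x))) = (\<lambda>z. (1 / \<epsilon>) *\<^sub>R grad \<phi> ((1 / \<epsilon>) *\<^sub>R (z - x)))"
proof -
  note D = C1_compact_supportD[OF assms(1)]
  obtain C where C: "compact C" "C \<subseteq> K" "\<And>x. x \<notin> C \<Longrightarrow> \<phi> x = 0" using D(6) by auto
  have 1: "((\<lambda>z. \<phi> ((1 / \<epsilon>) *\<^sub>R (z - x))) has_derivative (\<lambda>h. ((1 / \<epsilon>) *\<^sub>R grad \<phi> ((1 / \<epsilon>) *\<^sub>R (z - x))) \<bullet> h)) (at z)" for z
  proof -
    have "((\<lambda>z. (1 / \<epsilon>) *\<^sub>R (z - x)) has_derivative (\<lambda>h. (1 / \<epsilon>) *\<^sub>R h)) (at z)"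
      by (auto intro!: derivative_eq_intros)
    from has_derivative_compose[OF this D(1)] show ?thesis by (simp add: o_def)
  qed
  have 2: "continuous_on UNIV (\<lambda>z. (1 / \<epsilon>) *\<^sub>R grad \<phi> ((1 / \<epsilon>) *\<^sub>R (z - x)))"
    by (intro continuous_intros continuous_on_compose2[OF D(2)]) auto
  have 3: "compact ((\<lambda>y. x + \<epsilon> *\<^sub>R y) ` C)"
    by (intro compact_continuous_image continuous_intros C(1))
  have 4: "(\<lambda>y. x + \<epsilon> *\<^sub>R y) ` C \<subseteq> (\<lambda>y. x + \<epsilon> *\<^sub>R y) ` K" using C(2) by auto
  have 5: "\<phi> ((1 / \<epsilon>) *\<^sub>R (z - x)) = 0" if "z \<notin> (\<lambda>y. x + \<epsilon> *\<^sub>R y) ` C" for z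
  proof (rule C(3), rule)
    assume "(1 / \<epsilon>) *\<^sub>R (z - x) \<in> C"
    moreover have "z = x + \<epsilon> *\<^sub>R ((1 / \<epsilon>) *\<^sub>R (z - x))" using assms(2) by simp
    ultimately show False using that by blast
  qed
  show "(\<lambda>z. \<phi> ((1 / \<epsilon>) *\<^sub>R (z - x))) \<in> C1_compact_support ((\<lambda>y. x + \<epsilon> *\<^sub>R y) ` K)"
    and "grad (\<lambda>z. \<phi> ((1 / \<epsilon>) *\<^sub>R (z - x))) = (\<lambda>z. (1 / \<epsilon>) *\<^sub>R grad \<phi> ((1 / \<epsilon>) *\<^sub>R (z - x)))"
    using C1_compact_supportI[OF 1 2 3 4 5] by auto
qed

text \<open>Together with \<open>integral_grad_eq_0\<close> this product rule is integration by
  parts against a coordinate function; the weak derivative of a linear map rests on it.\<close>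

lemma C1_compact_support_coordinate_mult:
  fixes \<phi> :: "real^'n \<Rightarrow> real"
  assumes "\<phi> \<in> C1_compact_support K"
  shows "(\<lambda>x. x $ k * \<phi> x) \<in> C1_compact_support K"
    and "grad (\<lambda>x. x $ k * \<phi> x) = (\<lambda>x. (x $ k) *\<^sub>R grad \<phi> x + \<phi> x *\<^sub>R axis k 1)"
proof -
  note D = C1_compact_supportD[OF assms]
  obtain C where C: "compact C" "C \<subseteq> K" "\<And>x. x \<notin> C \<Longrightarrow> \<phi> x = 0" using D(6) by auto
  have 1: "((\<lambda>x. x $ k * \<phi> x) has_derivative (\<lambda>h. ((x $ k) *\<^sub>R grad \<phi> x + \<phi> x *\<^sub>R axis k 1) \<bullet> h)) (at x)" for x
  proof -
    have "((\<lambda>x::real^'n. x $ k) has_derivative (\<lambda>h. h $ k)) (at x)"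
      by (rule bounded_linear_imp_has_derivative[OF bounded_linear_vec_nth])
    from has_derivative_mult[OF this D(1)] show ?thesis
      by (rule has_derivative_eq_rhs) (auto simp: inner_add_left inner_axis' algebra_simps)
  qed
  have 2: "continuous_on UNIV (\<lambda>x. (x $ k) *\<^sub>R grad \<phi> x + \<phi> x *\<^sub>R axis k 1)"
    by (intro continuous_intros D)
  show "(\<lambda>x. x $ k * \<phi> x) \<in> C1_compact_support K"
    and "grad (\<lambda>x. x $ k * \<phi> x) = (\<lambda>x. (x $ k) *\<^sub>R grad \<phi> x + \<phi> x *\<^sub>R axis k 1)"
    using C1_compact_supportI[OF 1 2 C(1,2)] C(3) by auto
qed

lemma C1_compact_support_diff:
  fixes \<phi> :: "real^'n \<Rightarrow> real"
  assumes "\<phi> \<in> C1_compact_support K" "\<psi> \<in> C1_compact_support K"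
  shows "(\<lambda>x. \<phi> x - \<psi> x) \<in> C1_compact_support K"
proof -
  note D = C1_compact_supportD[OF assms(1)] and E = C1_compact_supportD[OF assms(2)]
  obtain C where C: "compact C" "C \<subseteq> K" "\<And>x. x \<notin> C \<Longrightarrow> \<phi> x = 0" using D(6) by auto
  obtain C' where C': "compact C'" "C' \<subseteq> K" "\<And>x. x \<notin> C' \<Longrightarrow> \<psi> x = 0" using E(6) by auto
  have 1: "((\<lambda>x. \<phi> x - \<psi> x) has_derivative (\<lambda>h. (grad \<phi> x - grad \<psi> x) \<bullet> h)) (at x)" for x
    by (rule has_derivative_eq_rhs[OF has_derivative_diff[OF D(1) E(1)]]) (auto simp: inner_diff_left)
  show ?thesis
    by (rule C1_compact_supportI[OF 1, of "C \<union> C'"]) (use C C' D E in \<open>auto intro!: continuous_intros\<close>)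
qed

subsection \<open>Cut-off functions\<close>

text \<open>A continuously differentiable substitute for the positive part, from which all cut-offs
  are built. At 0 the difference quotient is bounded by the modulus of the increment.\<close>

lemma has_real_derivative_max_square: "((\<lambda>s::real. (max 0 s)\<^sup>2) has_real_derivative 2 * max 0 s) (at s)"
proof (cases s "0::real" rule: linorder_cases)
  case less
  have "((\<lambda>s::real. 0) has_real_derivative 2 * max 0 s) (at s)" using less by simp
  then show ?thesis
    by (rule has_field_derivative_transform_within_open[where S="{..<0}"]) (use less in auto)
next
  case greater
  have "((\<lambda>s::real. s\<^sup>2) has_real_derivative 2 * max 0 s) (at s)"
    using greater by (auto intro!: derivative_eq_intros)
  then show ?thesis
    by (rule has_field_derivative_transform_within_open[where S="{0<..}"]) (use greater in auto)
next
  case equal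
  have "(\<lambda>h::real. (max 0 h)\<^sup>2 / h) \<midarrow>0\<rightarrow> 0"
  proof (rule Lim_null_comparison)
    show "\<forall>\<^sub>F h in at 0. norm ((max 0 h)\<^sup>2 / h) \<le> \<bar>h::real\<bar>"
      by (rule always_eventually) (auto simp: max_def power2_eq_square)
    show "(\<lambda>h::real. \<bar>h\<bar>) \<midarrow>0\<rightarrow> 0" by (rule tendsto_eq_intros | simp)+
  qed
  then show ?thesis using equal by (simp add: DERIV_def)
qed

text \<open>Test functions are C1 only, so sums of squared truncated paraboloids over a finite ball
  cover of \<open>C\<close> suffice. The sum is at least some \<open>c > 0\<close> on the compact
  set \<open>C\<close> and is flattened to 1 above that level.\<close>

lemma cutoff_exists:
  fixes C :: "(real^'n) set"
  assumes "compact C" "open U" "C \<subseteq> U"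
  obtains \<phi> where "\<phi> \<in> C1_compact_support U" "\<And>x. 0 \<le> \<phi> x" "\<And>x. \<phi> x \<le> 1" "\<And>x. x \<in> C \<Longrightarrow> \<phi> x = 1"
proof -
  have "\<exists>r>0. cball x r \<subseteq> U" if "x \<in> C" for x
    using open_contains_cball assms that by blast
  then obtain r where r: "\<And>x. x \<in> C \<Longrightarrow> 0 < r x \<and> cball x (r x) \<subseteq> U" by metis
  have "C \<subseteq> (\<Union>x\<in>C. ball x (r x))" using r by force
  then obtain F where F: "F \<subseteq> C" "finite F" "C \<subseteq> (\<Union>x\<in>F. ball x (r x))"
    using assms(1) by (elim compactE_image[of C C "\<lambda>x. ball x (r x)"]) auto
  define b where "b a x = (max 0 ((r a)\<^sup>2 - (x - a) \<bullet> (x - a)))\<^sup>2" for a x :: "real^'n"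
  define g where "g a x = (2 * max 0 ((r a)\<^sup>2 - (x - a) \<bullet> (x - a))) *\<^sub>R ((-2) *\<^sub>R (x - a))" for a x :: "real^'n"
  have db: "(b a has_derivative (\<lambda>h. g a x \<bullet> h)) (at x)" for a x
  proof -
    have "((\<lambda>x. (r a)\<^sup>2 - (x - a) \<bullet> (x - a)) has_derivative (\<lambda>h. ((-2) *\<^sub>R (x - a)) \<bullet> h)) (at x)"
      by (rule derivative_eq_intros | simp)+ (auto simp: inner_commute algebra_simps)
    from DERIV_compose_FDERIV[OF has_real_derivative_max_square this]
    show ?thesis unfolding b_def[abs_def] g_def
      by (rule has_derivative_eq_rhs) (auto simp: algebra_simps)
  qed
  have cg: "continuous_on UNIV (g a)" for a unfolding g_def by (intro continuous_intros)
  define S where "S x = (\<Sum>a\<in>F. b a x)" for x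
  have dS: "(S has_derivative (\<lambda>h. (\<Sum>a\<in>F. g a x) \<bullet> h)) (at x)" for x
    unfolding S_def[abs_def] by (rule has_derivative_eq_rhs[OF has_derivative_sum[OF db]]) (auto simp: inner_sum_left)
  have Spos: "0 < S x" if xC: "x \<in> C" for x
  proof -
    obtain a where a: "a \<in> F" "dist a x < r a" using subsetD[OF F(3) xC] by auto
    then have "(x - a) \<bullet> (x - a) < (r a)\<^sup>2"
      by (auto simp: dist_norm norm_minus_commute dot_square_norm intro!: power_strict_mono)
    then have "0 < b a x" by (simp add: b_def)
    then show ?thesis unfolding S_def using a F by (intro sum_pos2[of _ a]) (auto simp: b_def)
  qed
  obtain c where c: "0 < c" "\<And>x. x \<in> C \<Longrightarrow> c \<le> S x"
  proof (cases "C = {}")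
    case True then show ?thesis using that[of 1] by auto
  next
    case False
    have "continuous_on C S"
      using dS by (intro continuous_at_imp_continuous_on ballI has_derivative_continuous) auto
    then obtain x where "x \<in> C" "\<And>y. y \<in> C \<Longrightarrow> S x \<le> S y"
      using continuous_attains_inf[OF assms(1) False] by blast
    then show ?thesis using that[of "S x"] Spos by auto
  qed
  \<comment> \<open>As a function of \<open>S x / c\<close> this profile is C1, vanishes at 0 and
    equals 1 from 1 onwards.\<close>
  define \<phi> where "\<phi> x = 1 - (max 0 (1 - S x / c))\<^sup>2" for x
  have S0: "0 \<le> S x" for x unfolding S_def b_def by (intro sum_nonneg) auto
  have d\<phi>: "(\<phi> has_derivative (\<lambda>h. ((2 * max 0 (1 - S x / c) / c) *\<^sub>R (\<Sum>a\<in>F. g a x)) \<bullet> h)) (at x)" for x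
  proof -
    have "((\<lambda>x. 1 - S x / c) has_derivative (\<lambda>h. 0 - ((\<Sum>a\<in>F. g a x) \<bullet> h) * inverse c)) (at x)"
      unfolding divide_inverse
      by (intro has_derivative_diff has_derivative_const has_derivative_mult_left dS)
    from has_derivative_diff[OF has_derivative_const[of 1] DERIV_compose_FDERIV[OF has_real_derivative_max_square this]]
    show ?thesis unfolding \<phi>_def[abs_def]
      by (rule has_derivative_eq_rhs) (auto simp: divide_inverse algebra_simps)
  qed
  have cS: "continuous_on UNIV S"
    using dS by (intro continuous_at_imp_continuous_on ballI has_derivative_continuous) auto
  have "\<phi> \<in> C1_compact_support U"
  proof (rule C1_compact_supportI[OF d\<phi>])
    show "continuous_on UNIV (\<lambda>x. (2 * max 0 (1 - S x / c) / c) *\<^sub>R (\<Sum>a\<in>F. g a x))"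
      using cS cg c by (intro continuous_intros) auto
    show "compact (\<Union>a\<in>F. cball a (r a))" using F by auto
    show "(\<Union>a\<in>F. cball a (r a)) \<subseteq> U" using F r by blast
    fix x assume x: "x \<notin> (\<Union>a\<in>F. cball a (r a))"
    have "b a x = 0" if "a \<in> F" for a
    proof -
      have "r a < dist a x" "0 < r a" using x that F r by (auto simp: not_le)
      then have "(r a)\<^sup>2 \<le> (x - a) \<bullet> (x - a)"
        by (auto simp: dist_norm norm_minus_commute dot_square_norm intro!: power_mono)
      then show ?thesis by (simp add: b_def)
    qed
    then have "S x = 0" by (simp add: S_def)
    then show "\<phi> x = 0" by (simp add: \<phi>_def)
  qed
  moreover have "0 \<le> \<phi> x" "\<phi> x \<le> 1" for x
    using S0[of x] c(1) by (auto simp: \<phi>_def max_def intro!: power_le_one)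
  moreover have "\<phi> x = 1" if "x \<in> C" for x
    using c(2)[OF that] c(1) by (simp add: \<phi>_def max_def)
  ultimately show thesis by (rule that)
qed

text \<open>The functions are 1 on \<open>C\<close> within a compact exhaustion of
  \<open>\<Omega>\<close> and are supported in shrinking neighbourhoods of \<open>C\<close>, so at
  each point the sequence is eventually constant.\<close>

lemma cutoff_sequence_closed:
  fixes \<Omega> :: "(real^'n) set"
  assumes "open \<Omega>" "closed C"
  obtains \<phi> where "\<And>k::nat. \<phi> k \<in> C1_compact_support \<Omega>" "\<And>k x. 0 \<le> \<phi> k x" "\<And>k x. \<phi> k x \<le> 1"
    "\<And>x. (\<lambda>k. \<phi> k x) \<longlonglongrightarrow> indicator (C \<inter> \<Omega>) x"
proof -
  obtain D where D: "\<And>k::nat. compact (D k)" "\<And>k. D k \<subseteq> \<Omega>" "\<And>k. D k \<subseteq> interior (D (Suc k))"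
    "\<Union>(range D) = \<Omega>"
    using open_Union_compact_subsets[OF assms(1)] by metis
  have Dmono: "D k \<subseteq> D l" if "k \<le> l" for k l
    using that by (rule lift_Suc_mono_le[of D, rotated]) (use D(3) interior_subset in blast)
  define U where "U k = (\<Union>y\<in>C. ball y (1 / real (Suc k))) \<inter> \<Omega>" for k
  have "\<exists>\<phi>. \<phi> \<in> C1_compact_support (U k) \<and> (\<forall>x. 0 \<le> \<phi> x \<and> \<phi> x \<le> 1) \<and> (\<forall>x\<in>C \<inter> D k. \<phi> x = 1)" for k
  proof -
    have "compact (C \<inter> D k)" using assms(2) D(1) by (rule closed_Int_compact)
    moreover have "open (U k)" unfolding U_def using assms(1) by auto
    moreover have "C \<inter> D k \<subseteq> U k" using D(2) by (force simp: U_def)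
    ultimately show ?thesis using cutoff_exists[of "C \<inter> D k" "U k"] by metis
  qed
  then obtain \<phi> where \<phi>: "\<And>k. \<phi> k \<in> C1_compact_support (U k)" "\<And>k x. 0 \<le> \<phi> k x" "\<And>k x. \<phi> k x \<le> 1"
    "\<And>k x. x \<in> C \<Longrightarrow> x \<in> D k \<Longrightarrow> \<phi> k x = 1" by (metis IntI)
  have \<phi>0: "\<phi> k x = 0" if "x \<notin> U k" for k x
    using C1_compact_supportD(6)[OF \<phi>(1)[of k]] that by blast
  show thesis
  proof (rule that[of \<phi>])
    show "\<phi> k \<in> C1_compact_support \<Omega>" for k
      using \<phi>(1) by (rule C1_compact_support_mono) (auto simp: U_def)
    fix x
    have "eventually (\<lambda>k. \<phi> k x = indicator (C \<inter> \<Omega>) x) sequentially"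
    proof (cases "x \<in> \<Omega>")
      case False
      then show ?thesis using \<phi>0 by (intro always_eventually) (auto simp: U_def)
    next
      case xO: True
      show ?thesis
      proof (cases "x \<in> C")
        case True
        obtain k where "x \<in> D k" using D(4) xO by auto
        then show ?thesis unfolding eventually_sequentially using \<phi>(4) True xO Dmono
          by (intro exI[of _ k]) (auto simp: subset_eq)
      next
        case False
        then obtain e where e: "e > 0" "ball x e \<subseteq> - C" using assms(2) open_contains_ball[of "- C"] by (auto simp: open_Compl)
        obtain k :: nat where k: "1 / real (Suc k) < e" using nat_approx_posE[OF e(1)] by auto
        have "x \<notin> U l" if "k \<le> l" for l
        proof
          assume "x \<in> U l"
          then obtain y where y: "y \<in> C" "dist y x < 1 / real (Suc l)" by (auto simp: U_def)
          have "1 / real (Suc l) \<le> 1 / real (Suc k)" using that by (intro divide_left_mono) auto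
          then have "y \<in> ball x e" using y k by (auto simp: dist_commute)
          then show False using e y by auto
        qed
        then show ?thesis unfolding eventually_sequentially using \<phi>0 False by (intro exI[of _ k]) auto
      qed
    qed
    then show "(\<lambda>k. \<phi> k x) \<longlonglongrightarrow> indicator (C \<inter> \<Omega>) x" by (rule tendsto_eventually)
  qed (use \<phi> in auto)
qed

text \<open>The measures \<open>\<sigma>\<close> and \<open>\<tau>\<close> may differ, which allows
  comparing two representations of one derivative. Dominated convergence along cut-offs settles
  closed sets, an intersection-stable generator of the Borel sets.\<close>

lemma set_integral_eq_if_test_eq:
  fixes \<Omega> :: "(real^'n) set" and F G :: "real^'n \<Rightarrow> real"
  assumes "open \<Omega>" and sets: "sets \<sigma> = sets borel" "sets \<tau> = sets borel"
    and F: "integrable \<sigma> F" and G: "integrable \<tau> G"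
    and eq: "\<And>\<phi>. \<phi> \<in> C1_compact_support \<Omega> \<Longrightarrow> (LINT x|\<sigma>. \<phi> x * F x) = (LINT x|\<tau>. \<phi> x * G x)"
    and B: "B \<in> sets borel"
  shows "(LINT x:B \<inter> \<Omega>|\<sigma>. F x) = (LINT x:B \<inter> \<Omega>|\<tau>. G x)"
proof -
  have lim: "(\<lambda>k. LINT x|\<rho>. \<phi> k x * H x) \<longlonglongrightarrow> (LINT x:C \<inter> \<Omega>|\<rho>. H x)"
    if \<phi>: "\<And>k::nat. \<phi> k \<in> C1_compact_support \<Omega>" "\<And>k x. 0 \<le> \<phi> k x" "\<And>k x. \<phi> k x \<le> 1"
      "\<And>x. (\<lambda>k. \<phi> k x) \<longlonglongrightarrow> indicator (C \<inter> \<Omega>) x"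
      and C: "closed C" and \<rho>: "sets \<rho> = sets borel" "integrable \<rho> H" for C \<rho> and H :: "real^'n \<Rightarrow> real" and \<phi>
    unfolding set_lebesgue_integral_def
  proof (rule integral_dominated_convergence[where w="\<lambda>x. \<bar>H x\<bar>"])
    have [measurable]: "\<phi> k \<in> borel_measurable \<rho>" for k
      using C1_compact_supportD(4)[OF \<phi>(1)] \<rho>(1) by (simp cong: measurable_cong_sets)
    have [measurable]: "H \<in> borel_measurable \<rho>" using \<rho> by auto
    have "C \<inter> \<Omega> \<in> sets \<rho>" using \<rho> C assms(1) by auto
    then show "(\<lambda>x. indicat_real (C \<inter> \<Omega>) x *\<^sub>R H x) \<in> borel_measurable \<rho>" by measurable
    show "(\<lambda>x. \<phi> k x * H x) \<in> borel_measurable \<rho>" for k by measurable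
    show "integrable \<rho> (\<lambda>x. \<bar>H x\<bar>)" using \<rho> by auto
    show "AE x in \<rho>. (\<lambda>k. \<phi> k x * H x) \<longlonglongrightarrow> indicat_real (C \<inter> \<Omega>) x *\<^sub>R H x"
      using \<phi>(4) by (auto intro!: AE_I2 tendsto_mult)
    show "AE x in \<rho>. norm (\<phi> k x * H x) \<le> \<bar>H x\<bar>" for k
      using \<phi>(2)[of k] \<phi>(3)[of k] by (auto intro!: AE_I2 mult_left_le_one_le simp: abs_mult)
  qed
  have closed: "(LINT x:C \<inter> \<Omega>|\<sigma>. F x) = (LINT x:C \<inter> \<Omega>|\<tau>. G x)" if C: "closed C" for C
  proof -
    obtain \<phi> where \<phi>: "\<And>k::nat. \<phi> k \<in> C1_compact_support \<Omega>" "\<And>k x. 0 \<le> \<phi> k x" "\<And>k x. \<phi> k x \<le> 1"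
      "\<And>x. (\<lambda>k. \<phi> k x) \<longlonglongrightarrow> indicator (C \<inter> \<Omega>) x"
      using cutoff_sequence_closed[OF assms(1) C] by metis
    show ?thesis
      using lim[OF \<phi> C sets(1) F] lim[OF \<phi> C sets(2) G] eq[OF \<phi>(1)] by (auto intro: LIMSEQ_unique)
  qed
  have siF: "set_integrable \<sigma> A F" if "A \<in> sets borel" for A
    unfolding set_integrable_def using that sets F by (intro integrable_mult_indicator) auto
  have siG: "set_integrable \<tau> A G" if "A \<in> sets borel" for A
    unfolding set_integrable_def using that sets G by (intro integrable_mult_indicator) auto
  have "Int_stable (Collect closed :: (real^'n) set set)" "Collect closed \<subseteq> Pow (UNIV :: (real^'n) set)"
    by (auto simp: Int_stable_def)
  moreover have "B \<in> sigma_sets UNIV (Collect closed)" using B by (simp add: borel_eq_closed)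
  ultimately show ?thesis
  proof (induction rule: sigma_sets_induct_disjoint)
    case (basic A) then show ?case using closed by simp
  next
    case empty show ?case by (simp add: set_lebesgue_integral_def)
  next
    case (compl A)
    have A: "A \<in> sets borel" using compl(1) by (simp add: borel_eq_closed)
    have AO: "A \<inter> \<Omega> \<in> sets borel" "(UNIV - A) \<inter> \<Omega> \<in> sets borel" using A assms(1) by auto
    have disj: "(A \<inter> \<Omega>) \<inter> ((UNIV - A) \<inter> \<Omega>) = {}" and un: "UNIV \<inter> \<Omega> = (A \<inter> \<Omega>) \<union> ((UNIV - A) \<inter> \<Omega>)" by auto
    have "(LINT x:UNIV \<inter> \<Omega>|\<sigma>. F x) = (LINT x:A \<inter> \<Omega>|\<sigma>. F x) + (LINT x:(UNIV - A) \<inter> \<Omega>|\<sigma>. F x)"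
      unfolding un by (rule set_integral_Un[OF disj siF[OF AO(1)] siF[OF AO(2)]])
    moreover have "(LINT x:UNIV \<inter> \<Omega>|\<tau>. G x) = (LINT x:A \<inter> \<Omega>|\<tau>. G x) + (LINT x:(UNIV - A) \<inter> \<Omega>|\<tau>. G x)"
      unfolding un by (rule set_integral_Un[OF disj siG[OF AO(1)] siG[OF AO(2)]])
    ultimately show ?case using compl(2) closed[of UNIV] by simp
  next
    case (union A)
    have A: "A i \<in> sets borel" for i using union(2) by (auto simp: borel_eq_closed)
    have AO: "A i \<inter> \<Omega> \<in> sets borel" "(\<Union>i. A i \<inter> \<Omega>) \<in> sets borel" for i using A assms(1) by auto
    have disj: "A i \<inter> \<Omega> \<inter> (A j \<inter> \<Omega>) = {}" if "i \<noteq> j" for i j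
      using union(1) that by (auto simp: disjoint_family_on_def)
    have un: "(\<Union>i. A i) \<inter> \<Omega> = (\<Union>i. A i \<inter> \<Omega>)" by auto
    have "(LINT x:(\<Union>i. A i \<inter> \<Omega>)|\<sigma>. F x) = (\<Sum>i. LINT x:A i \<inter> \<Omega>|\<sigma>. F x)"
      by (rule lebesgue_integral_countable_add) (use AO sets disj siF in auto)
    moreover have "(LINT x:(\<Union>i. A i \<inter> \<Omega>)|\<tau>. G x) = (\<Sum>i. LINT x:A i \<inter> \<Omega>|\<tau>. G x)"
      by (rule lebesgue_integral_countable_add) (use AO sets disj siG in auto)
    ultimately show ?case unfolding un using union(3) by simp
  qed
qed

section \<open>Differentiation of measures along homothetic convex bodies\<close>

text \<open>A norm given as a function on the Euclidean type, since it depends on the body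
  \<open>K\<close>. The last two assumptions express equivalence with the Euclidean norm.\<close>

locale gauge_norm =
  fixes N :: "'a::euclidean_space \<Rightarrow> real"
  assumes N_scale: "N (a *\<^sub>R v) = \<bar>a\<bar> * N v"
    and N_add: "N (v + w) \<le> N v + N w"
    and N_lower: "\<exists>c>0. \<forall>v. c * norm v \<le> N v"
    and N_upper: "\<exists>C>0. \<forall>v. N v \<le> C * norm v"
begin

definition gball :: "'a \<Rightarrow> real \<Rightarrow> 'a set" where
  "gball x r = {y. N (y - x) < r}"

lemma N_0 [simp]: "N 0 = 0" using N_scale[of 0 0] by simp

lemma N_nonneg [simp]: "0 \<le> N v"
proof -
  obtain c where "c > 0" "c * norm v \<le> N v" using N_lower by auto
  moreover have "0 \<le> c * norm v" using \<open>c > 0\<close> by simp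
  ultimately show ?thesis by linarith
qed

lemma N_minus [simp]: "N (- v) = N v" using N_scale[of "-1" v] by simp

lemma N_minus_commute: "N (v - w) = N (w - v)" using N_minus[of "v - w"] by simp

lemma N_triangle: "N (x - z) \<le> N (x - y) + N (y - z)"
  using N_add[of "x - y" "y - z"] by simp

lemma N_eq_0_iff: "N v = 0 \<longleftrightarrow> v = 0"
proof
  assume "N v = 0"
  obtain c where "c > 0" "c * norm v \<le> N v" using N_lower by auto
  then show "v = 0" using \<open>N v = 0\<close> by (simp add: mult_le_0_iff)
qed simp

lemma continuous_N: "continuous_on UNIV N"
proof -
  obtain C where C: "C > 0" "\<And>v. N v \<le> C * norm v" using N_upper by auto
  have "\<bar>N v - N w\<bar> \<le> C * norm (v - w)" for v w
    using N_triangle[of v 0 w] N_triangle[of w 0 v] C(2)[of "v - w"] N_minus_commute[of v w] by simp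
  then have "C-lipschitz_on UNIV N"
    using C by (intro lipschitz_onI) (auto simp: dist_norm)
  then show ?thesis by (rule lipschitz_on_continuous_on)
qed

lemma open_gball: "open (gball x r)"
  unfolding gball_def
  by (intro open_Collect_less continuous_on_compose2[OF continuous_N] continuous_intros) auto

lemma gball_borel [measurable]: "gball x r \<in> sets borel" using open_gball by simp

lemma bounded_gball: "bounded (gball x r)"
proof -
  obtain c where c: "c > 0" "\<And>v. c * norm v \<le> N v" using N_lower by auto
  have "gball x r \<subseteq> cball x (r / c)"
  proof
    fix y assume "y \<in> gball x r"
    then have "c * norm (y - x) \<le> r" using c(2)[of "y - x"] by (simp add: gball_def)
    then show "y \<in> cball x (r / c)" using c(1) by (simp add: dist_norm norm_minus_commute field_simps)
  qed
  then show ?thesis by (rule bounded_subset[rotated]) simp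
qed

lemma eventually_gball_subset:
  assumes "open U" "x \<in> U"
  shows "eventually (\<lambda>r. gball x r \<subseteq> U) (at_right 0)"
proof -
  obtain e where e: "e > 0" "ball x e \<subseteq> U" using assms openE by blast
  obtain c where c: "c > 0" "\<And>v. c * norm v \<le> N v" using N_lower by auto
  have "eventually (\<lambda>r::real. r < c * e) (at_right 0)"
    using c e by (intro eventually_at_right_less[THEN eventually_mono[rotated]] order_tendstoD(2)[OF tendsto_ident_at]) auto
  then show ?thesis
  proof eventually_elim
    case (elim r)
    have "gball x r \<subseteq> ball x e"
    proof
      fix y assume "y \<in> gball x r"
      then have "c * norm (y - x) < c * e" using c(2)[of "y - x"] elim by (simp add: gball_def)
      then show "y \<in> ball x e" using c(1) by (simp add: dist_norm norm_minus_commute)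
    qed
    then show ?case using e by blast
  qed
qed

lemma finite_net:
  assumes "bounded A" "0 < e"
  shows "\<exists>C. finite C \<and> (\<forall>v\<in>A. \<exists>c\<in>C. N (v - c) < e)"
proof -
  have "compact (closure A)" using assms by (simp add: compact_closure)
  moreover have "v \<in> gball v e" for v using assms by (simp add: gball_def)
  then have "closure A \<subseteq> (\<Union>c\<in>UNIV. gball c e)" by blast
  ultimately obtain D where D: "D \<subseteq> UNIV" "finite D" "closure A \<subseteq> (\<Union>c\<in>D. gball c e)"
    using open_gball by (elim compactE_image[of "closure A" UNIV "\<lambda>c. gball c e"]) auto
  then show ?thesis using closure_subset[of A] by (intro exI[of _ D]) (force simp: gball_def)
qed

text \<open>Pigeonhole: two points assigned to the same net point would be closer than
  \<open>2 * e\<close>.\<close>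

lemma card_separated_le:
  assumes C: "finite C" "\<And>v. v \<in> F \<Longrightarrow> \<exists>c\<in>C. N (f v - c) < e"
    and sep: "\<And>x y. x \<in> F \<Longrightarrow> y \<in> F \<Longrightarrow> x \<noteq> y \<Longrightarrow> 2 * e \<le> N (f x - f y)"
  shows "finite F \<and> card F \<le> card C"
proof -
  obtain g where g: "\<And>v. v \<in> F \<Longrightarrow> g v \<in> C \<and> N (f v - g v) < e" using C(2) by metis
  have "inj_on g F"
  proof (rule inj_onI, rule ccontr)
    fix x y assume xy: "x \<in> F" "y \<in> F" "g x = g y" "x \<noteq> y"
    have "N (f x - f y) \<le> N (f x - g x) + N (f y - g y)"
      using N_triangle[of "f x" "f y" "g x"] xy N_minus_commute[of "g x" "f y"] by simp
    then show False using g[of x] g[of y] sep[of x y] xy by linarith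
  qed
  moreover have "g ` F \<subseteq> C" using g by auto
  ultimately show ?thesis using C(1) by (meson card_inj_on_le inj_on_finite)
qed

text \<open>The two relations between balls selected by \<open>separated_cover\<close>: the first
  alternative arises between different generations of radii, the second within one
  generation.\<close>

definition separated_pair :: "('a \<Rightarrow> real) \<Rightarrow> 'a \<Rightarrow> 'a \<Rightarrow> bool" where
  "separated_pair r x y \<longleftrightarrow> max (r x) (r y) \<le> N (x - y) \<or>
     (r x \<le> 2 * r y \<and> r y \<le> 2 * r x \<and> min (r x) (r y) \<le> N (x - y))"

text \<open>Two balls through a common point whose centres are seen from there in almost the same
  direction cannot miss each other's centres; so they belong to the second kind of pair, of
  comparable radii.\<close>

lemma overlap_bound:
  "\<exists>P::nat. \<forall>F r z. finite F \<longrightarrow> (\<forall>x\<in>F. z \<in> gball x (r x)) \<longrightarrow>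
     (\<forall>x\<in>F. \<forall>y\<in>F. x \<noteq> y \<longrightarrow> separated_pair r x y) \<longrightarrow> card F \<le> P"
proof -
  \<comment> \<open>One net serves twice: for the directions, whose gauge is at most 1, and for the
    centres rescaled by the smallest radius, whose gauge is below 2.\<close>
  obtain C where C: "finite C" "\<And>v. v \<in> gball 0 3 \<Longrightarrow> \<exists>c\<in>C. N (v - c) < 1/4"
    using finite_net[OF bounded_gball[of 0 3], of "1/4"] zero_less_divide_iff zero_less_one zero_less_numeral by metis
  have "card F \<le> card C * card C"
    if fin: "finite F" and z: "\<And>x. x \<in> F \<Longrightarrow> z \<in> gball x (r x)"
      and sep: "\<And>x y. x \<in> F \<Longrightarrow> y \<in> F \<Longrightarrow> x \<noteq> y \<Longrightarrow> separated_pair r x y" for F r z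
  proof -
    have zr: "N (x - z) < r x" if "x \<in> F" for x
      using z[OF that] N_minus_commute[of z x] by (simp add: gball_def)
    have rpos: "0 < r x" if "x \<in> F" for x using zr[OF that] N_nonneg[of "x - z"] by linarith
    define d where "d x = (1 / N (x - z)) *\<^sub>R (x - z)" for x
    have d: "x - z = N (x - z) *\<^sub>R d x" for x
      by (cases "x = z") (auto simp: d_def N_eq_0_iff)
    have Nd: "N (d x) \<le> 1" for x
      by (cases "x = z") (auto simp: d_def N_scale N_eq_0_iff)
    have "\<exists>c\<in>C. N (d x - c) < 1/4" for x
      using C(2)[of "d x"] Nd[of x] by (simp add: gball_def)
    then obtain g where g: "\<And>x. g x \<in> C" "\<And>x. N (d x - g x) < 1/4" by metis
    have comp: "r x \<le> 2 * r y \<and> r y \<le> 2 * r x \<and> min (r x) (r y) \<le> N (x - y)"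
      if xy: "x \<in> F" "y \<in> F" "x \<noteq> y" "g x = g y" for x y
    proof -
      have close: "N (d x - d y) < 1/2" if "g x = g y" for x y
        using N_triangle[of "d x" "d y" "g x"] g(2)[of x] g(2)[of y] N_minus_commute[of "g y" "d y"] that by simp
      \<comment> \<open>The vector \<open>x - y\<close> is split into a step along the direction of
        \<open>x\<close> and a difference of directions scaled by the shorter distance; a
        directional gap below 1/2 keeps the sum within \<open>N (x - z)\<close>.\<close>
      have lt: "N (x - y) < max (r x) (r y)" if "N (y - z) \<le> N (x - z)" "x \<in> F" "g x = g y" for x y
      proof -
        have "x - y = (x - z) - (y - z)" by simp
        also have "\<dots> = (N (x - z) - N (y - z)) *\<^sub>R d x + N (y - z) *\<^sub>R (d x - d y)"
          by (subst d[of x], subst d[of y]) (simp add: algebra_simps)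
        finally have "N (x - y) \<le> (N (x - z) - N (y - z)) * N (d x) + N (y - z) * N (d x - d y)"
          using N_add[of "(N (x - z) - N (y - z)) *\<^sub>R d x" "N (y - z) *\<^sub>R (d x - d y)"] that
          by (simp add: N_scale)
        also have "\<dots> \<le> (N (x - z) - N (y - z)) * 1 + N (y - z) * (1/2)"
          using that Nd[of x] close[OF that(3)] by (intro add_mono mult_left_mono) auto
        also have "\<dots> \<le> N (x - z)" using N_nonneg[of "y - z"] by simp
        finally show ?thesis using zr[OF that(2)] by simp
      qed
      have "N (x - y) < max (r x) (r y)"
        using lt[of y x] lt[of x y] xy N_minus_commute[of x y]
        by (cases "N (y - z) \<le> N (x - z)") (auto simp: max.commute)
      then show ?thesis using sep[OF xy(1-3)] by (auto simp: separated_pair_def)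
    qed
    \<comment> \<open>Within one direction class all radii are at most twice the smallest one,
      \<open>r m\<close>. After division by \<open>r m\<close> the centres are 1-separated and
      bounded, so the net limits their number.\<close>
    have fib: "card {x\<in>F. g x = c} \<le> card C" for c
    proof (cases "{x\<in>F. g x = c} = {}")
      case False
      let ?G = "{x\<in>F. g x = c}"
      obtain m where m: "m \<in> ?G" "\<And>x. x \<in> ?G \<Longrightarrow> r m \<le> r x"
      proof -
        have fG: "finite (r ` ?G)" "r ` ?G \<noteq> {}" using fin False by auto
        then obtain m where "m \<in> ?G" "r m = Min (r ` ?G)" using Min_in[OF fG] by (metis (no_types, lifting) imageE)
        then show ?thesis using that[of m] Min_le[OF fG(1)] by (metis (no_types, lifting) imageI)
      qed
      have "finite ?G \<and> card ?G \<le> card C"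
      proof (rule card_separated_le[where f="\<lambda>x. (1 / r m) *\<^sub>R (x - z)" and e="1/4", OF C(1)])
        fix x assume x: "x \<in> ?G"
        have "r x \<le> 2 * r m" using comp[of x m] x m rpos[of m] by (cases "x = m") auto
        then have "N (x - z) < 2 * r m" using zr[of x] x by simp
        then have "N ((1 / r m) *\<^sub>R (x - z)) < 3"
          using rpos[of m] m unfolding N_scale by (simp add: field_simps)
        then show "\<exists>c\<in>C. N ((1 / r m) *\<^sub>R (x - z) - c) < 1/4"
          using C(2) by (simp add: gball_def)
      next
        fix x y assume xy: "x \<in> ?G" "y \<in> ?G" "x \<noteq> y"
        have "r m \<le> N (x - y)" using comp[of x y] xy m(2)[of x] m(2)[of y] by auto
        moreover have "(1 / r m) *\<^sub>R (x - z) - (1 / r m) *\<^sub>R (y - z) = (1 / r m) *\<^sub>R (x - y)"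
          by (simp add: algebra_simps)
        ultimately show "2 * (1/4) \<le> N ((1 / r m) *\<^sub>R (x - z) - (1 / r m) *\<^sub>R (y - z))"
          using rpos[of m] m by (simp only: N_scale) (simp add: field_simps)
      qed
      then show ?thesis by simp
    next
      case True
      show ?thesis unfolding True by simp
    qed
    have "F = (\<Union>c\<in>C. {x\<in>F. g x = c})" using g(1) by auto
    then have "card F \<le> (\<Sum>c\<in>C. card {x\<in>F. g x = c})"
      using card_UN_le[OF C(1), of "\<lambda>c. {x\<in>F. g x = c}"] by simp
    also have "\<dots> \<le> (\<Sum>c\<in>C. card C)" by (intro sum_mono fib)
    finally show ?thesis by simp
  qed
  then show ?thesis by (intro exI[of _ "card C * card C"]) blast
qed

text \<open>Greedy selection by dyadic generations of radii, by induction on their number. In the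
  top generation a separated set of maximal cardinality is taken; maximality makes its balls cover
  that generation, and the points left over have smaller radii. The lower bound
  \<open>\<rho>\<close> keeps the selection finite.\<close>

lemma separated_cover:
  assumes "bounded A" "0 < \<rho>" "\<And>x. x \<in> A \<Longrightarrow> \<rho> \<le> r x \<and> r x < \<rho> * 2 ^ k"
  shows "\<exists>F. finite F \<and> F \<subseteq> A \<and> A \<subseteq> (\<Union>x\<in>F. gball x (r x)) \<and>
     (\<forall>x\<in>F. \<forall>y\<in>F. x \<noteq> y \<longrightarrow> separated_pair r x y)"
  using assms(1,3)
proof (induction k arbitrary: A)
  case 0
  then have "A = {}" by force
  then show ?case by auto
next
  case (Suc k)
  define T where "T = {x\<in>A. \<rho> * 2 ^ k \<le> r x}"
  define S where "S F \<longleftrightarrow> F \<subseteq> T \<and> (\<forall>x\<in>F. \<forall>y\<in>F. x \<noteq> y \<longrightarrow> min (r x) (r y) \<le> N (x - y))" for F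
  obtain C where C: "finite C" "\<And>v. v \<in> A \<Longrightarrow> \<exists>c\<in>C. N (v - c) < \<rho> / 2"
    using finite_net[OF Suc.prems(1), of "\<rho> / 2"] assms(2) by auto
  \<comment> \<open>The uniform bound on the cardinality is what makes a largest separated set
    exist.\<close>
  have S: "finite F \<and> card F \<le> card C" if "S F" for F
  proof (rule card_separated_le[where f="\<lambda>x. x", OF C])
    fix x y assume xy: "x \<in> F" "y \<in> F" "x \<noteq> y"
    then have "x \<in> A" "y \<in> A" "min (r x) (r y) \<le> N (x - y)" using that by (auto simp: S_def T_def)
    then show "2 * (\<rho> / 2) \<le> N (x - y)" using Suc.prems(2)[of x] Suc.prems(2)[of y] by auto
  qed (use that in \<open>auto simp: S_def T_def\<close>)
  have "S {}" by (simp add: S_def)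
  moreover have "\<forall>F. S F \<longrightarrow> card F < Suc (card C)" using S by (simp add: less_Suc_eq_le)
  ultimately have "\<exists>F0. S F0 \<and> (\<forall>F. S F \<longrightarrow> card F \<le> card F0)" by (rule ex_has_greatest_nat)
  then obtain F0 where F0: "S F0" "\<And>F. S F \<Longrightarrow> card F \<le> card F0" by auto
  define A' where "A' = A - (\<Union>x\<in>F0. gball x (r x))"
  have T0: "T \<subseteq> (\<Union>x\<in>F0. gball x (r x))"
  proof (rule ccontr)
    assume "\<not> ?thesis"
    then obtain y where y: "y \<in> T" "\<And>x. x \<in> F0 \<Longrightarrow> r x \<le> N (y - x)" proof -
      obtain y where "y \<in> T" "y \<notin> (\<Union>x\<in>F0. gball x (r x))" using \<open>\<not> T \<subseteq> _\<close> by blast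
      then show ?thesis using that[of y] by (auto simp: gball_def not_less)
    qed
    have yF: "y \<notin> F0"
    proof
      assume "y \<in> F0"
      then have "r y \<le> 0" using y(2)[of y] by simp
      then show False using y(1) Suc.prems(2)[of y] assms(2) by (auto simp: T_def)
    qed
    have "S (insert y F0)"
      unfolding S_def
    proof (intro conjI ballI impI)
      fix u v assume uv: "u \<in> insert y F0" "v \<in> insert y F0" "u \<noteq> v"
      show "min (r u) (r v) \<le> N (u - v)"
      proof -
        consider "u = y" "v \<in> F0" | "v = y" "u \<in> F0" | "u \<in> F0" "v \<in> F0" using uv by auto
        then show ?thesis
        proof cases
          case 1 then show ?thesis using y(2)[of v] by (simp add: min.coboundedI2)
        next
          case 2 then show ?thesis using y(2)[of u] N_minus_commute[of u v] by (simp add: min.coboundedI1)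
        next
          case 3 then show ?thesis using F0(1) uv(3) by (simp add: S_def)
        qed
      qed
    qed (use F0 y in \<open>auto simp: S_def\<close>)
    then have "card (insert y F0) \<le> card F0" by (rule F0(2))
    then show False using yF S[OF F0(1)] by simp
  qed
  have "bounded A'" using Suc.prems(1) by (rule bounded_subset) (auto simp: A'_def)
  moreover have A'r: "\<rho> \<le> r x \<and> r x < \<rho> * 2 ^ k" if "x \<in> A'" for x
    using that T0 Suc.prems(2)[of x] by (auto simp: A'_def T_def not_le[symmetric])
  ultimately obtain F1 where F1: "finite F1" "F1 \<subseteq> A'" "A' \<subseteq> (\<Union>x\<in>F1. gball x (r x))"
    "\<And>x y. x \<in> F1 \<Longrightarrow> y \<in> F1 \<Longrightarrow> x \<noteq> y \<Longrightarrow> separated_pair r x y"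
    using Suc.IH[of A'] by auto
  \<comment> \<open>A centre selected later lies outside the balls of the earlier generation and its
    radius is not larger: the first alternative of \<open>separated_pair\<close>.\<close>
  have cross: "separated_pair r x y \<and> separated_pair r y x" if x: "x \<in> F0" and y: "y \<in> F1" for x y
  proof -
    have "r x \<le> N (y - x)" using x y F1(2) by (auto simp: A'_def gball_def not_less)
    moreover have "r y \<le> r x" using A'r[of y] x y F1(2) F0(1) by (force simp: S_def T_def)
    ultimately show ?thesis using N_minus_commute[of x y] by (auto simp: separated_pair_def)
  qed
  have F0s: "separated_pair r x y" if "x \<in> F0" "y \<in> F0" "x \<noteq> y" for x y
  proof -
    have "x \<in> T" "y \<in> T" using that F0(1) by (auto simp: S_def)
    then have "r x \<le> 2 * r y" "r y \<le> 2 * r x"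
      using Suc.prems(2)[of x] Suc.prems(2)[of y] by (auto simp: T_def)
    then show ?thesis using that F0(1) by (auto simp: separated_pair_def S_def)
  qed
  show ?case
  proof (intro exI[of _ "F0 \<union> F1"] conjI ballI impI)
    show "finite (F0 \<union> F1)" using F1 S[OF F0(1)] by auto
    show "F0 \<union> F1 \<subseteq> A" using F1(2) F0(1) by (auto simp: S_def T_def A'_def)
    show "A \<subseteq> (\<Union>x\<in>F0 \<union> F1. gball x (r x))" using F1(3) by (auto simp: A'_def)
    fix x y assume "x \<in> F0 \<union> F1" "y \<in> F0 \<union> F1" "x \<noteq> y"
    then show "separated_pair r x y" using cross F0s F1(4) by blast
  qed
qed

text \<open>Differentiation for arbitrary finite Borel measures. The \<open>\<nu>\<close>-null set
  \<open>E\<close> lies in an open \<open>U\<close> of tiny \<open>\<nu>\<close>-mass; bad balls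
  inside \<open>U\<close> that cover the bad points with overlap at most \<open>P\<close> have
  \<open>\<mu>\<close>-mass at most \<open>P * measure \<nu> U / \<eta>\<close>.\<close>

lemma AE_measure_gball_le:
  assumes fin: "finite_measure \<mu>" "finite_measure \<nu>" and sets: "sets \<mu> = sets borel" "sets \<nu> = sets borel"
    and E: "E \<in> sets borel" "emeasure \<nu> E = 0" and \<eta>: "0 < \<eta>"
  shows "AE x in \<mu>. x \<in> E \<longrightarrow> eventually (\<lambda>r. measure \<nu> (gball x r) \<le> \<eta> * measure \<mu> (gball x r)) (at_right 0)"
proof -
  interpret \<mu>: finite_measure \<mu> by fact
  interpret \<nu>: finite_measure \<nu> by fact
  define Bad where "Bad = {x\<in>E. \<not> eventually (\<lambda>r. measure \<nu> (gball x r) \<le> \<eta> * measure \<mu> (gball x r)) (at_right 0)}"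
  from overlap_bound obtain P :: nat where P: "\<forall>F r z. finite F \<longrightarrow> (\<forall>x\<in>F. z \<in> gball x (r x)) \<longrightarrow>
     (\<forall>x\<in>F. \<forall>y\<in>F. x \<noteq> y \<longrightarrow> separated_pair r x y) \<longrightarrow> card F \<le> P" ..
  have small: "\<exists>H\<in>sets \<mu>. Bad \<subseteq> H \<and> measure \<mu> H \<le> e" if "0 < e" for e :: real
  proof -
    \<comment> \<open>Chosen so that \<open>(P + 1) * e' = \<eta> * e\<close>; the added 1 keeps the
      denominator positive.\<close>
    define e' where "e' = e * \<eta> / (P + 1)"
    have e': "0 < e'" using that \<eta> by (simp add: e'_def)
    have "emeasure \<nu> E = (INF U\<in>{U. E \<subseteq> U \<and> open U}. emeasure \<nu> U)"
      by (rule outer_regular[OF sets(2)]) (use E in auto)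
    then have "(INF U\<in>{U. E \<subseteq> U \<and> open U}. emeasure \<nu> U) < ennreal e'" using E e' by simp
    then obtain U where U: "E \<subseteq> U" "open U" "emeasure \<nu> U < ennreal e'"
      unfolding INF_less_iff by auto
    then have U': "measure \<nu> U < e'" using e' by (simp add: \<nu>.emeasure_eq_measure ennreal_less_iff)
    have "\<exists>r. 0 < r \<and> r < 1 \<and> gball x r \<subseteq> U \<and> \<eta> * measure \<mu> (gball x r) < measure \<nu> (gball x r)" if "x \<in> Bad" for x
    proof -
      have "frequently (\<lambda>r. \<eta> * measure \<mu> (gball x r) < measure \<nu> (gball x r)) (at_right 0)"
        using that by (simp add: Bad_def frequently_def not_less)
      moreover have "eventually (\<lambda>r. gball x r \<subseteq> U) (at_right 0)"
        using that U by (intro eventually_gball_subset) (auto simp: Bad_def)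
      moreover have "eventually (\<lambda>r::real. r \<in> {0<..<1}) (at_right 0)"
        by (rule eventually_at_right_real) simp
      ultimately have "frequently (\<lambda>r. (gball x r \<subseteq> U \<and> r \<in> {0<..<1}) \<and> \<eta> * measure \<mu> (gball x r) < measure \<nu> (gball x r)) (at_right 0)"
        by (intro frequently_eventually_conj eventually_conj)
      from frequently_ex[OF this] show ?thesis by auto
    qed
    then obtain r where r: "\<And>x. x \<in> Bad \<Longrightarrow> 0 < r x \<and> r x < 1 \<and> gball x (r x) \<subseteq> U \<and> \<eta> * measure \<mu> (gball x (r x)) < measure \<nu> (gball x (r x))"
      by metis
    \<comment> \<open>On \<open>A m\<close> the centres are bounded and the radii bounded below, as
      \<open>separated_cover\<close> demands.\<close>
    define A where "A m = {x\<in>Bad. norm x \<le> real m \<and> 1 / real (Suc m) \<le> r x}" for m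
    have "\<exists>H\<in>sets \<mu>. A m \<subseteq> H \<and> measure \<mu> H \<le> e" for m
    proof -
      obtain k :: nat where k: "real (Suc m) < 2 ^ k" using real_arch_pow[of 2 "real (Suc m)"] by auto
      have bA: "bounded (A m)" by (rule bounded_subset[of "cball 0 (real m)"]) (auto simp: A_def)
      obtain F where F: "finite F" "F \<subseteq> A m" "A m \<subseteq> (\<Union>x\<in>F. gball x (r x))"
        "\<forall>x\<in>F. \<forall>y\<in>F. x \<noteq> y \<longrightarrow> separated_pair r x y"
      proof -
        have "1 / real (Suc m) \<le> r x \<and> r x < 1 / real (Suc m) * 2 ^ k" if "x \<in> A m" for x
        proof -
          have "1 < 1 / real (Suc m) * 2 ^ k" using k by (simp add: field_simps)
          moreover have "1 / real (Suc m) \<le> r x" "r x < 1" using that r[of x] by (auto simp: A_def)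
          ultimately show ?thesis by linarith
        qed
        then show ?thesis using separated_cover[OF bA, of "1 / real (Suc m)" r k] that by auto
      qed
      have FB: "x \<in> Bad" if "x \<in> F" for x using that F by (auto simp: A_def)
      let ?H = "\<Union>x\<in>F. gball x (r x)"
      have "\<eta> * measure \<mu> ?H \<le> \<eta> * (\<Sum>x\<in>F. measure \<mu> (gball x (r x)))"
        using \<eta> F sets by (intro mult_left_mono \<mu>.finite_measure_subadditive_finite) auto
      also have "\<dots> \<le> (\<Sum>x\<in>F. measure \<nu> (gball x (r x)))"
        unfolding sum_distrib_left using r FB by (intro sum_mono) (auto intro: less_imp_le)
      also have "\<dots> = (\<Sum>x\<in>F. \<integral>z. indicator (gball x (r x)) z \<partial>\<nu>)"
        using sets by (intro sum.cong refl) (simp add: sets_eq_imp_space_eq[OF sets(2)])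
      also have "\<dots> = (\<integral>z. (\<Sum>x\<in>F. indicator (gball x (r x)) z) \<partial>\<nu>)"
        using sets by (intro Bochner_Integration.integral_sum[symmetric]) (auto simp: \<nu>.emeasure_eq_measure)
      also have "\<dots> \<le> (\<integral>z. real P * indicator U z \<partial>\<nu>)"
      proof (rule integral_mono)
        fix z
        have "(\<Sum>x\<in>F. indicator (gball x (r x)) z :: real) = card {x\<in>F. z \<in> gball x (r x)}"
          using F(1) by (simp add: indicator_def sum.If_cases Int_def)
        also have "\<dots> \<le> real P * indicator U z"
        proof (cases "{x\<in>F. z \<in> gball x (r x)} = {}")
          case True then show ?thesis by (simp only: True) simp
        next
          case False
          then have "z \<in> U" using r FB by blast
          moreover have "card {x\<in>F. z \<in> gball x (r x)} \<le> P" using F by (intro P[rule_format, of _ z r]) auto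
          ultimately show ?thesis by simp
        qed
        finally show "(\<Sum>x\<in>F. indicator (gball x (r x)) z :: real) \<le> real P * indicator U z" .
      qed (use sets U in \<open>auto simp: \<nu>.emeasure_eq_measure\<close>)
      also have "\<dots> = P * measure \<nu> U" using U sets by (simp add: sets_eq_imp_space_eq[OF sets(2)])
      also have "\<dots> \<le> (P + 1) * e'" using U' by (intro mult_mono) auto
      also have "\<dots> = \<eta> * e" by (simp add: e'_def)
      finally have "measure \<mu> ?H \<le> e" using \<eta> by simp
      then show ?thesis using F(1,3) sets by (intro bexI[of _ ?H]) auto
    qed
    then obtain H where H: "\<And>m. H m \<in> sets \<mu>" "\<And>m. A m \<subseteq> H m" "\<And>m. measure \<mu> (H m) \<le> e" by metis
    \<comment> \<open>\<open>Bad\<close> may fail to be measurable and the covers \<open>H m\<close>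
      are not nested. Their lower limit is measurable, contains \<open>Bad\<close> because each bad
      point lies in all late \<open>A m\<close>, and keeps the bound \<open>e\<close>.\<close>
    define H' where "H' m = (\<Inter>l\<in>{m..}. H l)" for m
    have H'm: "H' m \<in> sets \<mu>" for m unfolding H'_def using H by (intro sets.countable_INT') auto
    have "incseq H'" by (auto simp: incseq_def H'_def)
    then have "(\<lambda>m. measure \<mu> (H' m)) \<longlonglongrightarrow> measure \<mu> (\<Union>m. H' m)"
      using H'm by (intro \<mu>.finite_Lim_measure_incseq) auto
    moreover have "measure \<mu> (H' m) \<le> e" for m
    proof -
      have "H' m \<subseteq> H m" by (auto simp: H'_def)
      then show ?thesis using \<mu>.finite_measure_mono[of "H' m" "H m"] H(1,3)[of m] by linarith
    qed
    ultimately have "measure \<mu> (\<Union>m. H' m) \<le> e" by (intro LIMSEQ_le_const2) auto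
    moreover have "Bad \<subseteq> (\<Union>m. H' m)"
    proof
      fix x assume x: "x \<in> Bad"
      obtain m1 :: nat where m1: "norm x \<le> real m1" using real_arch_simple by blast
      obtain m2 :: nat where m2: "1 / real (Suc m2) < r x" using r[OF x] nat_approx_posE by blast
      have "x \<in> A l" if "max m1 m2 \<le> l" for l
      proof -
        have "1 / real (Suc l) \<le> 1 / real (Suc m2)" using that by (intro divide_left_mono) auto
        moreover have "real m1 \<le> real l" using that by simp
        ultimately show ?thesis using x m1 m2 unfolding A_def by auto
      qed
      then have "x \<in> H l" if "max m1 m2 \<le> l" for l using that H(2)[of l] by blast
      then have "x \<in> H' (max m1 m2)" by (auto simp: H'_def)
      then show "x \<in> (\<Union>m. H' m)" by auto
    qed
    ultimately show ?thesis using H'm by (intro bexI[of _ "\<Union>m. H' m"]) auto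
  qed
  obtain H where H: "\<And>j::nat. H j \<in> sets \<mu>" "\<And>j. Bad \<subseteq> H j" "\<And>j. measure \<mu> (H j) \<le> 1 / real (Suc j)"
    using small[of "1 / real (Suc _)"] by (metis of_nat_0_less_iff zero_less_Suc zero_less_divide_1_iff)
  have "measure \<mu> (\<Inter>j. H j) \<le> 1 / real (Suc j)" for j
  proof -
    have "(\<Inter>j. H j) \<subseteq> H j" by auto
    then show ?thesis using \<mu>.finite_measure_mono[of "\<Inter>j. H j" "H j"] H(1,3)[of j] by linarith
  qed
  then have "measure \<mu> (\<Inter>j. H j) \<le> 0"
    by (intro LIMSEQ_le_const[OF LIMSEQ_inverse_real_of_nat]) (auto simp: inverse_eq_divide)
  then have "(\<Inter>j. H j) \<in> null_sets \<mu>"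
    using H(1) by (auto simp: null_sets_def \<mu>.emeasure_eq_measure measure_le_0_iff)
  then show ?thesis
    by (rule AE_I') (use H(2) in \<open>auto simp: Bad_def\<close>)
qed

end

text \<open>The Minkowski functional of \<open>K\<close>: symmetry gives
  \<open>N (- v) = N v\<close>, convexity the triangle inequality, openness and boundedness the
  comparison with the Euclidean norm.\<close>

lemma symmetric_convex_body_gauge:
  fixes K :: "'a::euclidean_space set"
  assumes K: "K \<noteq> {}" "bounded K" "open K" "convex K" "K = uminus ` K"
  shows "\<exists>N. gauge_norm N \<and> K = {v. N v < 1}"
proof -
  obtain x where "x \<in> K" using K(1) by auto
  have sym: "- v \<in> K" if "v \<in> K" for v by (subst K(5)) (rule imageI[OF that])
  have "(1/2) *\<^sub>R x + (1/2) *\<^sub>R (- x) \<in> K"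
    using convexD[OF K(4) \<open>x \<in> K\<close> sym[OF \<open>x \<in> K\<close>], of "1/2" "1/2"] by simp
  then have K0: "0 \<in> K" by simp
  obtain s where s: "s > 0" "ball 0 s \<subseteq> K" using openE[OF K(3) K0] by auto
  obtain R where R: "R > 0" "\<And>v. v \<in> K \<Longrightarrow> norm v < R" using K(2) bounded_pos_less by metis
  define S where "S v = {t. 0 < t \<and> (1 / t) *\<^sub>R v \<in> K}" for v
  define N where "N v = Inf (S v)" for v
  have up: "t' \<in> S v" if "t \<in> S v" "t < t'" for t t' v
  proof -
    have t: "0 < t" "(1 / t) *\<^sub>R v \<in> K" using that by (auto simp: S_def)
    have "(t / t') *\<^sub>R ((1 / t) *\<^sub>R v) + (1 - t / t') *\<^sub>R 0 \<in> K"
      using t that K0 by (intro convexD[OF K(4)]) (auto simp: field_simps)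
    then show ?thesis using t that by (auto simp: S_def)
  qed
  have inS: "t \<in> S v" if "norm v < s * t" "0 < t" for t v
    using that s by (auto simp: S_def field_simps intro!: subsetD[OF s(2)])
  have bdd: "bdd_below (S v)" for v by (rule bdd_belowI[of _ 0]) (auto simp: S_def)
  have ne: "S v \<noteq> {}" for v
  proof -
    have "norm v < s * ((norm v + 1) / s)" "0 < (norm v + 1) / s" using s by (auto intro!: divide_pos_pos add_nonneg_pos)
    then show ?thesis using inS by blast
  qed
  \<comment> \<open>Openness of \<open>K\<close> makes the inequality strict: an admissible
    \<open>t\<close> can still be lowered a little. Homogeneity and the triangle inequality are read
    off from these strict bounds.\<close>
  have iff: "N v < t \<longleftrightarrow> t \<in> S v" if "0 < t" for t v
  proof
    assume "N v < t"
    then obtain t' where "t' \<in> S v" "t' < t" unfolding N_def using cInf_lessD[OF ne] by blast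
    then show "t \<in> S v" by (rule up)
  next
    assume "t \<in> S v"
    then have tK: "(1 / t) *\<^sub>R v \<in> K" by (auto simp: S_def)
    have "((\<lambda>u. (1 / u) *\<^sub>R v) \<longlongrightarrow> (1 / t) *\<^sub>R v) (at_left t)"
      using that by (intro tendsto_intros) auto
    then have "eventually (\<lambda>u. (1 / u) *\<^sub>R v \<in> K) (at_left t)" using K(3) tK by (rule topological_tendstoD)
    moreover have "eventually (\<lambda>u. u \<in> {0<..<t}) (at_left t)" by (rule eventually_at_left_real) (rule that)
    ultimately have "eventually (\<lambda>u. u \<in> S v \<and> u < t) (at_left t)" by eventually_elim (auto simp: S_def)
    then obtain u where "u \<in> S v" "u < t" using eventually_happens'[OF trivial_limit_at_left_real] by blast
    then show "N v < t" unfolding N_def using cInf_lower[OF _ bdd] by (meson le_less_trans)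
  qed
  have nn: "0 \<le> N v" for v unfolding N_def by (rule cInf_greatest[OF ne]) (auto simp: S_def)
  have eqI: "a = b" if "0 \<le> a" "0 \<le> b" "\<And>t. 0 < t \<Longrightarrow> a < t \<longleftrightarrow> b < t" for a b :: real
    using that(3)[of a] that(3)[of b] that(1,2) by (cases a b rule: linorder_cases) auto
  have pos: "N (a *\<^sub>R v) = a * N v" if "0 < a" for a v
  proof (rule eqI)
    fix t :: real assume t: "0 < t"
    have "N (a *\<^sub>R v) < t \<longleftrightarrow> t / a \<in> S v" unfolding iff[OF t] using that t by (simp add: S_def)
    also have "\<dots> \<longleftrightarrow> N v < t / a" using that t by (simp add: iff)
    finally show "N (a *\<^sub>R v) < t \<longleftrightarrow> a * N v < t" using that by (simp add: field_simps)
  qed (use nn that in auto)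
  have neg: "N (- v) = N v" for v
  proof -
    have "S (- v) = S v" unfolding S_def using sym[of "(1 / _) *\<^sub>R v"] sym[of "- ((1 / _) *\<^sub>R v)"] by auto
    then show ?thesis by (simp add: N_def)
  qed
  have zero: "N 0 = 0" by (rule eqI) (use nn iff K0 in \<open>auto simp: S_def\<close>)
  have "gauge_norm N"
  proof
    show "N (a *\<^sub>R v) = \<bar>a\<bar> * N v" for a v
      using pos[of a v] pos[of "- a" v] neg[of "a *\<^sub>R v"] zero by (cases a "0::real" rule: linorder_cases) auto
    show "N (v + w) \<le> N v + N w" for v w
    proof (rule field_le_epsilon)
      fix e :: real assume e: "0 < e"
      define a where "a = N v + e / 2"
      define b where "b = N w + e / 2"
      have ab: "0 < a" "0 < b" using e nn[of v] nn[of w] by (auto simp: a_def b_def)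
      have "a \<in> S v" "b \<in> S w" proof -
          have "N v < a" "N w < b" using e by (auto simp: a_def b_def)
          then show "a \<in> S v" "b \<in> S w" using iff[OF ab(1), of v] iff[OF ab(2), of w] by auto
        qed
      then have *: "(1 / a) *\<^sub>R v \<in> K" "(1 / b) *\<^sub>R w \<in> K" by (auto simp: S_def)
      have "(a / (a + b)) *\<^sub>R ((1 / a) *\<^sub>R v) + (b / (a + b)) *\<^sub>R ((1 / b) *\<^sub>R w) \<in> K"
        using ab by (intro convexD[OF K(4)] *) (simp_all add: add_divide_distrib[symmetric])
      then have "a + b \<in> S (v + w)" using ab by (auto simp: S_def algebra_simps)
      then have "N (v + w) < a + b" using iff[of "a + b"] ab by auto
      then show "N (v + w) \<le> N v + N w + e" by (simp add: a_def b_def)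
    qed
    show "\<exists>c>0. \<forall>v. c * norm v \<le> N v"
    proof (intro exI[of _ "1 / R"] conjI allI)
      fix v
      have "norm v / R \<le> t" if "t \<in> S v" for t
        using that R(2)[of "(1 / t) *\<^sub>R v"] R(1) by (auto simp: S_def field_simps)
      then show "1 / R * norm v \<le> N v" unfolding N_def by (intro cInf_greatest[OF ne]) auto
    qed (use R in auto)
    show "\<exists>C>0. \<forall>v. N v \<le> C * norm v"
    proof (intro exI[of _ "1 / s"] conjI allI)
      fix v
      show "N v \<le> 1 / s * norm v"
      proof (rule field_le_epsilon)
        fix e :: real assume e: "0 < e"
        have "norm v / s + e \<in> S v" using s e by (intro inS) (auto simp: field_simps add_nonneg_pos)
        then have "N v \<le> norm v / s + e" unfolding N_def by (rule cInf_lower[OF _ bdd])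
        then show "N v \<le> 1 / s * norm v + e" by simp
      qed
    qed (use s in auto)
  qed
  moreover have "K = {v. N v < 1}" using iff[of 1] by (auto simp: S_def)
  ultimately show ?thesis by blast
qed

section \<open>Null sets and Lebesgue decomposition of vector measures\<close>

lemma null_sets_total_variation_iff:
  fixes \<mu> :: "'a set \<Rightarrow> 'b::euclidean_space"
  assumes vm: "vector_measure M \<mu>" and A: "A \<in> sets M"
  shows "A \<in> null_sets (total_variation M \<mu>) \<longleftrightarrow> (\<forall>B\<in>sets M. B \<subseteq> A \<longrightarrow> \<mu> B = 0)"
proof
  assume null: "A \<in> null_sets (total_variation M \<mu>)"
  show "\<forall>B\<in>sets M. B \<subseteq> A \<longrightarrow> \<mu> B = 0"
  proof (intro ballI impI)
    fix B assume B: "B \<in> sets M" "B \<subseteq> A"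
    then have "B \<in> null_sets (total_variation M \<mu>)" using null_sets_subset[OF null, of B] by simp
    then have "measure (total_variation M \<mu>) B = 0" by (simp add: measure_eq_0_null_sets)
    then show "\<mu> B = 0" using norm_le_measure_total_variation[OF vm B(1)] by simp
  qed
next
  assume *: "\<forall>B\<in>sets M. B \<subseteq> A \<longrightarrow> \<mu> B = 0"
  have "variation_fun M \<mu> A \<le> 0"
  proof (rule variation_fun_le)
    fix C :: "nat \<Rightarrow> 'a set" assume C: "range C \<subseteq> sets M" "(\<Union>i. C i) = A"
    have "\<mu> (C i) = 0" for i using * C by blast
    then show "(\<Sum>i. ennreal (norm (\<mu> (C i)))) \<le> 0" by simp
  qed
  then show "A \<in> null_sets (total_variation M \<mu>)"
    using A by (simp add: null_sets_def emeasure_total_variation[OF vm A])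
qed

text \<open>The condition under \<open>THE\<close> in \<open>singular_part\<close>, isolated so that
  existence and uniqueness can be argued.\<close>

definition singular_decomposition ::
    "'a measure \<Rightarrow> ('a set \<Rightarrow> 'b::real_normed_vector) \<Rightarrow> ('a set \<Rightarrow> 'b) \<Rightarrow> bool" where
  "singular_decomposition M \<mu> \<nu> \<longleftrightarrow> vector_measure M \<nu> \<and> singular_vector_measure M \<nu> \<and>
     absolutely_continuous M (total_variation M (\<lambda>B. \<mu> B - \<nu> B))"

text \<open>A singular part is the restriction of \<open>\<mu>\<close> to a null set. Every larger
  null set \<open>N'\<close> serves as well, so two decompositions can be compared on the union of
  their null sets.\<close>

lemma singular_decomposition_concentrated:
  fixes \<mu> \<nu> :: "'a set \<Rightarrow> 'b::euclidean_space"
  assumes vm: "vector_measure M \<mu>" and d: "singular_decomposition M \<mu> \<nu>"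
  obtains N where "N \<in> null_sets M"
    "\<And>N' B. N' \<in> null_sets M \<Longrightarrow> N \<subseteq> N' \<Longrightarrow> B \<in> sets M \<Longrightarrow> \<nu> B = \<mu> (B \<inter> N')"
proof -
  have vn: "vector_measure M \<nu>" using d by (simp add: singular_decomposition_def)
  obtain N where N: "N \<in> null_sets M" "emeasure (total_variation M \<nu>) (space M - N) = 0"
    using d by (auto simp: singular_decomposition_def singular_vector_measure_def)
  have "\<nu> B = \<mu> (B \<inter> N')" if N': "N' \<in> null_sets M" "N \<subseteq> N'" and B: "B \<in> sets M" for N' B
  proof -
    have sN: "N \<in> sets M" "N' \<in> sets M" using N(1) N' by auto
    have "space M - N \<in> null_sets (total_variation M \<nu>)" using N sN by (auto simp: null_sets_def)
    moreover have "B - N' \<subseteq> space M - N" using sets.sets_into_space[OF B] N'(2) by auto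
    moreover have "B - N' \<in> sets M" "space M - N \<in> sets M" using B sN by auto
    ultimately have 1: "\<nu> (B - N') = 0" using null_sets_total_variation_iff[OF vn] by blast
    have "B \<inter> N' \<in> null_sets M" by (rule null_sets_subset[OF N'(1)]) (use B sN in auto)
    then have "B \<inter> N' \<in> null_sets (total_variation M (\<lambda>B. \<mu> B - \<nu> B))"
      using d by (auto simp: singular_decomposition_def absolutely_continuous_def)
    then have 2: "\<mu> (B \<inter> N') - \<nu> (B \<inter> N') = 0"
      using null_sets_total_variation_iff[OF vector_measure_diff[OF vm vn], of "B \<inter> N'"] B sN by auto
    have "\<nu> ((B \<inter> N') \<union> (B - N')) = \<nu> (B \<inter> N') + \<nu> (B - N')"
      by (rule vector_measure_Un[OF vn]) (use B sN in auto)
    moreover have "(B \<inter> N') \<union> (B - N') = B" by auto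
    ultimately show ?thesis using 1 2 by simp
  qed
  then show thesis using that N(1) by blast
qed

lemma singular_decomposition_unique:
  fixes \<mu> :: "'a set \<Rightarrow> 'b::euclidean_space"
  assumes vm: "vector_measure M \<mu>" and d: "singular_decomposition M \<mu> \<nu>" "singular_decomposition M \<mu> \<nu>'"
  shows "\<nu> = \<nu>'"
proof
  fix B
  obtain N where N: "N \<in> null_sets M"
    "\<And>N' B. N' \<in> null_sets M \<Longrightarrow> N \<subseteq> N' \<Longrightarrow> B \<in> sets M \<Longrightarrow> \<nu> B = \<mu> (B \<inter> N')"
    using singular_decomposition_concentrated[OF vm d(1)] by metis
  obtain N2 where N2: "N2 \<in> null_sets M"
    "\<And>N' B. N' \<in> null_sets M \<Longrightarrow> N2 \<subseteq> N' \<Longrightarrow> B \<in> sets M \<Longrightarrow> \<nu>' B = \<mu> (B \<inter> N')"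
    using singular_decomposition_concentrated[OF vm d(2)] by metis
  show "\<nu> B = \<nu>' B"
  proof (cases "B \<in> sets M")
    case True
    have "N \<union> N2 \<in> null_sets M" using N(1) N2(1) by auto
    then show ?thesis using N(2)[of "N \<union> N2" B] N2(2)[of "N \<union> N2" B] True by simp
  next
    case False
    then show ?thesis using d by (simp add: singular_decomposition_def vector_measure_def)
  qed
qed

lemma singular_part_eqI:
  fixes \<mu> :: "'a set \<Rightarrow> 'b::euclidean_space"
  assumes "vector_measure M \<mu>" "singular_decomposition M \<mu> \<nu>"
  shows "singular_part M \<mu> = \<nu>"
  unfolding singular_part_def singular_decomposition_def[symmetric]
proof (rule the_equality)
  show "singular_decomposition M \<mu> \<nu>" by fact
  show "\<nu>' = \<nu>" if "singular_decomposition M \<mu> \<nu>'" for \<nu>'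
    by (rule singular_decomposition_unique[OF assms(1) that assms(2)])
qed

text \<open>Exhaustion: the supremum of \<open>measure T\<close> over the null sets of
  \<open>M\<close> is attained by a countable union, and a null set with \<open>T\<close>-mass
  outside this union would exceed the supremum.\<close>

lemma maximal_null_set:
  assumes "finite_measure T" and sets: "sets T = sets M"
  obtains N where "N \<in> null_sets M" "\<And>A. A \<in> null_sets M \<Longrightarrow> A - N \<in> null_sets T"
proof -
  interpret T: finite_measure T by fact
  let ?S = "SUP N\<in>null_sets M. measure T N"
  have bdd: "bdd_above (measure T ` null_sets M)"
    by (rule bdd_aboveI[of _ "measure T (space T)"]) (auto intro: T.bounded_measure)
  have ne: "null_sets M \<noteq> {}" by blast
  have "\<exists>N\<in>null_sets M. ?S - 1 / real (Suc k) < measure T N" for k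
    using less_cSUP_iff[OF ne bdd, of "?S - 1 / real (Suc k)"] by simp
  then obtain N where N: "\<And>k. N k \<in> null_sets M" "\<And>k. ?S - 1 / real (Suc k) < measure T (N k)" by metis
  define N' where "N' = (\<Union>k. N k)"
  have N': "N' \<in> null_sets M" unfolding N'_def using N by auto
  have "?S \<le> measure T N'"
  proof (rule LIMSEQ_le_const2[of "\<lambda>k. ?S - 1 / real (Suc k)"])
    have "(\<lambda>k. ?S - inverse (real (Suc k))) \<longlonglongrightarrow> ?S - 0"
      by (intro tendsto_diff tendsto_const LIMSEQ_inverse_real_of_nat)
    then show "(\<lambda>k. ?S - 1 / real (Suc k)) \<longlonglongrightarrow> ?S" by (simp add: inverse_eq_divide)
    have "measure T (N k) \<le> measure T N'" for k
      using N' sets by (intro T.finite_measure_mono) (auto simp: N'_def)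
    then show "\<exists>n. \<forall>k\<ge>n. ?S - 1 / real (Suc k) \<le> measure T N'"
      using N(2) by (meson less_imp_le order_trans)
  qed
  have "A - N' \<in> null_sets T" if A: "A \<in> null_sets M" for A
  proof -
    have "N' \<union> (A - N') \<in> null_sets M" using N' A null_set_Diff[of A M N'] by auto
    then have "measure T (N' \<union> (A - N')) \<le> ?S" by (rule cSUP_upper[OF _ bdd])
    moreover have "measure T (N' \<union> (A - N')) = measure T N' + measure T (A - N')"
      using N' A sets by (intro T.finite_measure_Union) auto
    ultimately have "measure T (A - N') \<le> 0" using \<open>?S \<le> measure T N'\<close> by simp
    then show ?thesis using A N' sets by (auto simp: null_sets_def T.emeasure_eq_measure measure_le_0_iff)
  qed
  with N' show thesis by (rule that)
qed

text \<open>The singular part is the restriction of \<open>\<mu>\<close> to a null set that is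
  maximal for the total variation; the remainder then vanishes on all null sets.\<close>

lemma singular_decomposition_exists:
  fixes \<mu> :: "'a set \<Rightarrow> 'b::euclidean_space"
  assumes vm: "vector_measure M \<mu>"
  obtains N where "N \<in> sets M"
    "singular_decomposition M \<mu> (\<lambda>B. if B \<in> sets M then \<mu> (B \<inter> N) else 0)"
proof -
  obtain N where N: "N \<in> null_sets M" "\<And>A. A \<in> null_sets M \<Longrightarrow> A - N \<in> null_sets (total_variation M \<mu>)"
    using maximal_null_set[OF finite_measure_total_variation[OF vm] sets_total_variation] by metis
  define \<nu> where "\<nu> B = (if B \<in> sets M then \<mu> (B \<inter> N) else 0)" for B
  have sN: "N \<in> sets M" using N by auto
  have vn: "vector_measure M \<nu>"
    unfolding vector_measure_def
  proof (intro conjI allI impI)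
    fix A :: "nat \<Rightarrow> 'a set" assume A: "range A \<subseteq> sets M" "disjoint_family A"
    have "(\<lambda>i. \<mu> (A i \<inter> N)) sums \<mu> (\<Union>i. A i \<inter> N)"
      by (rule vector_measure_sums[OF vm]) (use A sN in \<open>auto simp: disjoint_family_on_def\<close>)
    moreover have "(\<Union>i. A i \<inter> N) = (\<Union>i. A i) \<inter> N" by auto
    moreover have "A i \<in> sets M" "(\<Union>i. A i) \<in> sets M" for i using A by auto
    ultimately show "(\<lambda>i. \<nu> (A i)) sums \<nu> (\<Union>i. A i)" by (simp add: \<nu>_def)
  qed (simp add: \<nu>_def)
  have "singular_decomposition M \<mu> \<nu>"
    unfolding singular_decomposition_def
  proof (intro conjI vn)
    have "space M - N \<in> null_sets (total_variation M \<nu>)"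
    proof (subst null_sets_total_variation_iff[OF vn], use sN in simp, intro ballI impI)
      fix B assume "B \<in> sets M" "B \<subseteq> space M - N"
      moreover then have "B \<inter> N = {}" by auto
      ultimately show "\<nu> B = 0" by (simp add: \<nu>_def vector_measure_empty[OF vm])
    qed
    then show "singular_vector_measure M \<nu>" using N(1) by (auto simp: singular_vector_measure_def)
    show "absolutely_continuous M (total_variation M (\<lambda>B. \<mu> B - \<nu> B))"
      unfolding absolutely_continuous_def
    proof
      fix A assume A: "A \<in> null_sets M"
      show "A \<in> null_sets (total_variation M (\<lambda>B. \<mu> B - \<nu> B))"
      proof (subst null_sets_total_variation_iff[OF vector_measure_diff[OF vm vn]], use A in auto)
        fix B assume B: "B \<in> sets M" "B \<subseteq> A"
        have "\<mu> ((B \<inter> N) \<union> (B - N)) = \<mu> (B \<inter> N) + \<mu> (B - N)"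
          by (rule vector_measure_Un[OF vm]) (use B sN in auto)
        moreover have "(B \<inter> N) \<union> (B - N) = B" by auto
        moreover have "\<mu> (B - N) = 0"
          proof -
          have "B - N \<in> sets M" "B - N \<subseteq> A - N" "A - N \<in> sets M" using A sN B by auto
          then show ?thesis using N(2)[OF A] null_sets_total_variation_iff[OF vm, of "A - N"] by blast
        qed
        ultimately show "\<mu> B = \<nu> B" using B by (simp add: \<nu>_def)
      qed
    qed
  qed
  then show thesis using that[OF sN] by (simp add: \<nu>_def[abs_def])
qed

lemma singular_part_of_singular:
  fixes \<mu> :: "'a set \<Rightarrow> 'b::euclidean_space"
  assumes vm: "vector_measure M \<mu>" and s: "singular_vector_measure M \<mu>"
  shows "singular_part M \<mu> = \<mu>"
proof (rule singular_part_eqI[OF vm])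
  have "vector_measure M (\<lambda>B. \<mu> B - \<mu> B)" by (rule vector_measure_diff[OF vm vm])
  then have "A \<in> null_sets (total_variation M (\<lambda>B. \<mu> B - \<mu> B))" if "A \<in> sets M" for A
    by (subst null_sets_total_variation_iff) (use that in auto)
  then show "singular_decomposition M \<mu> \<mu>"
    using vm s by (auto simp: singular_decomposition_def absolutely_continuous_def)
qed

text \<open>If the set function is not a measure, \<open>measure_of\<close> assigns 0. The bound is
  applied to \<open>BV_deriv_Cantor\<close>, whose countable additivity is not established
  here.\<close>

lemma emeasure_total_variation_le:
  "emeasure (total_variation M \<mu>) B \<le> variation_fun M \<mu> B"
  unfolding total_variation_alt emeasure_measure_of_conv by simp

text \<open>Taking the singular part and removing the discontinuity set both amount to evaluating
  \<open>BV_deriv\<close> on smaller sets, so a null set of \<open>BV_variation\<close> stays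
  null.\<close>

lemma AE_Cantor_variation:
  assumes vm: "vector_measure (lborel_on \<Omega>) (BV_deriv \<Omega> u)"
    and AE: "AE x in BV_variation \<Omega> u. P x"
  shows "AE x in BV_Cantor_variation \<Omega> u. P x"
proof -
  let ?M = "lborel_on \<Omega>" and ?\<mu> = "BV_deriv \<Omega> u"
  obtain N where N: "N \<in> sets ?M"
    "singular_decomposition ?M ?\<mu> (\<lambda>B. if B \<in> sets ?M then ?\<mu> (B \<inter> N) else 0)"
    by (rule singular_decomposition_exists[OF vm])
  have s: "BV_deriv_singular \<Omega> u = (\<lambda>B. if B \<in> sets ?M then ?\<mu> (B \<inter> N) else 0)"
    unfolding BV_deriv_singular_def by (rule singular_part_eqI[OF vm N(2)])
  obtain A where A': "\<And>x. x \<in> space (BV_variation \<Omega> u) - A \<Longrightarrow> P x" and A1: "A \<in> null_sets (BV_variation \<Omega> u)"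
    by (rule AE_E3[OF AE]) auto
  have A: "A \<in> null_sets (BV_variation \<Omega> u)" "{x\<in>space (BV_variation \<Omega> u). \<not> P x} \<subseteq> A"
    using A' A1 by auto
  have As: "A \<in> sets ?M" using A(1) by (auto simp: BV_variation_def)
  have z: "?\<mu> B = 0" if "B \<in> sets ?M" "B \<subseteq> A" for B
    using A(1) null_sets_total_variation_iff[OF vm As] that by (auto simp: BV_variation_def)
  have "variation_fun ?M (BV_deriv_Cantor \<Omega> u) A \<le> 0"
  proof (rule variation_fun_le)
    fix C :: "nat \<Rightarrow> _" assume C: "range C \<subseteq> sets ?M" "(\<Union>i. C i) = A"
    \<comment> \<open>Should the difference fail to be measurable, the singular part returns its
      default value 0, so the claim holds in either case.\<close>
    have "BV_deriv_Cantor \<Omega> u (C i) = 0" for i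
    proof -
      have "C i - approx_discontinuity_set \<Omega> u \<in> sets ?M \<Longrightarrow> ?\<mu> ((C i - approx_discontinuity_set \<Omega> u) \<inter> N) = 0"
        by (rule z) (use C N in auto)
      then show ?thesis by (simp add: BV_deriv_Cantor_def s)
    qed
    then show "(\<Sum>i. ennreal (norm (BV_deriv_Cantor \<Omega> u (C i)))) \<le> 0" by simp
  qed
  then have "emeasure (BV_Cantor_variation \<Omega> u) A \<le> 0"
    using emeasure_total_variation_le[of ?M "BV_deriv_Cantor \<Omega> u" A] unfolding BV_Cantor_variation_def by simp
  then have "A \<in> null_sets (BV_Cantor_variation \<Omega> u)"
    using As by (auto simp: null_sets_def BV_Cantor_variation_def)
  then show ?thesis
    by (rule AE_I') (use A(2) in \<open>auto simp: BV_Cantor_variation_def BV_variation_def\<close>)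
qed

section \<open>L1 norms by duality with test functions, and integrals of translates\<close>

lemma finite_measure_inner_compact:
  fixes \<tau> :: "'a::{second_countable_topology, complete_space} measure"
  assumes fin: "finite_measure \<tau>" and sets: "sets \<tau> = sets borel" and P: "P \<in> sets borel" and e: "0 < e"
  obtains C where "compact C" "C \<subseteq> P" "measure \<tau> (P - C) < e"
proof -
  interpret finite_measure \<tau> by fact
  have *: "emeasure \<tau> P = (SUP K\<in>{K. K \<subseteq> P \<and> compact K}. emeasure \<tau> K)"
    by (rule inner_regular[OF sets]) (use P in auto)
  have "\<exists>C. compact C \<and> C \<subseteq> P \<and> measure \<tau> P - e < measure \<tau> C"
  proof (cases "measure \<tau> P - e < 0")
    case True
    then show ?thesis by (intro exI[of _ "{}"]) auto
  next
    case False
    have "ennreal (measure \<tau> P - e) < emeasure \<tau> P"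
      using e False by (simp add: emeasure_eq_measure ennreal_less_iff)
    then obtain C where "compact C" "C \<subseteq> P" "ennreal (measure \<tau> P - e) < emeasure \<tau> C"
      unfolding * less_SUP_iff by auto
    then show ?thesis using False by (intro exI[of _ C]) (auto simp: emeasure_eq_measure ennreal_less_iff)
  qed
  then obtain C where C: "compact C" "C \<subseteq> P" "measure \<tau> P - e < measure \<tau> C" by auto
  have "measure \<tau> (P - C) = measure \<tau> P - measure \<tau> C"
    using C P sets by (intro finite_measure_Diff) (auto simp: compact_imp_closed)
  then show thesis using that C by auto
qed

text \<open>The sign of \<open>f\<close> on \<open>U\<close> is approximated by a difference of two
  cut-offs that equals 1 and -1 on compact parts of the positivity and the negativity set. Inner
  regularity of the measure with density \<open>\<bar>f\<bar>\<close> on \<open>U\<close> makes the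
  remainders small.\<close>

lemma L1_norm_le_if_test_le:
  fixes f :: "real^'n \<Rightarrow> real"
  assumes f: "integrable lborel f" and U: "open U"
    and le: "\<And>\<phi>. \<phi> \<in> C1_compact_support U \<Longrightarrow> (\<And>x. \<bar>\<phi> x\<bar> \<le> 1) \<Longrightarrow> (LINT x|lborel. f x * \<phi> x) \<le> A"
  shows "(LINT x:U|lborel. \<bar>f x\<bar>) \<le> A"
proof (rule field_le_epsilon)
  fix e :: real assume e: "0 < e"
  have fm[measurable]: "f \<in> borel_measurable borel" using f by auto
  have Um[measurable]: "U \<in> sets borel" using U by auto
  define g where "g x = indicator U x * \<bar>f x\<bar>" for x
  have gi: "integrable lborel g"
    using integrable_mult_indicator[of U lborel "\<lambda>x. \<bar>f x\<bar>"] f by (simp add: g_def[abs_def])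
  define \<tau> where "\<tau> = density lborel (\<lambda>x. ennreal (g x))"
  have sets: "sets \<tau> = sets borel" by (simp add: \<tau>_def)
  have g0: "0 \<le> g x" for x by (simp add: g_def)
  have fin: "finite_measure \<tau>"
  proof
    have "emeasure \<tau> (space \<tau>) = (\<integral>\<^sup>+x. ennreal (g x) \<partial>lborel)"
      unfolding \<tau>_def using gi by (subst emeasure_density) auto
    also have "\<dots> = ennreal (LINT x|lborel. g x)" by (rule nn_integral_eq_integral[OF gi]) (auto simp: g0)
    finally show "emeasure \<tau> (space \<tau>) \<noteq> \<infinity>" by simp
  qed
  define P where "P = {x\<in>U. 0 < f x}"
  define Q where "Q = {x\<in>U. f x < 0}"
  have PQ: "P \<in> sets borel" "Q \<in> sets borel" unfolding P_def Q_def by measurable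
  \<comment> \<open>Each of the two remainders enters the estimate with a factor 2, so
    \<open>e / 4\<close> for each adds up to \<open>e\<close>.\<close>
  obtain C1 where C1: "compact C1" "C1 \<subseteq> P" "measure \<tau> (P - C1) < e / 4"
    using finite_measure_inner_compact[OF fin sets PQ(1), of "e / 4"] e by auto
  obtain C2 where C2: "compact C2" "C2 \<subseteq> Q" "measure \<tau> (Q - C2) < e / 4"
    using finite_measure_inner_compact[OF fin sets PQ(2), of "e / 4"] e by auto
  have disj: "C1 \<inter> C2 = {}" using C1 C2 by (force simp: P_def Q_def)
  \<comment> \<open>Each cut-off is supported away from the other compact set and does not disturb
    the value prescribed there.\<close>
  have o: "open (U - C2)" "open (U - C1)" using U C1 C2 by (auto intro: open_Diff compact_imp_closed)
  have "C1 \<subseteq> U - C2" "C2 \<subseteq> U - C1" using disj C1 C2 by (auto simp: P_def Q_def)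
  then obtain \<phi> \<psi> where \<phi>: "\<phi> \<in> C1_compact_support (U - C2)" "\<And>x. 0 \<le> \<phi> x" "\<And>x. \<phi> x \<le> 1" "\<And>x. x \<in> C1 \<Longrightarrow> \<phi> x = 1"
    and \<psi>: "\<psi> \<in> C1_compact_support (U - C1)" "\<And>x. 0 \<le> \<psi> x" "\<And>x. \<psi> x \<le> 1" "\<And>x. x \<in> C2 \<Longrightarrow> \<psi> x = 1"
    using cutoff_exists[OF C1(1) o(1)] cutoff_exists[OF C2(1) o(2)] by metis
  define \<zeta> where "\<zeta> x = \<phi> x - \<psi> x" for x
  have \<zeta>C: "\<zeta> \<in> C1_compact_support U"
    unfolding \<zeta>_def[abs_def]
    by (intro C1_compact_support_diff C1_compact_support_mono[OF \<phi>(1)] C1_compact_support_mono[OF \<psi>(1)]) auto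
  have \<zeta>1: "\<bar>\<zeta> x\<bar> \<le> 1" for x using \<phi>(2,3)[of x] \<psi>(2,3)[of x] by (simp add: \<zeta>_def)
  have \<phi>0: "\<phi> x = 0" if "x \<notin> U - C2" for x using C1_compact_supportD(6)[OF \<phi>(1)] that by blast
  have \<psi>0: "\<psi> x = 0" if "x \<notin> U - C1" for x using C1_compact_supportD(6)[OF \<psi>(1)] that by blast
  have [measurable]: "\<zeta> \<in> borel_measurable borel" by (rule C1_compact_supportD(4)[OF \<zeta>C])
  have i1: "integrable lborel (\<lambda>x. f x * \<zeta> x)"
    by (rule Bochner_Integration.integrable_bound[OF f]) (use \<zeta>1 in \<open>auto intro!: AE_I2 mult_left_le simp: abs_mult\<close>)
  have Cm: "P - C1 \<in> sets borel" "Q - C2 \<in> sets borel" using PQ C1 C2 by (auto simp: compact_imp_closed)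
  have mt: "measure \<tau> X = (LINT x:X|lborel. g x)" "set_integrable lborel X g" if "X \<in> sets borel" for X
    using that finite_measure_density_measure[OF gi, of X] gi g0
    by (auto simp: \<tau>_def intro: integrable_imp_set_integrable)
  have i2: "integrable lborel (\<lambda>x. 2 * (indicator (P - C1) x * g x) + 2 * (indicator (Q - C2) x * g x))"
    using mt(2)[OF Cm(1)] mt(2)[OF Cm(2)] unfolding set_integrable_def by auto
  have rhs0: "0 \<le> 2 * (indicator (P - C1) x * g x) + 2 * (indicator (Q - C2) x * g x)" for x
    using g0[of x] by (intro add_nonneg_nonneg mult_nonneg_nonneg) auto
  have "(LINT x|lborel. g x - f x * \<zeta> x) \<le> (LINT x|lborel. 2 * (indicator (P - C1) x * g x) + 2 * (indicator (Q - C2) x * g x))"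
  proof (rule integral_mono)
    fix x
    consider "x \<in> C1" | "x \<in> C2" | "x \<in> P - C1" | "x \<in> Q - C2" | "x \<notin> U" | "f x = 0"
      using C1 C2 by (auto simp: P_def Q_def) force
    then show "g x - f x * \<zeta> x \<le> 2 * (indicator (P - C1) x * g x) + 2 * (indicator (Q - C2) x * g x)"
    proof cases
      case 1
      then have "\<zeta> x = 1" using \<phi>(4) \<psi>0 by (simp add: \<zeta>_def)
      moreover have "x \<in> P" using 1 C1 by auto
      then have "g x = f x" by (simp add: g_def P_def)
      ultimately have "g x - f x * \<zeta> x = 0" by simp
      then show ?thesis using rhs0[of x] by linarith
    next
      case 2
      then have "\<zeta> x = - 1" using \<psi>(4) \<phi>0 by (simp add: \<zeta>_def)
      moreover have "x \<in> Q" using 2 C2 by auto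
      then have "g x = - f x" by (simp add: g_def Q_def)
      ultimately have "g x - f x * \<zeta> x = 0" by simp
      then show ?thesis using rhs0[of x] by linarith
    next
      case 3
      have "g x - f x * \<zeta> x \<le> 2 * g x"
        using 3 \<zeta>1[of x] mult_left_mono[of "- \<zeta> x" 1 "f x"] by (simp add: g_def P_def)
      moreover have "0 \<le> indicator (Q - C2) x * g x" "indicator (P - C1) x * g x = g x" using 3 g0[of x] by auto
      ultimately show ?thesis by linarith
    next
      case 4
      have "g x - f x * \<zeta> x \<le> 2 * g x"
        using 4 \<zeta>1[of x] mult_left_mono[of "\<zeta> x" 1 "- f x"] by (simp add: g_def Q_def)
      moreover have "0 \<le> indicator (P - C1) x * g x" "indicator (Q - C2) x * g x = g x" using 4 g0[of x] by auto
      ultimately show ?thesis by linarith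
    next
      case 5
      then have "\<zeta> x = 0" using \<phi>0 \<psi>0 by (simp add: \<zeta>_def)
      then have "g x - f x * \<zeta> x = 0" using 5 by (simp add: g_def)
      then show ?thesis using rhs0[of x] by linarith
    next
      case 6
      then have "g x - f x * \<zeta> x = 0" by (simp add: g_def)
      then show ?thesis using rhs0[of x] by linarith
    qed
  qed (use i1 i2 gi in auto)
  also have "\<dots> = 2 * measure \<tau> (P - C1) + 2 * measure \<tau> (Q - C2)"
    using mt[OF Cm(1)] mt[OF Cm(2)] by (simp add: set_lebesgue_integral_def set_integrable_def)
  also have "\<dots> \<le> e" using C1 C2 by simp
  also have "(LINT x|lborel. g x - f x * \<zeta> x) = (LINT x:U|lborel. \<bar>f x\<bar>) - (LINT x|lborel. f x * \<zeta> x)"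
    using gi i1 by (simp add: g_def[abs_def] set_lebesgue_integral_def)
  finally show "(LINT x:U|lborel. \<bar>f x\<bar>) \<le> A + e" using le[OF \<zeta>C \<zeta>1] by simp
qed

text \<open>Differentiation under the integral sign: \<open>\<phi>\<close> is globally Lipschitz, so
  all difference quotients are dominated by \<open>\<bar>w\<bar>\<close> times a constant.\<close>

lemma has_derivative_translated_integral:
  fixes \<phi> w :: "real^'n \<Rightarrow> real"
  assumes w: "integrable lebesgue w" and \<phi>: "\<phi> \<in> C1_compact_support UNIV"
  shows "((\<lambda>t. LINT x|lebesgue. w x * \<phi> (x - t *\<^sub>R h)) has_real_derivative
     - (LINT x|lebesgue. w x * (grad \<phi> (x - t *\<^sub>R h) \<bullet> h))) (at t within S)"
  unfolding has_field_derivative_iff tendsto_at_iff_sequentially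
proof (intro allI impI)
  note D = C1_compact_supportD[OF \<phi>]
  obtain B where B: "B \<ge> 0" "\<And>x. \<bar>\<phi> x\<bar> \<le> B" using D(7) by auto
  obtain L where L: "L \<ge> 0" "\<And>x y. \<bar>\<phi> x - \<phi> y\<bar> \<le> L * norm (x - y)" using C1_compact_support_Lipschitz[OF \<phi>] by auto
  have wm[measurable]: "w \<in> borel_measurable lebesgue" using w by auto
  have bl: "f \<in> borel_measurable lebesgue" if "f \<in> borel_measurable borel" for f :: "real^'n \<Rightarrow> real"
    using that by (intro measurable_completion) auto
  have pm[measurable]: "(\<lambda>x. \<phi> (x - s *\<^sub>R h)) \<in> borel_measurable lebesgue" for s
    by (rule bl, rule measurable_compose[OF _ D(4)]) measurable
  have gm[measurable]: "(\<lambda>x. grad \<phi> (x - s *\<^sub>R h) \<bullet> h) \<in> borel_measurable lebesgue" for s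
  proof (rule bl)
    have "(\<lambda>x. grad \<phi> (x - s *\<^sub>R h)) \<in> borel_measurable borel"
      by (rule measurable_compose[OF _ D(5)]) measurable
    then show "(\<lambda>x. grad \<phi> (x - s *\<^sub>R h) \<bullet> h) \<in> borel_measurable borel" by simp
  qed
  have int: "integrable lebesgue (\<lambda>x. w x * \<phi> (x - s *\<^sub>R h))" for s
    by (rule Bochner_Integration.integrable_bound[of _ "\<lambda>x. w x * B"])
       (use w B in \<open>auto intro!: AE_I2 mult_left_mono simp: abs_mult\<close>)
  fix X assume X: "\<forall>i::nat. X i \<in> S - {t}" "X \<longlonglongrightarrow> t"
  have eq: "((\<lambda>y. ((LINT x|lebesgue. w x * \<phi> (x - y *\<^sub>R h)) - (LINT x|lebesgue. w x * \<phi> (x - t *\<^sub>R h))) / (y - t)) \<circ> X)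
     = (\<lambda>i. LINT x|lebesgue. w x * ((\<phi> (x - X i *\<^sub>R h) - \<phi> (x - t *\<^sub>R h)) / (X i - t)))"
  proof
    fix i
    have "(LINT x|lebesgue. w x * ((\<phi> (x - X i *\<^sub>R h) - \<phi> (x - t *\<^sub>R h)) / (X i - t)))
      = (LINT x|lebesgue. (w x * \<phi> (x - X i *\<^sub>R h) - w x * \<phi> (x - t *\<^sub>R h)) / (X i - t))"
      by (rule Bochner_Integration.integral_cong) (auto simp: right_diff_distrib)
    also have "\<dots> = ((LINT x|lebesgue. w x * \<phi> (x - X i *\<^sub>R h)) - (LINT x|lebesgue. w x * \<phi> (x - t *\<^sub>R h))) / (X i - t)"
      by (simp only: integral_divide_zero Bochner_Integration.integral_diff[OF int int])
    finally show "((\<lambda>y. ((LINT x|lebesgue. w x * \<phi> (x - y *\<^sub>R h)) - (LINT x|lebesgue. w x * \<phi> (x - t *\<^sub>R h))) / (y - t)) \<circ> X) i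
     = (LINT x|lebesgue. w x * ((\<phi> (x - X i *\<^sub>R h) - \<phi> (x - t *\<^sub>R h)) / (X i - t)))" by (simp only: o_def)
  qed
  have "(\<lambda>i. LINT x|lebesgue. w x * ((\<phi> (x - X i *\<^sub>R h) - \<phi> (x - t *\<^sub>R h)) / (X i - t)))
     \<longlonglongrightarrow> (LINT x|lebesgue. w x * (- (grad \<phi> (x - t *\<^sub>R h) \<bullet> h)))"
  proof (rule integral_dominated_convergence[where w="\<lambda>x. \<bar>w x\<bar> * (L * norm h)"])
    show "integrable lebesgue (\<lambda>x. \<bar>w x\<bar> * (L * norm h))" using w by simp
    show "AE x in lebesgue. norm (w x * ((\<phi> (x - X i *\<^sub>R h) - \<phi> (x - t *\<^sub>R h)) / (X i - t))) \<le> \<bar>w x\<bar> * (L * norm h)" for i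
    proof (rule AE_I2)
      fix x
      have "\<bar>\<phi> (x - X i *\<^sub>R h) - \<phi> (x - t *\<^sub>R h)\<bar> \<le> L * norm ((t - X i) *\<^sub>R h)"
        using L(2)[of "x - X i *\<^sub>R h" "x - t *\<^sub>R h"] by (simp add: algebra_simps)
      then have "\<bar>\<phi> (x - X i *\<^sub>R h) - \<phi> (x - t *\<^sub>R h)\<bar> / \<bar>X i - t\<bar> \<le> L * norm h"
        using X(1) by (subst pos_divide_le_eq) (auto simp: mult.commute mult.left_commute abs_minus_commute)
      from mult_left_mono[OF this abs_ge_zero[of "w x"]]
      show "norm (w x * ((\<phi> (x - X i *\<^sub>R h) - \<phi> (x - t *\<^sub>R h)) / (X i - t))) \<le> \<bar>w x\<bar> * (L * norm h)"
        by (simp add: abs_mult)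
    qed
    show "AE x in lebesgue. (\<lambda>i. w x * ((\<phi> (x - X i *\<^sub>R h) - \<phi> (x - t *\<^sub>R h)) / (X i - t)))
       \<longlonglongrightarrow> w x * (- (grad \<phi> (x - t *\<^sub>R h) \<bullet> h))"
    proof (intro AE_I2 tendsto_mult tendsto_const)
      fix x
      have "((\<lambda>s. x - s *\<^sub>R h) has_derivative (\<lambda>s. - (s *\<^sub>R h))) (at t)"
        by (auto intro!: derivative_eq_intros)
      from has_derivative_compose[OF this D(1)]
      have "((\<lambda>s. \<phi> (x - s *\<^sub>R h)) has_real_derivative - (grad \<phi> (x - t *\<^sub>R h) \<bullet> h)) (at t)"
        unfolding has_field_derivative_def by (rule has_derivative_eq_rhs) (auto simp: algebra_simps)
      then have "((\<lambda>s. (\<phi> (x - s *\<^sub>R h) - \<phi> (x - t *\<^sub>R h)) / (s - t)) \<longlongrightarrow> - (grad \<phi> (x - t *\<^sub>R h) \<bullet> h)) (at t)"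
        by (simp add: has_field_derivative_iff)
      then show "(\<lambda>i. (\<phi> (x - X i *\<^sub>R h) - \<phi> (x - t *\<^sub>R h)) / (X i - t)) \<longlonglongrightarrow> - (grad \<phi> (x - t *\<^sub>R h) \<bullet> h)"
        unfolding tendsto_at_iff_sequentially using X by (auto simp: o_def)
    qed
  qed measurable
  then show "((\<lambda>y. ((LINT x|lebesgue. w x * \<phi> (x - y *\<^sub>R h)) - (LINT x|lebesgue. w x * \<phi> (x - t *\<^sub>R h))) / (y - t)) \<circ> X)
     \<longlonglongrightarrow> - (LINT x|lebesgue. w x * (grad \<phi> (x - t *\<^sub>R h) \<bullet> h))"
    unfolding eq by simp
qed

lemma lborel_integral_translate:
  fixes f :: "'a::euclidean_space \<Rightarrow> real"
  assumes "f \<in> borel_measurable borel"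
  shows "(LINT x|lborel. f (x - a)) = (LINT x|lborel. f x)"
proof -
  have "(LINT x|lborel. f x) = (LINT x|distr lborel borel ((+) (- a)). f x)" by (simp add: lborel_distr_plus)
  also have "\<dots> = (LINT x|lborel. f (- a + x))" by (rule integral_distr) (use assms in auto)
  finally show ?thesis by simp
qed

text \<open>By translation invariance the integral of \<open>\<phi> (x - t *\<^sub>R h)\<close> does
  not depend on \<open>t\<close>, so its derivative at 0 vanishes.\<close>

lemma integral_grad_eq_0:
  fixes \<phi> :: "real^'n \<Rightarrow> real"
  assumes \<phi>: "\<phi> \<in> C1_compact_support UNIV"
  shows "(LINT x|lebesgue. grad \<phi> x \<bullet> h) = 0"
proof -
  note D = C1_compact_supportD[OF \<phi>]
  obtain C where C: "compact C" "\<And>x. x \<notin> C \<Longrightarrow> \<phi> x = 0 \<and> grad \<phi> x = 0" using D(6) by auto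
  obtain R where R: "R > 0" "\<And>x. x \<in> C \<Longrightarrow> norm x \<le> R" using compact_imp_bounded[OF C(1)] bounded_pos by metis
  \<comment> \<open>The derivative lemma asks for an integrable weight, which the constant 1 is not.
    This indicator equals 1 wherever a translate with \<open>\<bar>t\<bar> < 1\<close> is
    nonzero.\<close>
  define w :: "real^'n \<Rightarrow> real" where "w = indicator (cball 0 (R + norm h))"
  have w: "integrable lebesgue w" unfolding w_def
    using lmeasurable_iff_integrable lmeasurable_cball by blast
  have wg: "w x * (grad \<phi> x \<bullet> h) = grad \<phi> x \<bullet> h" for x
    using R(2)[of x] C(2)[of x] norm_ge_zero[of h] by (cases "x \<in> C") (auto simp: w_def indicator_def simp del: norm_ge_zero)
  have w\<phi>: "w x * \<phi> (x - t *\<^sub>R h) = \<phi> (x - t *\<^sub>R h)" if "t \<in> {-1<..<1}" for x t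
  proof (cases "x - t *\<^sub>R h \<in> C")
    case True
    have "norm x \<le> norm (x - t *\<^sub>R h) + norm (t *\<^sub>R h)" using norm_triangle_ineq[of "x - t *\<^sub>R h" "t *\<^sub>R h"] by simp
    also have "\<dots> \<le> R + 1 * norm h"
      using that mult_right_mono[of "\<bar>t\<bar>" 1 "norm h"] by (intro add_mono R True) auto
    finally show ?thesis by (simp add: w_def)
  qed (simp add: C(2))
  have const: "(LINT x|lebesgue. w x * \<phi> (x - t *\<^sub>R h)) = (LINT x|lborel. \<phi> x)" if t: "t \<in> {-1<..<1}" for t
  proof -
    have m: "(\<lambda>x. \<phi> (x - t *\<^sub>R h)) \<in> borel_measurable lborel"
      using measurable_compose[of "\<lambda>x. x - t *\<^sub>R h" borel borel, OF _ D(4)] by simp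
    show ?thesis unfolding w\<phi>[OF t] integral_completion[OF m] by (rule lborel_integral_translate[OF D(4)])
  qed
  have "((\<lambda>t. LINT x|lebesgue. w x * \<phi> (x - t *\<^sub>R h)) has_real_derivative
     - (LINT x|lebesgue. grad \<phi> x \<bullet> h)) (at 0)"
    using has_derivative_translated_integral[OF w \<phi>, of h 0 UNIV] by (simp add: wg)
  then have "((\<lambda>t::real. LINT x|lborel. \<phi> x) has_real_derivative - (LINT x|lebesgue. grad \<phi> x \<bullet> h)) (at 0)"
    by (rule has_field_derivative_transform_within_open[where S="{-1<..<1}"]) (auto simp: wg const)
  moreover have "((\<lambda>t::real. LINT x|lborel. \<phi> x) has_real_derivative 0) (at 0)" by simp
  ultimately have "- (LINT x|lebesgue. grad \<phi> x \<bullet> h) = 0" by (rule DERIV_unique)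
  then show ?thesis by simp
qed

section \<open>Distributional derivatives through densities\<close>

text \<open>The measure \<open>\<tau>\<close> lives on the whole space; what it does outside \<open>U\<close> is irrelevant.\<close>

definition weak_deriv ::
    "(real^'n) set \<Rightarrow> (real^'n \<Rightarrow> real^'m) \<Rightarrow> (real^'n) measure \<Rightarrow> (real^'n \<Rightarrow> real^'n^'m) \<Rightarrow> bool" where
  "weak_deriv U w \<tau> F \<longleftrightarrow> finite_measure \<tau> \<and> sets \<tau> = sets borel \<and> integrable \<tau> F \<and>
     (\<forall>\<phi>\<in>C1_compact_support U. \<forall>i j.
        (LINT x|lebesgue_on U. w x $ i * partial_deriv j \<phi> x) = - (LINT x|\<tau>. \<phi> x * F x $ i $ j))"

lemma bounded_linear_entry: "bounded_linear (\<lambda>A :: real^'n^'m. A $ i $ j)"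
  by (rule bounded_linear_compose[OF bounded_linear_vec_nth bounded_linear_vec_nth])

lemma integrable_entry: "integrable M (F :: _ \<Rightarrow> real^'n^'m) \<Longrightarrow> integrable M (\<lambda>x. F x $ i $ j)"
  by (rule integrable_bounded_linear[OF bounded_linear_entry])

lemma set_integral_entry:
  fixes F :: "_ \<Rightarrow> real^'n^'m"
  assumes "integrable M F" "B \<in> sets M"
  shows "(LINT x:B|M. F x) $ i $ j = (LINT x:B|M. F x $ i $ j)"
  unfolding set_lebesgue_integral_def
  using integral_bounded_linear[OF bounded_linear_entry[of i j] integrable_mult_indicator[OF assms(2,1)]]
  by (simp only: vector_scaleR_component)

lemma sets_lborel_on_iff:
  "U \<in> sets borel \<Longrightarrow> B \<in> sets (lborel_on U) \<longleftrightarrow> B \<in> sets borel \<and> B \<subseteq> U"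
  by (subst sets_restrict_space_iff) auto

lemma test_function_lborel_on:
  assumes "\<phi> \<in> C1_compact_support U"
  shows "\<phi> \<in> borel_measurable (lborel_on U)" "\<exists>C. \<forall>x. \<bar>\<phi> x\<bar> \<le> C"
  using C1_compact_supportD(4,7)[OF assms] by (auto intro: measurable_restrict_space1)

lemma signed_integral_entry_density:
  fixes F :: "real^'n \<Rightarrow> real^'n^'m"
  assumes fin: "finite_measure T" and F: "integrable T F" and sets: "sets T = sets (lborel_on U)"
    and vm: "vector_measure (lborel_on U) \<mu>"
    and \<mu>: "\<And>B. B \<in> sets (lborel_on U) \<Longrightarrow> \<mu> B = (LINT x:B|T. F x)"
    and \<phi>: "\<phi> \<in> C1_compact_support U"
  shows "signed_integral (lborel_on U) (\<lambda>B. \<mu> B $ i $ j) \<phi> = (LINT x|T. \<phi> x * F x $ i $ j)"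
proof -
  from test_function_lborel_on(2)[OF \<phi>] obtain C where "\<forall>x. \<bar>\<phi> x\<bar> \<le> C" ..
  then have C: "\<bar>\<phi> x\<bar> \<le> C" for x by simp
  show ?thesis
  proof (rule signed_integral_density[OF fin integrable_entry[OF F] sets _ _ test_function_lborel_on(1)[OF \<phi>] C])
    show "\<mu> B $ i $ j = (LINT x:B|T. F x $ i $ j)" if "B \<in> sets (lborel_on U)" for B
      using \<mu>[OF that] set_integral_entry[OF F, of B] that sets by simp
    show "vector_measure (lborel_on U) (\<lambda>B. \<mu> B $ i $ j)"
      by (rule vector_measure_bounded_linear[OF vm bounded_linear_entry])
  qed
qed

text \<open>Passage from set functions on \<open>U\<close> to a density over a Borel measure on the
  whole space: the total variation is pushed forward by the identity and its polar density is
  extended by zero.\<close>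

lemma is_distr_deriv_imp_weak_deriv:
  fixes \<mu> :: "(real^'n) set \<Rightarrow> real^'n^'m" and U :: "(real^'n) set" and w :: "real^'n \<Rightarrow> real^'m"
  defines "f \<equiv> polar_density (lborel_on U) \<mu>"
  defines "T \<equiv> total_variation (lborel_on U) \<mu>"
  assumes d: "is_distr_deriv U w \<mu>" and U: "open U"
  defines "\<tau> \<equiv> distr (T) borel (\<lambda>x. x)" and "F \<equiv> \<lambda>x. indicator U x *\<^sub>R f x"
  shows "weak_deriv U w \<tau> F" and "sets \<tau> = sets borel" and "finite_measure \<tau>"
    and "\<And>B. B \<in> sets borel \<Longrightarrow> measure \<tau> B = measure (T) (B \<inter> U)"
    and "\<And>B. B \<in> sets borel \<Longrightarrow> B \<subseteq> U \<Longrightarrow> \<mu> B = (LINT x:B|\<tau>. F x)"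
    and "AE x in \<tau>. x \<in> U \<and> norm (F x) = 1"
proof -
  let ?T = "T" and ?f = "f"
  have vm: "vector_measure (lborel_on U) \<mu>" using d by (simp add: is_distr_deriv_def)
  note P = polar_density_properties[OF vm, folded T_def f_def]
  have Ub: "U \<in> sets borel" using U by simp
  have Ts: "sets ?T = sets (lborel_on U)" "space ?T = U" by (auto simp: T_def space_restrict_space)
  have Tfin: "finite_measure ?T" unfolding T_def by (rule finite_measure_total_variation[OF vm])
  have id: "(\<lambda>x. x) \<in> measurable ?T borel"
    unfolding measurable_cong_sets[OF Ts(1) refl] by (rule measurable_restrict_space1) auto
  show s: "sets \<tau> = sets borel" by (simp add: \<tau>_def)
  show fin: "finite_measure \<tau>" unfolding \<tau>_def by (rule finite_measure.finite_measure_distr[OF Tfin id])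
  have fm: "?f \<in> borel_measurable (lborel_on U)"
    using P(1) Ts by (auto dest!: borel_measurable_integrable cong: measurable_cong_sets)
  have Fm: "F \<in> borel_measurable borel"
    using fm borel_measurable_restrict_space_iff[of U lborel ?f] Ub by (simp add: F_def)
  have Ff: "F x = ?f x" if "x \<in> space ?T" for x using that Ts by (simp add: F_def)
  have "integrable ?T F" using P(1) by (subst Bochner_Integration.integrable_cong[OF refl Ff]) auto
  then have Fi: "integrable \<tau> F" unfolding \<tau>_def using id Fm by (subst integrable_distr_eq) auto
  have "(\<lambda>x. x) -` B \<inter> space ?T = B \<inter> U" for B using Ts by auto
  then show "measure \<tau> B = measure ?T (B \<inter> U)" if "B \<in> sets borel" for B
    unfolding \<tau>_def using measure_distr[OF id that] by simp
  show \<mu>F: "\<mu> B = (LINT x:B|\<tau>. F x)" if B: "B \<in> sets borel" "B \<subseteq> U" for B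
  proof -
    have "(LINT x:B|\<tau>. F x) = (LINT x|?T. indicator B x *\<^sub>R F x)"
      unfolding set_lebesgue_integral_def \<tau>_def by (rule integral_distr[OF id]) (use B Fm in auto)
    also have "\<dots> = (LINT x:B|?T. ?f x)"
      unfolding set_lebesgue_integral_def by (rule Bochner_Integration.integral_cong) (auto simp: Ff)
    finally show ?thesis using P(2)[of B] B sets_lborel_on_iff[OF Ub] by simp
  qed
  show "AE x in \<tau>. x \<in> U \<and> norm (F x) = 1"
    unfolding \<tau>_def
  proof (subst AE_distr_iff[OF id])
    have "{x \<in> space borel. x \<in> U \<and> norm (F x) = 1} = U \<inter> {x. norm (F x) = 1}" by auto
    then show "{x \<in> space borel. x \<in> U \<and> norm (F x) = 1} \<in> sets borel"
      using Ub Fm by simp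
    show "AE x in ?T. x \<in> U \<and> norm (F x) = 1"
      using P(3) AE_space by eventually_elim (use Ff Ts in auto)
  qed
  have "(LINT x|lebesgue_on U. w x $ i * partial_deriv j \<phi> x) = - (LINT x|\<tau>. \<phi> x * F x $ i $ j)"
    if \<phi>: "\<phi> \<in> C1_compact_support U" for \<phi> i j
  proof -
    have "(LINT x|\<tau>. \<phi> x * F x $ i $ j) = (LINT x|?T. \<phi> x * F x $ i $ j)"
    proof (unfold \<tau>_def, rule integral_distr[OF id])
      have "(\<lambda>x. F x $ i $ j) \<in> borel_measurable borel"
        by (rule measurable_compose[OF Fm borel_measurable_continuous_onI[OF bounded_linear.continuous_on[OF bounded_linear_entry continuous_on_id]]])
      then show "(\<lambda>x. \<phi> x * F x $ i $ j) \<in> borel_measurable borel"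
        using C1_compact_supportD(4)[OF \<phi>] by simp
    qed
    also have "\<dots> = (LINT x|?T. \<phi> x * ?f x $ i $ j)"
      by (rule Bochner_Integration.integral_cong) (auto simp: Ff)
    also have "\<dots> = signed_integral (lborel_on U) (\<lambda>B. \<mu> B $ i $ j) \<phi>"
      by (rule signed_integral_entry_density[OF Tfin P(1) Ts(1) vm P(2) \<phi>, symmetric])
    finally show ?thesis using d \<phi> by (simp add: is_distr_deriv_def)
  qed
  then show "weak_deriv U w \<tau> F" unfolding weak_deriv_def using fin s Fi by blast
qed

lemma weak_deriv_unique:
  fixes w :: "real^'n \<Rightarrow> real^'m"
  assumes "weak_deriv U w \<sigma> F" "weak_deriv U w \<tau> G" "open U" "B \<in> sets borel" "B \<subseteq> U"
  shows "(LINT x:B|\<sigma>. F x) = (LINT x:B|\<tau>. G x)"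
proof -
  have *: "sets \<sigma> = sets borel" "sets \<tau> = sets borel" "integrable \<sigma> F" "integrable \<tau> G"
    using assms(1,2) by (auto simp: weak_deriv_def)
  have "(LINT x:B \<inter> U|\<sigma>. F x $ i $ j) = (LINT x:B \<inter> U|\<tau>. G x $ i $ j)" for i j
  proof (rule set_integral_eq_if_test_eq[OF assms(3) *(1,2) integrable_entry[OF *(3)] integrable_entry[OF *(4)] _ assms(4)])
    fix \<phi> assume \<phi>: "\<phi> \<in> C1_compact_support U"
    have "(LINT x|lebesgue_on U. w x $ i * partial_deriv j \<phi> x) = - (LINT x|\<sigma>. \<phi> x * F x $ i $ j)"
      "(LINT x|lebesgue_on U. w x $ i * partial_deriv j \<phi> x) = - (LINT x|\<tau>. \<phi> x * G x $ i $ j)"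
      using assms(1,2) \<phi> unfolding weak_deriv_def by blast+
    then show "(LINT x|\<sigma>. \<phi> x * F x $ i $ j) = (LINT x|\<tau>. \<phi> x * G x $ i $ j)" by simp
  qed
  moreover have "B \<inter> U = B" using assms(5) by auto
  ultimately show ?thesis
    using set_integral_entry[OF *(3), of B] set_integral_entry[OF *(4), of B] * assms(4)
    by (simp add: vec_eq_iff)
qed

text \<open>Justifies the \<open>THE\<close> in \<open>BV_deriv\<close>: two derivatives agree on
  measurable sets by \<open>weak_deriv_unique\<close>, and elsewhere both are 0 by the convention in
  \<open>vector_measure\<close>.\<close>

lemma BV_deriv_eqI:
  fixes w :: "real^'n \<Rightarrow> real^'m"
  assumes "is_distr_deriv U w \<mu>" "open U"
  shows "BV_deriv U w = \<mu>"
  unfolding BV_deriv_def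
proof (rule the_equality)
  fix \<nu> :: "(real^'n) set \<Rightarrow> real^'n^'m" assume \<nu>: "is_distr_deriv U w \<nu>"
  show "\<nu> = \<mu>"
  proof
    fix B
    show "\<nu> B = \<mu> B"
    proof (cases "B \<in> sets (lborel_on U)")
      case True
      then have B: "B \<in> sets borel" "B \<subseteq> U" using sets_lborel_on_iff[of U B] assms(2) by auto
      show ?thesis
        unfolding is_distr_deriv_imp_weak_deriv(5)[OF \<nu> assms(2) B] is_distr_deriv_imp_weak_deriv(5)[OF assms B]
        by (rule weak_deriv_unique[OF is_distr_deriv_imp_weak_deriv(1)[OF \<nu> assms(2)]
              is_distr_deriv_imp_weak_deriv(1)[OF assms] assms(2) B])
    next
      case False
      then show ?thesis using assms(1) \<nu> by (auto simp: is_distr_deriv_def vector_measure_def)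
    qed
  qed
qed (rule assms(1))

lemma BV_deriv_is_distr_deriv:
  assumes "w \<in> BV U" "open U"
  shows "is_distr_deriv U w (BV_deriv U w)"
  using assms BV_deriv_eqI[of U w] by (auto simp: BV_def)

lemma set_integral_restrict_space:
  fixes f :: "_ \<Rightarrow> 'b::{banach, second_countable_topology}"
  assumes "U \<in> sets M" "B \<subseteq> U"
  shows "(LINT x:B|restrict_space M U. f x) = (LINT x:B|M. f x)"
proof -
  have "(LINT x:B|restrict_space M U. f x) = (LINT x|M. indicator U x *\<^sub>R (indicator B x *\<^sub>R f x))"
    unfolding set_lebesgue_integral_def by (rule integral_restrict_space) (use assms in auto)
  also have "\<dots> = (LINT x:B|M. f x)"
    unfolding set_lebesgue_integral_def
    by (rule Bochner_Integration.integral_cong) (use assms in \<open>auto simp: indicator_def\<close>)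
  finally show ?thesis .
qed

text \<open>The way back to the defined notions, used for blow-ups and for linear maps. Here
  \<open>F\<close> need not have norm one, so the variation is the integral of its norm.\<close>

lemma weak_deriv_imp_BV:
  fixes w :: "real^'n \<Rightarrow> real^'m"
  assumes w: "weak_deriv U w \<tau> F" "integrable (lebesgue_on U) w" and U: "open U"
  shows "w \<in> BV U"
    and "measure (BV_variation U w) U = (LINT x:U|\<tau>. norm (F x))"
    and "B \<in> sets borel \<Longrightarrow> B \<subseteq> U \<Longrightarrow> BV_deriv U w B = (LINT x:B|\<tau>. F x)"
proof -
  have t: "finite_measure \<tau>" "sets \<tau> = sets borel" "integrable \<tau> F"
    and test: "\<And>\<phi> i j. \<phi> \<in> C1_compact_support U \<Longrightarrow>
      (LINT x|lebesgue_on U. w x $ i * partial_deriv j \<phi> x) = - (LINT x|\<tau>. \<phi> x * F x $ i $ j)"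
    using w(1) by (auto simp: weak_deriv_def)
  have Ub: "U \<in> sets borel" using U by simp
  have U\<tau>: "U \<in> sets \<tau>" using Ub t by simp
  define R where "R = restrict_space \<tau> U"
  have Rs: "sets R = sets (lborel_on U)"
    unfolding R_def by (rule sets_restrict_space_cong) (simp add: t)
  have Rfin: "finite_measure R"
    unfolding R_def by (rule finite_measure_restrict_space[OF t(1)]) (use U\<tau> in auto)
  have RF: "integrable R F"
    unfolding R_def using integrable_mult_indicator[OF U\<tau> t(3)] U\<tau>
    by (subst integrable_restrict_space) auto
  define \<mu> where "\<mu> B = (if B \<in> sets (lborel_on U) then LINT x:B|R. F x else 0)" for B
  have vm: "vector_measure (lborel_on U) \<mu>"
    unfolding \<mu>_def[abs_def] by (rule vector_measure_density[OF RF Rs])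
  have d: "is_distr_deriv U w \<mu>"
    unfolding is_distr_deriv_def
  proof (intro conjI vm ballI allI)
    fix \<phi> i j assume \<phi>: "\<phi> \<in> C1_compact_support U"
    have "signed_integral (lborel_on U) (\<lambda>B. \<mu> B $ i $ j) \<phi> = (LINT x|R. \<phi> x * F x $ i $ j)"
      by (rule signed_integral_entry_density[OF Rfin RF Rs vm _ \<phi>]) (simp add: \<mu>_def)
    also have "\<dots> = (LINT x|\<tau>. indicator U x *\<^sub>R (\<phi> x * F x $ i $ j))"
      unfolding R_def by (rule integral_restrict_space) (use U\<tau> in auto)
    also have "\<dots> = (LINT x|\<tau>. \<phi> x * F x $ i $ j)"
      using C1_compact_supportD(6)[OF \<phi>]
      by (intro Bochner_Integration.integral_cong refl) (auto simp: indicator_def)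
    finally show "(LINT x|lebesgue_on U. w x $ i * partial_deriv j \<phi> x) =
        - signed_integral (lborel_on U) (\<lambda>B. \<mu> B $ i $ j) \<phi>" using test[OF \<phi>] by simp
  qed
  then show "w \<in> BV U" using w(2) by (auto simp: BV_def)
  have D: "BV_deriv U w = \<mu>" by (rule BV_deriv_eqI[OF d U])
  show "BV_deriv U w B = (LINT x:B|\<tau>. F x)" if "B \<in> sets borel" "B \<subseteq> U"
    using that sets_lborel_on_iff[OF Ub] set_integral_restrict_space[OF U\<tau> that(2), of F]
    by (simp add: D \<mu>_def R_def)
  have "BV_variation U w = density R (\<lambda>x. ennreal (norm (F x)))"
    unfolding BV_variation_def D
    by (rule total_variation_density[OF Rfin RF Rs _ vm]) (simp add: \<mu>_def)
  then have "measure (BV_variation U w) U = (LINT x:U|R. norm (F x))"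
    using RF Rs sets_lborel_on_iff[OF Ub, of U] Ub by (simp add: finite_measure_density_measure)
  also have "\<dots> = (LINT x:U|\<tau>. norm (F x))"
    unfolding R_def by (rule set_integral_restrict_space[OF U\<tau>]) simp
  finally show "measure (BV_variation U w) U = (LINT x:U|\<tau>. norm (F x))" .
qed

section \<open>The Poincare inequality on convex bodies\<close>

lemma borel_measurable_lebesgueI_borel:
  "f \<in> borel_measurable borel \<Longrightarrow> f \<in> borel_measurable lebesgue"
  by (rule measurable_completion) simp

lemma lebesgue_on_open:
  fixes f :: "'a::euclidean_space \<Rightarrow> 'b::{banach, second_countable_topology}"
  assumes "open U"
  shows "(LINT x|lebesgue_on U. f x) = (LINT x|lebesgue. indicator U x *\<^sub>R f x)"
    and "integrable (lebesgue_on U) f \<longleftrightarrow> integrable lebesgue (\<lambda>x. indicator U x *\<^sub>R f x)"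
  by (rule integral_restrict_space, use assms in simp) (rule integrable_restrict_space, use assms in simp)

text \<open>Translations and Fubini are carried out over \<open>lborel\<close>, which calls for
  Borel representatives that vanish outside \<open>U\<close>.\<close>

lemma lebesgue_on_borel_representative:
  fixes f :: "'a::euclidean_space \<Rightarrow> real"
  assumes f: "integrable (lebesgue_on U) f" and U: "open U"
  obtains g where "integrable lborel g" "\<And>x. x \<notin> U \<Longrightarrow> g x = 0" "AE x in lebesgue_on U. f x = g x"
proof -
  let ?f = "\<lambda>x. indicator U x *\<^sub>R f x"
  have fi: "integrable lebesgue ?f" using f lebesgue_on_open(2)[OF U] by blast
  then obtain g0 where g0: "g0 \<in> borel_measurable lborel" "AE x in lborel. ?f x = g0 x"
    using completion_ex_borel_measurable_real[of ?f lborel] by auto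
  define g where "g x = indicator U x * g0 x" for x
  have gm: "g \<in> borel_measurable borel" unfolding g_def using g0 U by simp
  have ae: "AE x in lebesgue. ?f x = g x"
    using AE_completion[OF g0(2)] by eventually_elim (auto simp: g_def indicator_def split: if_splits)
  have "integrable lebesgue g"
    using fi by (subst integrable_cong_AE[of _ _ ?f]) (use ae gm fi in \<open>auto intro: borel_measurable_lebesgueI_borel\<close>)
  then have "integrable lborel g" using gm by (simp add: integrable_completion)
  moreover have "AE x in lebesgue_on U. f x = g x"
    using ae U by (subst AE_restrict_space_iff) (auto elim!: eventually_mono simp: indicator_def split: if_splits)
  ultimately show thesis using that[of g] by (simp add: g_def)
qed

lemma weak_deriv_directional:
  fixes w :: "real^'n \<Rightarrow> real^'m"
  assumes wd: "weak_deriv K w \<tau> F" and w: "integrable (lebesgue_on K) w" and K: "open K"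
    and g: "integrable lborel g" "\<And>x. x \<notin> K \<Longrightarrow> g x = 0" "AE x in lebesgue_on K. w x $ i = g x"
    and \<phi>: "\<phi> \<in> C1_compact_support K"
  shows "(LINT x|lebesgue. g x * (grad \<phi> x \<bullet> h)) = - (LINT x|\<tau>. \<phi> x * ((F x $ i) \<bullet> h))"
proof -
  note D = C1_compact_supportD[OF \<phi>]
  obtain B where B: "\<And>x. \<bar>\<phi> x\<bar> \<le> B" "\<And>x. norm (grad \<phi> x) \<le> B" using D(7) by auto
  have t: "sets \<tau> = sets borel" "integrable \<tau> F" using wd by (auto simp: weak_deriv_def)
  have gl: "integrable lebesgue g" using g(1) by (simp add: integrable_completion)
  have pm: "partial_deriv j \<phi> \<in> borel_measurable borel" for j
  proof -
    have "(\<lambda>x. grad \<phi> x \<bullet> axis j 1) \<in> borel_measurable borel" using D(5) by simp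
    then show ?thesis by (simp add: partial_deriv_eq_grad[abs_def])
  qed
  have pb: "\<bar>partial_deriv j \<phi> x\<bar> \<le> B" for j x
    using B(2)[of x] component_le_norm_cart[of "grad \<phi> x" j] by (simp add: grad_def)
  have i1: "integrable lebesgue (\<lambda>x. g x * partial_deriv j \<phi> x)" for j
  proof (rule Bochner_Integration.integrable_bound[of _ "\<lambda>x. g x * B"])
    show "integrable lebesgue (\<lambda>x. g x * B)" using gl by simp
    show "(\<lambda>x. g x * partial_deriv j \<phi> x) \<in> borel_measurable lebesgue"
      by (intro borel_measurable_times borel_measurable_integrable[OF gl] borel_measurable_lebesgueI_borel[OF pm])
    show "AE x in lebesgue. norm (g x * partial_deriv j \<phi> x) \<le> norm (g x * B)"
      by (auto intro!: AE_I2 mult_left_mono order_trans[OF pb abs_ge_self] simp: abs_mult)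
  qed
  have i2: "integrable \<tau> (\<lambda>x. \<phi> x * F x $ i $ j)" for j
  proof (rule Bochner_Integration.integrable_bound[of _ "\<lambda>x. B * F x $ i $ j"])
    show "integrable \<tau> (\<lambda>x. B * F x $ i $ j)" using integrable_entry[OF t(2)] by simp
    show "(\<lambda>x. \<phi> x * F x $ i $ j) \<in> borel_measurable \<tau>"
      using integrable_entry[OF t(2), of i j] D(4) t(1) by (intro borel_measurable_times) (auto cong: measurable_cong_sets)
    show "AE x in \<tau>. norm (\<phi> x * F x $ i $ j) \<le> norm (B * F x $ i $ j)"
      using B(1) by (auto intro!: AE_I2 mult_right_mono order_trans[OF B(1) abs_ge_self] simp: abs_mult)
  qed
  have eq: "(LINT x|lebesgue. g x * partial_deriv j \<phi> x) = - (LINT x|\<tau>. \<phi> x * F x $ i $ j)" for j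
  proof -
    have wm: "(\<lambda>x. w x $ i) \<in> borel_measurable (lebesgue_on K)"
      using w by (intro borel_measurable_integrable integrable_bounded_linear[OF bounded_linear_vec_nth])
    have gm: "g \<in> borel_measurable (lebesgue_on K)" "partial_deriv j \<phi> \<in> borel_measurable (lebesgue_on K)"
      using g(1) pm by (auto intro!: measurable_restrict_space1 borel_measurable_lebesgueI_borel)
    have "(LINT x|lebesgue. g x * partial_deriv j \<phi> x) = (LINT x|lebesgue_on K. g x * partial_deriv j \<phi> x)"
      unfolding lebesgue_on_open(1)[OF K]
      by (rule Bochner_Integration.integral_cong) (use g(2) in \<open>auto simp: indicator_def\<close>)
    also have "\<dots> = (LINT x|lebesgue_on K. w x $ i * partial_deriv j \<phi> x)"
      by (rule integral_cong_AE) (use g(3) wm gm in \<open>auto elim!: eventually_mono\<close>)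
    finally show ?thesis using wd \<phi> by (simp add: weak_deriv_def)
  qed
  have "(LINT x|lebesgue. g x * (grad \<phi> x \<bullet> h)) = (LINT x|lebesgue. (\<Sum>j\<in>UNIV. h $ j * (g x * partial_deriv j \<phi> x)))"
    by (rule Bochner_Integration.integral_cong) (auto simp: grad_def inner_vec_def sum_distrib_left mult_ac)
  also have "\<dots> = (\<Sum>j\<in>UNIV. h $ j * (LINT x|lebesgue. g x * partial_deriv j \<phi> x))"
    using i1 by (subst Bochner_Integration.integral_sum) auto
  also have "\<dots> = - (\<Sum>j\<in>UNIV. h $ j * (LINT x|\<tau>. \<phi> x * F x $ i $ j))"
    by (simp add: eq sum_negf)
  also have "(\<Sum>j\<in>UNIV. h $ j * (LINT x|\<tau>. \<phi> x * F x $ i $ j)) = (LINT x|\<tau>. (\<Sum>j\<in>UNIV. h $ j * (\<phi> x * F x $ i $ j)))"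
    using i2 by (subst Bochner_Integration.integral_sum) auto
  also have "\<dots> = (LINT x|\<tau>. \<phi> x * ((F x $ i) \<bullet> h))"
    by (rule Bochner_Integration.integral_cong) (auto simp: inner_vec_def sum_distrib_left mult_ac)
  finally show ?thesis .
qed

text \<open>By duality it suffices to pair the difference with a test function
  \<open>\<phi>\<close>. The pairing is \<open>G 1 - G 0\<close>, where \<open>G t\<close>
  integrates \<open>g\<close> against the translate of \<open>\<phi>\<close> by
  \<open>t *\<^sub>R h\<close>, and the derivative of \<open>G\<close> is an integral against
  \<open>F\<close>, at most \<open>norm h\<close> times the variation.\<close>

lemma translation_difference_bound:
  fixes w :: "real^'n \<Rightarrow> real^'m"
  assumes wd: "weak_deriv K w \<tau> F" and w: "integrable (lebesgue_on K) w" and K: "open K" "convex K"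
    and g: "integrable lborel g" "\<And>x. x \<notin> K \<Longrightarrow> g x = 0" "AE x in lebesgue_on K. w x $ i = g x"
  shows "(LINT y:{y\<in>K. y + h \<in> K}|lborel. \<bar>g (y + h) - g y\<bar>) \<le> norm h * (LINT x:K|\<tau>. norm (F x))"
proof (rule L1_norm_le_if_test_le)
  let ?V = "{y\<in>K. y + h \<in> K}" and ?A = "LINT x:K|\<tau>. norm (F x)"
  have t: "sets \<tau> = sets borel" "integrable \<tau> F" using wd by (auto simp: weak_deriv_def)
  have gl: "integrable lebesgue g" using g(1) by (simp add: integrable_completion)
  have gb: "g \<in> borel_measurable borel" using g(1) by auto
  have gh: "integrable lborel (\<lambda>y. g (y + h))"
    using integrable_distr_eq[of "(+) h" lborel borel g] gb g(1) by (simp add: lborel_distr_plus add.commute)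
  then show "integrable lborel (\<lambda>y. g (y + h) - g y)" using g(1) by simp
  have "?V = K \<inter> (\<lambda>y. y + h) -` K" by auto
  moreover have "open ((\<lambda>y. y + h) -` K)" by (intro open_vimage K(1) continuous_intros)
  ultimately show "open ?V" using K(1) by auto
  fix \<phi> :: "real^'n \<Rightarrow> real" assume \<phi>: "\<phi> \<in> C1_compact_support ?V" "\<And>x. \<bar>\<phi> x\<bar> \<le> 1"
  note D = C1_compact_supportD[OF \<phi>(1)]
  obtain C where C: "compact C" "C \<subseteq> ?V" "\<And>x. x \<notin> C \<Longrightarrow> \<phi> x = 0" using D(6) by auto
  \<comment> \<open>Convexity keeps all intermediate translates supported in \<open>K\<close>, so
    the weak derivative may be tested with them.\<close>
  have tr: "(\<lambda>x. \<phi> (x - t *\<^sub>R h)) \<in> C1_compact_support K \<and> grad (\<lambda>x. \<phi> (x - t *\<^sub>R h)) = (\<lambda>x. grad \<phi> (x - t *\<^sub>R h))"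
    if "t \<in> {0..1}" for t
  proof -
    have "(\<lambda>y. t *\<^sub>R h + 1 *\<^sub>R y) ` ?V \<subseteq> K"
    proof safe
      fix y assume "y \<in> K" "y + h \<in> K"
      then have "(1 - t) *\<^sub>R y + t *\<^sub>R (y + h) \<in> K" using that by (intro convexD_alt[OF K(2)]) auto
      then show "t *\<^sub>R h + 1 *\<^sub>R y \<in> K" by (simp add: algebra_simps)
    qed
    then show ?thesis
      using C1_compact_support_affine[OF \<phi>(1), of 1 "t *\<^sub>R h"] by (auto intro: C1_compact_support_mono)
  qed
  define G where "G t = (LINT x|lebesgue. g x * \<phi> (x - t *\<^sub>R h))" for t
  have "norm (G 1 - G 0) \<le> norm h * ?A * norm (1 - 0 :: real)"
  proof (rule field_differentiable_bound[of "{0..1}" G "\<lambda>t. - (LINT x|lebesgue. g x * (grad \<phi> (x - t *\<^sub>R h) \<bullet> h))"])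
    show "(G has_real_derivative - (LINT x|lebesgue. g x * (grad \<phi> (x - t *\<^sub>R h) \<bullet> h))) (at t within {0..1})" for t
      unfolding G_def[abs_def]
      by (rule has_derivative_translated_integral[OF gl C1_compact_support_mono[OF \<phi>(1)]]) simp
    fix t :: real assume t01: "t \<in> {0..1}"
    let ?\<phi> = "\<lambda>x. \<phi> (x - t *\<^sub>R h)"
    have \<phi>t: "?\<phi> \<in> C1_compact_support K" "grad ?\<phi> = (\<lambda>x. grad \<phi> (x - t *\<^sub>R h))" using tr[OF t01] by auto
    have "- (LINT x|lebesgue. g x * (grad \<phi> (x - t *\<^sub>R h) \<bullet> h)) = (LINT x|\<tau>. ?\<phi> x * ((F x $ i) \<bullet> h))"
      using weak_deriv_directional[OF wd w K(1) g \<phi>t(1), of h] by (simp add: \<phi>t(2))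
    moreover have "norm (LINT x|\<tau>. ?\<phi> x * ((F x $ i) \<bullet> h)) \<le> (LINT x|\<tau>. norm h * (indicator K x *\<^sub>R norm (F x)))"
    proof (rule order_trans[OF integral_norm_bound integral_mono])
      show "integrable \<tau> (\<lambda>x. norm h * (indicator K x *\<^sub>R norm (F x)))"
        using integrable_mult_indicator[of K \<tau> "\<lambda>x. norm (F x)"] t K(1) by auto
      fix x
      have "\<bar>F x $ i \<bullet> h\<bar> \<le> norm (F x $ i) * norm h" by (rule Cauchy_Schwarz_ineq2)
      also have "\<dots> \<le> norm (F x) * norm h" by (intro mult_right_mono Finite_Cartesian_Product.norm_nth_le) auto
      finally have 1: "\<bar>F x $ i \<bullet> h\<bar> \<le> norm h * norm (F x)" by (simp add: mult.commute)
      have "x \<in> K \<or> ?\<phi> x = 0" using C1_compact_supportD(6)[OF \<phi>t(1)] by blast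
      then show "norm (?\<phi> x * (F x $ i \<bullet> h)) \<le> norm h * (indicator K x *\<^sub>R norm (F x))"
        using mult_mono[OF \<phi>(2)[of "x - t *\<^sub>R h"] 1] by (auto simp: abs_mult)
      show "integrable \<tau> (\<lambda>x. norm (?\<phi> x * (F x $ i \<bullet> h)))"
      proof (rule integrable_norm, rule Bochner_Integration.integrable_bound[of _ "\<lambda>x. F x $ i \<bullet> h"])
        have Fi: "integrable \<tau> (\<lambda>x. F x $ i)" using t by (intro integrable_bounded_linear[OF bounded_linear_vec_nth])
        then show "integrable \<tau> (\<lambda>x. F x $ i \<bullet> h)" by simp
        show "(\<lambda>x. ?\<phi> x * (F x $ i \<bullet> h)) \<in> borel_measurable \<tau>"
          using C1_compact_supportD(4)[OF \<phi>t(1)] t(1) Fi by (intro borel_measurable_times) (auto cong: measurable_cong_sets)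
        show "AE x in \<tau>. norm (?\<phi> x * (F x $ i \<bullet> h)) \<le> norm (F x $ i \<bullet> h)"
          using \<phi>(2) by (auto intro!: AE_I2 mult_left_le_one_le simp: abs_mult)
      qed
    qed
    ultimately show "norm (- (LINT x|lebesgue. g x * (grad \<phi> (x - t *\<^sub>R h) \<bullet> h))) \<le> norm h * ?A"
      by (simp add: set_lebesgue_integral_def)
  qed auto
  then have le: "G 1 - G 0 \<le> norm h * ?A" by simp
  have pm: "\<phi> \<in> borel_measurable borel" by (rule D(4))
  have b: "integrable lborel (\<lambda>x. f x * \<phi> x)" if "integrable lborel f" for f :: "real^'n \<Rightarrow> real"
    by (rule Bochner_Integration.integrable_bound[OF that])
       (use that pm \<phi>(2) in \<open>auto intro!: AE_I2 mult_left_le simp: abs_mult\<close>)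
  have m1: "(\<lambda>x. g x * \<phi> (x - t *\<^sub>R h)) \<in> borel_measurable lborel" for t
    using gb measurable_compose[of "\<lambda>x. x - t *\<^sub>R h" borel borel, OF _ pm] by simp
  have "G 1 = (LINT x|lborel. g x * \<phi> (x - h))"
    unfolding G_def using integral_completion[OF m1[of 1]] by simp
  also have "\<dots> = (LINT x|lborel. g (x + h) * \<phi> x)"
    using lborel_integral_translate[of "\<lambda>x. g (x + h) * \<phi> x" h] gb pm by simp
  finally have G1: "G 1 = (LINT x|lborel. g (x + h) * \<phi> x)" .
  have G0: "G 0 = (LINT x|lborel. g x * \<phi> x)"
    unfolding G_def using integral_completion[OF m1[of 0]] by simp
  have "(LINT y|lborel. (g (y + h) - g y) * \<phi> y) = G 1 - G 0"
    unfolding G1 G0 using b[OF gh] b[OF g(1)] by (simp add: left_diff_distrib)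
  then show "(LINT y|lborel. (g (y + h) - g y) * \<phi> y) \<le> norm h * ?A" using le by simp
qed

text \<open>The deviation from the mean is an average of differences, so
  \<open>measure lborel K\<close> times the left side is at most the double integral of
  \<open>\<bar>g x - g y\<bar>\<close> over \<open>K\<close>. Substituting \<open>x = y + h\<close>
  and exchanging integrals leads to \<open>translation_difference_bound\<close>; only
  \<open>h\<close> in the ball of radius \<open>2 * R\<close> contribute, whence the
  constant.\<close>

lemma Poincare_component:
  fixes w :: "real^'n \<Rightarrow> real^'m"
  assumes wd: "weak_deriv K w \<tau> F" and w: "integrable (lebesgue_on K) w"
    and K: "open K" "convex K" "K \<subseteq> cball 0 R" "K \<noteq> {}"
    and g: "integrable lborel g" "\<And>x. x \<notin> K \<Longrightarrow> g x = 0" "AE x in lebesgue_on K. w x $ i = g x"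
  shows "(LINT y:K|lborel. \<bar>g y - (LINT x|lborel. g x) / measure lborel K\<bar>) \<le>
     (2 * R * measure lborel (cball (0::real^'n) (2 * R)) / measure lborel K) * (LINT x:K|\<tau>. norm (F x))"
proof -
  let ?A = "LINT x:K|\<tau>. norm (F x)" and ?k = "measure lborel K"
  have gb[measurable]: "g \<in> borel_measurable borel" using g(1) by auto
  have Kb[measurable]: "K \<in> sets borel" using K(1) by simp
  have Kfin: "emeasure lborel K < \<infinity>"
    using bounded_subset[OF bounded_cball K(3)] by (rule emeasure_bounded_finite)
  have kpos: "0 < ?k"
  proof -
    have "emeasure lborel K \<noteq> 0"
    proof
      assume "emeasure lborel K = 0"
      then have "negligible K" using Kb by (simp add: negligible_iff_null_sets null_sets_def)
      then show False using open_not_negligible[OF K(1,4)] by simp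
    qed
    then have "0 < emeasure lborel K" by (simp add: zero_less_iff_neq_zero)
    then show ?thesis using Kfin unfolding measure_def enn2real_positive_iff by simp
  qed
  have R0: "0 \<le> R" using K(3,4) by (auto intro: order_trans[OF norm_ge_zero])
  have A0: "0 \<le> ?A" unfolding set_lebesgue_integral_def by (rule integral_nonneg_AE) auto
  define a where "a = (LINT x|lborel. g x) / ?k"
  have one: "integrable lborel (indicator K :: _ \<Rightarrow> real)" using Kfin by simp
  have pt: "ennreal (?k * \<bar>g y - a\<bar>) \<le> (\<integral>\<^sup>+x. ennreal (indicator K x * \<bar>g x - g y\<bar>) \<partial>lborel)" if "y \<in> K" for y
  proof -
    have i: "integrable lborel (\<lambda>x. g x - g y * indicator K x)" using g(1) one by simp
    have "(LINT x|lborel. g x - g y * indicator K x) = ?k * (a - g y)"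
      using g(1) one kpos by (simp add: a_def algebra_simps)
    then have "ennreal (?k * \<bar>g y - a\<bar>) = ennreal (norm (LINT x|lborel. g x - g y * indicator K x))"
      using kpos by (simp add: abs_mult abs_minus_commute)
    also have "\<dots> \<le> (\<integral>\<^sup>+x. ennreal (norm (g x - g y * indicator K x)) \<partial>lborel)"
      by (rule integral_norm_bound_ennreal[OF i])
    also have "\<dots> = (\<integral>\<^sup>+x. ennreal (indicator K x * \<bar>g x - g y\<bar>) \<partial>lborel)"
      using g(2) by (intro nn_integral_cong) (auto simp: indicator_def)
    finally show ?thesis .
  qed
  \<comment> \<open>Both indicators are part of the integrand, so that the exchange of integrals
    takes place on the full product space.\<close>
  define q where "q y h = ennreal (indicator K y * (indicator K (y + h) * \<bar>g (y + h) - g y\<bar>))" for y h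
  have qm: "case_prod q \<in> borel_measurable (lborel \<Otimes>\<^sub>M lborel)"
    unfolding q_def case_prod_beta by measurable
  have "(\<integral>\<^sup>+y. ennreal (indicator K y * (?k * \<bar>g y - a\<bar>)) \<partial>lborel) \<le> (\<integral>\<^sup>+y. \<integral>\<^sup>+h. q y h \<partial>lborel \<partial>lborel)"
  proof (rule nn_integral_mono)
    fix y
    show "ennreal (indicator K y * (?k * \<bar>g y - a\<bar>)) \<le> (\<integral>\<^sup>+h. q y h \<partial>lborel)"
    proof (cases "y \<in> K")
      case True
      have "(\<integral>\<^sup>+x. ennreal (indicator K x * \<bar>g x - g y\<bar>) \<partial>lborel) =
        (\<integral>\<^sup>+x. ennreal (indicator K x * \<bar>g x - g y\<bar>) \<partial>distr lborel borel ((+) y))"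
        by (simp add: lborel_distr_plus)
      also have "\<dots> = (\<integral>\<^sup>+h. ennreal (indicator K (y + h) * \<bar>g (y + h) - g y\<bar>) \<partial>lborel)"
        by (subst nn_integral_distr) auto
      also have "\<dots> = (\<integral>\<^sup>+h. q y h \<partial>lborel)" using True by (simp add: q_def)
      finally show ?thesis using pt[OF True] True by simp
    qed simp
  qed
  also have "\<dots> = (\<integral>\<^sup>+h. \<integral>\<^sup>+y. q y h \<partial>lborel \<partial>lborel)"
    by (rule lborel_pair.Fubini'[OF qm, symmetric])
  also have "\<dots> \<le> (\<integral>\<^sup>+h. ennreal (2 * R * ?A) * indicator (cball (0::real^'n) (2 * R)) h \<partial>lborel)"
  proof (rule nn_integral_mono)
    fix h :: "real^'n"
    let ?V = "{y\<in>K. y + h \<in> K}"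
    have Vb: "?V \<in> sets borel" by measurable
    have qV: "q y h = ennreal (indicator ?V y *\<^sub>R \<bar>g (y + h) - g y\<bar>)" for y by (auto simp: q_def indicator_def)
    show "(\<integral>\<^sup>+y. q y h \<partial>lborel) \<le> ennreal (2 * R * ?A) * indicator (cball 0 (2 * R)) h"
    proof (cases "?V = {}")
      case True
      then have "q y h = 0" for y unfolding qV by simp
      then show ?thesis by simp
    next
      case False
      then obtain y where "y \<in> K" "y + h \<in> K" by auto
      then have "norm y \<le> R" "norm (y + h) \<le> R" using K(3) by auto
      then have nh: "norm h \<le> 2 * R" using norm_triangle_ineq4[of "y + h" y] by simp
      have gh: "integrable lborel (\<lambda>y. g (y + h))"
        using integrable_distr_eq[of "(+) h" lborel borel g] gb g(1) by (simp add: lborel_distr_plus add.commute)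
      have "(\<integral>\<^sup>+y. q y h \<partial>lborel) = ennreal (LINT y:?V|lborel. \<bar>g (y + h) - g y\<bar>)"
        unfolding qV set_lebesgue_integral_def
        by (rule nn_integral_eq_integral) (use g(1) gh Vb in \<open>auto intro!: integrable_mult_indicator AE_I2 scaleR_nonneg_nonneg simp del: real_scaleR_def\<close>)
      also have "\<dots> \<le> ennreal (norm h * ?A)"
        by (rule ennreal_leI[OF translation_difference_bound[OF wd w K(1,2) g]])
      also have "\<dots> \<le> ennreal (2 * R * ?A)" using nh A0 by (intro ennreal_leI mult_right_mono) auto
      finally show ?thesis using nh by simp
    qed
  qed
  also have "\<dots> = ennreal (2 * R * ?A) * emeasure lborel (cball (0::real^'n) (2 * R))"
    by (rule nn_integral_cmult_indicator) simp
  also have "emeasure lborel (cball (0::real^'n) (2 * R)) = ennreal (measure lborel (cball (0::real^'n) (2 * R)))"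
    by (rule emeasure_eq_ennreal_measure) (use emeasure_lborel_cball_finite in \<open>auto simp: less_top[symmetric]\<close>)
  also have "ennreal (2 * R * ?A) * ennreal (measure lborel (cball (0::real^'n) (2 * R)))
    = ennreal (2 * R * ?A * measure lborel (cball (0::real^'n) (2 * R)))"
    using R0 A0 by (simp add: ennreal_mult')
  finally have main: "(\<integral>\<^sup>+y. ennreal (indicator K y * (?k * \<bar>g y - a\<bar>)) \<partial>lborel)
     \<le> ennreal (2 * R * ?A * measure lborel (cball (0::real^'n) (2 * R)))" .
  have ii: "integrable lborel (\<lambda>y. indicator K y * (?k * \<bar>g y - a\<bar>))"
  proof -
    have "integrable lborel (\<lambda>y. ?k * \<bar>g y - indicator K y * a\<bar>)" using g(1) one by simp
    moreover have "?k * \<bar>g y - indicator K y * a\<bar> = indicator K y * (?k * \<bar>g y - a\<bar>)" for y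
      using g(2)[of y] by (auto simp: indicator_def)
    ultimately show ?thesis by simp
  qed
  have "(\<integral>\<^sup>+y. ennreal (indicator K y * (?k * \<bar>g y - a\<bar>)) \<partial>lborel) = ennreal (LINT y|lborel. indicator K y * (?k * \<bar>g y - a\<bar>))"
    by (rule nn_integral_eq_integral[OF ii]) (use kpos in auto)
  with main have "(LINT y|lborel. indicator K y * (?k * \<bar>g y - a\<bar>)) \<le> 2 * R * ?A * measure lborel (cball (0::real^'n) (2 * R))"
    using R0 A0 by simp
  also have "(LINT y|lborel. indicator K y * (?k * \<bar>g y - a\<bar>)) = ?k * (LINT y:K|lborel. \<bar>g y - a\<bar>)"
    unfolding set_lebesgue_integral_def integral_mult_right_zero[symmetric]
    by (rule Bochner_Integration.integral_cong) auto
  finally show ?thesis using kpos by (simp add: a_def field_simps)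
qed

text \<open>The constant depends on \<open>K\<close> and on the dimensions only. The factor
  \<open>CARD('m)\<close> comes from bounding the norm by the sum of the components.\<close>

lemma Poincare:
  fixes K :: "(real^'n) set"
  assumes K: "open K" "convex K" "bounded K" "K \<noteq> {}"
  obtains C where "0 \<le> C"
    "\<And>(w :: real^'n \<Rightarrow> real^'m) \<tau> F. weak_deriv K w \<tau> F \<Longrightarrow> integrable (lebesgue_on K) w \<Longrightarrow>
       (LINT y|lebesgue_on K. norm (w y - set_average K w)) \<le> C * (LINT x:K|\<tau>. norm (F x))"
proof -
  obtain R where R: "0 < R" "K \<subseteq> cball 0 R" using K(3) by (metis bounded_pos mem_cball_0 subset_eq)
  let ?c = "2 * R * measure lborel (cball (0::real^'n) (2 * R)) / measure lborel K"
  have Kb: "K \<in> sets borel" using K(1) by simp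
  have Kfin: "emeasure lborel K < \<infinity>" using K(3) by (rule emeasure_bounded_finite)
  have "(LINT y|lebesgue_on K. norm (w y - set_average K w)) \<le> (CARD('m) * ?c) * (LINT x:K|\<tau>. norm (F x))"
    if wd: "weak_deriv K w \<tau> F" and w: "integrable (lebesgue_on K) w" for w :: "real^'n \<Rightarrow> real^'m" and \<tau> F
  proof -
    let ?a = "set_average K w"
    have wi: "integrable (lebesgue_on K) (\<lambda>x. w x $ i)" for i
      by (rule integrable_bounded_linear[OF bounded_linear_vec_nth w])
    have ci: "integrable (lebesgue_on K) (\<lambda>x. c)" for c :: real
      using Kfin Kb by (subst lebesgue_on_open(2)[OF K(1)]) (simp add: integrable_completion)
    have comp: "(LINT y|lebesgue_on K. \<bar>w y $ i - ?a $ i\<bar>) \<le> ?c * (LINT x:K|\<tau>. norm (F x))" for i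
    proof -
      obtain g where g: "integrable lborel g" "\<And>x. x \<notin> K \<Longrightarrow> g x = 0" "AE x in lebesgue_on K. w x $ i = g x"
        using lebesgue_on_borel_representative[OF wi K(1)] by metis
      have gb: "g \<in> borel_measurable borel" using g(1) by auto
      have gm: "g \<in> borel_measurable (lebesgue_on K)"
        by (intro measurable_restrict_space1 borel_measurable_lebesgueI_borel gb)
      have "?a $ i = (LINT y|lebesgue_on K. w y $ i) / measure lborel K"
        unfolding set_average_def using integral_bounded_linear[OF bounded_linear_vec_nth w, of i] Kb by simp
      also have "(LINT y|lebesgue_on K. w y $ i) = (LINT y|lebesgue_on K. g y)"
        by (rule integral_cong_AE) (use wi gm g(3) in auto)
      also have "\<dots> = (LINT y|lebesgue. g y)"
        unfolding lebesgue_on_open(1)[OF K(1)]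
        by (rule Bochner_Integration.integral_cong) (use g(2) in \<open>auto simp: indicator_def\<close>)
      also have "\<dots> = (LINT y|lborel. g y)" by (rule integral_completion) (use gb in simp)
      finally have a: "?a $ i = (LINT y|lborel. g y) / measure lborel K" .
      have "(LINT y|lebesgue_on K. \<bar>w y $ i - ?a $ i\<bar>) = (LINT y|lebesgue_on K. \<bar>g y - ?a $ i\<bar>)"
        by (rule integral_cong_AE) (use wi gm g(3) in \<open>auto elim!: eventually_mono\<close>)
      also have "\<dots> = (LINT y:K|lborel. \<bar>g y - ?a $ i\<bar>)"
        unfolding lebesgue_on_open(1)[OF K(1)] set_lebesgue_integral_def
        by (rule integral_completion) (use gb Kb in simp)
      also have "\<dots> \<le> ?c * (LINT x:K|\<tau>. norm (F x))"
        unfolding a by (rule Poincare_component[OF wd w K(1,2) R(2) K(4) g])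
      finally show ?thesis .
    qed
    have "(LINT y|lebesgue_on K. norm (w y - ?a)) \<le> (LINT y|lebesgue_on K. (\<Sum>i\<in>UNIV. \<bar>w y $ i - ?a $ i\<bar>))"
    proof (rule integral_mono)
      show "norm (w y - ?a) \<le> (\<Sum>i\<in>UNIV. \<bar>w y $ i - ?a $ i\<bar>)" for y
        using norm_le_l1_cart[of "w y - ?a"] by simp
      show "integrable (lebesgue_on K) (\<lambda>y. norm (w y - ?a))"
      proof -
        have "integrable (lebesgue_on K) (\<lambda>y. ?a)"
          using integrable_scaleR_left[OF ci[of 1], of ?a] by simp
        then show ?thesis using w by auto
      qed
      show "integrable (lebesgue_on K) (\<lambda>y. \<Sum>i\<in>UNIV. \<bar>w y $ i - ?a $ i\<bar>)"
        by (intro Bochner_Integration.integrable_sum integrable_abs Bochner_Integration.integrable_diff wi ci)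
    qed
    also have "\<dots> = (\<Sum>i\<in>UNIV. LINT y|lebesgue_on K. \<bar>w y $ i - ?a $ i\<bar>)"
      by (intro Bochner_Integration.integral_sum integrable_abs Bochner_Integration.integrable_diff wi ci)
    also have "\<dots> \<le> (\<Sum>i\<in>(UNIV::'m set). ?c * (LINT x:K|\<tau>. norm (F x)))" by (intro sum_mono comp)
    finally show ?thesis by simp
  qed
  moreover have "0 \<le> CARD('m) * ?c" using R by simp
  ultimately show thesis using that by blast
qed

section \<open>Rescaling\<close>

lemma lebesgue_scaled_integral:
  fixes f :: "'a::euclidean_space \<Rightarrow> 'b::{banach, second_countable_topology}"
  assumes f: "f \<in> borel_measurable lebesgue" and \<epsilon>: "0 < \<epsilon>"
  shows "(LINT y|lebesgue. f (x + \<epsilon> *\<^sub>R y)) = (1 / \<epsilon> ^ DIM('a)) *\<^sub>R (LINT z|lebesgue. f z)"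
    and "integrable lebesgue f \<Longrightarrow> integrable lebesgue (\<lambda>y. f (x + \<epsilon> *\<^sub>R y))"
    and "(\<lambda>y. f (x + \<epsilon> *\<^sub>R y)) \<in> borel_measurable lebesgue"
proof -
  let ?T = "\<lambda>y. x + \<epsilon> *\<^sub>R y"
  have T: "(\<lambda>y. x + (\<Sum>j\<in>Basis. (\<epsilon> * (y \<bullet> j)) *\<^sub>R j)) = ?T"
    by (rule ext) (simp add: scaleR_scaleR[symmetric] scaleR_sum_right[symmetric] euclidean_representation del: scaleR_scaleR)
  have Tm: "?T \<in> lebesgue \<rightarrow>\<^sub>M lebesgue"
    using lebesgue_affine_measurable[of "\<lambda>_. \<epsilon>" x] \<epsilon> unfolding T by simp
  have leb: "lebesgue = density (distr lebesgue lebesgue ?T) (\<lambda>_. ennreal (\<epsilon> ^ DIM('a)))"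
    using lebesgue_affine_euclidean[of "\<lambda>_. \<epsilon>" x] \<epsilon> unfolding T by simp
  show m: "(\<lambda>y. f (x + \<epsilon> *\<^sub>R y)) \<in> borel_measurable lebesgue"
    by (rule measurable_compose[OF Tm f])
  have fd: "f \<in> borel_measurable (distr lebesgue lebesgue ?T)" using f by simp
  have "(LINT z|lebesgue. f z) = (LINT z|density (distr lebesgue lebesgue ?T) (\<lambda>_. ennreal (\<epsilon> ^ DIM('a))). f z)"
    using leb by simp
  also have "\<dots> = (LINT z|distr lebesgue lebesgue ?T. \<epsilon> ^ DIM('a) *\<^sub>R f z)"
    by (rule integral_density[OF fd]) (use \<epsilon> in auto)
  also have "\<dots> = (LINT y|lebesgue. \<epsilon> ^ DIM('a) *\<^sub>R f (?T y))"
    by (rule integral_distr[OF Tm]) (use f in simp)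
  finally show "(LINT y|lebesgue. f (x + \<epsilon> *\<^sub>R y)) = (1 / \<epsilon> ^ DIM('a)) *\<^sub>R (LINT z|lebesgue. f z)"
    using \<epsilon> by simp
  assume "integrable lebesgue f"
  then have "integrable (density (distr lebesgue lebesgue ?T) (\<lambda>_. ennreal (\<epsilon> ^ DIM('a)))) f"
    using leb by simp
  then have "integrable (distr lebesgue lebesgue ?T) (\<lambda>z. \<epsilon> ^ DIM('a) *\<^sub>R f z)"
    by (subst (asm) integrable_density[OF fd]) (use \<epsilon> in auto)
  then have "integrable (distr lebesgue lebesgue ?T) f"
    using \<epsilon> integrable_scaleR_right[of "1 / \<epsilon> ^ DIM('a)" "distr lebesgue lebesgue ?T" "\<lambda>z. \<epsilon> ^ DIM('a) *\<^sub>R f z"] by simp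
  then show "integrable lebesgue (\<lambda>y. f (x + \<epsilon> *\<^sub>R y))"
    using integrable_distr[OF Tm] by blast
qed

lemma dilate_at_iff:
  fixes K :: "'a::real_vector set"
  assumes "0 < \<epsilon>"
  shows "x + \<epsilon> *\<^sub>R y \<in> dilate_at K \<epsilon> x \<longleftrightarrow> y \<in> K"
  using assms by (auto simp: dilate_at_def)

lemma open_dilate_at:
  fixes K :: "'a::real_normed_vector set"
  assumes "open K" "0 < \<epsilon>" shows "open (dilate_at K \<epsilon> x)"
  unfolding dilate_at_def using open_affinity[OF assms(1), of \<epsilon> x] assms(2) by simp

lemma indicator_dilate_at:
  fixes K :: "'a::real_vector set"
  assumes "0 < \<epsilon>"
  shows "indicator (dilate_at K \<epsilon> x) (x + \<epsilon> *\<^sub>R y) = indicator K y"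
  using dilate_at_iff[OF assms] by (auto simp: indicator_def)

lemma lebesgue_on_scaled_integral:
  fixes f :: "'a::euclidean_space \<Rightarrow> 'b::{banach, second_countable_topology}"
  assumes K: "open K" and \<epsilon>: "0 < \<epsilon>" and f: "integrable (lebesgue_on (dilate_at K \<epsilon> x)) f"
  shows "(LINT y|lebesgue_on K. f (x + \<epsilon> *\<^sub>R y)) = (1 / \<epsilon> ^ DIM('a)) *\<^sub>R (LINT z|lebesgue_on (dilate_at K \<epsilon> x). f z)"
    and "integrable (lebesgue_on K) (\<lambda>y. f (x + \<epsilon> *\<^sub>R y))"
proof -
  note o = open_dilate_at[OF K \<epsilon>, of x]
  let ?f = "\<lambda>z. indicator (dilate_at K \<epsilon> x) z *\<^sub>R f z"
  have i: "integrable lebesgue ?f" using f by (simp only: lebesgue_on_open(2)[OF o])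
  then have m: "?f \<in> borel_measurable lebesgue" by (rule borel_measurable_integrable)
  show "(LINT y|lebesgue_on K. f (x + \<epsilon> *\<^sub>R y)) = (1 / \<epsilon> ^ DIM('a)) *\<^sub>R (LINT z|lebesgue_on (dilate_at K \<epsilon> x). f z)"
    unfolding lebesgue_on_open(1)[OF K] lebesgue_on_open(1)[OF o] lebesgue_scaled_integral(1)[OF m \<epsilon>, of x, symmetric]
    by (simp only: indicator_dilate_at[OF \<epsilon>])
  show "integrable (lebesgue_on K) (\<lambda>y. f (x + \<epsilon> *\<^sub>R y))"
    unfolding lebesgue_on_open(2)[OF K]
    using lebesgue_scaled_integral(2)[OF m \<epsilon> i, of x] by (simp only: indicator_dilate_at[OF \<epsilon>])
qed

lemma integrable_lebesgue_on_subset: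
  fixes f :: "'a::euclidean_space \<Rightarrow> 'b::{banach, second_countable_topology}"
  assumes "integrable (lebesgue_on U) f" "open U" "open V" "V \<subseteq> U"
  shows "integrable (lebesgue_on V) f"
proof -
  have "integrable lebesgue (\<lambda>x. indicator V x *\<^sub>R (indicator U x *\<^sub>R f x))"
    using assms by (intro integrable_mult_indicator[OF _ assms(1)[unfolded lebesgue_on_open(2)[OF assms(2)]]]) auto
  moreover have "(\<lambda>x. indicator V x *\<^sub>R (indicator U x *\<^sub>R f x)) = (\<lambda>x. indicator V x *\<^sub>R f x)"
    using assms(4) by (intro ext) (auto simp: indicator_def)
  ultimately show ?thesis by (simp only: lebesgue_on_open(2)[OF assms(3)])
qed

lemma lebesgue_on_norm_mono:
  fixes f :: "'a::euclidean_space \<Rightarrow> 'b::{banach, second_countable_topology}"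
  assumes "integrable (lebesgue_on U) f" "open U" "open V" "V \<subseteq> U"
  shows "(LINT x|lebesgue_on V. norm (f x)) \<le> (LINT x|lebesgue_on U. norm (f x))"
  unfolding lebesgue_on_open(1)[OF assms(2)] lebesgue_on_open(1)[OF assms(3)]
proof (rule integral_mono)
  show "integrable lebesgue (\<lambda>x. indicator V x *\<^sub>R norm (f x))"
    using integrable_norm[OF integrable_lebesgue_on_subset[OF assms]] by (simp only: lebesgue_on_open(2)[OF assms(3)])
  show "integrable lebesgue (\<lambda>x. indicator U x *\<^sub>R norm (f x))"
    using integrable_norm[OF assms(1)] by (simp only: lebesgue_on_open(2)[OF assms(2)])
  show "indicator V x *\<^sub>R norm (f x) \<le> indicator U x *\<^sub>R norm (f x)" for x
    using assms(4) by (auto simp: indicator_def)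
qed

lemma integrable_lebesgue_on_const:
  assumes "bounded K" "open K"
  shows "integrable (lebesgue_on K) (\<lambda>x::'a::euclidean_space. c::'b::{banach, second_countable_topology})"
proof -
  have "emeasure lborel K < \<infinity>" using assms(1) by (rule emeasure_bounded_finite)
  then have "integrable lebesgue (indicator K :: 'a \<Rightarrow> real)" using assms by (simp add: integrable_completion)
  then have "integrable lebesgue (\<lambda>x. (indicator K x :: real) *\<^sub>R c)" by (rule integrable_scaleR_left)
  then show ?thesis by (simp only: lebesgue_on_open(2)[OF assms(2)])
qed

lemma lebesgue_on_const:
  assumes "bounded K" "open K"
  shows "(LINT x|lebesgue_on K. (c::'b::{banach, second_countable_topology})) = measure lebesgue (K::'a::euclidean_space set) *\<^sub>R c"
proof -
  have "emeasure lborel K < \<infinity>" using assms(1) by (rule emeasure_bounded_finite)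
  then have "integrable lebesgue (indicator K :: 'a \<Rightarrow> real)" using assms by (simp add: integrable_completion)
  then have "(LINT x|lebesgue. (indicator K x :: real) *\<^sub>R c) = (LINT x|lebesgue. (indicator K x :: real)) *\<^sub>R c"
    by (rule integral_scaleR_left)
  then show ?thesis unfolding lebesgue_on_open(1)[OF assms(2)] using assms(2) by simp
qed

lemma measure_dilate_at:
  fixes K :: "'a::euclidean_space set"
  assumes "open K" "bounded K" "0 < \<epsilon>"
  shows "measure lebesgue (dilate_at K \<epsilon> x) = \<epsilon> ^ DIM('a) * measure lebesgue K"
proof -
  have "dilate_at K \<epsilon> x = (+) x ` ((*\<^sub>R) \<epsilon> ` K)" by (auto simp: dilate_at_def)
  then have b: "bounded (dilate_at K \<epsilon> x)" using assms(2) by (simp only: bounded_translation bounded_scaling)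
  note o = open_dilate_at[OF assms(1,3), of x]
  have "(LINT y|lebesgue_on K. (1::real)) = (1 / \<epsilon> ^ DIM('a)) *\<^sub>R (LINT z|lebesgue_on (dilate_at K \<epsilon> x). (1::real))"
    by (rule lebesgue_on_scaled_integral(1)[OF assms(1,3) integrable_lebesgue_on_const[OF b o]])
  then show ?thesis
    unfolding lebesgue_on_const[OF assms(2,1)] lebesgue_on_const[OF b o] using assms(3) by simp
qed

lemma set_average_dilate_at:
  fixes u :: "real^'n \<Rightarrow> 'b::{banach, second_countable_topology}"
  assumes K: "open K" "bounded K" and \<epsilon>: "0 < \<epsilon>" and u: "integrable (lebesgue_on (dilate_at K \<epsilon> x)) u"
  shows "set_average K (\<lambda>y. u (x + \<epsilon> *\<^sub>R y)) = set_average (dilate_at K \<epsilon> x) u"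
  unfolding set_average_def lebesgue_on_scaled_integral(1)[OF K(1) \<epsilon> u] measure_dilate_at[OF K \<epsilon>]
  by (simp add: mult.commute)

lemma test_function_integrable:
  assumes "\<phi> \<in> C1_compact_support U"
  shows "integrable lebesgue \<phi>" "integrable lebesgue (\<lambda>x. grad \<phi> x \<bullet> h)"
proof -
  note D = C1_compact_supportD[OF assms]
  obtain C where C: "compact C" "\<And>x. x \<notin> C \<Longrightarrow> \<phi> x = 0 \<and> grad \<phi> x = 0" using D(6) by auto
  obtain B where B: "B \<ge> 0" "\<And>x. \<bar>\<phi> x\<bar> \<le> B" "\<And>x. norm (grad \<phi> x) \<le> B" using D(7) by auto
  have ind: "integrable lebesgue (indicator C :: _ \<Rightarrow> real)"
    using lmeasurable_compact[OF C(1)] lmeasurable_iff_integrable by blast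
  show "integrable lebesgue \<phi>"
  proof (rule Bochner_Integration.integrable_bound[of _ "\<lambda>x. B * indicator C x"])
    show "AE x in lebesgue. norm (\<phi> x) \<le> norm (B * indicator C x)"
    proof (rule AE_I2)
      fix x show "norm (\<phi> x) \<le> norm (B * indicator C x)" using B C(2)[of x] by (cases "x \<in> C") auto
    qed
  qed (use ind in \<open>auto intro: borel_measurable_lebesgueI_borel D(4)\<close>)
  show "integrable lebesgue (\<lambda>x. grad \<phi> x \<bullet> h)"
  proof (rule Bochner_Integration.integrable_bound[of _ "\<lambda>x. (B * norm h) * indicator C x"])
    show "(\<lambda>x. grad \<phi> x \<bullet> h) \<in> borel_measurable lebesgue"
      by (rule borel_measurable_lebesgueI_borel) (use D(5) in simp)
    show "AE x in lebesgue. norm (grad \<phi> x \<bullet> h) \<le> norm ((B * norm h) * indicator C x)"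
    proof (rule AE_I2)
      fix x
      have "\<bar>grad \<phi> x \<bullet> h\<bar> \<le> norm (grad \<phi> x) * norm h" by (rule Cauchy_Schwarz_ineq2)
      also have "\<dots> \<le> B * norm h" using B by (intro mult_right_mono) auto
      finally show "norm (grad \<phi> x \<bullet> h) \<le> norm ((B * norm h) * indicator C x)"
        using C(2)[of x] B(1) by (cases "x \<in> C") (auto simp: abs_mult)
    qed
  qed (use ind in auto)
qed

text \<open>The first equation is the reason why subtracting a constant from a function leaves its
  weak derivative unchanged.\<close>

lemma partial_deriv_integral_0:
  assumes "\<phi> \<in> C1_compact_support U" "open U"
  shows "(LINT x|lebesgue_on U. partial_deriv j \<phi> x) = 0" "integrable (lebesgue_on U) (partial_deriv j \<phi>)"
proof -
  have z: "indicator U x *\<^sub>R partial_deriv j \<phi> x = grad \<phi> x \<bullet> axis j 1" for x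
    using C1_compact_supportD(6)[OF assms(1)] by (auto simp: partial_deriv_eq_grad indicator_def)
  have U: "\<phi> \<in> C1_compact_support UNIV" using assms(1) by (rule C1_compact_support_mono) simp
  show "(LINT x|lebesgue_on U. partial_deriv j \<phi> x) = 0"
    unfolding lebesgue_on_open(1)[OF assms(2)] z by (rule integral_grad_eq_0[OF U])
  show "integrable (lebesgue_on U) (partial_deriv j \<phi>)"
    unfolding lebesgue_on_open(2)[OF assms(2)] z by (rule test_function_integrable(2)[OF assms(1)])
qed

lemma integrable_mult_partial_deriv:
  fixes w :: "real^'n \<Rightarrow> real"
  assumes "\<phi> \<in> C1_compact_support U" "integrable (lebesgue_on V) w"
  shows "integrable (lebesgue_on V) (\<lambda>x. w x * partial_deriv j \<phi> x)"
proof -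
  note D = C1_compact_supportD[OF assms(1)]
  obtain B where B: "\<And>x. norm (grad \<phi> x) \<le> B" using D(7) by auto
  have pb: "\<bar>partial_deriv j \<phi> x\<bar> \<le> B" for x
    using B[of x] component_le_norm_cart[of "grad \<phi> x" j] by (simp add: grad_def)
  have "(\<lambda>x. grad \<phi> x \<bullet> axis j 1) \<in> borel_measurable borel" using D(5) by simp
  then have pm: "partial_deriv j \<phi> \<in> borel_measurable borel" by (simp add: partial_deriv_eq_grad[abs_def])
  show ?thesis
  proof (rule Bochner_Integration.integrable_bound[of _ "\<lambda>x. w x * B"])
    show "integrable (lebesgue_on V) (\<lambda>x. w x * B)" using assms(2) by simp
    show "(\<lambda>x. w x * partial_deriv j \<phi> x) \<in> borel_measurable (lebesgue_on V)"
      by (intro borel_measurable_times borel_measurable_integrable[OF assms(2)] measurable_restrict_space1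
          borel_measurable_lebesgueI_borel[OF pm])
    show "AE x in lebesgue_on V. norm (w x * partial_deriv j \<phi> x) \<le> norm (w x * B)"
      by (auto intro!: AE_I2 mult_left_mono order_trans[OF pb abs_ge_self] simp: abs_mult)
  qed
qed

text \<open>The measure is pushed forward without a Jacobian, so the density carries the factors:
  \<open>1 / \<epsilon> ^ CARD('n)\<close> from the change of variables in the Lebesgue integral,
  and \<open>\<epsilon>\<close> from the chain rule for the test function.\<close>

lemma weak_deriv_rescaled:
  fixes u :: "real^'n \<Rightarrow> real^'m" and x :: "real^'n" and a :: "real^'m" and c :: real
  assumes wd: "weak_deriv \<Omega> u \<tau> F" and u: "integrable (lebesgue_on \<Omega>) u" and \<Omega>: "open \<Omega>"
    and K: "open K" "bounded K" and \<epsilon>: "0 < \<epsilon>" and sub: "dilate_at K \<epsilon> x \<subseteq> \<Omega>"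
  defines "w \<equiv> \<lambda>y. c *\<^sub>R (u (x + \<epsilon> *\<^sub>R y) - a)"
    and "\<tau>' \<equiv> distr \<tau> borel (\<lambda>z. (1 / \<epsilon>) *\<^sub>R (z - x))"
    and "F' \<equiv> \<lambda>y. (c * \<epsilon> / \<epsilon> ^ CARD('n)) *\<^sub>R F (x + \<epsilon> *\<^sub>R y)"
  shows "weak_deriv K w \<tau>' F'" and "integrable (lebesgue_on K) w"
    and "\<And>B. B \<in> sets borel \<Longrightarrow> measure \<tau>' B = measure \<tau> (dilate_at B \<epsilon> x)"
    and "0 \<le> c \<Longrightarrow> (LINT y:K|\<tau>'. norm (F' y)) = (c * \<epsilon> / \<epsilon> ^ CARD('n)) * (LINT z:dilate_at K \<epsilon> x|\<tau>. norm (F z))"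
proof -
  let ?S = "\<lambda>z. (1 / \<epsilon>) *\<^sub>R (z - x)"
  let ?E = "dilate_at K \<epsilon> x"
  have t: "finite_measure \<tau>" "sets \<tau> = sets borel" "integrable \<tau> F" using wd by (auto simp: weak_deriv_def)
  have sp: "space \<tau> = UNIV" using sets_eq_imp_space_eq[OF t(2)] by simp
  have Sm: "?S \<in> measurable \<tau> borel" unfolding measurable_cong_sets[OF t(2) refl] by measurable
  have Tb: "(\<lambda>y. x + \<epsilon> *\<^sub>R y) \<in> borel_measurable borel" by measurable
  have TS: "x + \<epsilon> *\<^sub>R ?S z = z" for z using \<epsilon> by simp
  have Fb: "F \<in> borel_measurable borel" using t by (auto dest: borel_measurable_integrable cong: measurable_cong_sets)
  have FTb: "(\<lambda>y. F (x + \<epsilon> *\<^sub>R y)) \<in> borel_measurable borel" by (rule measurable_compose[OF Tb Fb])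
  have uE: "integrable (lebesgue_on ?E) u"
    by (rule integrable_lebesgue_on_subset[OF u \<Omega> open_dilate_at[OF K(1) \<epsilon>] sub])
  have uK: "integrable (lebesgue_on K) (\<lambda>y. u (x + \<epsilon> *\<^sub>R y))"
    by (rule lebesgue_on_scaled_integral(2)[OF K(1) \<epsilon> uE])
  show wK: "integrable (lebesgue_on K) w"
    unfolding w_def by (intro integrable_scaleR_right Bochner_Integration.integrable_diff uK integrable_lebesgue_on_const K)
  have fin: "finite_measure \<tau>'" unfolding \<tau>'_def by (rule finite_measure.finite_measure_distr[OF t(1) Sm])
  have s: "sets \<tau>' = sets borel" by (simp add: \<tau>'_def)
  have pre: "?S -` B \<inter> space \<tau> = dilate_at B \<epsilon> x" for B
  proof -
    have "z \<in> dilate_at B \<epsilon> x \<longleftrightarrow> ?S z \<in> B" for z using dilate_at_iff[OF \<epsilon>, of x "?S z" B] unfolding TS .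
    then show ?thesis using sp by auto
  qed
  show "measure \<tau>' B = measure \<tau> (dilate_at B \<epsilon> x)" if "B \<in> sets borel" for B
    unfolding \<tau>'_def using measure_distr[OF Sm that] pre by simp
  have "integrable \<tau> (\<lambda>z. F (x + \<epsilon> *\<^sub>R ?S z))" unfolding TS by (rule t(3))
  then have "integrable \<tau>' (\<lambda>y. F (x + \<epsilon> *\<^sub>R y))"
    unfolding \<tau>'_def by (subst integrable_distr_eq[OF Sm FTb])
  then have F'i: "integrable \<tau>' F'" unfolding F'_def by (rule integrable_scaleR_right)
  show "weak_deriv K w \<tau>' F'"
    unfolding weak_deriv_def
  proof (intro conjI fin s F'i ballI allI)
    fix \<phi> i j assume \<phi>: "\<phi> \<in> C1_compact_support K"
    define \<psi> where "\<psi> = (\<lambda>z. \<phi> ((1 / \<epsilon>) *\<^sub>R (z - x)))"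
    have e0: "\<epsilon> \<noteq> 0" using \<epsilon> by simp
    have \<psi>E: "\<psi> \<in> C1_compact_support ?E" and g\<psi>: "grad \<psi> = (\<lambda>z. (1 / \<epsilon>) *\<^sub>R grad \<phi> ((1 / \<epsilon>) *\<^sub>R (z - x)))"
      using C1_compact_support_affine[OF \<phi> e0, of x] by (auto simp: \<psi>_def dilate_at_def)
    have \<psi>\<Omega>: "\<psi> \<in> C1_compact_support \<Omega>" using \<psi>E sub by (rule C1_compact_support_mono)
    have pd: "partial_deriv j \<phi> y = \<epsilon> * partial_deriv j \<psi> (x + \<epsilon> *\<^sub>R y)" for y
      using \<epsilon> by (simp add: partial_deriv_eq_grad g\<psi>)
    have ui: "integrable (lebesgue_on V) (\<lambda>z. u z $ i)" if "integrable (lebesgue_on V) u" for V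
      by (rule integrable_bounded_linear[OF bounded_linear_vec_nth that])
    have uKi: "integrable (lebesgue_on K) (\<lambda>y. u (x + \<epsilon> *\<^sub>R y) $ i)"
      by (rule integrable_bounded_linear[OF bounded_linear_vec_nth uK])
    have "(LINT y|lebesgue_on K. w y $ i * partial_deriv j \<phi> y)
        = (LINT y|lebesgue_on K. c * (u (x + \<epsilon> *\<^sub>R y) $ i * partial_deriv j \<phi> y) - (c * a $ i) * partial_deriv j \<phi> y)"
      by (rule Bochner_Integration.integral_cong) (auto simp: w_def algebra_simps)
    also have "\<dots> = c * (LINT y|lebesgue_on K. u (x + \<epsilon> *\<^sub>R y) $ i * partial_deriv j \<phi> y)"
      using integrable_mult_partial_deriv[OF \<phi> uKi, of j] partial_deriv_integral_0[OF \<phi> K(1), of j] by simp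
    also have "(LINT y|lebesgue_on K. u (x + \<epsilon> *\<^sub>R y) $ i * partial_deriv j \<phi> y)
        = (LINT y|lebesgue_on K. (\<lambda>z. \<epsilon> * (u z $ i * partial_deriv j \<psi> z)) (x + \<epsilon> *\<^sub>R y))"
      by (rule Bochner_Integration.integral_cong) (auto simp: pd)
    also have "\<dots> = (1 / \<epsilon> ^ DIM(real^'n)) *\<^sub>R (LINT z|lebesgue_on ?E. \<epsilon> * (u z $ i * partial_deriv j \<psi> z))"
      by (rule lebesgue_on_scaled_integral(1)[OF K(1) \<epsilon>])
         (intro integrable_mult_right integrable_mult_partial_deriv[OF \<psi>E] ui[OF uE])
    also have "(LINT z|lebesgue_on ?E. \<epsilon> * (u z $ i * partial_deriv j \<psi> z)) = \<epsilon> * (LINT z|lebesgue_on ?E. u z $ i * partial_deriv j \<psi> z)"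
      by simp
    also have "(LINT z|lebesgue_on ?E. u z $ i * partial_deriv j \<psi> z) = (LINT z|lebesgue_on \<Omega>. u z $ i * partial_deriv j \<psi> z)"
      unfolding lebesgue_on_open(1)[OF \<Omega>] lebesgue_on_open(1)[OF open_dilate_at[OF K(1) \<epsilon>]]
    proof (rule Bochner_Integration.integral_cong[OF refl])
      fix z
      have "z \<in> ?E \<or> partial_deriv j \<psi> z = 0"
        using C1_compact_supportD(6)[OF \<psi>E] by (auto simp: partial_deriv_eq_grad)
      then show "indicator ?E z *\<^sub>R (u z $ i * partial_deriv j \<psi> z) = indicator \<Omega> z *\<^sub>R (u z $ i * partial_deriv j \<psi> z)"
        using sub by (auto simp: indicator_def)
    qed
    also have "\<dots> = - (LINT z|\<tau>. \<psi> z * F z $ i $ j)"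
      using wd \<psi>\<Omega> unfolding weak_deriv_def by blast
    also have "(LINT z|\<tau>. \<psi> z * F z $ i $ j) = (LINT y|\<tau>'. \<phi> y * F (x + \<epsilon> *\<^sub>R y) $ i $ j)"
    proof -
      have "(\<lambda>y. F (x + \<epsilon> *\<^sub>R y) $ i $ j) \<in> borel_measurable borel"
        by (rule measurable_compose[OF FTb borel_measurable_continuous_onI[OF bounded_linear.continuous_on[OF bounded_linear_entry continuous_on_id]]])
      then have "(\<lambda>y. \<phi> y * F (x + \<epsilon> *\<^sub>R y) $ i $ j) \<in> borel_measurable borel"
        using C1_compact_supportD(4)[OF \<phi>] by simp
      then have "(LINT y|\<tau>'. \<phi> y * F (x + \<epsilon> *\<^sub>R y) $ i $ j) = (LINT z|\<tau>. \<phi> (?S z) * F (x + \<epsilon> *\<^sub>R ?S z) $ i $ j)"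
        unfolding \<tau>'_def by (rule integral_distr[OF Sm])
      then show ?thesis unfolding TS \<psi>_def by simp
    qed
    finally have "(LINT y|lebesgue_on K. w y $ i * partial_deriv j \<phi> y)
      = - ((c * \<epsilon> / \<epsilon> ^ CARD('n)) * (LINT y|\<tau>'. \<phi> y * F (x + \<epsilon> *\<^sub>R y) $ i $ j))" by simp
    also have "(c * \<epsilon> / \<epsilon> ^ CARD('n)) * (LINT y|\<tau>'. \<phi> y * F (x + \<epsilon> *\<^sub>R y) $ i $ j) = (LINT y|\<tau>'. \<phi> y * F' y $ i $ j)"
      unfolding integral_mult_right_zero[symmetric]
      by (rule Bochner_Integration.integral_cong) (auto simp: F'_def)
    finally show "(LINT y|lebesgue_on K. w y $ i * partial_deriv j \<phi> y) = - (LINT y|\<tau>'. \<phi> y * F' y $ i $ j)" .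
  qed
  assume c: "0 \<le> c"
  have "(LINT y:K|\<tau>'. norm (F' y)) = (LINT y|\<tau>'. (c * \<epsilon> / \<epsilon> ^ CARD('n)) * (indicator K y *\<^sub>R norm (F (x + \<epsilon> *\<^sub>R y))))"
    unfolding set_lebesgue_integral_def
    by (rule Bochner_Integration.integral_cong) (use c \<epsilon> in \<open>auto simp: F'_def\<close>)
  also have "\<dots> = (c * \<epsilon> / \<epsilon> ^ CARD('n)) * (LINT y|\<tau>'. indicator K y *\<^sub>R norm (F (x + \<epsilon> *\<^sub>R y)))"
    by (rule integral_mult_right_zero)
  also have "(LINT y|\<tau>'. indicator K y *\<^sub>R norm (F (x + \<epsilon> *\<^sub>R y))) = (LINT z|\<tau>. indicator K (?S z) *\<^sub>R norm (F (x + \<epsilon> *\<^sub>R ?S z)))"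
    unfolding \<tau>'_def by (rule integral_distr[OF Sm]) (use FTb K in auto)
  also have "\<dots> = (LINT z:?E|\<tau>. norm (F z))"
    unfolding set_lebesgue_integral_def TS
  proof (rule Bochner_Integration.integral_cong[OF refl])
    fix z
    have "z \<in> ?E \<longleftrightarrow> ?S z \<in> K" using dilate_at_iff[OF \<epsilon>, of x "?S z" K] unfolding TS .
    then show "indicator K (?S z) *\<^sub>R norm (F z) = indicator ?E z *\<^sub>R norm (F z)" by (simp add: indicator_def)
  qed
  finally show "(LINT y:K|\<tau>'. norm (F' y)) = (c * \<epsilon> / \<epsilon> ^ CARD('n)) * (LINT z:?E|\<tau>. norm (F z))" .
qed

text \<open>A finite Borel measure on the whole space, the format that \<open>weak_deriv\<close>
  prescribes.\<close>

definition lborel_restricted :: "'a::euclidean_space set \<Rightarrow> 'a measure" where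
  "lborel_restricted K = density lborel (indicator K)"

lemma lborel_restricted:
  assumes "open K" "bounded K"
  shows "finite_measure (lborel_restricted K)" "sets (lborel_restricted K) = sets borel"
    "\<And>B. B \<in> sets borel \<Longrightarrow> emeasure (lborel_restricted K) B = emeasure lborel (B \<inter> K)"
    "\<And>B. B \<in> sets borel \<Longrightarrow> measure (lborel_restricted K) B = measure lborel (B \<inter> K)"
    "\<And>f :: _ \<Rightarrow> real. f \<in> borel_measurable borel \<Longrightarrow> (LINT x|lborel_restricted K. f x) = (LINT x|lborel. indicator K x * f x)"
proof -
  have K: "K \<in> sets borel" using assms(1) by simp
  show s: "sets (lborel_restricted K) = sets borel" by (simp add: lborel_restricted_def)
  show e: "emeasure (lborel_restricted K) B = emeasure lborel (B \<inter> K)" if "B \<in> sets borel" for B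
    unfolding lborel_restricted_def using that K
    by (subst emeasure_density) (auto simp: indicator_inter_arith[symmetric] Int_commute)
  then show "measure (lborel_restricted K) B = measure lborel (B \<inter> K)" if "B \<in> sets borel" for B
    using that by (simp add: measure_def)
  have "space (lborel_restricted K) = UNIV" by (simp add: lborel_restricted_def)
  then show "finite_measure (lborel_restricted K)"
    using e[of UNIV] emeasure_bounded_finite[OF assms(2)] by (intro finite_measureI) auto
  show "(LINT x|lborel_restricted K. f x) = (LINT x|lborel. indicator K x * f x)" if "f \<in> borel_measurable borel" for f :: "_ \<Rightarrow> real"
  proof -
    have "lborel_restricted K = density lborel (\<lambda>x. ennreal (indicator K x))"
      unfolding lborel_restricted_def by (rule density_cong) (use K in \<open>auto simp: ennreal_indicator\<close>)
    then show ?thesis using that K by (simp add: integral_density)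
  qed
qed

lemma weak_deriv_linear:
  fixes M :: "real^'n^'m"
  assumes K: "open K" "bounded K"
  shows "weak_deriv K (\<lambda>y. M *v y) (lborel_restricted K) (\<lambda>_. M)" and "integrable (lebesgue_on K) (\<lambda>y. M *v y)"
proof -
  note L = lborel_restricted[OF K]
  show i: "integrable (lebesgue_on K) (\<lambda>y. M *v y)"
  proof -
    obtain R where R: "0 < R" "\<And>y. y \<in> K \<Longrightarrow> norm y \<le> R" using K(2) bounded_pos by metis
    show ?thesis
    proof (rule Bochner_Integration.integrable_bound[OF integrable_lebesgue_on_const[OF K(2,1), of "onorm ((*v) M) * R"]])
      show "(\<lambda>y. M *v y) \<in> borel_measurable (lebesgue_on K)"
        by (intro measurable_restrict_space1 measurable_completion)
           (simp add: borel_measurable_continuous_onI matrix_vector_mult_linear_continuous_on)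
      show "AE y in lebesgue_on K. norm (M *v y) \<le> norm (onorm ((*v) M) * R)"
      proof (rule AE_I2)
        fix y assume "y \<in> space (lebesgue_on K)"
        then have y: "norm y \<le> R" using R by simp
        have "norm (M *v y) \<le> onorm ((*v) M) * norm y" by (rule onorm[OF matrix_vector_mul_bounded_linear])
        also have "\<dots> \<le> onorm ((*v) M) * R" using y by (intro mult_left_mono onorm_pos_le matrix_vector_mul_bounded_linear)
        finally show "norm (M *v y) \<le> norm (onorm ((*v) M) * R)" by simp
      qed
    qed
  qed
  have test: "(LINT y|lebesgue_on K. (M *v y) $ i * partial_deriv j \<phi> y) = - (LINT y|lborel_restricted K. \<phi> y * M $ i $ j)"
    if \<phi>: "\<phi> \<in> C1_compact_support K" for \<phi> i j
  proof -
    \<comment> \<open>The gradient of \<open>y $ k * \<phi> y\<close> integrates to 0, which leaves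
      minus the integral of \<open>\<phi>\<close> exactly when \<open>k = j\<close>; in the sum over
      \<open>k\<close> only the entry \<open>M $ i $ j\<close> survives.\<close>
    have k: "(LINT y|lebesgue. y $ k * (grad \<phi> y \<bullet> axis j 1)) = - (if k = j then (LINT y|lebesgue. \<phi> y) else 0)
       \<and> integrable lebesgue (\<lambda>y. y $ k * (grad \<phi> y \<bullet> axis j 1))" for k
    proof -
      define \<psi> where "\<psi> = (\<lambda>y. y $ k * \<phi> y)"
      have \<psi>: "\<psi> \<in> C1_compact_support K" "grad \<psi> = (\<lambda>y. (y $ k) *\<^sub>R grad \<phi> y + \<phi> y *\<^sub>R axis k 1)"
        unfolding \<psi>_def by (rule C1_compact_support_coordinate_mult[OF \<phi>])+
      have \<psi>U: "\<psi> \<in> C1_compact_support UNIV" by (rule C1_compact_support_mono[OF \<psi>(1)]) simp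
      have eq: "y $ k * (grad \<phi> y \<bullet> axis j 1) = grad \<psi> y \<bullet> axis j 1 - \<phi> y * (if k = j then 1 else 0)" for y
        unfolding \<psi>(2) by (simp add: inner_add_left inner_axis_axis)
      have i1: "integrable lebesgue (\<lambda>y. grad \<psi> y \<bullet> axis j 1)" by (rule test_function_integrable(2)[OF \<psi>(1)])
      have i2: "integrable lebesgue (\<lambda>y. \<phi> y * (if k = j then 1 else 0))"
        using test_function_integrable(1)[OF \<phi>] by simp
      have "(LINT y|lebesgue. y $ k * (grad \<phi> y \<bullet> axis j 1)) = (LINT y|lebesgue. grad \<psi> y \<bullet> axis j 1) - (LINT y|lebesgue. \<phi> y * (if k = j then 1 else 0))"
        unfolding eq by (rule Bochner_Integration.integral_diff[OF i1 i2])
      moreover have "integrable lebesgue (\<lambda>y. y $ k * (grad \<phi> y \<bullet> axis j 1))"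
        unfolding eq by (rule Bochner_Integration.integrable_diff[OF i1 i2])
      ultimately show ?thesis using integral_grad_eq_0[OF \<psi>U] by simp
    qed
    have "(LINT y|lebesgue_on K. (M *v y) $ i * partial_deriv j \<phi> y) = (LINT y|lebesgue. (\<Sum>k\<in>UNIV. M $ i $ k * (y $ k * (grad \<phi> y \<bullet> axis j 1))))"
      unfolding lebesgue_on_open(1)[OF K(1)]
    proof (rule Bochner_Integration.integral_cong[OF refl])
      fix y
      have "y \<in> K \<or> grad \<phi> y = 0" using C1_compact_supportD(6)[OF \<phi>] by blast
      then show "indicator K y *\<^sub>R ((M *v y) $ i * partial_deriv j \<phi> y) = (\<Sum>k\<in>UNIV. M $ i $ k * (y $ k * (grad \<phi> y \<bullet> axis j 1)))"
        unfolding partial_deriv_eq_grad by (auto simp: matrix_vector_mult_def sum_distrib_right mult.assoc)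
    qed
    also have "\<dots> = (\<Sum>k\<in>UNIV. M $ i $ k * (LINT y|lebesgue. y $ k * (grad \<phi> y \<bullet> axis j 1)))"
      using k by (subst Bochner_Integration.integral_sum) auto
    also have "\<dots> = (\<Sum>k\<in>UNIV. if k = j then - (M $ i $ k * (LINT y|lebesgue. \<phi> y)) else 0)"
      by (rule sum.cong) (auto simp: k)
    also have "\<dots> = - (M $ i $ j * (LINT y|lebesgue. \<phi> y))" by simp
    also have "(LINT y|lebesgue. \<phi> y) = (LINT y|lborel. \<phi> y)"
      by (rule integral_completion) (use C1_compact_supportD(4)[OF \<phi>] in simp)
    also have "M $ i $ j * (LINT y|lborel. \<phi> y) = (LINT y|lborel. indicator K y * (\<phi> y * M $ i $ j))"
      unfolding integral_mult_right_zero[symmetric]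
      by (rule Bochner_Integration.integral_cong[OF refl])
         (use C1_compact_supportD(6)[OF \<phi>] in \<open>auto simp: indicator_def\<close>)
    also have "\<dots> = (LINT y|lborel_restricted K. \<phi> y * M $ i $ j)"
      by (rule L(5)[symmetric]) (use C1_compact_supportD(4)[OF \<phi>] in simp)
    finally show ?thesis .
  qed
  have "integrable (lborel_restricted K) (\<lambda>_. M)" by (rule finite_measure.integrable_const[OF L(1)])
  then show "weak_deriv K (\<lambda>y. M *v y) (lborel_restricted K) (\<lambda>_. M)"
    unfolding weak_deriv_def using L(1,2) test by blast
qed

section \<open>Density points and comparison with Lebesgue measure\<close>

lemma restricted_measure:
  assumes fin: "finite_measure \<tau>" and sets: "sets \<tau> = sets borel" and S: "S \<in> sets borel"
  shows "finite_measure (density \<tau> (indicator S))" "sets (density \<tau> (indicator S)) = sets borel"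
    "\<And>B. B \<in> sets borel \<Longrightarrow> measure (density \<tau> (indicator S)) B = measure \<tau> (B \<inter> S)"
    "\<And>B. B \<in> sets borel \<Longrightarrow> emeasure (density \<tau> (indicator S)) B = emeasure \<tau> (B \<inter> S)"
proof -
  interpret finite_measure \<tau> by fact
  show s: "sets (density \<tau> (indicator S)) = sets borel" using sets by simp
  show e: "emeasure (density \<tau> (indicator S)) B = emeasure \<tau> (B \<inter> S)" if "B \<in> sets borel" for B
    using emeasure_restricted[of S \<tau> B] S that sets by (simp add: Int_commute)
  then show "measure (density \<tau> (indicator S)) B = measure \<tau> (B \<inter> S)" if "B \<in> sets borel" for B
    using that by (simp add: measure_def)
  have "space \<tau> = UNIV" using sets_eq_imp_space_eq[OF sets] by simp
  then show "finite_measure (density \<tau> (indicator S))"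
    using e[of UNIV] by (intro finite_measureI) auto
qed

context gauge_norm
begin

text \<open>The restriction of \<open>\<tau>\<close> to the complement of \<open>E\<close> vanishes
  on \<open>E\<close>, so on small balls around almost every point of \<open>E\<close> it is
  negligible against \<open>\<tau>\<close>.\<close>

lemma AE_density_point:
  assumes fin: "finite_measure \<tau>" and sets: "sets \<tau> = sets borel" and E: "E \<in> sets borel"
  shows "AE x in \<tau>. x \<in> E \<longrightarrow>
     (\<forall>e>0. eventually (\<lambda>r. measure \<tau> (gball x r - E) \<le> e * measure \<tau> (gball x r)) (at_right 0))"
proof -
  have E': "- E \<in> sets borel" using E by auto
  note R = restricted_measure[OF fin sets E']
  have "emeasure (density \<tau> (indicator (- E))) E = 0" using R(4)[OF E] by simp
  then have "AE x in \<tau>. x \<in> E \<longrightarrow> eventually (\<lambda>r. measure (density \<tau> (indicator (- E))) (gball x r)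
      \<le> (1 / real (Suc m)) * measure \<tau> (gball x r)) (at_right 0)" for m :: nat
    by (intro AE_measure_gball_le[OF fin R(1) sets R(2) E]) auto
  then have "AE x in \<tau>. \<forall>m::nat. x \<in> E \<longrightarrow> eventually (\<lambda>r. measure (density \<tau> (indicator (- E))) (gball x r)
      \<le> (1 / real (Suc m)) * measure \<tau> (gball x r)) (at_right 0)"
    by (simp only: AE_all_countable simp_thms)
  then show ?thesis
  proof eventually_elim
    case (elim x)
    show ?case
    proof (intro impI allI)
      fix e :: real assume x: "x \<in> E" and e: "0 < e"
      obtain m :: nat where m: "1 / real (Suc m) < e" using nat_approx_posE[OF e] by auto
      have "eventually (\<lambda>r. measure (density \<tau> (indicator (- E))) (gball x r)
          \<le> (1 / real (Suc m)) * measure \<tau> (gball x r)) (at_right 0)" using elim x by blast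
      then show "eventually (\<lambda>r. measure \<tau> (gball x r - E) \<le> e * measure \<tau> (gball x r)) (at_right 0)"
      proof eventually_elim
        case (elim r)
        have "measure \<tau> (gball x r - E) = measure (density \<tau> (indicator (- E))) (gball x r)"
          by (subst R(3)) (auto simp: Diff_eq)
        also have "\<dots> \<le> (1 / real (Suc m)) * measure \<tau> (gball x r)" by (rule elim)
        also have "\<dots> \<le> e * measure \<tau> (gball x r)" using m by (intro mult_right_mono) auto
        finally show ?case .
      qed
    qed
  qed
qed

text \<open>Almost every point is a density point of all those among the countably many sets
  \<open>E q k\<close> that contain it. As \<open>q\<close> ranges over a dense set, it can be taken
  close to \<open>F x\<close>.\<close>

lemma AE_approx_continuous:
  fixes F :: "'a \<Rightarrow> 'b::euclidean_space"
  assumes fin: "finite_measure \<tau>" and sets: "sets \<tau> = sets borel" and F: "F \<in> borel_measurable borel"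
  shows "AE x in \<tau>. \<forall>s>0. \<forall>e>0. eventually
     (\<lambda>r. measure \<tau> (gball x r \<inter> {z. s \<le> norm (F z - F x)}) \<le> e * measure \<tau> (gball x r)) (at_right 0)"
proof -
  interpret finite_measure \<tau> by fact
  obtain D :: "'b set" where D: "countable D" "\<And>X. open X \<Longrightarrow> X \<noteq> {} \<Longrightarrow> \<exists>d\<in>D. d \<in> X"
    using countable_dense_exists by blast
  define E where "E q k = {z. norm (F z - q) < 1 / real (Suc k)}" for q and k :: nat
  have E: "E q k \<in> sets borel" for q k unfolding E_def using F by measurable
  have "AE x in \<tau>. \<forall>q\<in>D. \<forall>k. x \<in> E q k \<longrightarrow>
     (\<forall>e>0. eventually (\<lambda>r. measure \<tau> (gball x r - E q k) \<le> e * measure \<tau> (gball x r)) (at_right 0))"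
    by (subst AE_ball_countable[OF D(1)], subst AE_all_countable) (use AE_density_point[OF fin sets E] in blast)
  then show ?thesis
  proof eventually_elim
    case (elim x)
    show ?case
    proof (intro allI impI)
      fix s e :: real assume s: "0 < s" and e: "0 < e"
      \<comment> \<open>The distances of \<open>F x\<close> and of \<open>F z\<close> to
        \<open>q\<close> together have to stay below \<open>s\<close>, hence the half.\<close>
      have "0 < s / 2" using s by simp
      then obtain k :: nat where k: "1 / real (Suc k) < s / 2" by (rule nat_approx_posE)
      obtain q where q: "q \<in> D" "q \<in> ball (F x) (1 / real (Suc k))"
        using D(2)[of "ball (F x) (1 / real (Suc k))"] by (metis centre_in_ball empty_iff of_nat_0_less_iff open_ball zero_less_Suc zero_less_divide_1_iff)
      have "x \<in> E q k" using q(2) by (simp add: E_def dist_norm)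
      then have "eventually (\<lambda>r. measure \<tau> (gball x r - E q k) \<le> e * measure \<tau> (gball x r)) (at_right 0)"
        using elim q(1) e by blast
      then show "eventually (\<lambda>r. measure \<tau> (gball x r \<inter> {z. s \<le> norm (F z - F x)}) \<le> e * measure \<tau> (gball x r)) (at_right 0)"
      proof eventually_elim
        case (elim r)
        have "gball x r \<inter> {z. s \<le> norm (F z - F x)} \<subseteq> gball x r - E q k"
        proof
          fix z assume z: "z \<in> gball x r \<inter> {z. s \<le> norm (F z - F x)}"
          have "norm (F z - F x) \<le> norm (F z - q) + norm (F x - q)" using norm_triangle_ineq4[of "F z - q" "F x - q"] by simp
          then show "z \<in> gball x r - E q k" using z k \<open>x \<in> E q k\<close> by (auto simp: E_def)
        qed
        then have "measure \<tau> (gball x r \<inter> {z. s \<le> norm (F z - F x)}) \<le> measure \<tau> (gball x r - E q k)"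
          by (rule finite_measure_mono) (use E sets in auto)
        then show ?case using elim by linarith
      qed
    qed
  qed
qed

end

text \<open>The infimum of the measures of Borel sets containing \<open>B\<close> is attained, and
  deleting from the minimiser a Borel set that misses \<open>B\<close> cannot lower it. This makes
  density points available for sets of unknown measurability.\<close>

lemma measurable_hull:
  assumes fin: "finite_measure \<tau>" and sets: "sets \<tau> = sets borel"
  obtains H where "H \<in> sets borel" "B \<subseteq> H" "\<And>A. A \<in> sets borel \<Longrightarrow> A \<subseteq> H \<Longrightarrow> A \<inter> B = {} \<Longrightarrow> measure \<tau> A = 0"
proof -
  interpret finite_measure \<tau> by fact
  let ?S = "{H \<in> sets borel. B \<subseteq> H}"
  let ?I = "INF H\<in>?S. measure \<tau> H"
  have ne: "?S \<noteq> {}" by (auto intro: exI[of _ UNIV])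
  have bdd: "bdd_below (measure \<tau> ` ?S)" by (rule bdd_belowI[of _ 0]) auto
  have "\<exists>H\<in>?S. measure \<tau> H < ?I + 1 / real (Suc j)" for j
    using cINF_less_iff[OF ne bdd, of "?I + 1 / real (Suc j)"] by simp
  then have "\<forall>j. \<exists>H. H \<in> ?S \<and> measure \<tau> H < ?I + 1 / real (Suc j)" by (simp only: Bex_def simp_thms)
  from choice[OF this] obtain H where "\<forall>j. H j \<in> ?S \<and> measure \<tau> (H j) < ?I + 1 / real (Suc j)" ..
  then have H: "\<And>j. H j \<in> ?S" "\<And>j. measure \<tau> (H j) < ?I + 1 / real (Suc j)" by simp_all
  define G where "G = (\<Inter>j. H j)"
  have G: "G \<in> ?S" using H(1) by (auto simp: G_def)
  have "measure \<tau> G \<le> ?I"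
  proof (rule LIMSEQ_le_const)
    have "(\<lambda>j. ?I + inverse (real (Suc j))) \<longlonglongrightarrow> ?I + 0"
      by (intro tendsto_add tendsto_const LIMSEQ_inverse_real_of_nat)
    then show "(\<lambda>j. ?I + 1 / real (Suc j)) \<longlonglongrightarrow> ?I" by (simp add: inverse_eq_divide)
    have "measure \<tau> G \<le> measure \<tau> (H j)" for j
      using H(1)[of j] G sets by (intro finite_measure_mono) (auto simp: G_def)
    then show "\<exists>n. \<forall>j\<ge>n. measure \<tau> G \<le> ?I + 1 / real (Suc j)" using H(2) by (meson less_imp_le order_trans)
  qed
  show thesis
  proof (rule that[of G])
    fix A assume A: "A \<in> sets borel" "A \<subseteq> G" "A \<inter> B = {}"
    have "G - A \<in> ?S" using G A by auto
    then have "?I \<le> measure \<tau> (G - A)" by (rule cINF_lower[OF bdd])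
    moreover have "measure \<tau> (G - A) = measure \<tau> G - measure \<tau> A"
      using A G sets by (intro finite_measure_Diff) auto
    ultimately show "measure \<tau> A = 0" using \<open>measure \<tau> G \<le> ?I\<close> measure_nonneg[of \<tau> A] by linarith
  qed (use G in auto)
qed

text \<open>Off a maximal null set, \<open>\<nu>\<close> has a Lebesgue density \<open>f\<close> on
  \<open>K\<close>, and \<open>f\<close> cannot vanish almost everywhere there because no null set
  carries \<open>\<nu>\<close> in \<open>K\<close>. Sorting the positive values of \<open>f\<close>
  into geometric slices of ratio \<open>1 + \<eta>\<close>, one of countably many slices has
  positive Lebesgue measure.\<close>

lemma absolutely_continuous_level_set:
  fixes \<nu> :: "'a::euclidean_space measure"
  assumes fin: "finite_measure \<nu>" and sets: "sets \<nu> = sets borel" and K: "K \<in> sets borel"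
    and ns: "\<And>A. A \<in> null_sets lborel \<Longrightarrow> measure \<nu> (K - A) \<noteq> 0" and \<eta>: "0 < \<eta>"
  obtains c E where "0 < c" "E \<in> sets borel" "E \<subseteq> K" "E \<notin> null_sets lborel"
    "\<And>B. B \<in> sets borel \<Longrightarrow> B \<subseteq> E \<Longrightarrow> ennreal c * emeasure lborel B \<le> emeasure \<nu> B"
    "\<And>B. B \<in> sets borel \<Longrightarrow> B \<subseteq> E \<Longrightarrow> emeasure \<nu> B \<le> ennreal ((1 + \<eta>) * c) * emeasure lborel B"
proof -
  interpret finite_measure \<nu> by fact
  have sl: "sets \<nu> = sets lborel" using sets by simp
  obtain A where A: "A \<in> null_sets lborel" "\<And>B. B \<in> null_sets lborel \<Longrightarrow> B - A \<in> null_sets \<nu>"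
    by (rule maximal_null_set[OF fin sl]) blast
  define S where "S = K - A"
  have S: "S \<in> sets borel" unfolding S_def using null_setsD2[OF A(1)] by (intro sets.Diff K) simp
  define \<nu>0 where "\<nu>0 = density \<nu> (indicator S)"
  note R = restricted_measure[OF fin sets S, folded \<nu>0_def]
  have ac: "absolutely_continuous lborel \<nu>0"
    unfolding absolutely_continuous_def
  proof
    fix B :: "'a set" assume B: "B \<in> null_sets lborel"
    have "B \<inter> S \<in> null_sets \<nu>"
    proof (rule null_sets_subset[OF A(2)[OF B]])
      show "B \<inter> S \<in> sets \<nu>" unfolding sets using null_setsD2[OF B] S by (intro sets.Int) simp_all
      show "B \<inter> S \<subseteq> B - A" unfolding S_def by blast
    qed
    moreover have Bb: "B \<in> sets borel" using null_setsD2[OF B] by simp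
    ultimately have "emeasure \<nu>0 B = 0" using R(4)[OF Bb] by (simp add: null_sets_def)
    then show "B \<in> null_sets \<nu>0" using Bb R(2) by (intro null_setsI) simp_all
  qed
  obtain f where f: "f \<in> borel_measurable lborel" "density lborel f = \<nu>0"
    using sigma_finite_measure.Radon_Nikodym[OF sigma_finite_lborel ac] R(2) by auto
  have fb[measurable]: "f \<in> borel_measurable borel" using f(1) by simp
  have \<nu>f: "emeasure \<nu> B = (\<integral>\<^sup>+x\<in>B. f x \<partial>lborel)" if "B \<in> sets borel" "B \<subseteq> S" for B
  proof -
    have "emeasure \<nu> B = emeasure \<nu>0 B" using R(4)[OF that(1)] that(2) by (simp add: Int_absorb2)
    also have "\<dots> = (\<integral>\<^sup>+x\<in>B. f x \<partial>lborel)" unfolding f(2)[symmetric] by (rule emeasure_density) (use that in auto)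
    finally show ?thesis .
  qed
  define E where "E j = {x\<in>S. ennreal ((1 + \<eta>) powr real_of_int j) \<le> f x \<and> f x \<le> ennreal ((1 + \<eta>) * (1 + \<eta>) powr real_of_int j)}" for j
  have E: "E j \<in> sets borel" for j unfolding E_def using S by measurable
  have "\<exists>j. E j \<notin> null_sets lborel"
  proof (rule ccontr)
    assume "\<not> ?thesis"
    then have "AE x in lborel. \<forall>j. x \<notin> E j" by (subst AE_all_countable) (auto intro: AE_not_in)
    moreover have "AE x in lborel. x \<in> S \<longrightarrow> f x \<noteq> top"
    proof -
      have "(\<integral>\<^sup>+x. f x * indicator S x \<partial>lborel) \<noteq> \<infinity>" using \<nu>f[OF S] by (metis emeasure_finite order_refl infinity_ennreal_def)
      then have "AE x in lborel. f x * indicator S x \<noteq> \<infinity>" by (rule nn_integral_PInf_AE[rotated]) (use S in measurable)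
      then show ?thesis by eventually_elim auto
    qed
    ultimately have "AE x in lborel. f x * indicator S x = 0"
    proof eventually_elim
      case (elim x)
      show ?case
      proof (rule ccontr)
        assume "f x * indicator S x \<noteq> 0"
        then have x: "x \<in> S" "f x \<noteq> 0" by (auto simp: indicator_def split: if_splits)
        then obtain r where r: "f x = ennreal r" "0 < r"
          using elim(2) by (cases "f x") (auto simp: less_le)
        \<comment> \<open>The slice of a positive value is found by rounding down its logarithm to
          the base \<open>1 + \<eta>\<close>.\<close>
        define j where "j = \<lfloor>log (1 + \<eta>) r\<rfloor>"
        have "real_of_int j \<le> log (1 + \<eta>) r" "log (1 + \<eta>) r \<le> 1 + real_of_int j" unfolding j_def by linarith+
        then have "(1 + \<eta>) powr real_of_int j \<le> (1 + \<eta>) powr log (1 + \<eta>) r"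
          "(1 + \<eta>) powr log (1 + \<eta>) r \<le> (1 + \<eta>) powr (1 + real_of_int j)"
          using \<eta> by (auto intro!: powr_mono)
        then have "(1 + \<eta>) powr real_of_int j \<le> r" "r \<le> (1 + \<eta>) * (1 + \<eta>) powr real_of_int j"
          using \<eta> r(2) by (auto simp: powr_add)
        then have "x \<in> E j" using x r by (auto simp: E_def intro!: ennreal_leI)
        then show False using elim(1) by blast
      qed
    qed
    then have "(\<integral>\<^sup>+x\<in>S. f x \<partial>lborel) = 0" by (subst nn_integral_0_iff_AE) (use S in measurable)
    then have "emeasure \<nu> S = 0" using \<nu>f[OF S] by simp
    then show False using ns[OF A(1)] by (simp add: S_def measure_def)
  qed
  then obtain j where j: "E j \<notin> null_sets lborel" ..
  let ?c = "(1 + \<eta>) powr real_of_int j"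
  show thesis
  proof (rule that[of ?c "E j"])
    show "0 < ?c" using \<eta> by simp
    show "E j \<subseteq> K" by (auto simp: E_def S_def)
    fix B assume B: "B \<in> sets borel" "B \<subseteq> E j"
    have BS: "B \<subseteq> S" using B by (auto simp: E_def)
    have "ennreal ?c * emeasure lborel B = (\<integral>\<^sup>+x\<in>B. ennreal ?c \<partial>lborel)"
      using B by (subst nn_integral_cmult_indicator) auto
    also have "\<dots> \<le> (\<integral>\<^sup>+x\<in>B. f x \<partial>lborel)"
      by (rule nn_integral_mono) (use B in \<open>auto simp: E_def indicator_def\<close>)
    finally show "ennreal ?c * emeasure lborel B \<le> emeasure \<nu> B" using \<nu>f[OF B(1) BS] by simp
    have "(\<integral>\<^sup>+x\<in>B. f x \<partial>lborel) \<le> (\<integral>\<^sup>+x\<in>B. ennreal ((1 + \<eta>) * ?c) \<partial>lborel)"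
      by (rule nn_integral_mono) (use B in \<open>auto simp: E_def indicator_def\<close>)
    also have "\<dots> = ennreal ((1 + \<eta>) * ?c) * emeasure lborel B"
      using B by (subst nn_integral_cmult_indicator) auto
    finally show "emeasure \<nu> B \<le> ennreal ((1 + \<eta>) * ?c) * emeasure lborel B" using \<nu>f[OF B(1) BS] by simp
  qed (use j E in auto)
qed

text \<open>Packing both measures into one complex measure yields a common reference measure, its
  total variation; the real and imaginary parts of the polar density are the two densities.\<close>

lemma joint_density:
  fixes \<nu> \<mu> :: "'a::topological_space measure"
  assumes fin: "finite_measure \<nu>" "finite_measure \<mu>" and sets: "sets \<nu> = sets borel" "sets \<mu> = sets borel"
  obtains \<sigma> a b where "finite_measure \<sigma>" "sets \<sigma> = sets borel" "integrable \<sigma> a" "integrable \<sigma> b"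
    "\<And>B. B \<in> sets borel \<Longrightarrow> measure \<nu> B = (LINT x:B|\<sigma>. a x)"
    "\<And>B. B \<in> sets borel \<Longrightarrow> measure \<mu> B = (LINT x:B|\<sigma>. b x)"
    "AE x in \<sigma>. 0 \<le> a x" "AE x in \<sigma>. 0 \<le> b x"
proof -
  define \<kappa> where "\<kappa> B = complex_of_real (measure \<nu> B) + \<i> * complex_of_real (measure \<mu> B)" for B
  have vm: "vector_measure borel \<kappa>"
    using vector_measure_measure[OF fin(1), of borel] vector_measure_measure[OF fin(2), of borel] sets
    unfolding vector_measure_def \<kappa>_def by (auto intro!: sums_add sums_mult sums_of_real)
  define \<sigma> where "\<sigma> = total_variation borel \<kappa>"
  define f where "f = polar_density borel \<kappa>"
  note P = polar_density_properties[OF vm, folded \<sigma>_def f_def]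
  have \<sigma>: "finite_measure \<sigma>" "sets \<sigma> = sets borel"
    using finite_measure_total_variation[OF vm] by (auto simp: \<sigma>_def)
  have a: "integrable \<sigma> (\<lambda>x. Re (f x))" and b: "integrable \<sigma> (\<lambda>x. Im (f x))"
    using P(1) by auto
  have i: "integrable \<sigma> (\<lambda>x. indicator B x *\<^sub>R f x)" if "B \<in> sets borel" for B
    by (rule integrable_mult_indicator[OF _ P(1)]) (use that \<sigma> in auto)
  have \<nu>: "measure \<nu> B = (LINT x:B|\<sigma>. Re (f x))" if B: "B \<in> sets borel" for B
  proof -
    have "measure \<nu> B = Re (\<kappa> B)" by (simp add: \<kappa>_def)
    also have "\<dots> = (LINT x|\<sigma>. Re (indicator B x *\<^sub>R f x))"
      unfolding P(2)[OF B] set_lebesgue_integral_def using integral_Re[OF i[OF B]] by simp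
    finally show ?thesis by (simp add: set_lebesgue_integral_def)
  qed
  have \<mu>: "measure \<mu> B = (LINT x:B|\<sigma>. Im (f x))" if B: "B \<in> sets borel" for B
  proof -
    have "measure \<mu> B = Im (\<kappa> B)" by (simp add: \<kappa>_def)
    also have "\<dots> = (LINT x|\<sigma>. Im (indicator B x *\<^sub>R f x))"
      unfolding P(2)[OF B] set_lebesgue_integral_def using integral_Im[OF i[OF B]] by simp
    finally show ?thesis by (simp add: set_lebesgue_integral_def)
  qed
  have "AE x in \<sigma>. 0 \<le> Re (f x)" "AE x in \<sigma>. 0 \<le> Im (f x)"
    by (rule AE_le_if_set_integral_le; use a b \<nu>[symmetric] \<mu>[symmetric] \<sigma> in \<open>simp add: set_lebesgue_integral_def[of _ _ "\<lambda>_. 0"]\<close>)+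
  then show thesis by (intro that[OF \<sigma> a b \<nu> \<mu>])
qed

text \<open>The signed integral of \<open>measure \<nu>\<close> is evaluated twice by
  \<open>signed_integral_density\<close>: with density \<open>a\<close> over \<open>\<sigma>\<close>
  and with density 1 over \<open>\<nu>\<close> itself.\<close>

lemma integral_eq_density_integral:
  fixes \<phi> :: "'a::topological_space \<Rightarrow> real"
  assumes fin: "finite_measure \<nu>" "finite_measure \<sigma>" and sets: "sets \<nu> = sets borel" "sets \<sigma> = sets borel"
    and a: "integrable \<sigma> a" "\<And>B. B \<in> sets borel \<Longrightarrow> measure \<nu> B = (LINT x:B|\<sigma>. a x)"
    and \<phi>: "\<phi> \<in> borel_measurable borel" "\<And>x. \<bar>\<phi> x\<bar> \<le> C"
  shows "(LINT x|\<nu>. \<phi> x) = (LINT x|\<sigma>. \<phi> x * a x)"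
proof -
  interpret finite_measure \<nu> by fact
  have vm: "vector_measure borel (measure \<nu>)" by (rule vector_measure_measure) (use fin sets in auto)
  have "signed_integral borel (measure \<nu>) \<phi> = (LINT x|\<sigma>. \<phi> x * a x)"
    by (rule signed_integral_density[OF fin(2) a(1) sets(2) a(2) vm \<phi>])
  moreover have "signed_integral borel (measure \<nu>) \<phi> = (LINT x|\<nu>. \<phi> x * 1)"
  proof (rule signed_integral_density[OF fin(1) _ sets(1) _ vm \<phi>])
    show "measure \<nu> B = (LINT x:B|\<nu>. 1)" if "B \<in> sets borel" for B
      using that sets sets_eq_imp_space_eq[OF sets(1)] by (simp add: set_lebesgue_integral_def)
  qed simp
  ultimately show ?thesis by simp
qed

section \<open>Limits of blow-ups\<close>

locale symmetric_body = gauge_norm N for N :: "real^'n \<Rightarrow> real" +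
  fixes K :: "(real^'n) set"
  assumes K_eq: "K = {v. N v < 1}"
begin

lemma K_gball: "K = gball 0 1" by (simp add: K_eq gball_def)

lemma open_K: "open K" unfolding K_gball by (rule open_gball)

lemma bounded_K: "bounded K" unfolding K_gball by (rule bounded_gball)

lemma zero_in_K: "0 \<in> K" by (simp add: K_eq)

lemma convex_K: "convex K"
proof (rule convexI)
  fix x y and u v :: real assume *: "x \<in> K" "y \<in> K" "0 \<le> u" "0 \<le> v" "u + v = 1"
  have "N (u *\<^sub>R x + v *\<^sub>R y) \<le> u * N x + v * N y"
    using N_add[of "u *\<^sub>R x" "v *\<^sub>R y"] * by (simp add: N_scale)
  also have "\<dots> < 1" using convex_bound_lt[of "N x" 1 "N y" u v] * by (simp add: K_eq)
  finally show "u *\<^sub>R x + v *\<^sub>R y \<in> K" by (simp add: K_eq)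
qed

lemma K_borel [measurable]: "K \<in> sets borel" using open_K by simp

lemma dilate_at_K: "0 < r \<Longrightarrow> dilate_at K r x = gball x r"
proof -
  assume r: "0 < r"
  have "z \<in> dilate_at K r x \<longleftrightarrow> z \<in> gball x r" for z
  proof -
    have "z \<in> dilate_at K r x \<longleftrightarrow> (1 / r) *\<^sub>R (z - x) \<in> K"
      using dilate_at_iff[OF r, of x "(1 / r) *\<^sub>R (z - x)" K] r by simp
    also have "\<dots> \<longleftrightarrow> z \<in> gball x r" using r by (simp add: K_eq gball_def N_scale)
    finally show ?thesis .
  qed
  then show ?thesis by blast
qed

abbreviation vol :: real where "vol \<equiv> measure lebesgue K"

lemma vol_pos: "0 < vol"
proof -
  have "emeasure lborel K < \<infinity>" using bounded_K by (rule emeasure_bounded_finite)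
  moreover have "emeasure lborel K \<noteq> 0"
  proof
    assume "emeasure lborel K = 0"
    then have "negligible K" by (simp add: negligible_iff_null_sets null_sets_def)
    then show False using open_not_negligible[OF open_K] zero_in_K by auto
  qed
  ultimately show ?thesis by (simp add: measure_def enn2real_positive_iff zero_less_iff_neq_zero)
qed

lemma measure_gball: "0 < r \<Longrightarrow> measure lborel (gball x r) = vol * r ^ CARD('n)"
  using measure_dilate_at[OF open_K bounded_K, of r x] dilate_at_K[of r x] by (simp add: mult.commute)

text \<open>L1 convergence passes to the limit in the tested derivatives and forces
  \<open>F = g M\<close> with the scalar \<open>g = M \<bullet> F\<close>. The approximating
  measures are positive, so \<open>g \<ge> 0\<close>, and \<open>norm F = norm M = 1\<close> then
  gives \<open>g = 1\<close>. The convergence of the rescaled measures against test functions is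
  recorded because it later controls the masses of balls.\<close>

lemma limit_derivative:
  fixes w :: "nat \<Rightarrow> real^'n \<Rightarrow> real^'m" and p :: "real^'n \<Rightarrow> real^'m"
  assumes wd: "\<And>i. weak_deriv K (w i) (t i) (G i)"
    and conv: "L1_converges K w p" and p: "p \<in> BV K"
    and M: "norm M = 1" and k: "\<And>i. 0 \<le> k i"
    and close: "(\<lambda>i. LINT y:K|t i. norm (G i y - k i *\<^sub>R M)) \<longlonglongrightarrow> 0"
  obtains \<nu> where "finite_measure \<nu>" "sets \<nu> = sets borel" "weak_deriv K p \<nu> (\<lambda>_. M)"
    "\<And>\<phi>. \<phi> \<in> C1_compact_support K \<Longrightarrow> (\<lambda>i. k i * (LINT y|t i. \<phi> y)) \<longlonglongrightarrow> (LINT y|\<nu>. \<phi> y)"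
    "\<And>B. B \<in> sets borel \<Longrightarrow> measure \<nu> B = measure (BV_variation K p) (B \<inter> K)"
proof -
  have d: "is_distr_deriv K p (BV_deriv K p)" by (rule BV_deriv_is_distr_deriv[OF p open_K])
  define \<nu> where "\<nu> = distr (total_variation (lborel_on K) (BV_deriv K p)) borel (\<lambda>x. x)"
  define F where "F = (\<lambda>x. indicator K x *\<^sub>R polar_density (lborel_on K) (BV_deriv K p) x)"
  note I = is_distr_deriv_imp_weak_deriv[OF d open_K, folded \<nu>_def F_def]
  interpret \<nu>: finite_measure \<nu> by (rule I(3))
  have wdp: "weak_deriv K p \<nu> F" by (rule I(1))
  have Fi: "integrable \<nu> F" using wdp by (simp add: weak_deriv_def)
  have wi: "integrable (lebesgue_on K) (w i)" and pi: "integrable (lebesgue_on K) p"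
    and L1: "(\<lambda>i. LINT y|lebesgue_on K. norm (w i y - p y)) \<longlonglongrightarrow> 0" for i
    using conv by (auto simp: L1_converges_def)
  define g where "g x = M \<bullet> F x" for x
  have gi: "integrable \<nu> g" unfolding g_def using Fi by simp
  have lim: "(\<lambda>i. k i * (LINT y|t i. \<phi> y)) \<longlonglongrightarrow> (LINT y|\<nu>. \<phi> y * g y)"
      and comp: "(LINT y|\<nu>. \<phi> y * F y $ a $ b) = M $ a $ b * (LINT y|\<nu>. \<phi> y * g y)"
    if \<phi>: "\<phi> \<in> C1_compact_support K" for \<phi> a b
  proof -
    note D = C1_compact_supportD[OF \<phi>]
    obtain B where B: "0 \<le> B" "\<And>x. \<bar>\<phi> x\<bar> \<le> B" "\<And>x. norm (grad \<phi> x) \<le> B" using D(7) by auto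
    \<comment> \<open>The difference of the tested derivatives is at most the bound on
      \<open>grad \<phi>\<close> times the L1 distance of the functions.\<close>
    have test1: "(\<lambda>i. LINT y|t i. \<phi> y * G i y $ a $ b) \<longlonglongrightarrow> (LINT y|\<nu>. \<phi> y * F y $ a $ b)" for a b
    proof -
      have int: "integrable (lebesgue_on K) (\<lambda>y. v y $ a * partial_deriv b \<phi> y)" if "integrable (lebesgue_on K) v" for v :: "real^'n \<Rightarrow> real^'m"
        by (rule integrable_mult_partial_deriv[OF \<phi> integrable_bounded_linear[OF bounded_linear_vec_nth that]])
      have "(\<lambda>i. (LINT y|t i. \<phi> y * G i y $ a $ b) - (LINT y|\<nu>. \<phi> y * F y $ a $ b)) \<longlonglongrightarrow> 0"
      proof (rule Lim_null_comparison)
        show "\<forall>\<^sub>F i in sequentially. norm ((LINT y|t i. \<phi> y * G i y $ a $ b) - (LINT y|\<nu>. \<phi> y * F y $ a $ b))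
           \<le> B * (LINT y|lebesgue_on K. norm (w i y - p y))"
        proof (rule always_eventually, rule allI)
          fix i
          have "(LINT y|lebesgue_on K. w i y $ a * partial_deriv b \<phi> y) = - (LINT y|t i. \<phi> y * G i y $ a $ b)"
            "(LINT y|lebesgue_on K. p y $ a * partial_deriv b \<phi> y) = - (LINT y|\<nu>. \<phi> y * F y $ a $ b)"
            using wd[of i] wdp \<phi> unfolding weak_deriv_def by blast+
          then have "norm ((LINT y|t i. \<phi> y * G i y $ a $ b) - (LINT y|\<nu>. \<phi> y * F y $ a $ b))
            = norm ((LINT y|lebesgue_on K. w i y $ a * partial_deriv b \<phi> y) - (LINT y|lebesgue_on K. p y $ a * partial_deriv b \<phi> y))"
            by (simp add: abs_minus_commute)
          also have "\<dots> = norm (LINT y|lebesgue_on K. w i y $ a * partial_deriv b \<phi> y - p y $ a * partial_deriv b \<phi> y)"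
            by (simp only: Bochner_Integration.integral_diff[OF int[OF wi] int[OF pi]])
          also have "\<dots> \<le> (LINT y|lebesgue_on K. B * norm (w i y - p y))"
          proof (rule order_trans[OF integral_norm_bound integral_mono])
            show "integrable (lebesgue_on K) (\<lambda>y. norm (w i y $ a * partial_deriv b \<phi> y - p y $ a * partial_deriv b \<phi> y))"
              using int[OF wi] int[OF pi] by auto
            show "integrable (lebesgue_on K) (\<lambda>y. B * norm (w i y - p y))" using wi pi by auto
            fix y
            have "\<bar>partial_deriv b \<phi> y\<bar> \<le> B"
              using B(3)[of y] component_le_norm_cart[of "grad \<phi> y" b] by (simp add: grad_def)
            moreover have "\<bar>w i y $ a - p y $ a\<bar> \<le> norm (w i y - p y)"
              using component_le_norm_cart[of "w i y - p y" a] by simp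
            ultimately have "\<bar>partial_deriv b \<phi> y\<bar> * \<bar>w i y $ a - p y $ a\<bar> \<le> B * norm (w i y - p y)"
              by (intro mult_mono B(1)) auto
            moreover have "w i y $ a * partial_deriv b \<phi> y - p y $ a * partial_deriv b \<phi> y = partial_deriv b \<phi> y * (w i y $ a - p y $ a)"
              by (simp add: algebra_simps)
            ultimately show "norm (w i y $ a * partial_deriv b \<phi> y - p y $ a * partial_deriv b \<phi> y) \<le> B * norm (w i y - p y)"
              by (simp only: real_norm_def abs_mult)
          qed
          finally show "norm ((LINT y|t i. \<phi> y * G i y $ a $ b) - (LINT y|\<nu>. \<phi> y * F y $ a $ b))
            \<le> B * (LINT y|lebesgue_on K. norm (w i y - p y))" by simp
        qed
        show "(\<lambda>i. B * (LINT y|lebesgue_on K. norm (w i y - p y))) \<longlonglongrightarrow> 0"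
          using tendsto_mult_right_zero[OF L1] by simp
      qed
      then show ?thesis by (rule LIM_zero_cancel)
    qed
    \<comment> \<open>Replacing \<open>G i\<close> by the constant matrix
      \<open>k i *\<^sub>R M\<close> costs the bound on \<open>\<phi>\<close> times the quantity
      that tends to 0 in \<open>close\<close>.\<close>
    have test2: "(\<lambda>i. (LINT y|t i. \<phi> y * G i y $ a $ b) - M $ a $ b * (k i * (LINT y|t i. \<phi> y))) \<longlonglongrightarrow> 0" for a b
    proof (rule Lim_null_comparison)
      show "\<forall>\<^sub>F i in sequentially. norm ((LINT y|t i. \<phi> y * G i y $ a $ b) - M $ a $ b * (k i * (LINT y|t i. \<phi> y)))
         \<le> B * (LINT y:K|t i. norm (G i y - k i *\<^sub>R M))"
      proof (rule always_eventually, rule allI)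
        fix i
        have ti: "finite_measure (t i)" "sets (t i) = sets borel" "integrable (t i) (G i)" using wd[of i] by (auto simp: weak_deriv_def)
        interpret ti: finite_measure "t i" by (rule ti(1))
        have \<phi>m: "\<phi> \<in> borel_measurable (t i)" using D(4) ti(2) by (simp cong: measurable_cong_sets)
        have \<phi>i: "integrable (t i) \<phi>" by (rule ti.integrable_const_bound[of _ B]) (use B \<phi>m in auto)
        have Gi: "integrable (t i) (\<lambda>y. \<phi> y * G i y $ a $ b)"
        proof (rule Bochner_Integration.integrable_bound[of _ "\<lambda>y. B * G i y $ a $ b"])
          show "integrable (t i) (\<lambda>y. B * G i y $ a $ b)" using integrable_entry[OF ti(3)] by simp
          show "(\<lambda>y. \<phi> y * G i y $ a $ b) \<in> borel_measurable (t i)"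
            by (intro borel_measurable_times \<phi>m borel_measurable_integrable[OF integrable_entry[OF ti(3)]])
          show "AE y in t i. norm (\<phi> y * G i y $ a $ b) \<le> norm (B * G i y $ a $ b)"
            using B by (auto intro!: AE_I2 mult_right_mono simp: abs_mult)
        qed
        have diffi: "integrable (t i) (\<lambda>y. G i y - k i *\<^sub>R M)" using ti(3) by simp
        have "(LINT y|t i. \<phi> y * G i y $ a $ b) - M $ a $ b * (k i * (LINT y|t i. \<phi> y))
           = (LINT y|t i. \<phi> y * G i y $ a $ b - M $ a $ b * (k i * \<phi> y))"
          using Gi \<phi>i by simp
        then have "norm ((LINT y|t i. \<phi> y * G i y $ a $ b) - M $ a $ b * (k i * (LINT y|t i. \<phi> y)))
           \<le> (LINT y|t i. norm (\<phi> y * G i y $ a $ b - M $ a $ b * (k i * \<phi> y)))"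
          by (simp only: integral_norm_bound)
        also have "\<dots> \<le> (LINT y|t i. B * (indicator K y *\<^sub>R norm (G i y - k i *\<^sub>R M)))"
        proof (rule integral_mono)
          show "integrable (t i) (\<lambda>y. norm (\<phi> y * G i y $ a $ b - M $ a $ b * (k i * \<phi> y)))"
            using Gi \<phi>i by auto
          show "integrable (t i) (\<lambda>y. B * (indicator K y *\<^sub>R norm (G i y - k i *\<^sub>R M)))"
            by (intro integrable_mult_right integrable_mult_indicator integrable_norm diffi) (simp add: ti)
          fix y
          have e: "\<phi> y * G i y $ a $ b - M $ a $ b * (k i * \<phi> y) = \<phi> y * (G i y - k i *\<^sub>R M) $ a $ b"
            by (simp add: algebra_simps)
          have "\<bar>(G i y - k i *\<^sub>R M) $ a $ b\<bar> \<le> norm ((G i y - k i *\<^sub>R M) $ a)" by (rule component_le_norm_cart)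
          also have "\<dots> \<le> norm (G i y - k i *\<^sub>R M)" by (rule Finite_Cartesian_Product.norm_nth_le)
          finally have 1: "\<bar>(G i y - k i *\<^sub>R M) $ a $ b\<bar> \<le> norm (G i y - k i *\<^sub>R M)" .
          have "y \<in> K \<or> \<phi> y = 0" using D(6) by blast
          then have "\<bar>\<phi> y\<bar> \<le> B * indicator K y" using B(1) B(2)[of y] by (auto simp: indicator_def)
          from mult_mono[OF this 1] have "\<bar>\<phi> y\<bar> * \<bar>(G i y - k i *\<^sub>R M) $ a $ b\<bar> \<le> B * indicator K y * norm (G i y - k i *\<^sub>R M)"
            using B(1) by simp
          then show "norm (\<phi> y * G i y $ a $ b - M $ a $ b * (k i * \<phi> y)) \<le> B * (indicator K y *\<^sub>R norm (G i y - k i *\<^sub>R M))"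
            unfolding e by (simp only: real_norm_def abs_mult real_scaleR_def mult.assoc)
        qed
        finally show "norm ((LINT y|t i. \<phi> y * G i y $ a $ b) - M $ a $ b * (k i * (LINT y|t i. \<phi> y)))
         \<le> B * (LINT y:K|t i. norm (G i y - k i *\<^sub>R M))" unfolding set_lebesgue_integral_def by simp
      qed
      show "(\<lambda>i. B * (LINT y:K|t i. norm (G i y - k i *\<^sub>R M))) \<longlonglongrightarrow> 0"
        using tendsto_mult_right_zero[OF close] by simp
    qed
    have M_lim: "(\<lambda>i. M $ a $ b * (k i * (LINT y|t i. \<phi> y))) \<longlonglongrightarrow> (LINT y|\<nu>. \<phi> y * F y $ a $ b)" for a b
      using tendsto_diff[OF test1[of a b] test2[of a b]] by simp
    \<comment> \<open>Contraction with \<open>M\<close>, which has norm one, recovers the scalar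
      limit from the limits of the entries.\<close>
    have MM: "(\<Sum>a\<in>UNIV. \<Sum>b\<in>UNIV. M $ a $ b * M $ a $ b) = 1"
    proof -
      have "M \<bullet> M = 1" using M by (simp add: dot_square_norm)
      then show ?thesis by (simp add: inner_vec_def)
    qed
    have "(\<lambda>i. \<Sum>a\<in>UNIV. \<Sum>b\<in>UNIV. M $ a $ b * (M $ a $ b * (k i * (LINT y|t i. \<phi> y))))
       \<longlonglongrightarrow> (\<Sum>a\<in>UNIV. \<Sum>b\<in>UNIV. M $ a $ b * (LINT y|\<nu>. \<phi> y * F y $ a $ b))"
      by (intro tendsto_sum tendsto_mult tendsto_const M_lim)
    moreover have "(\<Sum>a\<in>UNIV. \<Sum>b\<in>UNIV. M $ a $ b * (M $ a $ b * s)) = s" for s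
    proof -
      have "(\<Sum>a\<in>UNIV. \<Sum>b\<in>UNIV. M $ a $ b * (M $ a $ b * s)) = (\<Sum>a\<in>UNIV. \<Sum>b\<in>UNIV. M $ a $ b * M $ a $ b) * s"
        by (simp add: sum_distrib_right mult.assoc)
      then show ?thesis by (simp add: MM)
    qed
    moreover have "(\<Sum>a\<in>UNIV. \<Sum>b\<in>UNIV. M $ a $ b * (LINT y|\<nu>. \<phi> y * F y $ a $ b)) = (LINT y|\<nu>. \<phi> y * g y)"
    proof -
      have \<phi>m: "\<phi> \<in> borel_measurable \<nu>" using D(4) I(2) by (simp cong: measurable_cong_sets)
      have Fi2: "integrable \<nu> (\<lambda>y. \<phi> y * F y $ a $ b)" for a b
      proof (rule Bochner_Integration.integrable_bound[of _ "\<lambda>y. B * F y $ a $ b"])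
        show "integrable \<nu> (\<lambda>y. B * F y $ a $ b)" using integrable_entry[OF Fi] by simp
        show "(\<lambda>y. \<phi> y * F y $ a $ b) \<in> borel_measurable \<nu>"
          by (intro borel_measurable_times \<phi>m borel_measurable_integrable[OF integrable_entry[OF Fi]])
        show "AE y in \<nu>. norm (\<phi> y * F y $ a $ b) \<le> norm (B * F y $ a $ b)"
          using B by (auto intro!: AE_I2 mult_right_mono simp: abs_mult)
      qed
      have "(LINT y|\<nu>. \<phi> y * g y) = (LINT y|\<nu>. (\<Sum>a\<in>UNIV. \<Sum>b\<in>UNIV. M $ a $ b * (\<phi> y * F y $ a $ b)))"
        by (rule Bochner_Integration.integral_cong) (auto simp: g_def inner_vec_def sum_distrib_left mult_ac)
      also have "\<dots> = (\<Sum>a\<in>UNIV. (LINT y|\<nu>. (\<Sum>b\<in>UNIV. M $ a $ b * (\<phi> y * F y $ a $ b))))"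
        by (intro Bochner_Integration.integral_sum Bochner_Integration.integrable_sum integrable_mult_right Fi2)
      also have "\<dots> = (\<Sum>a\<in>UNIV. \<Sum>b\<in>UNIV. (LINT y|\<nu>. M $ a $ b * (\<phi> y * F y $ a $ b)))"
        by (intro sum.cong refl Bochner_Integration.integral_sum integrable_mult_right Fi2)
      finally show ?thesis by simp
    qed
    ultimately show lim: "(\<lambda>i. k i * (LINT y|t i. \<phi> y)) \<longlonglongrightarrow> (LINT y|\<nu>. \<phi> y * g y)" by simp
    have "(\<lambda>i. M $ a $ b * (k i * (LINT y|t i. \<phi> y))) \<longlonglongrightarrow> M $ a $ b * (LINT y|\<nu>. \<phi> y * g y)"
      by (intro tendsto_mult tendsto_const lim)
    then show "(LINT y|\<nu>. \<phi> y * F y $ a $ b) = M $ a $ b * (LINT y|\<nu>. \<phi> y * g y)"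
      using M_lim[of a b] LIMSEQ_unique by blast
  qed
  have gMi: "integrable \<nu> (\<lambda>x. g x *\<^sub>R M)" using gi by simp
  have wdg: "weak_deriv K p \<nu> (\<lambda>x. g x *\<^sub>R M)"
    unfolding weak_deriv_def
  proof (intro conjI I(2,3) gMi ballI allI)
    fix \<phi> a b assume \<phi>: "\<phi> \<in> C1_compact_support K"
    have "(LINT x|\<nu>. \<phi> x * (g x *\<^sub>R M) $ a $ b) = M $ a $ b * (LINT x|\<nu>. \<phi> x * g x)"
      unfolding integral_mult_right_zero[symmetric]
      by (rule Bochner_Integration.integral_cong) (auto simp: mult_ac)
    also have "\<dots> = (LINT x|\<nu>. \<phi> x * F x $ a $ b)" by (rule comp[OF \<phi>, symmetric])
    finally show "(LINT x|lebesgue_on K. p x $ a * partial_deriv b \<phi> x) = - (LINT x|\<nu>. \<phi> x * (g x *\<^sub>R M) $ a $ b)"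
      using wdp \<phi> unfolding weak_deriv_def by simp
  qed
  have inK: "AE x in \<nu>. x \<in> K" using I(6) by eventually_elim simp
  \<comment> \<open>\<open>weak_deriv_unique\<close> compares integrals over Borel subsets of
    \<open>K\<close>; since \<open>\<nu>\<close> is carried by \<open>K\<close>, this yields
    equality of the densities almost everywhere.\<close>
  have AEF: "AE x in \<nu>. F x = g x *\<^sub>R M"
  proof -
    have eq: "(LINT x:A|\<nu>. F x $ a $ b) = (LINT x:A|\<nu>. (g x *\<^sub>R M) $ a $ b)" if A: "A \<in> sets \<nu>" for A a b
    proof -
      have AK: "A \<inter> K \<in> sets borel" using A I(2) by simp
      have red: "(LINT x:A|\<nu>. f x) = (LINT x:A \<inter> K|\<nu>. f x)" if "integrable \<nu> f" for f :: "_ \<Rightarrow> real"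
        unfolding set_lebesgue_integral_def
      proof (rule integral_cong_AE)
        show "AE x in \<nu>. indicator A x *\<^sub>R f x = indicator (A \<inter> K) x *\<^sub>R f x"
          using inK by eventually_elim (auto simp: indicator_def)
      qed (use that A AK I(2) in \<open>auto intro!: borel_measurable_scaleR borel_measurable_integrable[OF that]\<close>)
      have "(LINT x:A \<inter> K|\<nu>. F x) = (LINT x:A \<inter> K|\<nu>. g x *\<^sub>R M)"
        by (rule weak_deriv_unique[OF wdp wdg open_K AK]) simp
      then have "(LINT x:A \<inter> K|\<nu>. F x $ a $ b) = (LINT x:A \<inter> K|\<nu>. (g x *\<^sub>R M) $ a $ b)"
        using set_integral_entry[OF Fi, of "A \<inter> K" a b] set_integral_entry[OF gMi, of "A \<inter> K" a b] AK I(2) by simp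
      from trans[OF red[OF integrable_entry[OF Fi]] trans[OF this red[OF integrable_entry[OF gMi], symmetric]]]
      show ?thesis .
    qed
    have "AE x in \<nu>. F x $ a $ b = (g x *\<^sub>R M) $ a $ b" for a b
    proof -
      have "AE x in \<nu>. F x $ a $ b \<le> (g x *\<^sub>R M) $ a $ b"
        by (rule AE_le_if_set_integral_le[OF integrable_entry[OF Fi] integrable_entry[OF gMi]]) (simp only: eq order_refl)
      moreover have "AE x in \<nu>. (g x *\<^sub>R M) $ a $ b \<le> F x $ a $ b"
        by (rule AE_le_if_set_integral_le[OF integrable_entry[OF gMi] integrable_entry[OF Fi]]) (simp only: eq order_refl)
      ultimately show ?thesis by eventually_elim simp
    qed
    then have "AE x in \<nu>. \<forall>a b. F x $ a $ b = (g x *\<^sub>R M) $ a $ b" by (simp add: AE_all_countable)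
    then show ?thesis by eventually_elim (simp add: vec_eq_iff)
  qed
  have gm: "g \<in> borel_measurable borel"
    using borel_measurable_integrable[OF gi] I(2) by (simp cong: measurable_cong_sets)
  \<comment> \<open>If \<open>g\<close> were negative on a set of positive measure, then also on a
    compact subset, and cut-offs converging to the indicator of that subset would turn nonnegative
    limits into a negative integral.\<close>
  have gnn: "AE x in \<nu>. 0 \<le> g x"
  proof -
    define E where "E = {x. g x < 0}"
    have E: "E \<in> sets borel" unfolding E_def using gm by measurable
    have "measure \<nu> E = 0"
    proof (rule ccontr)
      assume "measure \<nu> E \<noteq> 0"
      then have "0 < measure \<nu> E" using measure_nonneg[of \<nu> E] by linarith
      then obtain C where C: "compact C" "C \<subseteq> E" "measure \<nu> (E - C) < measure \<nu> E"
        using finite_measure_inner_compact[OF I(3,2) E] by metis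
      have Cb: "C \<in> sets borel" using C(1) by (simp add: compact_imp_closed)
      obtain \<phi> where \<phi>: "\<And>j::nat. \<phi> j \<in> C1_compact_support K" "\<And>j x. 0 \<le> \<phi> j x" "\<And>j x. \<phi> j x \<le> 1"
        "\<And>x. (\<lambda>j. \<phi> j x) \<longlonglongrightarrow> indicator (C \<inter> K) x"
        using cutoff_sequence_closed[OF open_K compact_imp_closed[OF C(1)]] by metis
      have nn: "0 \<le> (LINT y|\<nu>. \<phi> j y * g y)" for j
      proof (rule LIMSEQ_le_const[OF lim[OF \<phi>(1)]])
        have "0 \<le> k i * (LINT y|t i. \<phi> j y)" for i
          using k \<phi>(2) by (intro mult_nonneg_nonneg integral_nonneg_AE AE_I2) auto
        then show "\<exists>N. \<forall>i\<ge>N. 0 \<le> k i * (LINT y|t i. \<phi> j y)" by blast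
      qed
      have "(\<lambda>j. LINT y|\<nu>. \<phi> j y * g y) \<longlonglongrightarrow> (LINT y|\<nu>. indicator (C \<inter> K) y * g y)"
      proof (rule integral_dominated_convergence[where w="\<lambda>x. \<bar>g x\<bar>"])
        show "(\<lambda>x. \<phi> j x * g x) \<in> borel_measurable \<nu>" for j
          using C1_compact_supportD(4)[OF \<phi>(1)] gm I(2) by (simp cong: measurable_cong_sets)
        show "(\<lambda>y. indicat_real (C \<inter> K) y * g y) \<in> borel_measurable \<nu>"
          using gm I(2) Cb by (simp cong: measurable_cong_sets)
        show "AE y in \<nu>. (\<lambda>j. \<phi> j y * g y) \<longlonglongrightarrow> indicat_real (C \<inter> K) y * g y"
          by (intro AE_I2 tendsto_mult \<phi>(4) tendsto_const)
        show "AE y in \<nu>. norm (\<phi> j y * g y) \<le> \<bar>g y\<bar>" for j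
          using \<phi>(2,3)[of j] by (auto intro!: AE_I2 mult_left_le_one_le simp: abs_mult)
      qed (use gi in auto)
      then have "0 \<le> (LINT y|\<nu>. indicator (C \<inter> K) y * g y)"
        by (rule LIMSEQ_le_const) (use nn in blast)
      moreover have ii: "integrable \<nu> (\<lambda>y. indicator (C \<inter> K) y *\<^sub>R g y)"
        by (rule integrable_mult_indicator[OF _ gi]) (use Cb I(2) in simp)
      moreover have neg: "indicator (C \<inter> K) y * g y \<le> 0" for y
        using C(2) by (auto simp: indicator_def E_def)
      ultimately have "(LINT y|\<nu>. - (indicator (C \<inter> K) y * g y)) = 0"
      proof -
        have "0 \<le> (LINT y|\<nu>. - (indicator (C \<inter> K) y * g y))" by (rule integral_nonneg_AE) (use neg in auto)
        moreover have "(LINT y|\<nu>. - (indicator (C \<inter> K) y * g y)) = - (LINT y|\<nu>. indicator (C \<inter> K) y * g y)" by simp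
        ultimately show ?thesis using \<open>0 \<le> (LINT y|\<nu>. indicator (C \<inter> K) y * g y)\<close> by linarith
      qed
      then have "AE y in \<nu>. - (indicator (C \<inter> K) y * g y) = 0"
        by (subst (asm) integral_nonneg_eq_0_iff_AE) (use ii neg in auto)
      then have "AE y in \<nu>. y \<notin> C"
        using inK by eventually_elim (use C(2) in \<open>auto simp: indicator_def E_def\<close>)
      then have "measure \<nu> C = 0"
        using Cb I(2) by (subst (asm) AE_iff_measurable[of C]) (auto simp: measure_def sets_eq_imp_space_eq[OF I(2)])
      moreover have "measure \<nu> (E - C) = measure \<nu> E - measure \<nu> C"
        using C(2) E Cb I(2) by (intro \<nu>.finite_measure_Diff) auto
      ultimately show False using C(3) by simp
    qed
    then have "E \<in> null_sets \<nu>" using E I(2) by (simp add: null_sets_def \<nu>.emeasure_eq_measure)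
    then show ?thesis by (rule AE_I') (auto simp: E_def)
  qed
  have g1: "AE x in \<nu>. g x = 1"
    using gnn AEF I(6)
  proof eventually_elim
    case (elim x)
    have "norm (F x) = 1" using elim(3) by (auto simp: F_def)
    moreover have "norm (F x) = g x" using elim(1) M unfolding elim(2) by simp
    ultimately show "g x = 1" by simp
  qed
  have g1': "(LINT y|\<nu>. \<phi> y * g y) = (LINT y|\<nu>. \<phi> y)" if \<phi>: "\<phi> \<in> C1_compact_support K" for \<phi>
  proof (rule integral_cong_AE)
    show "AE y in \<nu>. \<phi> y * g y = \<phi> y" using g1 by eventually_elim simp
  qed (use C1_compact_supportD(4)[OF \<phi>] gm I(2) in \<open>simp_all cong: measurable_cong_sets\<close>)
  have wdM: "weak_deriv K p \<nu> (\<lambda>_. M)"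
    unfolding weak_deriv_def
  proof (intro conjI I(2,3) \<nu>.integrable_const ballI allI)
    fix \<phi> a b assume \<phi>: "\<phi> \<in> C1_compact_support K"
    have "(LINT x|\<nu>. \<phi> x * M $ a $ b) = M $ a $ b * (LINT x|\<nu>. \<phi> x)" by simp
    then show "(LINT x|lebesgue_on K. p x $ a * partial_deriv b \<phi> x) = - (LINT x|\<nu>. \<phi> x * M $ a $ b)"
      using wdp \<phi> comp[OF \<phi>, of a b] g1'[OF \<phi>] unfolding weak_deriv_def by simp
  qed
  show thesis
  proof (rule that[OF I(3,2) wdM])
    show "(\<lambda>i. k i * (LINT y|t i. \<phi> y)) \<longlonglongrightarrow> (LINT y|\<nu>. \<phi> y)" if "\<phi> \<in> C1_compact_support K" for \<phi>
      using lim[OF that] g1'[OF that] by simp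
    show "measure \<nu> B = measure (BV_variation K p) (B \<inter> K)" if "B \<in> sets borel" for B
      using I(4)[OF that] by (simp add: BV_variation_def)
  qed
qed

end

section \<open>Points near which the limit function looks linear\<close>

context symmetric_body
begin

text \<open>The point \<open>y0\<close> is a Lebesgue density point of the level set
  \<open>E\<close>, near which the part of \<open>\<nu>\<close> outside \<open>E\<close> is also
  small relative to Lebesgue measure \<open>L\<close>. On small balls around it the signed measure
  \<open>\<nu> - c L\<close> therefore has variation at most \<open>3 * \<eta> * c\<close> times the
  volume, and this measure times \<open>M\<close> is the derivative of \<open>p\<close> minus the
  linear map \<open>c M\<close>.\<close>

lemma flat_point:
  fixes p :: "real^'n \<Rightarrow> real^'m"
  assumes fin: "finite_measure \<nu>" and sets: "sets \<nu> = sets borel"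
    and wd: "weak_deriv K p \<nu> (\<lambda>_. M)" and p: "integrable (lebesgue_on K) p"
    and ns: "\<And>A. A \<in> null_sets lborel \<Longrightarrow> measure \<nu> (K - A) \<noteq> 0" and \<eta>: "0 < \<eta>"
  obtains c y0 \<sigma> f where "0 < c" "y0 \<in> K" "weak_deriv K (\<lambda>y. p y - c *\<^sub>R (M *v y)) \<sigma> (\<lambda>x. f x *\<^sub>R M)"
    "eventually (\<lambda>r. gball y0 r \<subseteq> K \<and>
       \<bar>measure \<nu> (gball y0 r) - c * (vol * r ^ CARD('n))\<bar> \<le> 3 * \<eta> * (c * (vol * r ^ CARD('n))) \<and>
       (LINT x:gball y0 r|\<sigma>. \<bar>f x\<bar>) \<le> 3 * \<eta> * (c * (vol * r ^ CARD('n)))) (at_right 0)"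
proof -
  interpret \<nu>: finite_measure \<nu> by fact
  define L where "L = lborel_restricted K"
  note L = lborel_restricted[OF open_K bounded_K, folded L_def]
  interpret L: finite_measure L by (rule L(1))
  obtain c E where c: "0 < c" and E: "E \<in> sets borel" "E \<subseteq> K" "E \<notin> null_sets lborel"
    and lev: "\<And>B. B \<in> sets borel \<Longrightarrow> B \<subseteq> E \<Longrightarrow> ennreal c * emeasure lborel B \<le> emeasure \<nu> B"
    "\<And>B. B \<in> sets borel \<Longrightarrow> B \<subseteq> E \<Longrightarrow> emeasure \<nu> B \<le> ennreal ((1 + \<eta>) * c) * emeasure lborel B"
    by (rule absolutely_continuous_level_set[OF fin sets K_borel ns \<eta>]) blast+
  have lev': "c * measure L B \<le> measure \<nu> B" "measure \<nu> B \<le> (1 + \<eta>) * c * measure L B"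
    if B: "B \<in> sets borel" "B \<subseteq> E" for B
  proof -
    have "emeasure L B = emeasure lborel B" using L(3)[OF B(1)] B(2) E(2) by (simp add: Int_absorb2)
    then have e: "emeasure lborel B = ennreal (measure L B)" by (simp add: L.emeasure_eq_measure)
    show "c * measure L B \<le> measure \<nu> B"
      using lev(1)[OF B] c unfolding e \<nu>.emeasure_eq_measure by (simp add: ennreal_mult'[symmetric])
    show "measure \<nu> B \<le> (1 + \<eta>) * c * measure L B"
      using lev(2)[OF B] c \<eta> unfolding e \<nu>.emeasure_eq_measure by (simp add: ennreal_mult'[symmetric])
  qed
  obtain \<sigma> a b where \<sigma>: "finite_measure \<sigma>" "sets \<sigma> = sets borel" "integrable \<sigma> a" "integrable \<sigma> b"
    and a: "\<And>B. B \<in> sets borel \<Longrightarrow> measure \<nu> B = (LINT x:B|\<sigma>. a x)"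
    and b: "\<And>B. B \<in> sets borel \<Longrightarrow> measure L B = (LINT x:B|\<sigma>. b x)"
    and nn: "AE x in \<sigma>. 0 \<le> a x" "AE x in \<sigma>. 0 \<le> b x"
    by (rule joint_density[OF fin L(1) sets L(2)]) blast
  have si: "set_integrable \<sigma> B a" "set_integrable \<sigma> B b" if "B \<in> sets borel" for B
    using that \<sigma> by (auto intro: integrable_imp_set_integrable)
  \<comment> \<open>Over the common reference measure \<open>\<sigma>\<close> this is the density of
    \<open>\<nu> - c L\<close>, so the variation of that signed measure is the integral of
    \<open>\<bar>f\<bar>\<close>.\<close>
  define f where "f x = a x - c * b x" for x
  have fi: "integrable \<sigma> f" unfolding f_def using \<sigma> by simp
  have fB: "(LINT x:B|\<sigma>. f x) = measure \<nu> B - c * measure L B" if B: "B \<in> sets borel" for B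
  proof -
    have "(LINT x:B|\<sigma>. f x) = (LINT x:B|\<sigma>. a x) - (LINT x:B|\<sigma>. c * b x)"
      unfolding f_def by (rule set_integral_diff(2)[OF si(1)[OF B] set_integrable_mult_right[OF si(2)[OF B]]])
    then show ?thesis using a[OF B] b[OF B] by simp
  qed
  have wdl: "weak_deriv K (\<lambda>y. M *v y) L (\<lambda>_. M)" and li: "integrable (lebesgue_on K) (\<lambda>y. M *v y)"
    unfolding L_def by (rule weak_deriv_linear[OF open_K bounded_K])+
  have fMi: "integrable \<sigma> (\<lambda>x. f x *\<^sub>R M)" using fi by simp
  have wdf: "weak_deriv K (\<lambda>y. p y - c *\<^sub>R (M *v y)) \<sigma> (\<lambda>x. f x *\<^sub>R M)"
    unfolding weak_deriv_def
  proof (intro conjI \<sigma>(1,2) fMi ballI allI)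
    fix \<phi> i j assume \<phi>: "\<phi> \<in> C1_compact_support K"
    obtain B where B: "\<And>x. \<bar>\<phi> x\<bar> \<le> B" using C1_compact_supportD(7)[OF \<phi>] by blast
    note \<phi>m = C1_compact_supportD(4)[OF \<phi>]
    have int: "integrable (lebesgue_on K) (\<lambda>y. v y $ i * partial_deriv j \<phi> y)" if "integrable (lebesgue_on K) v" for v :: "real^'n \<Rightarrow> real^'m"
      by (rule integrable_mult_partial_deriv[OF \<phi> integrable_bounded_linear[OF bounded_linear_vec_nth that]])
    have \<phi>i: "integrable \<sigma> (\<lambda>x. \<phi> x * h x)" if "integrable \<sigma> h" for h
    proof (rule Bochner_Integration.integrable_bound[of _ "\<lambda>x. B * h x"])
      show "(\<lambda>x. \<phi> x * h x) \<in> borel_measurable \<sigma>"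
        by (intro borel_measurable_times borel_measurable_integrable[OF that]) (use \<phi>m \<sigma>(2) in \<open>simp cong: measurable_cong_sets\<close>)
      show "AE x in \<sigma>. norm (\<phi> x * h x) \<le> norm (B * h x)"
        using B by (auto intro!: AE_I2 mult_right_mono order_trans[OF B abs_ge_self] simp: abs_mult)
    qed (use that in simp)
    have i1: "(LINT x|\<nu>. \<phi> x) = (LINT x|\<sigma>. \<phi> x * a x)"
      by (rule integral_eq_density_integral[OF fin \<sigma>(1) sets \<sigma>(2,3) a \<phi>m B])
    have i2: "(LINT x|L. \<phi> x) = (LINT x|\<sigma>. \<phi> x * b x)"
      by (rule integral_eq_density_integral[OF L(1) \<sigma>(1) L(2) \<sigma>(2,4) b \<phi>m B])
    have "(LINT y|lebesgue_on K. (p y - c *\<^sub>R (M *v y)) $ i * partial_deriv j \<phi> y)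
      = (LINT y|lebesgue_on K. p y $ i * partial_deriv j \<phi> y - c * ((M *v y) $ i * partial_deriv j \<phi> y))"
      by (rule Bochner_Integration.integral_cong) (auto simp: algebra_simps)
    also have "\<dots> = (LINT y|lebesgue_on K. p y $ i * partial_deriv j \<phi> y) - c * (LINT y|lebesgue_on K. (M *v y) $ i * partial_deriv j \<phi> y)"
      using int[OF p] int[OF li] by simp
    also have "(LINT y|lebesgue_on K. p y $ i * partial_deriv j \<phi> y) = - (LINT x|\<nu>. \<phi> x * M $ i $ j)"
      using wd \<phi> unfolding weak_deriv_def by blast
    also have "(LINT y|lebesgue_on K. (M *v y) $ i * partial_deriv j \<phi> y) = - (LINT x|L. \<phi> x * M $ i $ j)"
      using wdl \<phi> unfolding weak_deriv_def by blast
    also have "- (LINT x|\<nu>. \<phi> x * M $ i $ j) - c * - (LINT x|L. \<phi> x * M $ i $ j)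
       = - (M $ i $ j * ((LINT x|\<sigma>. \<phi> x * a x) - c * (LINT x|\<sigma>. \<phi> x * b x)))"
      by (simp add: i1 i2 algebra_simps)
    also have "(LINT x|\<sigma>. \<phi> x * a x) - c * (LINT x|\<sigma>. \<phi> x * b x) = (LINT x|\<sigma>. \<phi> x * a x - c * (\<phi> x * b x))"
      using \<phi>i[OF \<sigma>(3)] \<phi>i[OF \<sigma>(4)] by simp
    also have "M $ i $ j * (LINT x|\<sigma>. \<phi> x * a x - c * (\<phi> x * b x)) = (LINT x|\<sigma>. \<phi> x * (f x *\<^sub>R M) $ i $ j)"
      unfolding integral_mult_right_zero[symmetric]
      by (rule Bochner_Integration.integral_cong) (auto simp: f_def algebra_simps)
    finally show "(LINT y|lebesgue_on K. (p y - c *\<^sub>R (M *v y)) $ i * partial_deriv j \<phi> y)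
      = - (LINT x|\<sigma>. \<phi> x * (f x *\<^sub>R M) $ i $ j)" .
  qed
  \<comment> \<open>On \<open>E\<close> the level bounds pinch \<open>f\<close> between 0 and
    \<open>\<eta> * c * b\<close>. Outside \<open>E\<close> the trivial bound is enough, because
    both measures have little mass there near \<open>y0\<close>.\<close>
  have AEf: "AE x in \<sigma>. \<bar>f x\<bar> \<le> \<eta> * c * b x + indicator (- E) x * (a x + c * b x)"
  proof -
    have iE: "integrable \<sigma> (\<lambda>x. indicator E x *\<^sub>R h x)" if "integrable \<sigma> h" for h :: "_ \<Rightarrow> real"
      by (rule integrable_mult_indicator[OF _ that]) (use E \<sigma>(2) in simp)
    have red: "(LINT x:A|\<sigma>. indicator E x *\<^sub>R h x) = (LINT x:A \<inter> E|\<sigma>. h x)" for A and h :: "_ \<Rightarrow> real"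
      unfolding set_lebesgue_integral_def
      by (rule Bochner_Integration.integral_cong) (auto simp: indicator_def)
    have "AE x in \<sigma>. 0 \<le> indicator E x *\<^sub>R f x"
    proof (rule AE_le_if_set_integral_le[OF _ iE[OF fi]])
      fix A assume A: "A \<in> sets \<sigma>"
      have AE: "A \<inter> E \<in> sets borel" using A E \<sigma>(2) by simp
      have "0 \<le> measure \<nu> (A \<inter> E) - c * measure L (A \<inter> E)" using lev'(1)[OF AE] by simp
      then show "(LINT x:A|\<sigma>. 0) \<le> (LINT x:A|\<sigma>. indicator E x *\<^sub>R f x)"
        unfolding red fB[OF AE] by (simp add: set_lebesgue_integral_def)
    qed simp
    moreover have "AE x in \<sigma>. indicator E x *\<^sub>R f x \<le> indicator E x *\<^sub>R (\<eta> * c * b x)"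
    proof (rule AE_le_if_set_integral_le[OF iE[OF fi] iE])
      show "integrable \<sigma> (\<lambda>x. \<eta> * c * b x)" using \<sigma>(4) by simp
      fix A assume A: "A \<in> sets \<sigma>"
      have AE: "A \<inter> E \<in> sets borel" using A E \<sigma>(2) by simp
      have "(LINT x:A \<inter> E|\<sigma>. \<eta> * c * b x) = \<eta> * c * measure L (A \<inter> E)"
        using set_integral_mult_right[of \<sigma> "A \<inter> E" "\<eta> * c" b] unfolding b[OF AE] .
      moreover have "measure \<nu> (A \<inter> E) - c * measure L (A \<inter> E) \<le> \<eta> * c * measure L (A \<inter> E)"
        using lev'(2)[OF AE] by (simp add: algebra_simps)
      ultimately show "(LINT x:A|\<sigma>. indicator E x *\<^sub>R f x) \<le> (LINT x:A|\<sigma>. indicator E x *\<^sub>R (\<eta> * c * b x))"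
        unfolding red fB[OF AE] by linarith
    qed
    ultimately show ?thesis using nn
    proof eventually_elim
      case (elim x)
      have cb: "0 \<le> c * b x" "0 \<le> \<eta> * c * b x" using elim c \<eta> by auto
      show ?case
      proof (cases "x \<in> E")
        case True then show ?thesis using elim by simp
      next
        case False
        have "\<bar>f x\<bar> \<le> a x + c * b x" using elim cb unfolding f_def by linarith
        then show ?thesis using False cb by simp
      qed
    qed
  qed
  define \<nu>' where "\<nu>' = density \<nu> (indicator (- E))"
  define L' where "L' = density L (indicator (- E))"
  have E': "- E \<in> sets borel" using E(1) by auto
  note R = restricted_measure[OF fin sets E', folded \<nu>'_def] and S = restricted_measure[OF L(1,2) E', folded L'_def]
  \<comment> \<open>The tolerances are \<open>\<eta> * c\<close> for \<open>\<nu>'\<close> and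
    \<open>\<eta>\<close> for \<open>L'\<close>, so that both contribute \<open>\<eta> * c\<close>
    times the volume.\<close>
  have ec: "0 < \<eta> * c" using c \<eta> by simp
  have "AE x in L. x \<in> E \<longrightarrow> eventually (\<lambda>r. measure \<nu>' (gball x r) \<le> (\<eta> * c) * measure L (gball x r)) (at_right 0)"
    by (rule AE_measure_gball_le[OF L(1) R(1) L(2) R(2) E(1) _ ec]) (use R(4)[OF E(1)] in simp)
  moreover have "AE x in L. x \<in> E \<longrightarrow> eventually (\<lambda>r. measure L' (gball x r) \<le> \<eta> * measure L (gball x r)) (at_right 0)"
    by (rule AE_measure_gball_le[OF L(1) S(1) L(2) S(2) E(1) _ \<eta>]) (use S(4)[OF E(1)] in simp)
  ultimately have ae: "AE x in L. x \<in> E \<longrightarrow> eventually (\<lambda>r. measure \<nu>' (gball x r) \<le> (\<eta> * c) * measure L (gball x r)) (at_right 0)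
      \<and> eventually (\<lambda>r. measure L' (gball x r) \<le> \<eta> * measure L (gball x r)) (at_right 0)"
    by eventually_elim blast
  \<comment> \<open>\<open>E\<close> has positive Lebesgue measure, so the almost everywhere
    statements hold at some point of \<open>E\<close>.\<close>
  have "\<not> (AE x in L. x \<notin> E)"
  proof
    assume "AE x in L. x \<notin> E"
    then have "emeasure L E = 0"
      using E(1) L(2) by (subst (asm) AE_iff_measurable[of E]) (auto simp: sets_eq_imp_space_eq[OF L(2)])
    then show False using E L(3)[OF E(1)] by (simp add: null_sets_def Int_absorb2)
  qed
  then have notAE: "\<not> (AE x in L. x \<notin> E)" .
  have "\<exists>y. y \<in> E \<and> eventually (\<lambda>r. measure \<nu>' (gball y r) \<le> (\<eta> * c) * measure L (gball y r)) (at_right 0)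
      \<and> eventually (\<lambda>r. measure L' (gball y r) \<le> \<eta> * measure L (gball y r)) (at_right 0)"
  proof (rule ccontr)
    assume no: "\<not> ?thesis"
    have "AE x in L. x \<notin> E" using ae
    proof eventually_elim
      case (elim x)
      then show "x \<notin> E" using no by blast
    qed
    then show False using notAE by blast
  qed
  then obtain y0 where y0: "y0 \<in> E" "eventually (\<lambda>r. measure \<nu>' (gball y0 r) \<le> (\<eta> * c) * measure L (gball y0 r)) (at_right 0)"
      "eventually (\<lambda>r. measure L' (gball y0 r) \<le> \<eta> * measure L (gball y0 r)) (at_right 0)" by blast
  have y0K: "y0 \<in> K" using y0(1) E(2) by blast
  have "eventually (\<lambda>r. gball y0 r \<subseteq> K \<and>
       \<bar>measure \<nu> (gball y0 r) - c * (vol * r ^ CARD('n))\<bar> \<le> 3 * \<eta> * (c * (vol * r ^ CARD('n))) \<and>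
       (LINT x:gball y0 r|\<sigma>. \<bar>f x\<bar>) \<le> 3 * \<eta> * (c * (vol * r ^ CARD('n)))) (at_right 0)"
    using y0(2,3) eventually_gball_subset[OF open_K y0K] eventually_at_right_less
  proof eventually_elim
    case (elim r)
    let ?B = "gball y0 r" and ?V = "vol * r ^ CARD('n)"
    have r: "0 < r" using elim(4) .
    have LV: "measure L ?B = ?V"
      using L(4)[OF gball_borel] elim(3) measure_gball[OF r] by (simp add: Int_absorb2)
    have BE: "?B \<inter> E \<in> sets borel" "?B \<inter> E \<subseteq> E" "?B - E \<in> sets borel" using E(1) by auto
    have n1: "measure \<nu> (?B - E) \<le> \<eta> * c * ?V" using elim(1) R(3)[OF gball_borel] LV by (simp add: Diff_eq)
    have l1: "measure L (?B - E) \<le> \<eta> * ?V" using elim(2) S(3)[OF gball_borel] LV by (simp add: Diff_eq)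
    have split: "measure m ?B = measure m (?B \<inter> E) + measure m (?B - E)" if "finite_measure m" "sets m = sets borel" for m
    proof -
      have "measure m ((?B \<inter> E) \<union> (?B - E)) = measure m (?B \<inter> E) + measure m (?B - E)"
        by (rule finite_measure.finite_measure_Union[OF that(1)]) (use BE that(2) in auto)
      moreover have "(?B \<inter> E) \<union> (?B - E) = ?B" by auto
      ultimately show ?thesis by simp
    qed
    note s\<nu> = split[OF fin sets] and sL = split[OF L(1,2)]
    have LE: "measure L (?B \<inter> E) \<le> ?V" using sL LV measure_nonneg[of L "?B - E"] by linarith
    have V0: "0 \<le> ?V" using vol_pos r by simp
    have up: "measure \<nu> ?B \<le> c * ?V + 3 * \<eta> * (c * ?V)"
    proof -
      have "measure \<nu> (?B \<inter> E) \<le> (1 + \<eta>) * c * ?V"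
      proof (rule order_trans[OF lev'(2)[OF BE(1,2)] mult_left_mono[OF LE]])
        show "0 \<le> (1 + \<eta>) * c" using c \<eta> by simp
      qed
      then have "measure \<nu> ?B \<le> (1 + \<eta>) * c * ?V + \<eta> * c * ?V" using s\<nu> n1 by linarith
      also have "\<dots> \<le> c * ?V + 3 * \<eta> * (c * ?V)"
        using mult_nonneg_nonneg[OF less_imp_le[OF ec] V0] by (simp add: algebra_simps)
      finally show ?thesis .
    qed
    have low: "c * ?V - 3 * \<eta> * (c * ?V) \<le> measure \<nu> ?B"
    proof -
      have "c * ?V - 3 * \<eta> * (c * ?V) \<le> c * (?V - \<eta> * ?V)"
        using mult_nonneg_nonneg[OF less_imp_le[OF ec] V0] by (simp add: algebra_simps)
      also have "\<dots> \<le> c * measure L (?B \<inter> E)"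
        using sL LV l1 c by (intro mult_left_mono) linarith+
      also have "\<dots> \<le> measure \<nu> (?B \<inter> E)" by (rule lev'(1)[OF BE(1,2)])
      also have "\<dots> \<le> measure \<nu> ?B" using s\<nu> by simp
      finally show ?thesis .
    qed
    \<comment> \<open>Three errors of size \<open>\<eta> * c * ?V\<close>: the pinching on
      \<open>E\<close>, and the masses of \<open>\<nu>\<close> and of \<open>c L\<close> outside
      \<open>E\<close>.\<close>
    have tv: "(LINT x:?B|\<sigma>. \<bar>f x\<bar>) \<le> 3 * \<eta> * (c * ?V)"
    proof -
      have isi: "integrable \<sigma> (\<lambda>x. indicator A x *\<^sub>R h x)" if "integrable \<sigma> h" "A \<in> sets borel" for h :: "_ \<Rightarrow> real" and A
        by (rule integrable_mult_indicator[OF _ that(1)]) (use that(2) \<sigma>(2) in simp)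
      have "(LINT x:?B|\<sigma>. \<bar>f x\<bar>) \<le> (LINT x|\<sigma>. \<eta> * c * (indicator ?B x *\<^sub>R b x)
          + (indicator (?B - E) x *\<^sub>R a x + c * (indicator (?B - E) x *\<^sub>R b x)))"
        unfolding set_lebesgue_integral_def
      proof (rule integral_mono_AE)
        show "integrable \<sigma> (\<lambda>x. indicator ?B x *\<^sub>R \<bar>f x\<bar>)" by (rule isi[OF _ gball_borel]) (use fi in simp)
        show "integrable \<sigma> (\<lambda>x. \<eta> * c * (indicator ?B x *\<^sub>R b x) + (indicator (?B - E) x *\<^sub>R a x + c * (indicator (?B - E) x *\<^sub>R b x)))"
          by (intro Bochner_Integration.integrable_add integrable_mult_right isi \<sigma>(3,4) gball_borel BE(3))
        show "AE x in \<sigma>. indicator ?B x *\<^sub>R \<bar>f x\<bar> \<le> \<eta> * c * (indicator ?B x *\<^sub>R b x)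
          + (indicator (?B - E) x *\<^sub>R a x + c * (indicator (?B - E) x *\<^sub>R b x))"
          using AEf by eventually_elim (auto simp: indicator_def split: if_splits)
      qed
      also have "\<dots> = \<eta> * c * measure L ?B + (measure \<nu> (?B - E) + c * measure L (?B - E))"
        unfolding a[OF BE(3)] b[OF BE(3)] b[OF gball_borel] set_lebesgue_integral_def
        by (subst Bochner_Integration.integral_add Bochner_Integration.integral_mult_right_zero |
            intro Bochner_Integration.integrable_add integrable_mult_right isi \<sigma>(3,4) gball_borel BE(3))+ simp
      also have "\<dots> \<le> \<eta> * c * ?V + (\<eta> * c * ?V + c * (\<eta> * ?V))"
        using n1 l1 c ec unfolding LV by (intro add_mono mult_left_mono) auto
      finally show ?thesis by (simp add: algebra_simps)
    qed
    show ?case using elim(3) up low tv by linarith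
  qed
  then show thesis by (rule that[OF c y0K wdf])
qed

end

section \<open>Blow-ups of functions of bounded variation\<close>

text \<open>Together with \<open>BV_density\<close> this is the polar decomposition of the
  derivative in Borel form on the whole space, the representation used from here on.\<close>

definition BV_density_measure :: "(real^'n) set \<Rightarrow> (real^'n \<Rightarrow> real^'m) \<Rightarrow> (real^'n) measure" where
  "BV_density_measure \<Omega> u = distr (BV_variation \<Omega> u) borel (\<lambda>x. x)"

definition BV_density :: "(real^'n) set \<Rightarrow> (real^'n \<Rightarrow> real^'m) \<Rightarrow> real^'n \<Rightarrow> real^'n^'m" where
  "BV_density \<Omega> u = (\<lambda>x. indicator \<Omega> x *\<^sub>R polar_density (lborel_on \<Omega>) (BV_deriv \<Omega> u) x)"

lemma BV_density:
  assumes u: "u \<in> BV \<Omega>" and \<Omega>: "open \<Omega>"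
  shows "weak_deriv \<Omega> u (BV_density_measure \<Omega> u) (BV_density \<Omega> u)"
    and "finite_measure (BV_density_measure \<Omega> u)" and "sets (BV_density_measure \<Omega> u) = sets borel"
    and "\<And>B. B \<in> sets borel \<Longrightarrow> measure (BV_density_measure \<Omega> u) B = measure (BV_variation \<Omega> u) (B \<inter> \<Omega>)"
    and "AE x in BV_density_measure \<Omega> u. x \<in> \<Omega> \<and> norm (BV_density \<Omega> u x) = 1"
    and "BV_density \<Omega> u \<in> borel_measurable borel" and "integrable (lebesgue_on \<Omega>) u"
proof -
  have d: "is_distr_deriv \<Omega> u (BV_deriv \<Omega> u)" by (rule BV_deriv_is_distr_deriv[OF u \<Omega>])
  note I = is_distr_deriv_imp_weak_deriv[OF d \<Omega>, folded BV_variation_def, folded BV_density_measure_def]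
  show wd: "weak_deriv \<Omega> u (BV_density_measure \<Omega> u) (BV_density \<Omega> u)"
    unfolding BV_density_def by (rule I(1))
  show s: "finite_measure (BV_density_measure \<Omega> u)" "sets (BV_density_measure \<Omega> u) = sets borel" by (rule I)+
  show "measure (BV_density_measure \<Omega> u) B = measure (BV_variation \<Omega> u) (B \<inter> \<Omega>)" if "B \<in> sets borel" for B
    by (rule I(4)[OF that])
  show "AE x in BV_density_measure \<Omega> u. x \<in> \<Omega> \<and> norm (BV_density \<Omega> u x) = 1"
    unfolding BV_density_def by (rule I(6))
  have "integrable (BV_density_measure \<Omega> u) (BV_density \<Omega> u)" using wd by (simp add: weak_deriv_def)
  then show "BV_density \<Omega> u \<in> borel_measurable borel"
    using borel_measurable_integrable s(2) by (simp cong: measurable_cong_sets)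
  show "integrable (lebesgue_on \<Omega>) u" using u by (simp add: BV_def)
qed

lemma norm_matrix_vector_mult_le:
  fixes M :: "real^'n^'m"
  shows "norm (M *v y) \<le> CARD('m) * (norm M * norm y)"
proof -
  have "norm (M *v y) \<le> (\<Sum>i\<in>UNIV. \<bar>(M *v y) $ i\<bar>)" by (rule norm_le_l1_cart)
  also have "\<dots> \<le> (\<Sum>i\<in>(UNIV :: 'm set). norm M * norm y)"
  proof (rule sum_mono)
    fix i
    have "\<bar>(M *v y) $ i\<bar> = \<bar>M $ i \<bullet> y\<bar>" by (simp add: matrix_vector_mult_def inner_vec_def)
    also have "\<dots> \<le> norm (M $ i) * norm y" by (rule Cauchy_Schwarz_ineq2)
    also have "\<dots> \<le> norm M * norm y" by (intro mult_right_mono Finite_Cartesian_Product.norm_nth_le) auto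
    finally show "\<bar>(M *v y) $ i\<bar> \<le> norm M * norm y" .
  qed
  finally show ?thesis by simp
qed

context symmetric_body
begin

lemma dilate_gball: "0 < \<epsilon> \<Longrightarrow> dilate_at (gball z r) \<epsilon> x = gball (x + \<epsilon> *\<^sub>R z) (\<epsilon> * r)"
proof -
  assume e: "0 < \<epsilon>"
  have "y \<in> dilate_at (gball z r) \<epsilon> x \<longleftrightarrow> y \<in> gball (x + \<epsilon> *\<^sub>R z) (\<epsilon> * r)" for y
  proof -
    have "y \<in> dilate_at (gball z r) \<epsilon> x \<longleftrightarrow> (1 / \<epsilon>) *\<^sub>R (y - x) \<in> gball z r"
      using dilate_at_iff[OF e, of x "(1 / \<epsilon>) *\<^sub>R (y - x)" "gball z r"] e by simp
    also have "\<dots> \<longleftrightarrow> N ((1 / \<epsilon>) *\<^sub>R (y - x) - z) < r" by (simp add: gball_def)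
    also have "(1 / \<epsilon>) *\<^sub>R (y - x) - z = (1 / \<epsilon>) *\<^sub>R (y - (x + \<epsilon> *\<^sub>R z))"
      using e by (simp add: algebra_simps)
    also have "N \<dots> = (1 / \<epsilon>) * N (y - (x + \<epsilon> *\<^sub>R z))" using e by (simp only: N_scale) simp
    also have "\<dots> < r \<longleftrightarrow> y \<in> gball (x + \<epsilon> *\<^sub>R z) (\<epsilon> * r)"
      using e by (simp add: gball_def field_simps)
    finally show ?thesis .
  qed
  then show ?thesis by blast
qed

lemma gball_mono: "N (z - x) + r \<le> r' \<Longrightarrow> gball z r \<subseteq> gball x r'"
proof (rule subsetI)
  fix y assume "N (z - x) + r \<le> r'" "y \<in> gball z r"
  then show "y \<in> gball x r'" using N_triangle[of y x z] by (simp add: gball_def)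
qed

lemma card_power: "(r::real) ^ (CARD('n) - 1) * r = r ^ CARD('n)"
  by (cases "CARD('n)") auto

text \<open>The normalisation gives every blow-up the same variation \<open>vol\<close> in
  \<open>K\<close>: its density is \<open>k\<close> times a function of norm one almost everywhere,
  and \<open>k\<close> times the mass of the copy of \<open>K\<close> is \<open>vol\<close>.\<close>

lemma blow_up_weak_deriv:
  fixes u :: "real^'n \<Rightarrow> real^'m"
  assumes u: "u \<in> BV \<Omega>" and \<Omega>: "open \<Omega>" and \<epsilon>: "0 < \<epsilon>" and sub: "gball x \<epsilon> \<subseteq> \<Omega>"
  defines "\<tau> \<equiv> BV_density_measure \<Omega> u" and "F \<equiv> BV_density \<Omega> u"
  assumes pos: "0 < measure \<tau> (gball x \<epsilon>)"
  defines "k \<equiv> vol / measure \<tau> (gball x \<epsilon>)" and "t \<equiv> distr \<tau> borel (\<lambda>z. (1 / \<epsilon>) *\<^sub>R (z - x))"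
  shows "blow_up \<Omega> u K \<epsilon> x = (\<lambda>y. inverse (measure \<tau> (gball x \<epsilon>) / (vol * \<epsilon> ^ (CARD('n) - 1))) *\<^sub>R
        (u (x + \<epsilon> *\<^sub>R y) - set_average (gball x \<epsilon>) u))"
    and "weak_deriv K (blow_up \<Omega> u K \<epsilon> x) t (\<lambda>y. k *\<^sub>R F (x + \<epsilon> *\<^sub>R y))"
    and "integrable (lebesgue_on K) (blow_up \<Omega> u K \<epsilon> x)"
    and "\<And>B. B \<in> sets borel \<Longrightarrow> measure t B = measure \<tau> (dilate_at B \<epsilon> x)"
    and "blow_up \<Omega> u K \<epsilon> x \<in> BV K" and "measure (BV_variation K (blow_up \<Omega> u K \<epsilon> x)) K = vol"
    and "(LINT y:K|t. norm (k *\<^sub>R F (x + \<epsilon> *\<^sub>R y) - k *\<^sub>R M)) = k * (LINT z:gball x \<epsilon>|\<tau>. norm (F z - M))"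
proof -
  note B = BV_density[OF u \<Omega>, folded \<tau>_def F_def]
  note dil = dilate_at_K[OF \<epsilon>, of x]
  have sub': "dilate_at K \<epsilon> x \<subseteq> \<Omega>" using sub dil by simp
  let ?m = "measure \<tau> (gball x \<epsilon>)"
  let ?c = "inverse (?m / (vol * \<epsilon> ^ (CARD('n) - 1)))"
  have "measure (BV_variation \<Omega> u) (gball x \<epsilon>) = ?m"
    using B(4)[OF gball_borel, of x \<epsilon>] sub by (simp add: Int_absorb2)
  then show eq: "blow_up \<Omega> u K \<epsilon> x = (\<lambda>y. ?c *\<^sub>R (u (x + \<epsilon> *\<^sub>R y) - set_average (gball x \<epsilon>) u))"
    unfolding blow_up_def dil by simp
  \<comment> \<open>The scalar factor of the blow-up combined with the one from
    \<open>weak_deriv_rescaled\<close>; the powers of \<open>\<epsilon>\<close> cancel.\<close>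
  have k: "?c * \<epsilon> / \<epsilon> ^ CARD('n) = k"
    using \<epsilon> pos vol_pos unfolding k_def card_power[of \<epsilon>, symmetric] by (simp add: field_simps)
  have kpos: "0 < k" using pos vol_pos by (simp add: k_def)
  note D = B(1,7) \<Omega> open_K bounded_K \<epsilon> sub'
  note R1 = weak_deriv_rescaled(1)[OF D, where c = ?c and a = "set_average (gball x \<epsilon>) u", unfolded k, folded eq t_def]
  note R2 = weak_deriv_rescaled(2)[OF D, where c = ?c and a = "set_average (gball x \<epsilon>) u", folded eq]
  note R3 = weak_deriv_rescaled(3)[OF D, folded t_def]
  note R4 = weak_deriv_rescaled(4)[OF D, where c = ?c, unfolded k, folded t_def]
  show wd: "weak_deriv K (blow_up \<Omega> u K \<epsilon> x) t (\<lambda>y. k *\<^sub>R F (x + \<epsilon> *\<^sub>R y))" by (rule R1)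
  show i: "integrable (lebesgue_on K) (blow_up \<Omega> u K \<epsilon> x)" by (rule R2)
  show "measure t B = measure \<tau> (dilate_at B \<epsilon> x)" if "B \<in> sets borel" for B by (rule R3[OF that])
  show "blow_up \<Omega> u K \<epsilon> x \<in> BV K" by (rule weak_deriv_imp_BV(1)[OF wd i open_K])
  have sp: "space \<tau> = UNIV" using sets_eq_imp_space_eq[OF B(3)] by simp
  have c0: "0 \<le> ?c" using pos vol_pos \<epsilon> by simp
  have "measure (BV_variation K (blow_up \<Omega> u K \<epsilon> x)) K = k * (LINT z:gball x \<epsilon>|\<tau>. norm (F z))"
    unfolding weak_deriv_imp_BV(2)[OF wd i open_K] using R4[OF c0] unfolding dil .
  also have "(LINT z:gball x \<epsilon>|\<tau>. norm (F z)) = (LINT z:gball x \<epsilon>|\<tau>. 1)"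
    unfolding set_lebesgue_integral_def
  proof (rule integral_cong_AE)
    show "AE z in \<tau>. indicator (gball x \<epsilon>) z *\<^sub>R norm (F z) = indicator (gball x \<epsilon>) z *\<^sub>R 1"
      using B(5) by eventually_elim simp
  qed (use B(3,6) in \<open>simp_all cong: measurable_cong_sets\<close>)
  also have "\<dots> = ?m" by (simp add: set_lebesgue_integral_def sp)
  also have "k * ?m = vol" using pos by (simp add: k_def)
  finally show "measure (BV_variation K (blow_up \<Omega> u K \<epsilon> x)) K = vol" .
  let ?S = "\<lambda>z. (1 / \<epsilon>) *\<^sub>R (z - x)"
  have Sm: "?S \<in> measurable \<tau> borel" unfolding measurable_cong_sets[OF B(3) refl] by measurable
  have TS: "x + \<epsilon> *\<^sub>R ?S z = z" for z using \<epsilon> by simp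
  have FT: "(\<lambda>y. F (x + \<epsilon> *\<^sub>R y)) \<in> borel_measurable borel"
    by (rule measurable_compose[OF _ B(6)]) measurable
  have "(LINT y:K|t. norm (k *\<^sub>R F (x + \<epsilon> *\<^sub>R y) - k *\<^sub>R M)) = (LINT y|t. k * (indicator K y *\<^sub>R norm (F (x + \<epsilon> *\<^sub>R y) - M)))"
    unfolding set_lebesgue_integral_def
    by (rule Bochner_Integration.integral_cong) (use kpos in \<open>auto simp flip: scaleR_diff_right\<close>)
  also have "\<dots> = k * (LINT y|t. indicator K y *\<^sub>R norm (F (x + \<epsilon> *\<^sub>R y) - M))"
    by (rule integral_mult_right_zero)
  also have "(LINT y|t. indicator K y *\<^sub>R norm (F (x + \<epsilon> *\<^sub>R y) - M)) = (LINT z|\<tau>. indicator K (?S z) *\<^sub>R norm (F (x + \<epsilon> *\<^sub>R ?S z) - M))"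
    unfolding t_def by (rule integral_distr[OF Sm]) (use FT in simp)
  also have "\<dots> = (LINT z:gball x \<epsilon>|\<tau>. norm (F z - M))"
    unfolding set_lebesgue_integral_def TS
  proof (rule Bochner_Integration.integral_cong[OF refl])
    fix z
    have "z \<in> gball x \<epsilon> \<longleftrightarrow> ?S z \<in> K" using dilate_at_iff[OF \<epsilon>, of x "?S z" K] unfolding TS dil .
    then show "indicator K (?S z) *\<^sub>R norm (F z - M) = indicator (gball x \<epsilon>) z *\<^sub>R norm (F z - M)" by (simp add: indicator_def)
  qed
  finally show "(LINT y:K|t. norm (k *\<^sub>R F (x + \<epsilon> *\<^sub>R y) - k *\<^sub>R M)) = k * (LINT z:gball x \<epsilon>|\<tau>. norm (F z - M))" .
qed

lemma set_average_const_add: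
  fixes f :: "real^'n \<Rightarrow> 'b::{banach, second_countable_topology}"
  assumes "integrable (lebesgue_on K) f"
  shows "set_average K (\<lambda>y. c *\<^sub>R f y + a) = c *\<^sub>R set_average K f + a"
proof -
  have "(LINT y|lebesgue_on K. c *\<^sub>R f y + a) = c *\<^sub>R (LINT y|lebesgue_on K. f y) + vol *\<^sub>R a"
    using assms by (simp only: Bochner_Integration.integral_add[OF integrable_scaleR_right[OF assms]
        integrable_lebesgue_on_const[OF bounded_K open_K]] integral_scaleR_right lebesgue_on_const[OF bounded_K open_K])
  then show ?thesis using vol_pos unfolding set_average_def by (simp add: scaleR_add_right)
qed

text \<open>Blowing up at a nearby point on a smaller scale is blowing up the blow-up
  \<open>w\<close>. Subtracting averages removes the additive constants, and the normalisation
  leaves only \<open>m\<close>, the variation of \<open>w\<close> in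
  \<open>gball z \<delta>\<close>.\<close>

lemma blow_up_blow_up:
  fixes u :: "real^'n \<Rightarrow> real^'m"
  assumes u: "u \<in> BV \<Omega>" and \<Omega>: "open \<Omega>" and \<epsilon>: "0 < \<epsilon>" and sub: "gball x \<epsilon> \<subseteq> \<Omega>"
  defines "\<tau> \<equiv> BV_density_measure \<Omega> u"
  assumes pos: "0 < measure \<tau> (gball x \<epsilon>)"
    and \<delta>: "0 < \<delta>" and z: "gball z \<delta> \<subseteq> K"
    and pos2: "0 < measure \<tau> (gball (x + \<epsilon> *\<^sub>R z) (\<epsilon> * \<delta>))"
  defines "w \<equiv> blow_up \<Omega> u K \<epsilon> x"
    and "m \<equiv> vol / measure \<tau> (gball x \<epsilon>) * measure \<tau> (gball (x + \<epsilon> *\<^sub>R z) (\<epsilon> * \<delta>))"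
  shows "blow_up \<Omega> u K (\<epsilon> * \<delta>) (x + \<epsilon> *\<^sub>R z) y =
     (vol * \<delta> ^ (CARD('n) - 1) / m) *\<^sub>R (w (z + \<delta> *\<^sub>R y) - set_average K (\<lambda>y. w (z + \<delta> *\<^sub>R y)))"
    and "gball (x + \<epsilon> *\<^sub>R z) (\<epsilon> * \<delta>) \<subseteq> gball x \<epsilon>"
proof -
  let ?x = "x + \<epsilon> *\<^sub>R z" and ?e = "\<epsilon> * \<delta>"
  have e: "0 < ?e" using \<epsilon> \<delta> by simp
  have "dilate_at (gball z \<delta>) \<epsilon> x \<subseteq> dilate_at K \<epsilon> x" using z by (auto simp: dilate_at_def)
  then show sub2: "gball ?x ?e \<subseteq> gball x \<epsilon>" unfolding dilate_gball[OF \<epsilon>] dilate_at_K[OF \<epsilon>] .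
  then have sub3: "gball ?x ?e \<subseteq> \<Omega>" using sub by blast
  note B = blow_up_weak_deriv[OF u \<Omega> \<epsilon> sub pos[unfolded \<tau>_def], folded \<tau>_def w_def]
  note B2 = blow_up_weak_deriv[OF u \<Omega> e sub3 pos2[unfolded \<tau>_def], folded \<tau>_def]
  let ?q = "measure \<tau> (gball x \<epsilon>) / (vol * \<epsilon> ^ (CARD('n) - 1))"
  have q: "?q \<noteq> 0" using pos vol_pos \<epsilon> by simp
  let ?a = "set_average (gball x \<epsilon>) u"
  have uw: "u (x + \<epsilon> *\<^sub>R y) = ?q *\<^sub>R w y + ?a" for y
    unfolding fun_cong[OF B(1)] using q by simp
  have arg: "?x + ?e *\<^sub>R y = x + \<epsilon> *\<^sub>R (z + \<delta> *\<^sub>R y)" for y by (simp add: algebra_simps)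
  have ui: "integrable (lebesgue_on (dilate_at K ?e ?x)) u"
    using integrable_lebesgue_on_subset[OF BV_density(7)[OF u \<Omega>] \<Omega> open_gball sub3] by (simp add: dilate_at_K[OF e])
  have wi: "integrable (lebesgue_on K) (\<lambda>y. w (z + \<delta> *\<^sub>R y))"
    by (rule lebesgue_on_scaled_integral(2)[OF open_K \<delta>], rule integrable_lebesgue_on_subset[OF B(3) open_K])
       (use z dilate_at_K[OF \<delta>] open_gball in auto)
  have "set_average (gball ?x ?e) u = set_average K (\<lambda>y. u (?x + ?e *\<^sub>R y))"
    using set_average_dilate_at[OF open_K bounded_K e ui] by (simp add: dilate_at_K[OF e])
  also have "\<dots> = ?q *\<^sub>R set_average K (\<lambda>y. w (z + \<delta> *\<^sub>R y)) + ?a"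
    unfolding arg uw by (rule set_average_const_add[OF wi])
  finally have avg: "set_average (gball ?x ?e) u = ?q *\<^sub>R set_average K (\<lambda>y. w (z + \<delta> *\<^sub>R y)) + ?a" .
  have coef: "inverse (measure \<tau> (gball ?x ?e) / (vol * ?e ^ (CARD('n) - 1))) * ?q = vol * \<delta> ^ (CARD('n) - 1) / m"
    using pos pos2 vol_pos \<epsilon> \<delta> unfolding m_def by (simp add: field_simps power_mult_distrib)
  have "blow_up \<Omega> u K ?e ?x y = inverse (measure \<tau> (gball ?x ?e) / (vol * ?e ^ (CARD('n) - 1))) *\<^sub>R
      (?q *\<^sub>R w (z + \<delta> *\<^sub>R y) + ?a - (?q *\<^sub>R set_average K (\<lambda>y. w (z + \<delta> *\<^sub>R y)) + ?a))"
    unfolding fun_cong[OF B2(1)] avg arg uw ..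
  also have "\<dots> = (inverse (measure \<tau> (gball ?x ?e) / (vol * ?e ^ (CARD('n) - 1))) * ?q) *\<^sub>R
      (w (z + \<delta> *\<^sub>R y) - set_average K (\<lambda>y. w (z + \<delta> *\<^sub>R y)))"
    by (simp only: scaleR_scaleR[symmetric] scaleR_diff_right add_diff_cancel_right)
  finally show "blow_up \<Omega> u K ?e ?x y =
     (vol * \<delta> ^ (CARD('n) - 1) / m) *\<^sub>R (w (z + \<delta> *\<^sub>R y) - set_average K (\<lambda>y. w (z + \<delta> *\<^sub>R y)))"
    unfolding coef .
qed

text \<open>The integrand is odd and \<open>K\<close> is symmetric. So the linear limit has mean
  zero, as the blow-ups do.\<close>

lemma set_average_linear:
  fixes M :: "real^'n^'m"
  shows "set_average K (\<lambda>y. M *v y) = 0"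
proof -
  have sym: "indicator K (- y) = (indicator K y :: real)" for y by (simp add: K_eq indicator_def)
  have neg: "M *v (- y) = - (M *v y)" for y using matrix_vector_mult_scaleR[of M "-1" y] by simp
  let ?f = "\<lambda>y. indicator K y *\<^sub>R (M *v y)"
  have lin: "(\<lambda>y. M *v y) \<in> borel_measurable borel"
    by (simp add: borel_measurable_continuous_onI matrix_vector_mult_linear_continuous_on)
  have fm: "?f \<in> borel_measurable borel" using lin by simp
  have "distr lborel borel uminus = (lborel :: (real^'n) measure)"
    using lborel_affine[of "-1" "0 :: real^'n"] by (simp add: density_1)
  then have "(LINT y|lborel. ?f y) = (LINT y|distr lborel borel uminus. ?f y)" by simp
  also have "\<dots> = (LINT y|lborel. ?f (- y))" by (rule integral_distr) (use fm in auto)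
  also have "\<dots> = (LINT y|lborel. - ?f y)"
    by (rule Bochner_Integration.integral_cong) (auto simp: sym neg)
  also have "\<dots> = - (LINT y|lborel. ?f y)" by simp
  finally have "(LINT y|lborel. ?f y) + (LINT y|lborel. ?f y) = 0" by (metis add.right_inverse)
  then have "2 *\<^sub>R (LINT y|lborel. ?f y) = 0" by (simp only: scaleR_2)
  then have "(LINT y|lborel. ?f y) = 0" by simp
  then show ?thesis
    unfolding set_average_def lebesgue_on_open(1)[OF open_K] using integral_completion[of ?f lborel] fm by simp
qed

text \<open>Two comparisons, both after rescaling: \<open>w\<close> with \<open>p\<close> by their
  L1 distance, and \<open>p\<close> with the linear map \<open>c M\<close> by the Poincare
  inequality. The latter controls functions only up to constants, which is why averages are
  subtracted throughout.\<close>

lemma secondary_blow_up_estimate: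
  fixes w p :: "real^'n \<Rightarrow> real^'m"
  assumes w: "integrable (lebesgue_on K) w" and p: "integrable (lebesgue_on K) p"
    and wd: "weak_deriv K (\<lambda>y. p y - c *\<^sub>R (M *v y)) \<sigma> (\<lambda>x. f x *\<^sub>R M)" and M: "norm M = 1"
    and \<delta>: "0 < \<delta>" and z: "gball z \<delta> \<subseteq> K"
    and C: "0 \<le> C" "\<And>(w :: real^'n \<Rightarrow> real^'m) \<tau> F. weak_deriv K w \<tau> F \<Longrightarrow> integrable (lebesgue_on K) w \<Longrightarrow>
       (LINT y|lebesgue_on K. norm (w y - set_average K w)) \<le> C * (LINT x:K|\<tau>. norm (F x))"
  shows "(LINT y|lebesgue_on K. norm (w (z + \<delta> *\<^sub>R y) - set_average K (\<lambda>y. w (z + \<delta> *\<^sub>R y)) - (c * \<delta>) *\<^sub>R (M *v y)))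
     \<le> 2 / \<delta> ^ CARD('n) * (LINT y|lebesgue_on K. norm (w y - p y)) +
       C * (\<delta> / \<delta> ^ CARD('n) * (LINT x:gball z \<delta>|\<sigma>. \<bar>f x\<bar>))"
    and "integrable (lebesgue_on K) (\<lambda>y. w (z + \<delta> *\<^sub>R y) - set_average K (\<lambda>y. w (z + \<delta> *\<^sub>R y)) - (c * \<delta>) *\<^sub>R (M *v y))"
proof -
  have dil: "dilate_at K \<delta> z = gball z \<delta>" by (rule dilate_at_K[OF \<delta>])
  have sub: "dilate_at K \<delta> z \<subseteq> K" using z dil by simp
  have li: "integrable (lebesgue_on K) (\<lambda>y. M *v y)" by (rule weak_deriv_linear(2)[OF open_K bounded_K])
  have sc: "integrable (lebesgue_on K) (\<lambda>y. v (z + \<delta> *\<^sub>R y))" if "integrable (lebesgue_on K) v"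
    for v :: "real^'n \<Rightarrow> real^'m"
    by (rule lebesgue_on_scaled_integral(2)[OF open_K \<delta>], rule integrable_lebesgue_on_subset[OF that open_K])
       (use sub dil open_gball in auto)
  have ki: "integrable (lebesgue_on K) (\<lambda>y. a)" for a :: "real^'m"
    by (rule integrable_lebesgue_on_const[OF bounded_K open_K])
  define q where "q y = w (z + \<delta> *\<^sub>R y)" for y
  define P where "P y = p (z + \<delta> *\<^sub>R y)" for y
  \<comment> \<open>The rescaled difference between \<open>p\<close> and its linear model; the
    constant contributed by \<open>M *v z\<close> disappears with the average.\<close>
  define r where "r y = P y - c *\<^sub>R (M *v (z + \<delta> *\<^sub>R y))" for y
  have qi: "integrable (lebesgue_on K) q" and Pi: "integrable (lebesgue_on K) P"
    unfolding q_def P_def by (rule sc[OF w], rule sc[OF p])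
  have r_eq: "r y = P y - (c * \<delta>) *\<^sub>R (M *v y) - c *\<^sub>R (M *v z)" for y
    by (simp add: r_def matrix_vector_right_distrib matrix_vector_mult_scaleR scaleR_add_right)
  have ri: "integrable (lebesgue_on K) r"
    unfolding r_eq[abs_def] by (intro Bochner_Integration.integrable_diff Pi integrable_scaleR_right li ki)
  have pci: "integrable (lebesgue_on K) (\<lambda>y. p y - c *\<^sub>R (M *v y))"
    by (intro Bochner_Integration.integrable_diff p integrable_scaleR_right li)
  have "weak_deriv K r (distr \<sigma> borel (\<lambda>za. (1 / \<delta>) *\<^sub>R (za - z))) (\<lambda>y. (\<delta> / \<delta> ^ CARD('n)) *\<^sub>R (f (z + \<delta> *\<^sub>R y) *\<^sub>R M))"
    using weak_deriv_rescaled(1)[OF wd pci open_K open_K bounded_K \<delta> sub, where c = 1 and a = 0]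
    unfolding r_def[abs_def] P_def by simp
  from C(2)[OF this ri]
  have "(LINT y|lebesgue_on K. norm (r y - set_average K r)) \<le>
     C * (LINT y:K|distr \<sigma> borel (\<lambda>za. (1 / \<delta>) *\<^sub>R (za - z)). norm ((\<delta> / \<delta> ^ CARD('n)) *\<^sub>R (f (z + \<delta> *\<^sub>R y) *\<^sub>R M)))" .
  also have "(LINT y:K|distr \<sigma> borel (\<lambda>za. (1 / \<delta>) *\<^sub>R (za - z)). norm ((\<delta> / \<delta> ^ CARD('n)) *\<^sub>R (f (z + \<delta> *\<^sub>R y) *\<^sub>R M)))
     = \<delta> / \<delta> ^ CARD('n) * (LINT x:gball z \<delta>|\<sigma>. \<bar>f x\<bar>)"
    using weak_deriv_rescaled(4)[OF wd pci open_K open_K bounded_K \<delta> sub, where c = 1] M unfolding dil by simp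
  finally have Poin: "(LINT y|lebesgue_on K. norm (r y - set_average K r)) \<le> C * (\<delta> / \<delta> ^ CARD('n) * (LINT x:gball z \<delta>|\<sigma>. \<bar>f x\<bar>))" .
  have avg_diff: "set_average K (\<lambda>y. v y - v' y) = set_average K v - set_average K v'"
    if "integrable (lebesgue_on K) v" "integrable (lebesgue_on K) v'" for v v' :: "real^'n \<Rightarrow> real^'m"
    unfolding set_average_def using that by (simp add: scaleR_diff_right)
  have avg_r: "set_average K r = set_average K P - c *\<^sub>R (M *v z)"
  proof -
    have "set_average K r = set_average K (\<lambda>y. P y - (c * \<delta>) *\<^sub>R (M *v y)) - set_average K (\<lambda>y. c *\<^sub>R (M *v z))"
      unfolding r_eq[abs_def] by (intro avg_diff Bochner_Integration.integrable_diff Pi integrable_scaleR_right li ki)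
    also have "set_average K (\<lambda>y. P y - (c * \<delta>) *\<^sub>R (M *v y)) = set_average K P - set_average K (\<lambda>y. (c * \<delta>) *\<^sub>R (M *v y))"
      by (intro avg_diff Pi integrable_scaleR_right li)
    also have "set_average K (\<lambda>y. (c * \<delta>) *\<^sub>R (M *v y)) = 0"
      using set_average_const_add[OF li, of "c * \<delta>" 0] set_average_linear[of M] by simp
    also have "set_average K (\<lambda>y. c *\<^sub>R (M *v z)) = c *\<^sub>R (M *v z)"
      unfolding set_average_def lebesgue_on_const[OF bounded_K open_K] using vol_pos by simp
    finally show ?thesis by simp
  qed
  define I where "I = (LINT y|lebesgue_on K. norm (q y - P y))"
  have qP: "integrable (lebesgue_on K) (\<lambda>y. q y - P y)" using qi Pi by simp
  have wp: "integrable (lebesgue_on K) (\<lambda>y. w y - p y)" using w p by simp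
  have I_le: "I \<le> 1 / \<delta> ^ CARD('n) * (LINT y|lebesgue_on K. norm (w y - p y))"
  proof -
    have wpd: "integrable (lebesgue_on (dilate_at K \<delta> z)) (\<lambda>y. w y - p y)"
      by (rule integrable_lebesgue_on_subset[OF wp open_K _ sub]) (simp add: dil open_gball)
    have "I = (1 / \<delta> ^ DIM(real^'n)) *\<^sub>R (LINT y|lebesgue_on (dilate_at K \<delta> z). norm (w y - p y))"
      unfolding I_def q_def P_def by (rule lebesgue_on_scaled_integral(1)[OF open_K \<delta> integrable_norm[OF wpd]])
    also have "\<dots> \<le> (1 / \<delta> ^ DIM(real^'n)) *\<^sub>R (LINT y|lebesgue_on K. norm (w y - p y))"
      using lebesgue_on_norm_mono[OF wp open_K _ sub] \<delta>
      by (intro scaleR_left_mono) (simp_all add: dil open_gball)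
    finally show ?thesis by simp
  qed
  \<comment> \<open>The averages of \<open>q\<close> and \<open>P\<close> differ by at most
    \<open>I / vol\<close>, so the distance from \<open>w\<close> to \<open>p\<close> is paid twice;
    hence the factor 2 in the estimate.\<close>
  have avgs: "vol * norm (set_average K q - set_average K P) \<le> I"
  proof -
    have "set_average K q - set_average K P = set_average K (\<lambda>y. q y - P y)" by (rule avg_diff[OF qi Pi, symmetric])
    also have "vol * norm \<dots> = norm (LINT y|lebesgue_on K. q y - P y)"
      unfolding set_average_def using vol_pos by simp
    also have "\<dots> \<le> I" unfolding I_def by (rule integral_norm_bound)
    finally show ?thesis .
  qed
  have split: "q y - set_average K q - (c * \<delta>) *\<^sub>R (M *v y) = (r y - set_average K r) + (q y - P y) - (set_average K q - set_average K P)" for y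
    unfolding r_eq avg_r by simp
  have ii: "integrable (lebesgue_on K) (\<lambda>y. q y - set_average K q - (c * \<delta>) *\<^sub>R (M *v y))"
    by (intro Bochner_Integration.integrable_diff qi ki integrable_scaleR_right li)
  then show "integrable (lebesgue_on K) (\<lambda>y. w (z + \<delta> *\<^sub>R y) - set_average K (\<lambda>y. w (z + \<delta> *\<^sub>R y)) - (c * \<delta>) *\<^sub>R (M *v y))"
    unfolding q_def[abs_def] .
  have kr: "integrable (lebesgue_on K) (\<lambda>y. a)" for a :: real
    by (rule integrable_lebesgue_on_const[OF bounded_K open_K])
  have rr: "integrable (lebesgue_on K) (\<lambda>y. norm (r y - set_average K r))"
    by (intro integrable_norm Bochner_Integration.integrable_diff ri ki)
  have "(LINT y|lebesgue_on K. norm (q y - set_average K q - (c * \<delta>) *\<^sub>R (M *v y))) \<le>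
     (LINT y|lebesgue_on K. (norm (r y - set_average K r) + norm (q y - P y)) + norm (set_average K q - set_average K P))"
  proof (rule integral_mono)
    show "norm (q y - set_average K q - (c * \<delta>) *\<^sub>R (M *v y)) \<le>
       (norm (r y - set_average K r) + norm (q y - P y)) + norm (set_average K q - set_average K P)" for y
      unfolding split by (intro order_trans[OF norm_triangle_ineq4] add_mono norm_triangle_ineq order_refl)
  qed (intro integrable_norm[OF ii] Bochner_Integration.integrable_add rr integrable_norm[OF qP] kr)+
  also have "\<dots> = (LINT y|lebesgue_on K. norm (r y - set_average K r)) + I + vol * norm (set_average K q - set_average K P)"
    by (simp only: Bochner_Integration.integral_add[OF Bochner_Integration.integrable_add[OF rr integrable_norm[OF qP]] kr]
        Bochner_Integration.integral_add[OF rr integrable_norm[OF qP]] lebesgue_on_const[OF bounded_K open_K] real_scaleR_def I_def)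
  also have "\<dots> \<le> C * (\<delta> / \<delta> ^ CARD('n) * (LINT x:gball z \<delta>|\<sigma>. \<bar>f x\<bar>)) + I + I"
    using Poin avgs by simp
  also have "\<dots> \<le> 2 / \<delta> ^ CARD('n) * (LINT y|lebesgue_on K. norm (w y - p y)) + C * (\<delta> / \<delta> ^ CARD('n) * (LINT x:gball z \<delta>|\<sigma>. \<bar>f x\<bar>))"
    using I_le by simp
  finally show "(LINT y|lebesgue_on K. norm (w (z + \<delta> *\<^sub>R y) - set_average K (\<lambda>y. w (z + \<delta> *\<^sub>R y)) - (c * \<delta>) *\<^sub>R (M *v y)))
     \<le> 2 / \<delta> ^ CARD('n) * (LINT y|lebesgue_on K. norm (w y - p y)) + C * (\<delta> / \<delta> ^ CARD('n) * (LINT x:gball z \<delta>|\<sigma>. \<bar>f x\<bar>))"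
    unfolding q_def[abs_def] .
qed

end

section \<open>Linear blow-ups at nearby points\<close>

context symmetric_body
begin

text \<open>Convergence is known against test functions only, so the mass of a ball is compared with
  that of a slightly larger one through a cut-off between the two radii.\<close>

lemma mass_comparison:
  assumes fin: "\<And>i. finite_measure (t i)" "finite_measure \<nu>"
    and sets: "\<And>i. sets (t i) = sets borel" "sets \<nu> = sets borel" and k: "\<And>i. 0 \<le> k i"
    and lim: "\<And>\<phi>. \<phi> \<in> C1_compact_support K \<Longrightarrow> (\<lambda>i. k i * (LINT y|t i. \<phi> y)) \<longlonglongrightarrow> (LINT y|\<nu>. \<phi> y)"
    and r: "0 < r1" "r1 < r2" "gball y r2 \<subseteq> K" and e: "0 < e"
  shows "eventually (\<lambda>i. k i * measure (t i) (gball y r1) < measure \<nu> (gball y r2) + e) sequentially"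
    and "eventually (\<lambda>i. measure \<nu> (gball y r1) - e < k i * measure (t i) (gball y r2)) sequentially"
proof -
  let ?C = "{x. N (x - y) \<le> r1}"
  have sub: "?C \<subseteq> gball y r2" using r by (auto simp: gball_def)
  have "closed ?C"
    by (intro closed_Collect_le continuous_on_compose2[OF continuous_N] continuous_intros) auto
  moreover have "bounded ?C" by (rule bounded_subset[OF bounded_gball sub])
  ultimately have "compact ?C" by (simp add: compact_eq_bounded_closed)
  then obtain \<phi> where \<phi>: "\<phi> \<in> C1_compact_support (gball y r2)" "\<And>x. 0 \<le> \<phi> x" "\<And>x. \<phi> x \<le> 1" "\<And>x. x \<in> ?C \<Longrightarrow> \<phi> x = 1"
    using cutoff_exists[OF _ open_gball sub] by metis
  have \<phi>K: "\<phi> \<in> C1_compact_support K" by (rule C1_compact_support_mono[OF \<phi>(1) r(3)])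
  have lo: "indicator (gball y r1) x \<le> \<phi> x" for x
    using \<phi>(2)[of x] \<phi>(4)[of x] by (auto simp: indicator_def gball_def)
  have hi: "\<phi> x \<le> indicator (gball y r2) x" for x
  proof -
    have "x \<in> gball y r2 \<or> \<phi> x = 0" using C1_compact_supportD(6)[OF \<phi>(1)] by blast
    then show ?thesis using \<phi>(3)[of x] by (auto simp: indicator_def)
  qed
  have bounds: "measure m (gball y r1) \<le> (LINT x|m. \<phi> x) \<and> (LINT x|m. \<phi> x) \<le> measure m (gball y r2)"
    if m: "finite_measure m" "sets m = sets borel" for m
  proof -
    interpret m: finite_measure m by (rule m(1))
    have sp: "space m = UNIV" using sets_eq_imp_space_eq[OF m(2)] by simp
    have \<phi>m: "\<phi> \<in> borel_measurable m" using C1_compact_supportD(4)[OF \<phi>(1)] m(2) by (simp cong: measurable_cong_sets)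
    have \<phi>i: "integrable m \<phi>" by (rule m.integrable_const_bound[of _ 1]) (use \<phi>(2,3) \<phi>m in auto)
    have ind: "integrable m (indicator (gball y r) :: _ \<Rightarrow> real)" for r
      using m(2) by (simp add: m.emeasure_eq_measure)
    have "(LINT x|m. indicator (gball y r1) x) \<le> (LINT x|m. \<phi> x)" by (rule integral_mono[OF ind \<phi>i lo])
    moreover have "(LINT x|m. \<phi> x) \<le> (LINT x|m. indicator (gball y r2) x)" by (rule integral_mono[OF \<phi>i ind hi])
    ultimately show ?thesis by (simp add: sp)
  qed
  have up: "eventually (\<lambda>i. k i * (LINT x|t i. \<phi> x) < (LINT x|\<nu>. \<phi> x) + e) sequentially"
    by (rule order_tendstoD(2)[OF lim[OF \<phi>K]]) (use e in simp)
  then show "eventually (\<lambda>i. k i * measure (t i) (gball y r1) < measure \<nu> (gball y r2) + e) sequentially"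
  proof eventually_elim
    case (elim i)
    have "k i * measure (t i) (gball y r1) \<le> k i * (LINT x|t i. \<phi> x)"
      using bounds[OF fin(1) sets(1)] k by (intro mult_left_mono) auto
    then show ?case using elim bounds[OF fin(2) sets(2)] by linarith
  qed
  have low: "eventually (\<lambda>i. (LINT x|\<nu>. \<phi> x) - e < k i * (LINT x|t i. \<phi> x)) sequentially"
    by (rule order_tendstoD(1)[OF lim[OF \<phi>K]]) (use e in simp)
  then show "eventually (\<lambda>i. measure \<nu> (gball y r1) - e < k i * measure (t i) (gball y r2)) sequentially"
  proof eventually_elim
    case (elim i)
    have "k i * (LINT x|t i. \<phi> x) \<le> k i * measure (t i) (gball y r2)"
      using bounds[OF fin(1) sets(1)] k by (intro mult_left_mono) auto
    then show ?case using elim bounds[OF fin(2) sets(2)] by linarith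
  qed
qed

text \<open>If a Lebesgue null set carried \<open>\<nu>\<close> in \<open>K\<close>, the derivative
  of \<open>p\<close> would be singular and hence equal to its singular part.\<close>

lemma not_totally_singular_imp:
  fixes p :: "real^'n \<Rightarrow> real^'m"
  assumes p: "p \<in> BV K" and ne: "BV_deriv K p \<noteq> BV_deriv_singular K p"
    and \<nu>: "\<And>B. B \<in> sets borel \<Longrightarrow> measure \<nu> B = measure (BV_variation K p) (B \<inter> K)"
    and A: "A \<in> null_sets lborel"
  shows "measure \<nu> (K - A) \<noteq> 0"
proof
  assume zero: "measure \<nu> (K - A) = 0"
  have vm: "vector_measure (lborel_on K) (BV_deriv K p)"
    using BV_deriv_is_distr_deriv[OF p open_K] by (simp add: is_distr_deriv_def)
  have Ab: "A \<in> sets borel" using null_setsD2[OF A] by simp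
  interpret T: finite_measure "BV_variation K p"
    unfolding BV_variation_def by (rule finite_measure_total_variation[OF vm])
  have "K - A \<in> sets borel" using Ab by (intro sets.Diff K_borel)
  from \<nu>[OF this] zero have z: "measure (BV_variation K p) (K - A) = 0" by (simp add: Int_absorb2)
  have "A \<inter> K \<in> null_sets lborel" by (rule null_sets_subset[OF A]) (use Ab in \<open>simp_all add: sets.Int\<close>)
  then have "A \<inter> K \<in> null_sets (lborel_on K)" by (subst null_sets_restrict_space) auto
  moreover have "emeasure (total_variation (lborel_on K) (BV_deriv K p)) (space (lborel_on K) - A \<inter> K) = 0"
  proof -
    have "space (lborel_on K) - A \<inter> K = K - A" by (auto simp: space_restrict_space)
    then show ?thesis using z T.emeasure_eq_measure[of "K - A"] by (simp add: BV_variation_def)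
  qed
  ultimately have "singular_vector_measure (lborel_on K) (BV_deriv K p)"
    unfolding singular_vector_measure_def by blast
  then have "BV_deriv_singular K p = BV_deriv K p"
    unfolding BV_deriv_singular_def by (rule singular_part_of_singular[OF vm])
  then show False using ne by simp
qed

text \<open>Preiss' principle that tangents of tangents are tangents: the blow-ups at points of \<open>B\<close> close
  to \<open>x + \<epsilon>\<^sub>i y\<^sub>0\<close>, where \<open>y\<^sub>0\<close> is a point at which the limit \<open>p\<close> looks linear, are almost linear.\<close>

lemma nearby_linear_blow_up:
  fixes u :: "real^'n \<Rightarrow> real^'m"
  assumes u: "u \<in> BV \<Omega>" and \<Omega>: "open \<Omega>"
  defines "\<tau> \<equiv> BV_density_measure \<Omega> u" and "F \<equiv> BV_density \<Omega> u"
  assumes M: "norm (F x) = 1"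
    and leb: "\<And>s e. 0 < s \<Longrightarrow> 0 < e \<Longrightarrow>
       eventually (\<lambda>r. measure \<tau> (gball x r \<inter> {z. s \<le> norm (F z - F x)}) \<le> e * measure \<tau> (gball x r)) (at_right 0)"
    and dens: "\<And>e. 0 < e \<Longrightarrow> eventually (\<lambda>r. measure \<tau> (gball x r - H) \<le> e * measure \<tau> (gball x r)) (at_right 0)"
    and H: "H \<in> sets borel" and hull: "\<And>A. A \<in> sets borel \<Longrightarrow> A \<subseteq> H \<Longrightarrow> A \<inter> B = {} \<Longrightarrow> measure \<tau> A = 0"
    and lp: "L1_limit_point \<Omega> u K x p" and p: "p \<in> BV K" and ne: "BV_deriv K p \<noteq> BV_deriv_singular K p"
    and \<kappa>: "0 < \<kappa>"
  obtains x' \<epsilon>' where "x' \<in> B" "0 < \<epsilon>'" "\<epsilon>' < \<kappa>" "gball x' \<epsilon>' \<subseteq> \<Omega>" "0 < measure \<tau> (gball x' \<epsilon>')"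
    "(LINT y|lebesgue_on K. norm (blow_up \<Omega> u K \<epsilon>' x' y - F x' *v y)) < \<kappa>"
proof -
  note D = BV_density[OF u \<Omega>, folded \<tau>_def F_def]
  interpret \<tau>: finite_measure \<tau> by (rule D(2))
  let ?M = "F x"
  let ?n = "CARD('n)"
  obtain \<epsilon> where scales: "blow_up_scales \<Omega> u K x \<epsilon>" and conv: "L1_converges K (\<lambda>i. blow_up \<Omega> u K (\<epsilon> i) x) p"
    using lp by (auto simp: L1_limit_point_def)
  have \<epsilon>: "\<epsilon> \<longlonglongrightarrow> 0" "\<And>i. 0 < \<epsilon> i" using scales by (auto simp: blow_up_scales_def)
  have sub: "gball x (\<epsilon> i) \<subseteq> \<Omega>" and pos: "0 < measure \<tau> (gball x (\<epsilon> i))" for i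
  proof -
    have *: "dilate_at K (\<epsilon> i) x \<subseteq> \<Omega>" "0 < measure (BV_variation \<Omega> u) (dilate_at K (\<epsilon> i) x)"
      using scales by (auto simp: blow_up_scales_def)
    then show "gball x (\<epsilon> i) \<subseteq> \<Omega>" by (simp add: dilate_at_K[OF \<epsilon>(2)])
    then show "0 < measure \<tau> (gball x (\<epsilon> i))"
      using * D(4)[OF gball_borel, of x "\<epsilon> i"] by (simp add: dilate_at_K[OF \<epsilon>(2)] Int_absorb2)
  qed
  have \<epsilon>_right: "filterlim \<epsilon> (at_right 0) sequentially"
    using \<epsilon> by (auto simp: filterlim_at less_imp_neq[symmetric] intro!: always_eventually)
  define w where "w i = blow_up \<Omega> u K (\<epsilon> i) x" for i
  define k where "k i = vol / measure \<tau> (gball x (\<epsilon> i))" for i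
  define t where "t i = distr \<tau> borel (\<lambda>z. (1 / \<epsilon> i) *\<^sub>R (z - x))" for i
  note BU = blow_up_weak_deriv[OF u \<Omega> \<epsilon>(2) sub pos[unfolded \<tau>_def], folded \<tau>_def F_def, folded k_def t_def w_def]
  have k0: "0 \<le> k i" for i using vol_pos by (simp add: k_def)
  have km: "k i * measure \<tau> (gball x (\<epsilon> i)) = vol" for i using pos[of i] by (simp add: k_def)
  have Fi: "integrable \<tau> F" using D(1) by (simp add: weak_deriv_def)
  \<comment> \<open>Where \<open>F\<close> is \<open>s\<close>-close to \<open>F x\<close> the
    integrand is below \<open>s\<close>; elsewhere it is at most 2, and approximate continuity makes
    that part small. The total \<open>3 * s * vol\<close> is three quarters of
    \<open>e\<close>.\<close>
  have close: "(\<lambda>i. LINT y:K|t i. norm (k i *\<^sub>R F (x + \<epsilon> i *\<^sub>R y) - k i *\<^sub>R ?M)) \<longlonglongrightarrow> 0"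
  proof (rule LIMSEQ_I)
    fix e :: real assume e: "0 < e"
    define s where "s = e / (4 * vol)"
    have s: "0 < s" using e vol_pos by (simp add: s_def)
    have ev: "eventually (\<lambda>i. measure \<tau> (gball x (\<epsilon> i) \<inter> {z. s \<le> norm (F z - ?M)}) \<le> s * measure \<tau> (gball x (\<epsilon> i))) sequentially"
      by (rule eventually_compose_filterlim[OF leb[OF s s] \<epsilon>_right])
    have "eventually (\<lambda>i. norm ((LINT y:K|t i. norm (k i *\<^sub>R F (x + \<epsilon> i *\<^sub>R y) - k i *\<^sub>R ?M)) - 0) < e) sequentially"
      using ev
    proof eventually_elim
      case (elim i)
      let ?g = "gball x (\<epsilon> i)" and ?S = "{z. s \<le> norm (F z - ?M)}"
      have Sb: "?S \<in> sets borel" using D(6) by measurable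
      have "(LINT z:?g|\<tau>. norm (F z - ?M)) \<le> (LINT z|\<tau>. s * indicator ?g z + 2 * indicator (?g \<inter> ?S) z)"
        unfolding set_lebesgue_integral_def
      proof (rule integral_mono_AE)
        show "integrable \<tau> (\<lambda>z. indicator ?g z *\<^sub>R norm (F z - ?M))"
          by (rule integrable_mult_indicator) (use D(3) Fi in auto)
        show "integrable \<tau> (\<lambda>z. s * indicator ?g z + 2 * indicator (?g \<inter> ?S) z)"
          using D(3) Sb by (auto simp: \<tau>.emeasure_eq_measure)
        show "AE z in \<tau>. indicator ?g z *\<^sub>R norm (F z - ?M) \<le> s * indicator ?g z + 2 * indicator (?g \<inter> ?S) z"
          using D(5)
        proof eventually_elim
          case (elim z)
          have "norm (F z - ?M) \<le> 2" using norm_triangle_ineq4[of "F z" ?M] elim M by simp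
          then show ?case using s by (auto simp: indicator_def)
        qed
      qed
      also have "\<dots> = s * measure \<tau> ?g + 2 * measure \<tau> (?g \<inter> ?S)"
        using D(3) Sb sets_eq_imp_space_eq[OF D(3)] by (simp add: \<tau>.emeasure_eq_measure)
      also have "\<dots> \<le> 3 * s * measure \<tau> ?g" using elim by simp
      finally have "k i * (LINT z:?g|\<tau>. norm (F z - ?M)) \<le> k i * (3 * s * measure \<tau> ?g)"
        by (rule mult_left_mono[OF _ k0])
      also have "\<dots> = 3 * s * vol" using km[of i] by (simp add: mult.left_commute mult.commute)
      also have "\<dots> < e" using e vol_pos by (simp add: s_def)
      finally have "k i * (LINT z:?g|\<tau>. norm (F z - ?M)) < e" .
      moreover have "0 \<le> k i * (LINT z:?g|\<tau>. norm (F z - ?M))"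
        using k0 unfolding set_lebesgue_integral_def by (intro mult_nonneg_nonneg integral_nonneg_AE) auto
      ultimately show ?case unfolding BU(7) by simp
    qed
    then show "\<exists>no. \<forall>i\<ge>no. norm ((LINT y:K|t i. norm (k i *\<^sub>R F (x + \<epsilon> i *\<^sub>R y) - k i *\<^sub>R ?M)) - 0) < e"
      unfolding eventually_sequentially .
  qed
  have convw: "L1_converges K w p" using conv by (simp add: w_def[abs_def])
  obtain \<nu> where \<nu>: "finite_measure \<nu>" "sets \<nu> = sets borel" "weak_deriv K p \<nu> (\<lambda>_. ?M)"
    "\<And>\<phi>. \<phi> \<in> C1_compact_support K \<Longrightarrow> (\<lambda>i. k i * (LINT y|t i. \<phi> y)) \<longlonglongrightarrow> (LINT y|\<nu>. \<phi> y)"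
    "\<And>B. B \<in> sets borel \<Longrightarrow> measure \<nu> B = measure (BV_variation K p) (B \<inter> K)"
    by (rule limit_derivative[OF BU(2) convw p M k0 close]) blast
  interpret \<nu>: finite_measure \<nu> by (rule \<nu>(1))
  have tfin: "finite_measure (t i)" and tsets: "sets (t i) = sets borel" for i
    using BU(2)[of i] by (auto simp: weak_deriv_def)
  have pi: "integrable (lebesgue_on K) p" using p by (simp add: BV_def)
  obtain R where R: "0 < R" "\<And>y. y \<in> K \<Longrightarrow> norm y \<le> R" using bounded_K bounded_pos by metis
  obtain C where C: "0 \<le> C" "\<And>(w :: real^'n \<Rightarrow> real^'m) \<tau> F. weak_deriv K w \<tau> F \<Longrightarrow> integrable (lebesgue_on K) w \<Longrightarrow>
       (LINT y|lebesgue_on K. norm (w y - set_average K w)) \<le> C * (LINT x:K|\<tau>. norm (F x))"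
    using Poincare[OF open_K convex_K bounded_K] zero_in_K by (metis empty_iff)
  \<comment> \<open>The L1 norm on \<open>K\<close> of a linear map \<open>A\<close> is at most
    \<open>norm A * Q\<close>.\<close>
  define Q where "Q = real CARD('m) * R * vol"
  have Q: "0 < Q" using R vol_pos by (simp add: Q_def)
  \<comment> \<open>The error budget of the conclusion:
    \<open>2 * \<zeta> * Q \<le> \<kappa> / 5\<close> for the inexact normalisation,
    \<open>s * Q = \<kappa> / 5\<close> for \<open>F x'\<close> in place of \<open>F x\<close>, and
    \<open>2 * (\<kappa> / 5)\<close> for the deviation from the linear model, which is governed by
    \<open>\<eta>\<close> and by the L1 distance between \<open>w i\<close> and
    \<open>p\<close>.\<close>
  define \<zeta> where "\<zeta> = min (1 / 2) (\<kappa> / (10 * Q))"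
  have \<zeta>: "0 < \<zeta>" "\<zeta> \<le> 1 / 2" "2 * \<zeta> * Q \<le> \<kappa> / 5"
    using \<kappa> Q by (auto simp: \<zeta>_def min_def field_simps)
  define s where "s = \<kappa> / (5 * Q)"
  have s: "0 < s" "s * Q = \<kappa> / 5" using \<kappa> Q by (auto simp: s_def)
  \<comment> \<open>The bound \<open>\<zeta> / 16\<close> keeps masses between
    \<open>1 - \<zeta>\<close> and \<open>1 + \<zeta>\<close> times their model value. The other
    bound makes the Poincare term small, with \<open>C + 1\<close> because \<open>C\<close> may be
    0.\<close>
  define \<eta> where "\<eta> = min (\<zeta> / 16) (\<kappa> / (30 * 2 ^ ?n * (C + 1) * vol))"
  have \<eta>0: "0 < \<kappa> / (30 * 2 ^ ?n * (C + 1) * vol)" using \<kappa> C(1) vol_pos by simp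
  have \<eta>: "0 < \<eta>" "\<eta> \<le> \<zeta> / 16" using \<zeta>(1) \<eta>0 by (auto simp: \<eta>_def)
  have \<eta>3: "6 * 2 ^ ?n * C * vol * \<eta> \<le> \<kappa> / 5"
  proof -
    have "6 * 2 ^ ?n * C * vol * \<eta> \<le> 6 * 2 ^ ?n * (C + 1) * vol * (\<kappa> / (30 * 2 ^ ?n * (C + 1) * vol))"
      using C(1) vol_pos \<eta>(1) by (intro mult_mono) (auto simp: \<eta>_def)
    also have "\<dots> = 6 * (2 ^ ?n * (C + 1) * vol) * (\<kappa> / (30 * (2 ^ ?n * (C + 1) * vol)))" by (simp only: mult.assoc)
    also have "\<dots> = \<kappa> / 5"
    proof -
      have "6 * X * (\<kappa> / (30 * X)) = \<kappa> / 5" if "X \<noteq> 0" for X :: real using that by simp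
      then show ?thesis using C(1) vol_pos by simp
    qed
    finally show ?thesis .
  qed
  have ns: "measure \<nu> (K - A) \<noteq> 0" if "A \<in> null_sets lborel" for A
    by (rule not_totally_singular_imp[OF p ne \<nu>(5) that])
  obtain c y0 \<sigma> f where c: "0 < c" and y0: "y0 \<in> K"
    and wdf: "weak_deriv K (\<lambda>y. p y - c *\<^sub>R (?M *v y)) \<sigma> (\<lambda>x. f x *\<^sub>R ?M)"
    and evf: "eventually (\<lambda>r. gball y0 r \<subseteq> K \<and>
       \<bar>measure \<nu> (gball y0 r) - c * (vol * r ^ ?n)\<bar> \<le> 3 * \<eta> * (c * (vol * r ^ ?n)) \<and>
       (LINT x:gball y0 r|\<sigma>. \<bar>f x\<bar>) \<le> 3 * \<eta> * (c * (vol * r ^ ?n))) (at_right 0)"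
    by (rule flat_point[OF \<nu>(1,2,3) pi ns \<eta>(1)]) blast+
  obtain r0 where r0: "0 < r0" and flat: "\<And>r. 0 < r \<Longrightarrow> r < r0 \<Longrightarrow> gball y0 r \<subseteq> K \<and>
       \<bar>measure \<nu> (gball y0 r) - c * (vol * r ^ ?n)\<bar> \<le> 3 * \<eta> * (c * (vol * r ^ ?n)) \<and>
       (LINT x:gball y0 r|\<sigma>. \<bar>f x\<bar>) \<le> 3 * \<eta> * (c * (vol * r ^ ?n))"
    using evf unfolding eventually_at_right_field by auto
  \<comment> \<open>The quarter leaves \<open>gball y0 (2 * \<delta>)\<close> within the range where
    \<open>flat\<close> applies; this ball contains all secondary balls.\<close>
  define \<delta> where "\<delta> = r0 / 4"
  have \<delta>: "0 < \<delta>" "2 * \<delta> < r0" using r0 by (auto simp: \<delta>_def)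
  define V where "V = c * (vol * \<delta> ^ ?n)"
  have V: "0 < V" using c vol_pos \<delta> by (simp add: V_def)
  \<comment> \<open>The centre may be displaced by \<open>b * \<delta>\<close>. Changing the radius
    by \<open>2 * b * \<delta>\<close> then alters the volume by a relative
    \<open>\<zeta> / 4\<close> at most.\<close>
  obtain b where b: "0 < b" "b \<le> 1 / 4" "(1 + 2 * b) ^ ?n \<le> 1 + \<zeta> / 4" "1 - \<zeta> / 4 \<le> (1 - 2 * b) ^ ?n"
  proof -
    have "((\<lambda>b::real. (1 + 2 * b) ^ ?n) \<longlongrightarrow> (1 + 2 * 0) ^ ?n) (at_right 0)" by (intro tendsto_intros)
    then have "eventually (\<lambda>b::real. (1 + 2 * b) ^ ?n < 1 + \<zeta> / 4) (at_right 0)"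
      by (rule order_tendstoD(2)) (use \<zeta> in simp)
    moreover have "((\<lambda>b::real. (1 - 2 * b) ^ ?n) \<longlongrightarrow> (1 - 2 * 0) ^ ?n) (at_right 0)" by (intro tendsto_intros)
    then have "eventually (\<lambda>b::real. 1 - \<zeta> / 4 < (1 - 2 * b) ^ ?n) (at_right 0)"
      by (rule order_tendstoD(1)) (use \<zeta> in simp)
    moreover have "eventually (\<lambda>b::real. b \<in> {0<..<1/4}) (at_right 0)" by (rule eventually_at_right_real) simp
    ultimately have "eventually (\<lambda>b::real. (1 + 2 * b) ^ ?n < 1 + \<zeta> / 4 \<and> 1 - \<zeta> / 4 < (1 - 2 * b) ^ ?n \<and> b \<in> {0<..<1/4}) (at_right 0)"
      by eventually_elim blast
    from eventually_happens'[OF trivial_limit_at_right_real this] show ?thesis using that by (auto intro: less_imp_le)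
  qed
  have scaleV: "c * (vol * (a * \<delta>) ^ ?n) = a ^ ?n * V" for a by (simp add: V_def power_mult_distrib)
  have nuV: "\<bar>measure \<nu> (gball y0 (a * \<delta>)) - a ^ ?n * V\<bar> \<le> 3 * \<eta> * (a ^ ?n * V)" and nuK: "gball y0 (a * \<delta>) \<subseteq> K"
    if "0 < a" "a \<le> 2" for a
  proof -
    have "a * \<delta> \<le> 2 * \<delta>" using that \<delta> by simp
    then have "a * \<delta> < r0" using \<delta>(2) by linarith
    moreover have "0 < a * \<delta>" using that \<delta> by simp
    ultimately have "0 < a * \<delta>" "a * \<delta> < r0" by blast+
    from flat[OF this] show "\<bar>measure \<nu> (gball y0 (a * \<delta>)) - a ^ ?n * V\<bar> \<le> 3 * \<eta> * (a ^ ?n * V)" "gball y0 (a * \<delta>) \<subseteq> K"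
      unfolding scaleV by auto
  qed
  have \<eta>small: "\<eta> \<le> 1 / 32" using \<eta>(2) \<zeta>(2) by simp
  \<comment> \<open>Half the value that the linear model predicts for \<open>\<nu>\<close> on
    \<open>gball y0 (b / 2 * \<delta>)\<close>.\<close>
  define \<mu>0 where "\<mu>0 = (b / 2) ^ ?n * V / 2"
  have \<mu>0: "0 < \<mu>0" using b V by (simp add: \<mu>0_def)
  have nu_small: "2 * \<mu>0 - \<mu>0 / 2 \<le> measure \<nu> (gball y0 (b / 2 * \<delta>))"
  proof -
    have "3 * \<eta> * ((b / 2) ^ ?n * V) \<le> 1 / 4 * ((b / 2) ^ ?n * V)"
      using \<eta>small b V by (intro mult_right_mono) auto
    moreover have "\<bar>measure \<nu> (gball y0 (b / 2 * \<delta>)) - (b / 2) ^ ?n * V\<bar> \<le> 3 * \<eta> * ((b / 2) ^ ?n * V)"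
      by (rule nuV) (use b in auto)
    ultimately show ?thesis unfolding \<mu>0_def by linarith
  qed
  \<comment> \<open>After multiplication by \<open>k i\<close> the two exceptional sets weigh at
    most \<open>2 * e * vol = \<mu>0 / 2\<close> together, while the small ball around
    \<open>y0\<close> weighs more than \<open>\<mu>0\<close>.\<close>
  define e where "e = \<mu>0 / (4 * vol)"
  have e: "0 < e" using \<mu>0 vol_pos by (simp add: e_def)
  \<comment> \<open>Displacements use radii changed by \<open>b * \<delta>\<close>; the further
    \<open>b * \<delta>\<close> is the gap between radii that \<open>mass_comparison\<close>
    consumes.\<close>
  have ev1: "eventually (\<lambda>i. k i * measure (t i) (gball y0 ((1 + b) * \<delta>)) < measure \<nu> (gball y0 ((1 + 2 * b) * \<delta>)) + \<eta> * V) sequentially"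
    by (rule mass_comparison(1)[OF tfin \<nu>(1) tsets \<nu>(2) k0 \<nu>(4)]) (use b \<delta> V \<eta> nuK[of "1 + 2 * b"] in auto)
  have ev2: "eventually (\<lambda>i. measure \<nu> (gball y0 ((1 - 2 * b) * \<delta>)) - \<eta> * V < k i * measure (t i) (gball y0 ((1 - b) * \<delta>))) sequentially"
    by (rule mass_comparison(2)[OF tfin \<nu>(1) tsets \<nu>(2) k0 \<nu>(4)]) (use b \<delta> V \<eta> nuK[of "1 - b"] in auto)
  have ev3: "eventually (\<lambda>i. measure \<nu> (gball y0 (b / 2 * \<delta>)) - \<mu>0 / 2 < k i * measure (t i) (gball y0 (b * \<delta>))) sequentially"
    by (rule mass_comparison(2)[OF tfin \<nu>(1) tsets \<nu>(2) k0 \<nu>(4)]) (use b \<delta> \<mu>0 nuK[of b] in auto)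
  have ev4: "eventually (\<lambda>i. measure \<tau> (gball x (\<epsilon> i) \<inter> {z. s \<le> norm (F z - ?M)}) \<le> e * measure \<tau> (gball x (\<epsilon> i))) sequentially"
    by (rule eventually_compose_filterlim[OF leb[OF s(1) e] \<epsilon>_right])
  have ev5: "eventually (\<lambda>i. measure \<tau> (gball x (\<epsilon> i) - H) \<le> e * measure \<tau> (gball x (\<epsilon> i))) sequentially"
    by (rule eventually_compose_filterlim[OF dens[OF e] \<epsilon>_right])
  have ev6: "eventually (\<lambda>i. \<epsilon> i < \<kappa> / \<delta>) sequentially"
    by (rule order_tendstoD(2)[OF \<epsilon>(1)]) (use \<kappa> \<delta> in simp)
  have L1: "(\<lambda>i. LINT y|lebesgue_on K. norm (w i y - p y)) \<longlonglongrightarrow> 0" using convw by (simp add: L1_converges_def)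
  have "0 < \<kappa> / 5 * (c * \<delta> * \<delta> ^ ?n) / 4" using \<kappa> c \<delta> by simp
  from order_tendstoD(2)[OF L1 this]
  have ev7: "eventually (\<lambda>i. (LINT y|lebesgue_on K. norm (w i y - p y)) < \<kappa> / 5 * (c * \<delta> * \<delta> ^ ?n) / 4) sequentially" .
  have "eventually (\<lambda>i. k i * measure (t i) (gball y0 ((1 + b) * \<delta>)) < measure \<nu> (gball y0 ((1 + 2 * b) * \<delta>)) + \<eta> * V \<and>
    measure \<nu> (gball y0 ((1 - 2 * b) * \<delta>)) - \<eta> * V < k i * measure (t i) (gball y0 ((1 - b) * \<delta>)) \<and>
    measure \<nu> (gball y0 (b / 2 * \<delta>)) - \<mu>0 / 2 < k i * measure (t i) (gball y0 (b * \<delta>)) \<and>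
    measure \<tau> (gball x (\<epsilon> i) \<inter> {z. s \<le> norm (F z - ?M)}) \<le> e * measure \<tau> (gball x (\<epsilon> i)) \<and>
    measure \<tau> (gball x (\<epsilon> i) - H) \<le> e * measure \<tau> (gball x (\<epsilon> i)) \<and> \<epsilon> i < \<kappa> / \<delta> \<and>
    (LINT y|lebesgue_on K. norm (w i y - p y)) < \<kappa> / 5 * (c * \<delta> * \<delta> ^ ?n) / 4) sequentially"
    by (intro eventually_conj ev1 ev2 ev3 ev4 ev5 ev6 ev7)
  from eventually_happens'[OF sequentially_bot this] obtain i where
    i1: "k i * measure (t i) (gball y0 ((1 + b) * \<delta>)) < measure \<nu> (gball y0 ((1 + 2 * b) * \<delta>)) + \<eta> * V" and
    i2: "measure \<nu> (gball y0 ((1 - 2 * b) * \<delta>)) - \<eta> * V < k i * measure (t i) (gball y0 ((1 - b) * \<delta>))" and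
    i3: "measure \<nu> (gball y0 (b / 2 * \<delta>)) - \<mu>0 / 2 < k i * measure (t i) (gball y0 (b * \<delta>))" and
    i4: "measure \<tau> (gball x (\<epsilon> i) \<inter> {z. s \<le> norm (F z - ?M)}) \<le> e * measure \<tau> (gball x (\<epsilon> i))" and
    i5: "measure \<tau> (gball x (\<epsilon> i) - H) \<le> e * measure \<tau> (gball x (\<epsilon> i))" and i6: "\<epsilon> i < \<kappa> / \<delta>" and
    i7: "(LINT y|lebesgue_on K. norm (w i y - p y)) < \<kappa> / 5 * (c * \<delta> * \<delta> ^ ?n) / 4" by blast
  have tmass: "measure (t i) (gball z r) = measure \<tau> (gball (x + \<epsilon> i *\<^sub>R z) (\<epsilon> i * r))" for z r
    using BU(4)[OF gball_borel] by (simp add: dilate_gball[OF \<epsilon>(2)])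
  let ?G = "gball (x + \<epsilon> i *\<^sub>R y0) (\<epsilon> i * (b * \<delta>))"
  let ?S = "{z. s \<le> norm (F z - ?M)}"
  have Sb: "?S \<in> sets borel" using D(6) by measurable
  have Gsub: "?G \<subseteq> gball x (\<epsilon> i)"
  proof -
    have "dilate_at (gball y0 (b * \<delta>)) (\<epsilon> i) x \<subseteq> dilate_at K (\<epsilon> i) x"
      using nuK[of b] b by (auto simp: dilate_at_def)
    then show ?thesis by (simp add: dilate_gball[OF \<epsilon>(2)] dilate_at_K[OF \<epsilon>(2)])
  qed
  \<comment> \<open>Points near \<open>x + \<epsilon> i *\<^sub>R y0\<close> that lie in the hull
    \<open>H\<close> and at which \<open>F\<close> is close to \<open>F x\<close>. Once this set has
    positive measure, the hull property puts a point of \<open>B\<close> into it.\<close>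
  define A where "A = ?G - (gball x (\<epsilon> i) \<inter> ?S) - (gball x (\<epsilon> i) - H)"
  have Ab: "A \<in> sets borel" unfolding A_def using Sb H by auto
  have Apos: "0 < measure \<tau> A"
  proof (rule ccontr)
    assume "\<not> ?thesis"
    then have A0: "measure \<tau> A = 0" using measure_nonneg[of \<tau> A] by linarith
    have "measure \<tau> ?G \<le> measure \<tau> (A \<union> ((gball x (\<epsilon> i) \<inter> ?S) \<union> (gball x (\<epsilon> i) - H)))"
      by (rule \<tau>.finite_measure_mono) (use Ab Sb H D(3) in \<open>auto simp: A_def\<close>)
    also have "\<dots> \<le> measure \<tau> A + (measure \<tau> (gball x (\<epsilon> i) \<inter> ?S) + measure \<tau> (gball x (\<epsilon> i) - H))"
      using Ab Sb H D(3)
      by (intro order_trans[OF measure_Un_le] add_left_mono measure_Un_le) auto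
    also have "\<dots> \<le> 2 * e * measure \<tau> (gball x (\<epsilon> i))" using A0 i4 i5 by linarith
    finally have "k i * measure \<tau> ?G \<le> k i * (2 * e * measure \<tau> (gball x (\<epsilon> i)))"
      by (rule mult_left_mono[OF _ k0])
    also have "\<dots> = 2 * e * vol" using km[of i] by (simp add: mult.left_commute mult.commute)
    also have "\<dots> = \<mu>0 / 2" using vol_pos by (simp add: e_def)
    finally have "k i * measure (t i) (gball y0 (b * \<delta>)) \<le> \<mu>0 / 2" by (simp add: tmass)
    then show False using i3 nu_small \<mu>0 by linarith
  qed
  have AH: "A \<subseteq> H" using Gsub by (auto simp: A_def)
  obtain x' where x': "x' \<in> A" "x' \<in> B"
    using hull[OF Ab AH] Apos by (metis disjoint_iff less_irrefl)
  define z where "z = (1 / \<epsilon> i) *\<^sub>R (x' - x)"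
  have xz: "x' = x + \<epsilon> i *\<^sub>R z" using \<epsilon>(2)[of i] by (simp add: z_def)
  have zy: "N (z - y0) < b * \<delta>"
  proof -
    have "x' \<in> dilate_at (gball y0 (b * \<delta>)) (\<epsilon> i) x" using x'(1) by (auto simp: A_def dilate_gball[OF \<epsilon>(2)])
    then have "z \<in> gball y0 (b * \<delta>)" unfolding xz dilate_at_iff[OF \<epsilon>(2)] .
    then show ?thesis by (simp add: gball_def)
  qed
  have Fx': "norm (F x' - ?M) < s" using x'(1) Gsub by (auto simp: A_def not_le)
  have z1: "gball z \<delta> \<subseteq> gball y0 ((1 + b) * \<delta>)"
    by (rule gball_mono) (use zy in \<open>simp add: algebra_simps\<close>)
  have z2: "gball y0 ((1 - b) * \<delta>) \<subseteq> gball z \<delta>"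
    by (rule gball_mono) (use zy N_minus_commute[of y0 z] in \<open>simp add: algebra_simps\<close>)
  have z3: "gball z \<delta> \<subseteq> K" using z1 nuK[of "1 + b"] b by auto
  have z4: "gball z \<delta> \<subseteq> gball y0 (2 * \<delta>)"
  proof (rule gball_mono)
    have "b * \<delta> \<le> 1 * \<delta>" using b \<delta> by (intro mult_right_mono) auto
    then show "N (z - y0) + \<delta> \<le> 2 * \<delta>" using zy by linarith
  qed
  \<comment> \<open>The variation of \<open>w i\<close> in \<open>gball z \<delta>\<close>. This
    ball lies between two balls around \<open>y0\<close>, so \<open>m\<close> nearly equals the
    model value \<open>V\<close>.\<close>
  define m where "m = k i * measure (t i) (gball z \<delta>)"
  have m_up: "m \<le> (1 + \<zeta>) * V"
  proof -
    have "m \<le> k i * measure (t i) (gball y0 ((1 + b) * \<delta>))"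
      unfolding m_def by (intro mult_left_mono k0 finite_measure.finite_measure_mono[OF tfin z1]) (simp add: tsets)
    also have "\<dots> \<le> (1 + 2 * b) ^ ?n * V + 3 * \<eta> * ((1 + 2 * b) ^ ?n * V) + \<eta> * V"
      using i1 nuV[of "1 + 2 * b"] b by auto
    also have "\<dots> = ((1 + 3 * \<eta>) * (1 + 2 * b) ^ ?n + \<eta>) * V" by (simp add: algebra_simps)
    also have "\<dots> \<le> (1 + \<zeta>) * V"
    proof (rule mult_right_mono)
      have "(1 + 3 * \<eta>) * (1 + 2 * b) ^ ?n \<le> (1 + 3 * \<eta>) * (1 + \<zeta> / 4)"
        using b \<eta> by (intro mult_left_mono) auto
      also have "\<dots> = 1 + \<zeta> / 4 + 3 * \<eta> + 3 * \<eta> * (\<zeta> / 4)" by (simp add: algebra_simps)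
      also have "3 * \<eta> * (\<zeta> / 4) \<le> 3 * \<eta> * 1" using \<eta> \<zeta> by (intro mult_left_mono) auto
      finally show "(1 + 3 * \<eta>) * (1 + 2 * b) ^ ?n + \<eta> \<le> 1 + \<zeta>" using \<eta> \<zeta> by linarith
    qed (use V in simp)
    finally show ?thesis .
  qed
  have m_low: "(1 - \<zeta>) * V \<le> m"
  proof -
    have "(1 - \<zeta>) * V \<le> ((1 - 3 * \<eta>) * (1 - 2 * b) ^ ?n - \<eta>) * V"
    proof (rule mult_right_mono)
      have "(1 - 3 * \<eta>) * (1 - \<zeta> / 4) \<le> (1 - 3 * \<eta>) * (1 - 2 * b) ^ ?n"
        using b \<eta>small by (intro mult_left_mono) auto
      moreover have "(1 - 3 * \<eta>) * (1 - \<zeta> / 4) = 1 - \<zeta> / 4 - 3 * \<eta> + 3 * \<eta> * (\<zeta> / 4)" by (simp add: algebra_simps)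
      moreover have "0 \<le> 3 * \<eta> * (\<zeta> / 4)" using \<eta> \<zeta> by simp
      ultimately show "1 - \<zeta> \<le> (1 - 3 * \<eta>) * (1 - 2 * b) ^ ?n - \<eta>" using \<eta> \<zeta> by linarith
    qed (use V in simp)
    also have "\<dots> = (1 - 2 * b) ^ ?n * V - 3 * \<eta> * ((1 - 2 * b) ^ ?n * V) - \<eta> * V" by (simp add: algebra_simps)
    also have "\<dots> \<le> k i * measure (t i) (gball y0 ((1 - b) * \<delta>))"
      using i2 nuV[of "1 - 2 * b"] b by auto
    also have "\<dots> \<le> m"
      unfolding m_def by (intro mult_left_mono k0 finite_measure.finite_measure_mono[OF tfin z2]) (simp add: tsets)
    finally show ?thesis .
  qed
  have "1 / 2 * V \<le> (1 - \<zeta>) * V" using \<zeta> V by (intro mult_right_mono) auto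
  then have m_half: "V / 2 \<le> m" using m_low by simp
  then have mpos: "0 < m" using V by linarith
  have pos2: "0 < measure \<tau> (gball (x + \<epsilon> i *\<^sub>R z) (\<epsilon> i * \<delta>))"
  proof (rule ccontr)
    assume "\<not> ?thesis"
    then have "measure (t i) (gball z \<delta>) = 0" using measure_nonneg[of \<tau> "gball (x + \<epsilon> i *\<^sub>R z) (\<epsilon> i * \<delta>)"] by (simp add: tmass)
    then show False using mpos by (simp add: m_def)
  qed
  note BB = blow_up_blow_up[OF u \<Omega> \<epsilon>(2) sub pos[unfolded \<tau>_def] \<delta>(1) z3 pos2[unfolded \<tau>_def], folded \<tau>_def,
      folded k_def w_def, folded tmass m_def, folded xz]
  \<comment> \<open>Model mass over true mass, the only defect of normalisation in the secondary
    blow-up.\<close>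
  define \<theta> where "\<theta> = V / m"
  have \<theta>: "0 < \<theta>" "\<theta> \<le> 2" using V mpos m_half by (auto simp: \<theta>_def field_simps)
  have \<theta>1: "\<bar>\<theta> - 1\<bar> \<le> 2 * \<zeta>"
  proof -
    have "\<bar>V - m\<bar> \<le> \<zeta> * V" using m_up m_low by (auto simp: algebra_simps)
    also have "\<dots> \<le> \<zeta> * (2 * m)" using m_half \<zeta> by (intro mult_left_mono) auto
    finally have "\<bar>V - m\<bar> / m \<le> 2 * \<zeta>" using mpos by (simp add: field_simps)
    moreover have "\<theta> - 1 = (V - m) / m" using mpos by (simp add: \<theta>_def field_simps)
    then have "\<bar>\<theta> - 1\<bar> = \<bar>V - m\<bar> / m" using mpos by simp
    ultimately show ?thesis by simp
  qed
  have coef: "vol * \<delta> ^ (?n - 1) / m = \<theta> / (c * \<delta>)"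
    using c \<delta> mpos unfolding \<theta>_def V_def card_power[of \<delta>, symmetric] by (simp add: field_simps)
  define W where "W y = w i (z + \<delta> *\<^sub>R y) - set_average K (\<lambda>y. w i (z + \<delta> *\<^sub>R y)) - (c * \<delta>) *\<^sub>R (?M *v y)" for y
  note est = secondary_blow_up_estimate[OF BU(3) pi wdf M \<delta>(1) z3 C, of i, folded W_def]
  \<comment> \<open>The three error terms: deviation of the rescaled \<open>w i\<close> from the
    linear model, inexact normalisation, and the exchange of \<open>F x\<close> for
    \<open>F x'\<close>.\<close>
  have dec: "blow_up \<Omega> u K (\<epsilon> i * \<delta>) x' y - F x' *v y = (\<theta> / (c * \<delta>)) *\<^sub>R W y + (\<theta> - 1) *\<^sub>R (?M *v y) + (?M - F x') *v y" for y
  proof -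
    have "(\<theta> / (c * \<delta>)) * (c * \<delta>) = \<theta>" using c \<delta> by simp
    then have "(\<theta> / (c * \<delta>)) *\<^sub>R ((c * \<delta>) *\<^sub>R (?M *v y)) = \<theta> *\<^sub>R (?M *v y)" by (simp only: scaleR_scaleR)
    then show ?thesis
      unfolding BB(1) coef W_def scaleR_diff_right scaleR_left_diff_distrib matrix_vector_mult_diff_rdistrib
      by (simp only: scaleR_one) (simp only: algebra_simps)
  qed
  have lin: "(LINT y|lebesgue_on K. norm (A *v y)) \<le> norm A * Q" for A :: "real^'n^'m"
  proof -
    have "(LINT y|lebesgue_on K. norm (A *v y)) \<le> (LINT y|lebesgue_on K. real CARD('m) * (norm A * R))"
    proof (rule integral_mono)
      show "integrable (lebesgue_on K) (\<lambda>y. norm (A *v y))"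
        by (intro integrable_norm weak_deriv_linear(2)[OF open_K bounded_K])
      show "integrable (lebesgue_on K) (\<lambda>y. real CARD('m) * (norm A * R))"
        by (rule integrable_lebesgue_on_const[OF bounded_K open_K])
      fix y assume "y \<in> space (lebesgue_on K)"
      then have "norm y \<le> R" using R(2) by simp
      then have "CARD('m) * (norm A * norm y) \<le> CARD('m) * (norm A * R)" by (intro mult_left_mono) auto
      then show "norm (A *v y) \<le> real CARD('m) * (norm A * R)" using norm_matrix_vector_mult_le[of A y] by linarith
    qed
    also have "\<dots> = norm A * Q"
      unfolding lebesgue_on_const[OF bounded_K open_K] by (simp add: Q_def)
    finally show ?thesis .
  qed
  have Wi: "integrable (lebesgue_on K) W" using est(2) by (simp add: W_def[abs_def])
  \<comment> \<open>One half of the bound comes from the Poincare term through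
    \<open>\<eta>3\<close>, the other from the L1 distance between \<open>w i\<close> and
    \<open>p\<close> through \<open>i7\<close>.\<close>
  have W1: "(LINT y|lebesgue_on K. norm (W y)) \<le> (c * \<delta>) * (\<kappa> / 5)"
  proof -
    let ?I = "LINT y|lebesgue_on K. norm (w i y - p y)"
    let ?A = "LINT x:gball z \<delta>|\<sigma>. \<bar>f x\<bar>"
    have fi: "integrable \<sigma> f"
    proof -
      have "integrable \<sigma> (\<lambda>x. f x *\<^sub>R ?M)" using wdf by (simp add: weak_deriv_def)
      then have "integrable \<sigma> (\<lambda>x. (f x *\<^sub>R ?M) \<bullet> ?M)" by (rule integrable_inner_left)
      moreover have "?M \<bullet> ?M = 1" using M by (simp add: dot_square_norm)
      ultimately show ?thesis by (simp only: inner_scaleR_left mult_1_right)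
    qed
    have sm: "sets \<sigma> = sets borel" using wdf by (auto simp: weak_deriv_def)
    have "?A \<le> (LINT x:gball y0 (2 * \<delta>)|\<sigma>. \<bar>f x\<bar>)"
      unfolding set_lebesgue_integral_def
    proof (rule integral_mono)
      show "integrable \<sigma> (\<lambda>x. indicator (gball z \<delta>) x *\<^sub>R \<bar>f x\<bar>)" "integrable \<sigma> (\<lambda>x. indicator (gball y0 (2 * \<delta>)) x *\<^sub>R \<bar>f x\<bar>)"
        by (rule integrable_mult_indicator; use fi sm in simp)+
      show "indicator (gball z \<delta>) x *\<^sub>R \<bar>f x\<bar> \<le> indicator (gball y0 (2 * \<delta>)) x *\<^sub>R \<bar>f x\<bar>" for x
        using z4 by (auto simp: indicator_def)
    qed
    also have "\<dots> \<le> 3 * \<eta> * (c * (vol * (2 * \<delta>) ^ ?n))" using flat[of "2 * \<delta>"] \<delta> by simp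
    finally have A: "?A \<le> 3 * \<eta> * (c * (vol * (2 * \<delta>) ^ ?n))" .
    have "C * (\<delta> / \<delta> ^ ?n * ?A) \<le> C * (\<delta> / \<delta> ^ ?n * (3 * \<eta> * (c * (vol * (2 * \<delta>) ^ ?n))))"
      using C(1) \<delta> A by (intro mult_left_mono) auto
    also have "\<dots> = (c * \<delta>) * (6 * 2 ^ ?n * C * vol * \<eta>) / 2"
      using \<delta> by (simp add: power_mult_distrib field_simps)
    also have "\<dots> \<le> (c * \<delta>) * (\<kappa> / 5) / 2"
      using \<eta>3 c \<delta> by (intro divide_right_mono mult_left_mono) auto
    finally have 1: "C * (\<delta> / \<delta> ^ ?n * ?A) \<le> (c * \<delta>) * (\<kappa> / 5) / 2" .
    have "2 / \<delta> ^ ?n * ?I \<le> 2 / \<delta> ^ ?n * (\<kappa> / 5 * (c * \<delta> * \<delta> ^ ?n) / 4)"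
      using i7 \<delta> by (intro mult_left_mono) auto
    also have "\<dots> = (c * \<delta>) * (\<kappa> / 5) / 2" using \<delta> by (simp add: field_simps)
    finally show ?thesis using est(1) 1 by linarith
  qed
  have Ml: "integrable (lebesgue_on K) (\<lambda>y. A *v y)" for A :: "real^'n^'m"
    by (rule weak_deriv_linear(2)[OF open_K bounded_K])
  have ints: "integrable (lebesgue_on K) (\<lambda>y. (\<theta> / (c * \<delta>)) * norm (W y))" "integrable (lebesgue_on K) (\<lambda>y. \<bar>\<theta> - 1\<bar> * norm (?M *v y))"
     "integrable (lebesgue_on K) (\<lambda>y. norm ((?M - F x') *v y))"
    by (intro integrable_mult_right integrable_norm Wi Ml)+
  have "(LINT y|lebesgue_on K. norm (blow_up \<Omega> u K (\<epsilon> i * \<delta>) x' y - F x' *v y))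
     \<le> (LINT y|lebesgue_on K. ((\<theta> / (c * \<delta>)) * norm (W y) + \<bar>\<theta> - 1\<bar> * norm (?M *v y)) + norm ((?M - F x') *v y))"
  proof (rule integral_mono)
    show "integrable (lebesgue_on K) (\<lambda>y. norm (blow_up \<Omega> u K (\<epsilon> i * \<delta>) x' y - F x' *v y))"
      unfolding dec by (intro integrable_norm Bochner_Integration.integrable_add integrable_scaleR_right Wi Ml)
    show "integrable (lebesgue_on K) (\<lambda>y. ((\<theta> / (c * \<delta>)) * norm (W y) + \<bar>\<theta> - 1\<bar> * norm (?M *v y)) + norm ((?M - F x') *v y))"
      by (intro Bochner_Integration.integrable_add ints)
    fix y
    have "norm ((\<theta> / (c * \<delta>)) *\<^sub>R W y) = (\<theta> / (c * \<delta>)) * norm (W y)" using \<theta> c \<delta> by simp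
    moreover have "norm ((\<theta> - 1) *\<^sub>R (?M *v y)) = \<bar>\<theta> - 1\<bar> * norm (?M *v y)" by simp
    ultimately show "norm (blow_up \<Omega> u K (\<epsilon> i * \<delta>) x' y - F x' *v y) \<le> ((\<theta> / (c * \<delta>)) * norm (W y) + \<bar>\<theta> - 1\<bar> * norm (?M *v y)) + norm ((?M - F x') *v y)"
      unfolding dec by (smt (verit) norm_triangle_ineq)
  qed
  also have "\<dots> = ((\<theta> / (c * \<delta>)) * (LINT y|lebesgue_on K. norm (W y)) + \<bar>\<theta> - 1\<bar> * (LINT y|lebesgue_on K. norm (?M *v y))) + (LINT y|lebesgue_on K. norm ((?M - F x') *v y))"
    by (simp only: Bochner_Integration.integral_add[OF Bochner_Integration.integrable_add[OF ints(1,2)] ints(3)]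
        Bochner_Integration.integral_add[OF ints(1,2)] integral_mult_right_zero)
  also have "\<dots> \<le> (2 * (\<kappa> / 5) + \<kappa> / 5) + \<kappa> / 5"
  proof (intro add_mono)
    have "(\<theta> / (c * \<delta>)) * (LINT y|lebesgue_on K. norm (W y)) \<le> (\<theta> / (c * \<delta>)) * ((c * \<delta>) * (\<kappa> / 5))"
      using W1 \<theta> c \<delta> by (intro mult_left_mono) auto
    also have "\<dots> = \<theta> * (\<kappa> / 5)" using c \<delta> by simp
    also have "\<dots> \<le> 2 * (\<kappa> / 5)" using \<theta> \<kappa> by (intro mult_right_mono) auto
    finally show "(\<theta> / (c * \<delta>)) * (LINT y|lebesgue_on K. norm (W y)) \<le> 2 * (\<kappa> / 5)" .
    have "\<bar>\<theta> - 1\<bar> * (LINT y|lebesgue_on K. norm (?M *v y)) \<le> 2 * \<zeta> * (norm ?M * Q)"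
      using \<theta>1 lin[of ?M] \<zeta> Q by (intro mult_mono) auto
    then show "\<bar>\<theta> - 1\<bar> * (LINT y|lebesgue_on K. norm (?M *v y)) \<le> \<kappa> / 5" using M \<zeta>(3) by simp
    have "(LINT y|lebesgue_on K. norm ((?M - F x') *v y)) \<le> norm (?M - F x') * Q" by (rule lin)
    also have "\<dots> \<le> s * Q" using Fx' Q by (intro mult_right_mono) (auto simp: norm_minus_commute)
    finally show "(LINT y|lebesgue_on K. norm ((?M - F x') *v y)) \<le> \<kappa> / 5" using s by simp
  qed
  also have "\<dots> < \<kappa>" using \<kappa> by simp
  finally have final: "(LINT y|lebesgue_on K. norm (blow_up \<Omega> u K (\<epsilon> i * \<delta>) x' y - F x' *v y)) < \<kappa>" .
  show thesis
  proof (rule that[OF x'(2) _ _ _ _ final])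
    show "0 < \<epsilon> i * \<delta>" using \<epsilon>(2)[of i] \<delta> by simp
    show "\<epsilon> i * \<delta> < \<kappa>" using i6 \<delta> by (simp add: field_simps)
    show "gball x' (\<epsilon> i * \<delta>) \<subseteq> \<Omega>" using BB(2) sub[of i] by blast
    show "0 < measure \<tau> (gball x' (\<epsilon> i * \<delta>))" using pos2 xz by simp
  qed
qed

end

section \<open>Strict convergence and the almost everywhere statement\<close>

context symmetric_body
begin

text \<open>The approximating scales tend to 0 but need not decrease, so a monotone subsequence is
  extracted; being positive with limit 0 it cannot be increasing. Convergence of the variations is
  constancy: all of them, and that of the limit, equal \<open>vol\<close>.\<close>

lemma blow_up_strictly_converges:
  fixes u :: "real^'n \<Rightarrow> real^'m"
  assumes u: "u \<in> BV \<Omega>" and \<Omega>: "open \<Omega>"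
  defines "\<tau> \<equiv> BV_density_measure \<Omega> u"
  assumes M: "norm M = 1"
    and approx: "\<And>j::nat. \<exists>\<epsilon>>0. \<epsilon> < 1 / Suc j \<and> gball x \<epsilon> \<subseteq> \<Omega> \<and> 0 < measure \<tau> (gball x \<epsilon>) \<and>
       (LINT y|lebesgue_on K. norm (blow_up \<Omega> u K \<epsilon> x y - M *v y)) < 1 / Suc j"
  shows "\<exists>\<epsilon>. blow_up_scales \<Omega> u K x \<epsilon> \<and> BV_strictly_converges K (\<lambda>i. blow_up \<Omega> u K (\<epsilon> i) x) (\<lambda>y. M *v y)"
proof -
  from choice[OF allI[OF approx]] obtain E where
    *: "\<forall>j::nat. 0 < E j \<and> E j < 1 / Suc j \<and> gball x (E j) \<subseteq> \<Omega> \<and> 0 < measure \<tau> (gball x (E j)) \<and>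
       (LINT y|lebesgue_on K. norm (blow_up \<Omega> u K (E j) x y - M *v y)) < 1 / Suc j" ..
  have E: "0 < E j" "E j < 1 / Suc j" "gball x (E j) \<subseteq> \<Omega>" "0 < measure \<tau> (gball x (E j))"
    "(LINT y|lebesgue_on K. norm (blow_up \<Omega> u K (E j) x y - M *v y)) < 1 / Suc j" for j
    using *[rule_format, of j] by (auto simp only:)
  have inv: "(\<lambda>j. 1 / real (Suc j)) \<longlonglongrightarrow> 0" by (rule LIMSEQ_Suc[OF lim_1_over_n])
  have E0: "E \<longlonglongrightarrow> 0"
    by (rule tendsto_sandwich[OF _ _ tendsto_const inv]) (use E(1,2) in \<open>auto intro!: always_eventually less_imp_le\<close>)
  have L0: "(\<lambda>j. LINT y|lebesgue_on K. norm (blow_up \<Omega> u K (E j) x y - M *v y)) \<longlonglongrightarrow> 0"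
    by (rule tendsto_sandwich[OF _ _ tendsto_const inv]) (use E(5) in \<open>auto intro!: always_eventually less_imp_le\<close>)
  obtain f where f: "strict_mono f" "monoseq (\<lambda>n. E (f n))" using seq_monosub[of E] by blast
  define \<epsilon> where "\<epsilon> n = E (f n)" for n
  have \<epsilon>0: "\<epsilon> \<longlonglongrightarrow> 0" using LIMSEQ_subseq_LIMSEQ[OF E0 f(1)] by (simp add: \<epsilon>_def[abs_def] o_def)
  have "\<not> incseq \<epsilon>" using incseq_le[OF _ \<epsilon>0, of 0] E(1)[of "f 0"] by (auto simp: \<epsilon>_def)
  then have dec: "decseq \<epsilon>" using f(2) by (simp add: monoseq_iff \<epsilon>_def[abs_def])
  note D = BV_density[OF u \<Omega>, folded \<tau>_def]
  have "blow_up_scales \<Omega> u K x \<epsilon>"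
    unfolding blow_up_scales_def
  proof (intro conjI allI dec \<epsilon>0)
    fix i
    show "0 < \<epsilon> i" by (simp add: \<epsilon>_def E)
    then have dil: "dilate_at K (\<epsilon> i) x = gball x (\<epsilon> i)" by (rule dilate_at_K)
    show "dilate_at K (\<epsilon> i) x \<subseteq> \<Omega>" unfolding dil by (simp add: \<epsilon>_def E)
    then show "0 < measure (BV_variation \<Omega> u) (dilate_at K (\<epsilon> i) x)"
      using E(4)[of "f i"] D(4)[OF gball_borel, of x "\<epsilon> i"] unfolding dil by (simp add: \<epsilon>_def Int_absorb2)
  qed
  moreover have "BV_strictly_converges K (\<lambda>i. blow_up \<Omega> u K (\<epsilon> i) x) (\<lambda>y. M *v y)"
  proof -
    note BU = blow_up_weak_deriv[OF u \<Omega> E(1) E(3) E(4)[unfolded \<tau>_def]]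
    note L = lborel_restricted[OF open_K bounded_K]
    note lin = weak_deriv_linear[OF open_K bounded_K, of M]
    note linBV = weak_deriv_imp_BV[OF lin open_K]
    have "measure (BV_variation K (\<lambda>y. M *v y)) K = measure (lborel_restricted K) K"
      unfolding linBV(2) set_lebesgue_integral_def using M L(2) sets_eq_imp_space_eq[OF L(2)] by simp
    also have "\<dots> = vol" using L(4)[OF K_borel] by simp
    finally have mass: "measure (BV_variation K (\<lambda>y. M *v y)) K = vol" .
    have "(\<lambda>i. LINT y|lebesgue_on K. norm (blow_up \<Omega> u K (\<epsilon> i) x y - M *v y)) \<longlonglongrightarrow> 0"
      using LIMSEQ_subseq_LIMSEQ[OF L0 f(1)] by (simp add: \<epsilon>_def o_def)
    then have "L1_converges K (\<lambda>i. blow_up \<Omega> u K (\<epsilon> i) x) (\<lambda>y. M *v y)"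
      unfolding L1_converges_def \<epsilon>_def using BU(3) lin(2) by blast
    moreover have "blow_up \<Omega> u K (\<epsilon> i) x \<in> BV K" for i unfolding \<epsilon>_def by (rule BU(5))
    moreover have "(\<lambda>i. measure (BV_variation K (blow_up \<Omega> u K (\<epsilon> i) x)) K) \<longlonglongrightarrow> vol"
      unfolding \<epsilon>_def BU(6) by (rule tendsto_const)
    ultimately show ?thesis unfolding BV_strictly_converges_def mass using linBV(1) by blast
  qed
  ultimately show ?thesis by blast
qed

text \<open>Countably many exceptional null sets are discarded: points of \<open>H j\<close> that
  are not density points of \<open>H j\<close>, for every \<open>j\<close>, points without
  approximate continuity of the density, and points where its norm is not 1.\<close>

lemma AE_strict_blow_up:
  fixes u :: "real^'n \<Rightarrow> real^'m"
  assumes u: "u \<in> BV \<Omega>" and \<Omega>: "open \<Omega>"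
  shows "AE x in BV_density_measure \<Omega> u. x \<in> \<Omega> - totally_singular_points \<Omega> u K \<longrightarrow>
    (\<exists>\<epsilon>. blow_up_scales \<Omega> u K x \<epsilon> \<and>
       BV_strictly_converges K (\<lambda>i. blow_up \<Omega> u K (\<epsilon> i) x) (\<lambda>y. BV_density \<Omega> u x *v y))"
proof -
  let ?\<tau> = "BV_density_measure \<Omega> u" and ?F = "BV_density \<Omega> u"
  note D = BV_density[OF u \<Omega>]
  \<comment> \<open>The value \<open>1 / Suc j\<close> bounds both the scale and the error. With it
    as \<open>\<kappa>\<close>, \<open>nearby_linear_blow_up\<close> produces a point of
    \<open>B j\<close> that violates the defining inequality of \<open>B j\<close>.\<close>
  define B where "B j = {x \<in> \<Omega>. \<forall>\<epsilon>>0. \<epsilon> < 1 / real (Suc j) \<longrightarrow> gball x \<epsilon> \<subseteq> \<Omega> \<longrightarrow> 0 < measure ?\<tau> (gball x \<epsilon>) \<longrightarrow>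
      1 / real (Suc j) \<le> (LINT y|lebesgue_on K. norm (blow_up \<Omega> u K \<epsilon> x y - ?F x *v y))}" for j
  have "\<forall>j. \<exists>H. H \<in> sets borel \<and> B j \<subseteq> H \<and> (\<forall>A. A \<in> sets borel \<longrightarrow> A \<subseteq> H \<longrightarrow> A \<inter> B j = {} \<longrightarrow> measure ?\<tau> A = 0)"
  proof
    fix j
    show "\<exists>H. H \<in> sets borel \<and> B j \<subseteq> H \<and> (\<forall>A. A \<in> sets borel \<longrightarrow> A \<subseteq> H \<longrightarrow> A \<inter> B j = {} \<longrightarrow> measure ?\<tau> A = 0)"
      by (rule measurable_hull[OF D(2,3), of "B j"]) blast
  qed
  from choice[OF this] obtain H where *: "\<forall>j. H j \<in> sets borel \<and> B j \<subseteq> H j \<and>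
    (\<forall>A. A \<in> sets borel \<longrightarrow> A \<subseteq> H j \<longrightarrow> A \<inter> B j = {} \<longrightarrow> measure ?\<tau> A = 0)" ..
  have H: "H j \<in> sets borel" "B j \<subseteq> H j"
    "A \<in> sets borel \<Longrightarrow> A \<subseteq> H j \<Longrightarrow> A \<inter> B j = {} \<Longrightarrow> measure ?\<tau> A = 0" for j A
    using *[rule_format, of j] by simp_all
  have dens: "AE x in ?\<tau>. \<forall>j. x \<in> H j \<longrightarrow>
     (\<forall>e>0. eventually (\<lambda>r. measure ?\<tau> (gball x r - H j) \<le> e * measure ?\<tau> (gball x r)) (at_right 0))"
    unfolding AE_all_countable by (intro allI AE_density_point D(2,3) H(1))
  show ?thesis
    using dens D(5) AE_approx_continuous[OF D(2,3,6)]
  proof eventually_elim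
    case (elim x)
    show ?case
    proof
      assume x: "x \<in> \<Omega> - totally_singular_points \<Omega> u K"
      then obtain p where p: "p \<in> BV K" "L1_limit_point \<Omega> u K x p" "BV_deriv K p \<noteq> BV_deriv_singular K p"
        by (auto simp: totally_singular_points_def)
      have M: "norm (?F x) = 1" using elim by blast
      have nB: "x \<notin> B j" for j
      proof
        assume "x \<in> B j"
        then have xH: "x \<in> H j" using H(2) by blast
        have leb: "\<And>s e. 0 < s \<Longrightarrow> 0 < e \<Longrightarrow> eventually (\<lambda>r. measure ?\<tau> (gball x r \<inter> {z. s \<le> norm (?F z - ?F x)}) \<le> e * measure ?\<tau> (gball x r)) (at_right 0)"
          using elim(3) by blast
        have dp: "\<And>e. 0 < e \<Longrightarrow> eventually (\<lambda>r. measure ?\<tau> (gball x r - H j) \<le> e * measure ?\<tau> (gball x r)) (at_right 0)"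
          using elim(1) xH by blast
        show False
        proof (rule nearby_linear_blow_up[OF u \<Omega>, where x = x and B = "B j" and H = "H j" and p = p and \<kappa> = "1 / real (Suc j)"])
          fix x' \<epsilon> assume "x' \<in> B j" "0 < \<epsilon>" "\<epsilon> < 1 / real (Suc j)" "gball x' \<epsilon> \<subseteq> \<Omega>" "0 < measure ?\<tau> (gball x' \<epsilon>)"
            "(LINT y|lebesgue_on K. norm (blow_up \<Omega> u K \<epsilon> x' y - ?F x' *v y)) < 1 / real (Suc j)"
          then show False unfolding B_def by fastforce
        next
          show "norm (?F x) = 1" "H j \<in> sets borel" "L1_limit_point \<Omega> u K x p" "p \<in> BV K"
            "BV_deriv K p \<noteq> BV_deriv_singular K p" by (rule M H(1) p)+
          show "0 < 1 / real (Suc j)" by simp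
          show "eventually (\<lambda>r. measure ?\<tau> (gball x r \<inter> {z. s \<le> norm (?F z - ?F x)}) \<le> e * measure ?\<tau> (gball x r)) (at_right 0)"
            if "0 < s" "0 < e" for s e by (rule leb[OF that])
          show "eventually (\<lambda>r. measure ?\<tau> (gball x r - H j) \<le> e * measure ?\<tau> (gball x r)) (at_right 0)" if "0 < e" for e
            by (rule dp[OF that])
          show "measure ?\<tau> A = 0" if "A \<in> sets borel" "A \<subseteq> H j" "A \<inter> B j = {}" for A by (rule H(3)[OF that])
        qed
      qed
      show "\<exists>\<epsilon>. blow_up_scales \<Omega> u K x \<epsilon> \<and> BV_strictly_converges K (\<lambda>i. blow_up \<Omega> u K (\<epsilon> i) x) (\<lambda>y. ?F x *v y)"
      proof (rule blow_up_strictly_converges[OF u \<Omega> M])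
        fix j :: nat
        show "\<exists>\<epsilon>>0. \<epsilon> < 1 / real (Suc j) \<and> gball x \<epsilon> \<subseteq> \<Omega> \<and> 0 < measure ?\<tau> (gball x \<epsilon>) \<and>
           (LINT y|lebesgue_on K. norm (blow_up \<Omega> u K \<epsilon> x y - ?F x *v y)) < 1 / real (Suc j)"
          using nB[of j] x unfolding B_def by (auto simp only: mem_Collect_eq Diff_iff not_le)
      qed
    qed
  qed
qed

end

theorem theorem4p2:
  fixes \<Omega> K :: "(real^'n) set" and u :: "real^'n \<Rightarrow> real^'m"
  assumes "CARD('n) \<ge> 2"
    and "open \<Omega>" "bounded \<Omega>" "Lipschitz_boundary \<Omega>"
    and "u \<in> BV \<Omega>"
    and "K \<noteq> {}" "bounded K" "open K" "convex K" "K = uminus ` K"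
  shows "AE x in BV_Cantor_variation \<Omega> u. x \<in> \<Omega> - totally_singular_points \<Omega> u K \<longrightarrow>
    (\<exists>\<epsilon>. blow_up_scales \<Omega> u K x \<epsilon> \<and>
       BV_strictly_converges K (\<lambda>i. blow_up \<Omega> u K (\<epsilon> i) x)
         (\<lambda>y. polar_density (lborel_on \<Omega>) (BV_deriv \<Omega> u) x *v y))"
proof (rule AE_Cantor_variation)
  have "is_distr_deriv \<Omega> u (BV_deriv \<Omega> u)" using assms(5,2) by (rule BV_deriv_is_distr_deriv)
  then show "vector_measure (lborel_on \<Omega>) (BV_deriv \<Omega> u)" by (simp add: is_distr_deriv_def)
  obtain N where N: "gauge_norm N" "K = {v. N v < 1}" using symmetric_convex_body_gauge[OF assms(6-10)] by blast
  interpret symmetric_body N K using N by (simp add: symmetric_body_def symmetric_body_axioms_def)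
  have id: "(\<lambda>x. x) \<in> measurable (BV_variation \<Omega> u) borel"
  proof -
    have sets: "sets (BV_variation \<Omega> u) = sets (lborel_on \<Omega>)" by (simp add: BV_variation_def)
    show ?thesis unfolding measurable_cong_sets[OF sets refl] by (rule measurable_restrict_space1) auto
  qed
  \<comment> \<open>\<open>BV_density_measure\<close> is the image of \<open>BV_variation\<close>
    under the identity, and at points of \<open>\<Omega>\<close> the indicator in
    \<open>BV_density\<close> equals 1.\<close>
  from AE_distrD[OF id AE_strict_blow_up[OF assms(5,2), unfolded BV_density_measure_def]]
  show "AE x in BV_variation \<Omega> u. x \<in> \<Omega> - totally_singular_points \<Omega> u K \<longrightarrow>
    (\<exists>\<epsilon>. blow_up_scales \<Omega> u K x \<epsilon> \<and>
       BV_strictly_converges K (\<lambda>i. blow_up \<Omega> u K (\<epsilon> i) x)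
         (\<lambda>y. polar_density (lborel_on \<Omega>) (BV_deriv \<Omega> u) x *v y))"
    by eventually_elim (simp add: BV_density_def)
qed

end
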